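(* Let $\Omega\subset\mathbb{R}^3$ be a domain and $S_0\subset\Omega$ a bounded connected domain, both uniformly $C^3$. There is a constant $c_0>0$, depending only on the shape of $S_0$ and on $\Omega$, such that the following holds. Let $S(t)\subset\Omega$ be the moving rigid body with initial position $S_0$ described in the context, $F(t)=\Omega\setminus\overline{S(t)}$, $h(t)=\operatorname{dist}(S(t),\partial\Omega)$, and let the vector field $\mathbf{u}$ satisfy $$\mathbf{u}\in L^\infty(0,T;L^2(\Omega))\cap L^1(0,T;W^{1,2}_0(S(t),\Omega)),\qquad\operatorname{div}\mathbf{u}=0,$$ and in addition $$\int_0^t\|\nabla^2\mathbf{u}\|_{L^2(F(s))}\,ds<\infty\qquad\forall\,t\in[0,T).$$ If $h(0)>0$, then $h(t)$ remains positive for $t\in[0,T)$. Moreover, if $\liminf_{t\to T}h(t)=0$, then $$\lim_{t\to T}\int_0^th^{\frac12}(\tau)\,\|\nabla^2\mathbf{u}\|_{L^2(\mathcal{C}_{\sigma_{h(\tau)}}\cap F(\tau))}\,d\tau=\infty,$$ where $\sigma_{h(\tau)}=c_0\,h(\tau)^{\frac12}$.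
   Context: A domain $D\subset\mathbb{R}^3$ is uniformly $C^3$ if there are constants $\sigma_0,K>0$ such that, near each boundary point $x_0$, in suitable orthonormal coordinates centred at $x_0$ with $x_3$-axis normal to $\partial D$, $\partial D$ is the graph $x_3=g(\mathbf{x}')$, $\mathbf{x}'=(x_1,x_2)$, $|\mathbf{x}'|<\sigma_0$, with $|\nabla^ig(\mathbf{x}')|\le K|\mathbf{x}'|^{2-i}$ for $i=0,1,2$ and $|\nabla^3g(\mathbf{x}')|\le K$. Motion of the body: there are functions $\mathbf{u}_*(t),\boldsymbol{\omega}(t)\in L^\infty(0,T)$ (with values in $\mathbb{R}^3$) such that $S(t)\subset\Omega$ consists of the points $\mathbf{x}(t)$ satisfying $\frac{d\mathbf{x}(t)}{dt}=\mathbf{u}_*(t)+\boldsymbol{\omega}(t)\times(\mathbf{x}(t)-\mathbf{x}_*(t))$, $\mathbf{x}(0)=\mathbf{x}_0\in S_0$, where $\mathbf{x}_*(t)\in\overline{S(t)}$ is the position at time $t$ of a fixed point of the body. For $q\ge1$, $$L^q(0,T;W^{1,2}_0(S(t),\Omega))=\{\mathbf{u}\in L^q(0,T;W^{1,2}_0(\Omega)):\ \mathbf{u}(\mathbf{x},t)=\mathbf{u}_*(t)+\boldsymbol{\omega}(t)\times(\mathbf{x}-\mathbf{x}_*(t))\ \text{for }\mathbf{x}\in S(t)\},$$ with $\mathbf{u}:\Omega\times(0,T)\to\mathbb{R}^3$. At each time $t$, let $P\in\partial S(t)$, $Q\in\partial\Omega$ realize the distance $h(t)=|PQ|$, and use orthogonal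 coordinates $(x_1,x_2,x_3)$ with origin $Q$ and $P=(0,0,h(t))$, the plane of $\mathbf{x}'=(x_1,x_2)$ being tangent to $\partial\Omega$ at $Q$ and parallel to the tangent plane of $\partial S(t)$ at $P$. In these coordinates $\mathcal{C}_\sigma\cap F(t)=\{|\mathbf{x}'|<\sigma\}\cap F(t)$. It is assumed throughout that the distances $h$ considered satisfy $h<\operatorname{diam}S_0$. *)

theory Defs
  imports "HOL-Analysis.Analysis"
begin

section \<open>Classical derivatives and test functions\<close>

definition pd :: "'n::finite \<Rightarrow> (real^'n \<Rightarrow> 'b::real_normed_vector) \<Rightarrow> real^'n \<Rightarrow> 'b" where
  "pd i f x = frechet_derivative f (at x) (axis i 1)"

definition iter_pd :: "'n::finite list \<Rightarrow> (real^'n \<Rightarrow> 'b::real_normed_vector) \<Rightarrow> real^'n \<Rightarrow> 'b" where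
  "iter_pd js f = foldr pd js f"

text \<open>Used for open \<open>U\<close> only.\<close>

definition C_k_on :: "nat \<Rightarrow> (real^'n::finite) set \<Rightarrow> (real^'n \<Rightarrow> 'b::real_normed_vector) \<Rightarrow> bool" where
  "C_k_on k U f \<longleftrightarrow>
     (\<forall>js. length js < k \<longrightarrow> iter_pd js f differentiable_on U) \<and>
     (\<forall>js. length js \<le> k \<longrightarrow> continuous_on U (iter_pd js f))"

text \<open>The Euclidean norm of the tensor of all partial derivatives of order \<open>k\<close>.\<close>

definition grad_norm :: "nat \<Rightarrow> (real^'n::finite \<Rightarrow> 'b::real_normed_vector) \<Rightarrow> real^'n \<Rightarrow> real" where
  "grad_norm k f x = sqrt (\<Sum>js | length js = k. (norm (iter_pd js f x))\<^sup>2)"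

definition test_function :: "(real^'n::finite) set \<Rightarrow> (real^'n \<Rightarrow> 'b::real_normed_vector) \<Rightarrow> bool" where
  "test_function U \<phi> \<longleftrightarrow>
     (\<forall>k. C_k_on k UNIV \<phi>) \<and>
     compact (closure {x. \<phi> x \<noteq> 0}) \<and> closure {x. \<phi> x \<noteq> 0} \<subseteq> U"

section \<open>Weak derivatives and Sobolev spaces\<close>

definition locally_integrable_on ::
    "(real^'n::finite \<Rightarrow> 'b::euclidean_space) \<Rightarrow> (real^'n) set \<Rightarrow> bool" where
  "locally_integrable_on f U \<longleftrightarrow> (\<forall>C. compact C \<and> C \<subseteq> U \<longrightarrow> set_integrable lebesgue C f)"

definition weak_pd ::
    "(real^'n::finite) set \<Rightarrow> 'n \<Rightarrow> (real^'n \<Rightarrow> 'b::euclidean_space) \<Rightarrow> (real^'n \<Rightarrow> 'b) \<Rightarrow> bool" where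
  "weak_pd U i f g \<longleftrightarrow>
     locally_integrable_on f U \<and> locally_integrable_on g U \<and>
     (\<forall>\<phi> :: real^'n \<Rightarrow> real. test_function U \<phi> \<longrightarrow>
        (\<integral>x\<in>U. pd i \<phi> x *\<^sub>R f x \<partial>lebesgue) = - (\<integral>x\<in>U. \<phi> x *\<^sub>R g x \<partial>lebesgue))"

definition weak_gradient ::
    "(real^'n::finite) set \<Rightarrow> (real^'n \<Rightarrow> 'b::euclidean_space) \<Rightarrow> ('n \<Rightarrow> real^'n \<Rightarrow> 'b) \<Rightarrow> bool" where
  "weak_gradient U f G \<longleftrightarrow> (\<forall>i. weak_pd U i f (G i))"

definition weak_hessian ::
    "(real^'n::finite) set \<Rightarrow> (real^'n \<Rightarrow> 'b::euclidean_space) \<Rightarrow> ('n \<Rightarrow> 'n \<Rightarrow> real^'n \<Rightarrow> 'b) \<Rightarrow> bool" where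
  "weak_hessian U f H \<longleftrightarrow>
     (\<exists>G. weak_gradient U f G \<and> (\<forall>i j. weak_pd U j (G i) (H i j)))"

definition weakly_div_free :: "(real^'n::finite) set \<Rightarrow> (real^'n \<Rightarrow> real^'n) \<Rightarrow> bool" where
  "weakly_div_free U v \<longleftrightarrow>
     (\<exists>G. weak_gradient U v G \<and> (AE x in lebesgue_on U. (\<Sum>i\<in>UNIV. G i x $ i) = 0))"

definition L2_norm :: "'a::euclidean_space set \<Rightarrow> ('a \<Rightarrow> 'b::euclidean_space) \<Rightarrow> ennreal" where
  "L2_norm U f =
     (let I = \<integral>\<^sup>+x\<in>U. ennreal ((norm (f x))\<^sup>2) \<partial>lebesgue
      in if I = \<infinity> then \<infinity> else ennreal (sqrt (enn2real I)))"

definition L2_space :: "'a::euclidean_space set \<Rightarrow> ('a \<Rightarrow> 'b::euclidean_space) set" where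
  "L2_space U = {f. f \<in> borel_measurable (lebesgue_on U) \<and> L2_norm U f < \<infinity>}"

text \<open>Weak derivatives are unique up to null sets, so the infima in the next definition and in
  \<open>hessian_norm\<close> range over equal values; they only select that value. The infimum of
  the empty set is \<open>\<infinity>\<close>, so a field without weak derivatives gets norm \<open>\<infinity>\<close>.\<close>

definition W12_norm :: "(real^'n::finite) set \<Rightarrow> (real^'n \<Rightarrow> 'b::euclidean_space) \<Rightarrow> ennreal" where
  "W12_norm U f =
     (INF G\<in>{G. weak_gradient U f G}.
        L2_norm U (\<lambda>x. sqrt ((norm (f x))\<^sup>2 + (\<Sum>i\<in>UNIV. (norm (G i x))\<^sup>2))))"

definition W12_space :: "(real^'n::finite) set \<Rightarrow> (real^'n \<Rightarrow> 'b::euclidean_space) set" where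
  "W12_space U = {f \<in> L2_space U. \<exists>G. weak_gradient U f G \<and> (\<forall>i. G i \<in> L2_space U)}"

definition W12_0_space :: "(real^'n::finite) set \<Rightarrow> (real^'n \<Rightarrow> 'b::euclidean_space) set" where
  "W12_0_space U =
     {f \<in> W12_space U. \<exists>\<phi> :: nat \<Rightarrow> real^'n \<Rightarrow> 'b.
        (\<forall>n. test_function U (\<phi> n)) \<and> (\<lambda>n. W12_norm U (\<lambda>x. f x - \<phi> n x)) \<longlonglongrightarrow> 0}"

definition hessian_norm :: "(real^'n::finite) set \<Rightarrow> (real^'n \<Rightarrow> 'b::euclidean_space) \<Rightarrow> ennreal" where
  "hessian_norm U f =
     (INF H\<in>{H. weak_hessian U f H}.
        L2_norm U (\<lambda>x. sqrt (\<Sum>i\<in>UNIV. \<Sum>j\<in>UNIV. (norm (H i j x))\<^sup>2)))"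

section \<open>Time-dependent spaces\<close>

text \<open>Bochner (strong) measurability on \<open>(0,T)\<close> with values in a space \<open>X\<close> of functions
  seminormed by \<open>N\<close>: a limit in \<open>N\<close>, at almost every time, of simple functions.\<close>

definition bochner_measurable ::
    "real \<Rightarrow> ('a \<Rightarrow> 'b::euclidean_space) set \<Rightarrow> (('a \<Rightarrow> 'b) \<Rightarrow> ennreal) \<Rightarrow>
     (real \<Rightarrow> 'a \<Rightarrow> 'b) \<Rightarrow> bool" where
  "bochner_measurable T X N u \<longleftrightarrow>
     (AE t in lebesgue_on {0<..<T}. u t \<in> X) \<and>
     (\<exists>s :: nat \<Rightarrow> real \<Rightarrow> 'a \<Rightarrow> 'b.
        (\<forall>n. finite (s n ` {0<..<T}) \<and> s n ` {0<..<T} \<subseteq> X \<and>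
             (\<forall>v. {t \<in> {0<..<T}. s n t = v} \<in> sets lebesgue)) \<and>
        (AE t in lebesgue_on {0<..<T}. (\<lambda>n. N (\<lambda>x. u t x - s n t x)) \<longlonglongrightarrow> 0))"

definition L1_time ::
    "real \<Rightarrow> ('a \<Rightarrow> 'b::euclidean_space) set \<Rightarrow> (('a \<Rightarrow> 'b) \<Rightarrow> ennreal) \<Rightarrow>
     (real \<Rightarrow> 'a \<Rightarrow> 'b) set" where
  "L1_time T X N =
     {u. bochner_measurable T X N u \<and> (\<integral>\<^sup>+t\<in>{0<..<T}. N (u t) \<partial>lebesgue) < \<infinity>}"

definition Linf_time ::
    "real \<Rightarrow> ('a \<Rightarrow> 'b::euclidean_space) set \<Rightarrow> (('a \<Rightarrow> 'b) \<Rightarrow> ennreal) \<Rightarrow>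
     (real \<Rightarrow> 'a \<Rightarrow> 'b) set" where
  "Linf_time T X N =
     {u. bochner_measurable T X N u \<and>
         (\<exists>M::real. AE t in lebesgue_on {0<..<T}. N (u t) \<le> ennreal M)}"

definition Linf :: "real \<Rightarrow> (real \<Rightarrow> 'b::euclidean_space) set" where
  "Linf T =
     {f \<in> borel_measurable (lebesgue_on {0<..<T}).
        \<exists>M. AE t in lebesgue_on {0<..<T}. norm (f t) \<le> M}"

section \<open>Uniformly \<open>C\<^sup>3\<close> domains\<close>

definition horiz :: "real^3 \<Rightarrow> real^2" where
  "horiz y = vector [y $ 1, y $ 2]"

text \<open>The coordinates \<open>y\<close> are given by \<open>x = x0 + A y\<close>. The boundary is required to be a graph
  in a neighbourhood of \<open>x0\<close> of uniform size; after decreasing \<open>\<sigma>0\<close> the shape of that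
  neighbourhood is immaterial, so the same \<open>\<sigma>0\<close> bounds the vertical coordinate.
  The bound for \<open>i = 1\<close> gives \<open>\<nabla>g(0) = 0\<close>, i.e. the third axis is normal to the boundary.\<close>

definition uniformly_C3 :: "(real^3) set \<Rightarrow> bool" where
  "uniformly_C3 D \<longleftrightarrow>
     (\<exists>\<sigma>0>0. \<exists>K>0. \<forall>x0\<in>frontier D.
        \<exists>(A :: real^3 \<Rightarrow> real^3) (g :: real^2 \<Rightarrow> real).
          orthogonal_transformation A \<and>
          (\<forall>y. norm (horiz y) < \<sigma>0 \<and> \<bar>y $ 3\<bar> < \<sigma>0 \<longrightarrow>
             (x0 + A y \<in> frontier D \<longleftrightarrow> y $ 3 = g (horiz y))) \<and>
          C_k_on 3 (ball 0 \<sigma>0) g \<and>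
          (\<forall>y'\<in>ball 0 \<sigma>0.
             (\<forall>i\<le>2. grad_norm i g y' \<le> K * norm y' ^ (2 - i)) \<and>
             grad_norm 3 g y' \<le> K))"

definition congruent_sets :: "(real^3) set \<Rightarrow> (real^3) set \<Rightarrow> bool" where
  "congruent_sets A B \<longleftrightarrow>
     (\<exists>a R. orthogonal_transformation R \<and> B = (\<lambda>x. a + R x) ` A)"

section \<open>Motion of the rigid body\<close>

text \<open>The velocity data are merely bounded and measurable, so the equation holds almost
  everywhere and its (Caratheodory) solutions are Lipschitz functions.\<close>

definition trajectory ::
    "real \<Rightarrow> (real \<Rightarrow> real^3) \<Rightarrow> (real \<Rightarrow> real^3) \<Rightarrow> (real \<Rightarrow> real^3) \<Rightarrow> (real \<Rightarrow> real^3) \<Rightarrow> bool" where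
  "trajectory T us \<omega> xs x \<longleftrightarrow>
     (\<exists>C. C-lipschitz_on {0..<T} x) \<and>
     (AE t in lebesgue_on {0<..<T}.
        (x has_vector_derivative us t + cross3 (\<omega> t) (x t - xs t)) (at t))"

definition rigid_motion ::
    "(real^3) set \<Rightarrow> (real^3) set \<Rightarrow> real \<Rightarrow> (real \<Rightarrow> real^3) \<Rightarrow> (real \<Rightarrow> real^3) \<Rightarrow>
     (real \<Rightarrow> real^3) \<Rightarrow> (real \<Rightarrow> (real^3) set) \<Rightarrow> bool" where
  "rigid_motion \<Omega> S0 T us \<omega> xs S \<longleftrightarrow>
     us \<in> Linf T \<and> \<omega> \<in> Linf T \<and>
     trajectory T us \<omega> xs xs \<and>
     (\<forall>t\<in>{0..<T}.
        S t = {x t |x. trajectory T us \<omega> xs x \<and> x 0 \<in> S0} \<and>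
        S t \<subseteq> \<Omega> \<and> xs t \<in> closure (S t))"

definition L1_W12_0_body ::
    "real \<Rightarrow> (real^3) set \<Rightarrow> (real \<Rightarrow> (real^3) set) \<Rightarrow> (real \<Rightarrow> real^3) \<Rightarrow> (real \<Rightarrow> real^3) \<Rightarrow>
     (real \<Rightarrow> real^3) \<Rightarrow> (real \<Rightarrow> real^3 \<Rightarrow> real^3) set" where
  "L1_W12_0_body T \<Omega> S us \<omega> xs =
     {u \<in> L1_time T (W12_0_space \<Omega>) (W12_norm \<Omega>).
        AE t in lebesgue_on {0<..<T}. AE x in lebesgue_on (S t).
          u t x = us t + cross3 (\<omega> t) (x - xs t)}"

definition fluid :: "(real^3) set \<Rightarrow> (real \<Rightarrow> (real^3) set) \<Rightarrow> real \<Rightarrow> (real^3) set" where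
  "fluid \<Omega> S t = \<Omega> - closure (S t)"

definition wall_distance :: "(real^3) set \<Rightarrow> (real \<Rightarrow> (real^3) set) \<Rightarrow> real \<Rightarrow> real" where
  "wall_distance \<Omega> S t = setdist (S t) (frontier \<Omega>)"

definition distance_points ::
    "(real^3) set \<Rightarrow> (real \<Rightarrow> (real^3) set) \<Rightarrow> real \<Rightarrow> real^3 \<Rightarrow> real^3 \<Rightarrow> bool" where
  "distance_points \<Omega> S t p q \<longleftrightarrow>
     p \<in> frontier (S t) \<and> q \<in> frontier \<Omega> \<and> dist p q = wall_distance \<Omega> S t"

text \<open>For \<open>p \<noteq> q\<close>: the points with \<open>|x'| < \<sigma>\<close>, where \<open>x'\<close> is the part of \<open>x - q\<close> orthogonal to the
  axis from \<open>q\<close> to \<open>p\<close>.\<close>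

definition cylinder :: "real^3 \<Rightarrow> real^3 \<Rightarrow> real \<Rightarrow> (real^3) set" where
  "cylinder q p \<sigma> =
     {x. norm ((x - q) - ((x - q) \<bullet> sgn (p - q)) *\<^sub>R sgn (p - q)) < \<sigma>}"

end

theory Submission
  imports Defs
begin

text \<open>Let \<open>v\<close> be the velocity of the body point nearest to the wall and \<open>n\<close> the direction of the gap of
  width \<open>h\<close>. Test \<open>div u = 0\<close> in the gap against \<open>\<eta>\<close>, a radial bump of width \<open>r\<close> comparable to \<open>sqrt h\<close>:
  the flux \<open>n \<bullet> v\<close> through the body equals minus the integral of \<open>\<nabla>\<eta> \<bullet> u\<close>. Since \<open>u\<close> vanishes on the wall and
  is rigid on the body, integrating by parts twice along \<open>n\<close>, with a quadratic weight vanishing on both boundaries,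
  replaces \<open>u\<close> by its second normal derivative times the square of the width. The rigid boundary terms have
  a leading part that is odd under the half turn about the axis of the gap and hence cancels; the remainder
  is estimated by the third derivatives of the boundaries. The result is
  \<open>\<bar>n \<bullet> v\<bar> \<le> h * (C1 * sqrt h * \<parallel>\<nabla>\<^sup>2 u\<parallel> + C2)\<close>. Hence the decrease of \<open>ln h\<close> is bounded
  by the time integral of \<open>sqrt h * \<parallel>\<nabla>\<^sup>2 u\<parallel>\<close> up to a bounded term, which gives both claims.\<close>

section \<open>Smooth functions and bumps\<close>

text \<open>The exponent 1/2 comes from scaling. Boundaries of bounded curvature leave a gap of
  thickness comparable to \<open>h\<close> only over a disc of radius comparable to
  \<open>sqrt h\<close>; this fixes \<open>c0\<close>. For the bump
  \<open>max 0 (r\<^sup>2 - \<bar>x'\<bar>\<^sup>2)\<close> squared the flux has weight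
  \<open>r ^ 6\<close>, while the Hessian term is at most \<open>h\<^sup>2\<close> (quadratic
  weight) times \<open>r ^ 3\<close> (gradient of the bump) times \<open>r * sqrt h\<close> (root of
  the gap volume) times the norm. With \<open>r\<^sup>2\<close> comparable to \<open>h\<close> the
  quotient is \<open>h * sqrt h\<close> times the norm. All rigid terms must be of order
  \<open>h\<close> after division by \<open>r ^ 6\<close>; for the translation term a crude bound
  gives only \<open>sqrt h\<close>, so the cancellation is essential. The obstacle is the lack of
  regularity: \<open>u\<close> has no pointwise boundary values. The zero boundary values on the
  wall enter only through approximating test functions, and the rigid values on the body only
  through volume integrals: the integrations by parts run over the region above the wall, straight
  through the body surface, and are cut off well inside the body.\<close>

text \<open>Only the term of order \<open>k + 2\<close> of the series for \<open>exp (1 / s)\<close>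
  is kept. The two orders beyond \<open>k\<close> leave the factor \<open>s\<^sup>2\<close>, which
  later gives derivative 0 at the origin.\<close>

lemma power_times_exp_minus_inverse_le:
  fixes s :: real
  assumes "s > 0"
  shows "exp (- 1 / s) / s ^ k \<le> fact (k + 2) * s\<^sup>2"
proof -
  have "(1 / s) ^ (k + 2) / fact (k + 2) \<le> exp (1 / s)"
    using exp_lower_Taylor_quadratic
  proof -
    have "(1/s) ^ (k+2) / fact (k+2) = (\<Sum>i\<in>{k+2}. (1/s) ^ i /\<^sub>R fact i)"
      by (simp add: divide_inverse mult.commute)
    also have "\<dots> \<le> (\<Sum>i. (1/s) ^ i /\<^sub>R fact i)"
      using assms by (intro sum_le_suminf summable_exp_generic) auto
    finally show ?thesis by (simp add: exp_def)
  qed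
  then have "(1 / s) ^ (k + 2) \<le> exp (1 / s) * fact (k + 2)"
    by (subst (asm) pos_divide_le_eq) auto
  then have "(1 / s) ^ (k + 2) \<le> fact (k + 2) * exp (1 / s)"
    by (simp only: mult.commute)
  then have "exp (- 1 / s) * (1 / s) ^ (k + 2) \<le> exp (- 1 / s) * (fact (k + 2) * exp (1 / s))"
    by (intro mult_left_mono) auto
  also have "\<dots> = fact (k + 2)" by (simp add: mult_exp_exp)
  finally have "exp (- 1 / s) / s ^ k / s\<^sup>2 \<le> fact (k + 2)"
    using assms by (simp add: power_add power_divide power2_eq_square field_simps)
  then show ?thesis using assms by (simp add: divide_le_eq mult_ac)
qed

text \<open>Differentiating \<open>exp (- 1 / t)\<close> produces powers of \<open>1 / t\<close>;
  with these powers as an index, the family is closed under differentiation up to linear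
  combinations.\<close>

definition flat :: "nat \<Rightarrow> real \<Rightarrow> real" where
  "flat k t = (if t > 0 then exp (- 1 / t) / t ^ k else 0)"

lemma flat_nonneg: "flat k t \<ge> 0" by (simp add: flat_def)

lemma flat_le: "flat k t \<le> fact (k + 2) * t\<^sup>2"
  using power_times_exp_minus_inverse_le[of t k] by (auto simp: flat_def)

lemma has_real_derivative_flat:
  "(flat k has_real_derivative flat (k + 2) t - k * flat (k + 1) t) (at t)"
proof -
  consider "t > 0" | "t < 0" | "t = 0" by linarith
  then show ?thesis
  proof cases
    case 1
    have "((\<lambda>t. exp (- 1 / t) / t ^ k) has_real_derivative flat (k + 2) t - k * flat (k + 1) t) (at t)"
    proof (cases k)
      case (Suc m)
      have *: "t ^ m = t * t ^ (m - Suc 0) \<or> m = 0" by (cases m) auto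
      show ?thesis
        using 1 Suc * by (auto intro!: derivative_eq_intros simp: flat_def field_simps power2_eq_square)
    qed (use 1 in \<open>auto intro!: derivative_eq_intros simp: flat_def field_simps power2_eq_square\<close>)
    then show ?thesis
      by (rule has_field_derivative_transform_within_open[where S="{0<..}"]) (use 1 in \<open>auto simp: flat_def\<close>)
  next
    case 2
    have "((\<lambda>t. 0) has_real_derivative flat (k + 2) t - k * flat (k + 1) t) (at t)"
      using 2 by (simp add: flat_def)
    then show ?thesis
      by (rule has_field_derivative_transform_within_open[where S="{..<0}"]) (use 2 in \<open>auto simp: flat_def\<close>)
  next
    case 3
    have "((\<lambda>s. flat k s / s) \<longlongrightarrow> 0) (at 0)"
    proof (rule Lim_null_comparison)
      show "\<forall>\<^sub>F s in at 0. norm (flat k s / s) \<le> fact (k + 2) * \<bar>s\<bar>"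
      proof (intro always_eventually allI)
        fix s :: real
        have "norm (flat k s / s) = flat k s / \<bar>s\<bar>" using flat_nonneg by simp
        also have "\<dots> \<le> fact (k + 2) * s\<^sup>2 / \<bar>s\<bar>" by (intro divide_right_mono flat_le) auto
        also have "\<dots> = fact (k + 2) * \<bar>s\<bar>" by (simp add: power2_eq_square divide_simps)
        finally show "norm (flat k s / s) \<le> fact (k + 2) * \<bar>s\<bar>" .
      qed
      show "((\<lambda>s. fact (k + 2) * \<bar>s\<bar>) \<longlongrightarrow> 0) (at (0::real))"
        by (auto intro!: tendsto_eq_intros)
    qed
    then show ?thesis using 3 unfolding DERIV_def by (simp add: flat_def)
  qed
qed

text \<open>An algebra of smooth functions that is closed under partial derivatives by construction.\<close>

inductive_set flat_algebra :: "(real^'n::finite \<Rightarrow> real) set" where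
  flat: "(\<lambda>x. flat k (c * x $ i + d)) \<in> flat_algebra"
| const: "(\<lambda>x. c) \<in> flat_algebra"
| add: "f \<in> flat_algebra \<Longrightarrow> g \<in> flat_algebra \<Longrightarrow> (\<lambda>x. f x + g x) \<in> flat_algebra"
| mult: "f \<in> flat_algebra \<Longrightarrow> g \<in> flat_algebra \<Longrightarrow> (\<lambda>x. f x * g x) \<in> flat_algebra"

text \<open>Only one derivative is treated by induction on the generators. Since the partial
  derivatives fall back into the algebra, all higher orders follow by iteration.\<close>

lemma flat_algebra_derivative:
  assumes "f \<in> flat_algebra"
  obtains D where "\<And>x. (f has_derivative D x) (at x)" "\<And>i. (\<lambda>x. D x (axis i 1)) \<in> flat_algebra"
proof -
  have "\<exists>D. (\<forall>x. (f has_derivative D x) (at x)) \<and> (\<forall>i. (\<lambda>x. D x (axis i 1)) \<in> flat_algebra)"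
    using assms
  proof induction
    case (flat k c i d)
    let ?e = "\<lambda>x. flat (k + 2) (c * x $ i + d) + (- real k) * flat (k + 1) (c * x $ i + d)"
    let ?D = "\<lambda>x h. (c * h $ i) * ?e x"
    have "((\<lambda>x. flat k (c * x $ i + d)) has_derivative ?D x) (at x)" for x
    proof -
      have "((\<lambda>x. c * x $ i + d) has_derivative (\<lambda>h. c * h $ i)) (at x)"
        by (auto intro!: derivative_eq_intros bounded_linear_imp_has_derivative bounded_linear_vec_nth)
      from has_derivative_compose[OF this has_real_derivative_flat[unfolded has_field_derivative_def]]
      show ?thesis by (rule has_derivative_eq_rhs) (auto simp: algebra_simps)
    qed
    moreover have "(\<lambda>x. ?D x (axis j 1)) \<in> flat_algebra" for j
      by (intro flat_algebra.intros)
    ultimately show ?case by (intro exI[of _ ?D]) auto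
  next
    case (const c)
    then show ?case by (intro exI[of _ "\<lambda>x h. 0"]) (auto intro: flat_algebra.intros)
  next
    case (add f g)
    then obtain D E where D: "\<forall>x. (f has_derivative D x) (at x)" "\<forall>i. (\<lambda>x. D x (axis i 1)) \<in> flat_algebra"
      and E: "\<forall>x. (g has_derivative E x) (at x)" "\<forall>i. (\<lambda>x. E x (axis i 1)) \<in> flat_algebra"
      by blast
    show ?case
      using D E by (intro exI[of _ "\<lambda>x h. D x h + E x h"]) (auto intro!: flat_algebra.intros derivative_intros)
  next
    case (mult f g)
    then obtain D E where D: "\<forall>x. (f has_derivative D x) (at x)" "\<forall>i. (\<lambda>x. D x (axis i 1)) \<in> flat_algebra"
      and E: "\<forall>x. (g has_derivative E x) (at x)" "\<forall>i. (\<lambda>x. E x (axis i 1)) \<in> flat_algebra"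
      by blast
    show ?case
      using D E mult.hyps
      by (intro exI[of _ "\<lambda>x h. f x * E x h + D x h * g x"]) (auto intro!: flat_algebra.intros derivative_intros)
  qed
  then show thesis using that by blast
qed

lemma flat_algebra_differentiable:
  "f \<in> flat_algebra \<Longrightarrow> f differentiable at x"
  by (metis flat_algebra_derivative differentiableI)

lemma pd_eqI: "(f has_derivative D) (at x) \<Longrightarrow> pd i f x = D (axis i 1)"
  by (simp add: pd_def frechet_derivative_at[symmetric])

lemma pd_flat_algebra: "f \<in> flat_algebra \<Longrightarrow> pd i f \<in> flat_algebra"
proof -
  assume "f \<in> flat_algebra"
  then obtain D where D: "\<And>x. (f has_derivative D x) (at x)" "\<And>i. (\<lambda>x. D x (axis i 1)) \<in> flat_algebra"
    by (rule flat_algebra_derivative) blast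
  have "pd i f = (\<lambda>x. D x (axis i 1))"
    by (rule ext) (rule pd_eqI[OF D(1)])
  then show ?thesis using D(2) by simp
qed

lemma iter_pd_Cons: "iter_pd (i # js) f = pd i (iter_pd js f)"
  by (simp add: iter_pd_def)

lemma iter_pd_Nil: "iter_pd [] f = f"
  by (simp add: iter_pd_def)

lemma iter_pd_append: "iter_pd (is @ js) f = iter_pd is (iter_pd js f)"
  by (simp add: iter_pd_def)

lemma iter_pd_flat_algebra: "f \<in> flat_algebra \<Longrightarrow> iter_pd js f \<in> flat_algebra"
  by (induction js) (auto simp: iter_pd_Nil iter_pd_Cons pd_flat_algebra)

lemma prod_flat_algebra:
  "finite I \<Longrightarrow> (\<And>i. i \<in> I \<Longrightarrow> f i \<in> flat_algebra) \<Longrightarrow> (\<lambda>x. \<Prod>i\<in>I. f i x) \<in> flat_algebra"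
  by (induction I rule: finite_induct) (auto intro: flat_algebra.intros)

text \<open>Differentiability of every iterated partial derivative already makes each of them
  continuous, so the two clauses of \<open>C_k_on\<close> for all orders collapse into one.\<close>

definition smooth :: "(real^'n::finite \<Rightarrow> 'b::real_normed_vector) \<Rightarrow> bool" where
  "smooth f \<longleftrightarrow> (\<forall>js x. iter_pd js f differentiable at x)"

lemma smooth_iff_C_k: "smooth f \<longleftrightarrow> (\<forall>k. C_k_on k UNIV f)"
proof
  assume "smooth f"
  then show "\<forall>k. C_k_on k UNIV f"
    by (auto simp: smooth_def C_k_on_def differentiable_on_def differentiable_imp_continuous_on)
next
  assume *: "\<forall>k. C_k_on k UNIV f"
  show "smooth f"
    unfolding smooth_def
  proof (intro allI)
    fix js :: "'a list" and x
    from * have "C_k_on (Suc (length js)) UNIV f" by blast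
    then show "iter_pd js f differentiable at x"
      by (auto simp: C_k_on_def differentiable_on_def)
  qed
qed

lemma flat_algebra_smooth: "f \<in> flat_algebra \<Longrightarrow> smooth f"
  unfolding smooth_def by (metis flat_algebra_differentiable iter_pd_flat_algebra)

lemma smooth_pd: "smooth f \<Longrightarrow> smooth (pd i f)"
  unfolding smooth_def by (metis iter_pd_append iter_pd_Cons iter_pd_Nil)

lemma smooth_differentiable: "smooth f \<Longrightarrow> f differentiable at x"
  unfolding smooth_def by (metis iter_pd_Nil)

lemma smooth_continuous: "smooth f \<Longrightarrow> continuous_on A f"
  by (meson smooth_differentiable differentiable_imp_continuous_within continuous_at_imp_continuous_on)

section \<open>Partial and directional derivatives, supports of test functions\<close>

lemma has_derivative_pd:
  assumes "(f :: real^'n::finite \<Rightarrow> 'b::real_normed_vector) differentiable at x"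
  shows "(f has_derivative (\<lambda>h. \<Sum>i\<in>UNIV. h $ i *\<^sub>R pd i f x)) (at x)"
proof -
  let ?D = "frechet_derivative f (at x)"
  have D: "(f has_derivative ?D) (at x)" using assms by (simp add: frechet_derivative_works)
  then have lin: "linear ?D" by (simp add: has_derivative_linear)
  have "?D h = (\<Sum>i\<in>UNIV. h $ i *\<^sub>R pd i f x)" for h
  proof -
    have "?D h = ?D (\<Sum>i\<in>UNIV. h $ i *\<^sub>R axis i 1)"
      using basis_expansion[of h] by (simp add: scalar_mult_eq_scaleR)
    also have "\<dots> = (\<Sum>i\<in>UNIV. h $ i *\<^sub>R pd i f x)"
      by (simp add: linear_sum[OF lin] linear_cmul[OF lin] pd_def)
    finally show ?thesis .
  qed
  then have "?D = (\<lambda>h. \<Sum>i\<in>UNIV. h $ i *\<^sub>R pd i f x)" by (rule ext)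
  with D show ?thesis by simp
qed

definition dir_deriv :: "real^'n::finite \<Rightarrow> (real^'n \<Rightarrow> 'b::real_normed_vector) \<Rightarrow> real^'n \<Rightarrow> 'b" where
  "dir_deriv e f x = (\<Sum>i\<in>UNIV. e $ i *\<^sub>R pd i f x)"

lemma has_derivative_imp_line:
  assumes "(f has_derivative D) (at (x::'a::real_normed_vector))"
  shows "((\<lambda>s. f (x + s *\<^sub>R e)) has_vector_derivative D e) (at 0)"
proof -
  have "((\<lambda>s. x + s *\<^sub>R e) has_derivative (\<lambda>s. s *\<^sub>R e)) (at 0)"
    by (auto intro!: derivative_eq_intros)
  moreover have "(f has_derivative D) (at (x + 0 *\<^sub>R e))" using assms by simp
  ultimately have "((\<lambda>s. f (x + s *\<^sub>R e)) has_derivative (\<lambda>s. D (s *\<^sub>R e))) (at 0)"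
    by (rule has_derivative_compose)
  then show ?thesis
    using has_derivative_linear[OF assms] by (simp add: has_vector_derivative_def linear_cmul)
qed

lemma dir_deriv_line:
  assumes "f differentiable at (x :: real^'n::finite)"
  shows "((\<lambda>s. f (x + s *\<^sub>R e)) has_vector_derivative dir_deriv e f x) (at 0)"
  unfolding dir_deriv_def by (rule has_derivative_imp_line[OF has_derivative_pd[OF assms]])

lemma dir_deriv_axis: "dir_deriv (axis i 1) f = pd i f"
  by (auto simp: dir_deriv_def axis_def if_distrib[where f="\<lambda>c. c *\<^sub>R _"] cong: if_cong)

lemma smooth_dir_deriv_continuous: "smooth f \<Longrightarrow> continuous_on A (dir_deriv e f)"
  unfolding dir_deriv_def[abs_def]
  by (intro continuous_intros smooth_continuous smooth_pd)

lemma test_function_smooth: "test_function U \<phi> \<Longrightarrow> smooth \<phi>"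
  by (simp add: test_function_def smooth_iff_C_k)

lemma pd_zero_outside:
  assumes "x \<notin> closure {x. f x \<noteq> 0}"
  shows "pd i f x = 0"
proof -
  have "((\<lambda>x. 0) has_derivative (\<lambda>h. 0)) (at x)" by simp
  then have "(f has_derivative (\<lambda>h. 0)) (at x)"
    by (rule has_derivative_transform_within_open[where s="- closure {x. f x \<noteq> 0}"])
       (use assms closure_subset[of "{x. f x \<noteq> 0}"] in auto)
  then show ?thesis by (rule pd_eqI)
qed

lemma test_function_pd:
  assumes "test_function U \<phi>" shows "test_function U (pd i \<phi>)"
proof -
  have "{x. pd i \<phi> x \<noteq> 0} \<subseteq> closure {x. \<phi> x \<noteq> 0}"
    using pd_zero_outside by blast
  then have "closure {x. pd i \<phi> x \<noteq> 0} \<subseteq> closure {x. \<phi> x \<noteq> 0}"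
    by (simp add: closure_minimal)
  moreover have "smooth (pd i \<phi>)" using assms by (simp add: test_function_smooth smooth_pd)
  moreover have "compact (closure {x. pd i \<phi> x \<noteq> 0})"
    using calculation(1) assms by (metis compact_Int_closed closed_closure inf.absorb2 test_function_def)
  ultimately show ?thesis
    using assms unfolding test_function_def smooth_iff_C_k[symmetric]
    by blast
qed

text \<open>\<open>flat 0\<close> is applied to the scaled signed distances to the faces; large
  \<open>j\<close> steepens the sides, so that the limit is the indicator of the open box. The
  arguments are written as \<open>c * x $ i + d\<close> to match the generators of
  \<open>flat_algebra\<close>.\<close>

definition box_bump :: "real^'n::finite \<Rightarrow> real^'n \<Rightarrow> real \<Rightarrow> real^'n \<Rightarrow> real" where
  "box_bump a b j x = (\<Prod>i\<in>UNIV. flat 0 (j * x $ i + - j * a $ i) * flat 0 (- j * x $ i + j * b $ i))"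

lemma box_bump_flat_algebra: "box_bump a b j \<in> flat_algebra"
  unfolding box_bump_def[abs_def] by (intro prod_flat_algebra flat_algebra.intros) auto

lemma flat0_le_1: "flat 0 t \<le> 1"
  by (auto simp: flat_def)

lemma box_bump_bounds: "0 \<le> box_bump a b j x" "box_bump a b j x \<le> 1"
  unfolding box_bump_def
  by (intro prod_nonneg ballI mult_nonneg_nonneg flat_nonneg)
     (intro prod_le_1 conjI mult_nonneg_nonneg mult_le_one flat_nonneg flat0_le_1)

lemma box_bump_pos_iff: "j > 0 \<Longrightarrow> box_bump a b j x \<noteq> 0 \<longleftrightarrow> x \<in> box a b"
proof -
  assume j: "j > 0"
  have 1: "(flat 0 t \<noteq> 0) = (t > 0)" for t by (auto simp: flat_def)
  have 2: "j * x $ i + - j * a $ i > 0 \<longleftrightarrow> a $ i < x $ i" "- j * x $ i + j * b $ i > 0 \<longleftrightarrow> x $ i < b $ i" for i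
  proof -
    have "j * x $ i + - j * a $ i = j * (x $ i - a $ i)" "- j * x $ i + j * b $ i = j * (b $ i - x $ i)"
      by (simp_all add: algebra_simps)
    then show "j * x $ i + - j * a $ i > 0 \<longleftrightarrow> a $ i < x $ i" "- j * x $ i + j * b $ i > 0 \<longleftrightarrow> x $ i < b $ i"
      using j by (simp_all only: zero_less_mult_iff) auto
  qed
  show ?thesis
    unfolding box_bump_def mem_box_cart by (simp add: 1 2[simplified])
qed

lemma box_bump_test:
  assumes "j > 0" "cbox a b \<subseteq> U" shows "test_function U (box_bump a b j)"
proof -
  have "closure {x. box_bump a b j x \<noteq> 0} \<subseteq> cbox a b"
    by (rule closure_minimal) (auto simp: box_bump_pos_iff assms box_subset_cbox[THEN subsetD] closed_cbox)
  then show ?thesis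
    unfolding test_function_def smooth_iff_C_k[symmetric]
    using assms flat_algebra_smooth[OF box_bump_flat_algebra]
    by (auto intro: bounded_subset[OF bounded_cbox order_trans[OF closure_subset]])
qed

lemma box_bump_tendsto:
  "(\<lambda>j. box_bump a b (real j + 1) x) \<longlonglongrightarrow> indicator (box a b) x"
proof (cases "x \<in> box a b")
  case True
  have *: "(\<lambda>j. flat 0 ((real j + 1) * t)) \<longlonglongrightarrow> 1" if "t > 0" for t
  proof -
    have "(\<lambda>j. exp (- 1 / ((real j + 1) * t))) \<longlonglongrightarrow> exp 0"
    proof (intro tendsto_exp)
      have "(\<lambda>j. (- 1 / t) * inverse (real (Suc j))) \<longlonglongrightarrow> (- 1 / t) * 0"
        by (intro tendsto_mult tendsto_const LIMSEQ_inverse_real_of_nat)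
      then show "(\<lambda>j. - 1 / ((real j + 1) * t)) \<longlonglongrightarrow> 0" by (simp add: field_simps)
    qed
    then show ?thesis using that by (simp add: flat_def)
  qed
  have "(\<lambda>j. \<Prod>i\<in>UNIV. flat 0 ((real j + 1) * (x $ i - a $ i)) * flat 0 ((real j + 1) * (b $ i - x $ i)))
      \<longlonglongrightarrow> (\<Prod>i\<in>(UNIV::'a set). 1 * 1)"
    using True by (intro tendsto_prod tendsto_mult *) (auto simp: mem_box_cart)
  then show ?thesis using True by (simp add: box_bump_def algebra_simps)
next
  case False
  then have "box_bump a b (real j + 1) x = 0" for j
    using box_bump_pos_iff[of "real j + 1" a b x] by auto
  then show ?thesis using False by simp
qed

text \<open>The integral of a directional derivative vanishes because the integral is translation
  invariant; this replaces Fubini and the divergence theorem throughout.\<close>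

lemma integral_directional_derivative:
  fixes F D :: "'a::euclidean_space \<Rightarrow> 'b::euclidean_space"
  assumes F: "continuous_on UNIV F" and D: "continuous_on UNIV D"
    and supp: "\<And>x. norm x > R \<Longrightarrow> F x = 0"
    and der: "\<And>x. ((\<lambda>s. F (x + s *\<^sub>R e)) has_vector_derivative D x) (at 0)"
  shows "integrable lborel D" "(\<integral>x. D x \<partial>lborel) = 0"
proof -
  \<comment> \<open>The margin \<open>norm e + 1\<close> beyond \<open>\<bar>R\<bar>\<close> absorbs
    the shifts by \<open>e / (k + 1)\<close>, so all difference quotients below vanish outside this
    ball.\<close>
  define R' where "R' = \<bar>R\<bar> + norm e + 1"
  have D0: "D x = 0" if "norm x > R" for x
  proof -
    have "((\<lambda>s. F (x + s *\<^sub>R e)) has_vector_derivative 0) (at 0)"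
    proof (rule has_vector_derivative_transform_within_open[of "\<lambda>s. 0" _ _ "{s. norm (x + s *\<^sub>R e) > R}"])
      show "open {s. norm (x + s *\<^sub>R e) > R}"
        by (intro open_Collect_less continuous_intros)
    qed (use that supp in auto)
    with der[of x] show ?thesis by (rule vector_derivative_unique_at)
  qed
  have der': "((\<lambda>s. F (x + s *\<^sub>R e)) has_vector_derivative D (x + t *\<^sub>R e)) (at t)" for x t
  proof -
    have "((\<lambda>s. F ((x + t *\<^sub>R e) + s *\<^sub>R e)) has_vector_derivative D (x + t *\<^sub>R e)) (at (t - t))"
      using der[of "x + t *\<^sub>R e"] by simp
    moreover have "((\<lambda>s. s - t) has_vector_derivative 1) (at t)"
      by (auto intro!: derivative_eq_intros)
    ultimately have "((\<lambda>s. F ((x + t *\<^sub>R e) + s *\<^sub>R e)) \<circ> (\<lambda>s. s - t) has_vector_derivative (1 *\<^sub>R D (x + t *\<^sub>R e))) (at t)"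
      by (intro vector_diff_chain_at) auto
    then show ?thesis by (simp add: o_def algebra_simps)
  qed
  have "bounded (D ` cball 0 R')"
    by (intro compact_imp_bounded compact_continuous_image continuous_on_subset[OF D]) auto
  then obtain L where L: "L > 0" "\<And>x. norm x \<le> R' \<Longrightarrow> norm (D x) \<le> L"
    unfolding bounded_pos by auto
  have L': "norm (D x) \<le> L" for x
  proof (cases "norm x \<le> R'")
    case False
    then have "norm x > R" using norm_ge_zero[of e] unfolding R'_def by linarith
    then show ?thesis using D0 L by simp
  qed (use L in auto)
  \<comment> \<open>The mean value inequality along \<open>e\<close> supplies the constant that
    dominates all difference quotients.\<close>
  have lip: "norm (F (x + s *\<^sub>R e) - F x) \<le> L * \<bar>s\<bar>" for x s
  proof -
    have "norm (F (x + s *\<^sub>R e) - F (x + 0 *\<^sub>R e)) \<le> L * norm (s - 0)"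
      by (rule differentiable_bound[where S=UNIV and f'="\<lambda>t u. u *\<^sub>R D (x + t *\<^sub>R e)"])
         (use der' L' in \<open>auto simp: has_vector_derivative_def intro!: onorm_le\<close>,
          metis L' mult.commute mult_left_mono abs_ge_zero)
    then show ?thesis by simp
  qed
  have Fint: "integrable lborel F"
  proof -
    have "integrable lborel (\<lambda>x. indicator (cball 0 R') x *\<^sub>R F x)"
      using borel_integrable_compact[of "cball 0 R'" F] F
      by (auto intro: continuous_on_subset)
    moreover have "(\<lambda>x. indicator (cball 0 R') x *\<^sub>R F x) = F"
    proof (rule ext)
      fix x show "indicator (cball 0 R') x *\<^sub>R F x = F x"
      proof (cases "norm x \<le> R'")
        case False
        then have "norm x > R" using norm_ge_zero[of e] unfolding R'_def by linarith
        then show ?thesis using supp by simp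
      qed simp
    qed
    ultimately show ?thesis by simp
  qed
  define g where "g = (\<lambda>(k::nat) x. real (Suc k) *\<^sub>R (F (x + (1 / real (Suc k)) *\<^sub>R e) - F x))"
  have Fm: "F \<in> borel_measurable borel" "D \<in> borel_measurable borel"
    using F D by (auto intro: borel_measurable_continuous_onI)
  have trans: "integrable lborel (\<lambda>x. F (x + c))" "(\<integral>x. F (x + c) \<partial>lborel) = (\<integral>x. F x \<partial>lborel)" for c
  proof -
    have m: "(+) c \<in> measurable lborel borel" by simp
    show "integrable lborel (\<lambda>x. F (x + c))"
      using integrable_distr_eq[OF m Fm(1)] Fint by (simp add: lborel_distr_plus add.commute)
    show "(\<integral>x. F (x + c) \<partial>lborel) = (\<integral>x. F x \<partial>lborel)"
      using integral_distr[OF m Fm(1)] by (simp add: lborel_distr_plus add.commute)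
  qed
  have g0: "(\<integral>x. g k x \<partial>lborel) = 0" for k
    unfolding g_def using trans Fint by simp
  have glim: "(\<lambda>k. g k x) \<longlonglongrightarrow> D x" for x
  proof -
    have "((\<lambda>s. norm (F (x + s *\<^sub>R e) - F x - s *\<^sub>R D x) / norm s) \<longlongrightarrow> 0) (at 0)"
      using der[of x] by (simp add: has_vector_derivative_def has_derivative_at)
    then have "((\<lambda>s. norm ((F (x + s *\<^sub>R e) - F x) /\<^sub>R s - D x)) \<longlongrightarrow> 0) (at 0)"
    proof (rule Lim_transform_eventually)
      show "\<forall>\<^sub>F s in at 0. norm (F (x + s *\<^sub>R e) - F x - s *\<^sub>R D x) / norm s
          = norm ((F (x + s *\<^sub>R e) - F x) /\<^sub>R s - D x)"
      proof (unfold eventually_at_filter, intro always_eventually allI impI)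
        fix s :: real assume "s \<noteq> 0"
        then have "(F (x + s *\<^sub>R e) - F x) /\<^sub>R s - D x = (1 / s) *\<^sub>R (F (x + s *\<^sub>R e) - F x - s *\<^sub>R D x)"
          by (simp add: scaleR_diff_right inverse_eq_divide)
        then show "norm (F (x + s *\<^sub>R e) - F x - s *\<^sub>R D x) / norm s
          = norm ((F (x + s *\<^sub>R e) - F x) /\<^sub>R s - D x)" by simp
      qed
    qed
    then have "((\<lambda>s. (F (x + s *\<^sub>R e) - F x) /\<^sub>R s) \<longlongrightarrow> D x) (at 0)"
      by (simp add: tendsto_norm_zero_iff LIM_zero_iff)
    moreover have "filterlim (\<lambda>k. 1 / real (Suc k)) (at 0) sequentially"
      using LIMSEQ_inverse_real_of_nat by (auto simp: filterlim_at inverse_eq_divide)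
    ultimately have "(\<lambda>k. (F (x + (1 / real (Suc k)) *\<^sub>R e) - F x) /\<^sub>R (1 / real (Suc k))) \<longlonglongrightarrow> D x"
      by (rule filterlim_compose)
    then show ?thesis by (simp add: g_def)
  qed
  let ?w = "\<lambda>x. indicator (cball 0 R') x *\<^sub>R (L::real)"
  have dom: "norm (g k x) \<le> ?w x" for k x
  proof (cases "x \<in> cball 0 R'")
    case True
    have "norm (g k x) \<le> real (Suc k) * (L * \<bar>1 / real (Suc k)\<bar>)"
      unfolding g_def norm_scaleR by (intro mult_mono lip) auto
    then show ?thesis using True by simp
  next
    case False
    then have nx: "norm x > \<bar>R\<bar> + norm e + 1" by (simp add: R'_def)
    have "norm x \<le> norm (x + (1 / real (Suc k)) *\<^sub>R e) + norm ((1 / real (Suc k)) *\<^sub>R e)"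
      by (metis add_diff_cancel norm_triangle_ineq4)
    also have "norm ((1 / real (Suc k)) *\<^sub>R e) \<le> norm e" by (simp add: divide_le_eq distrib_left)
    finally have "norm (x + (1 / real (Suc k)) *\<^sub>R e) > R" using nx by linarith
    moreover have "norm x > R" using nx norm_ge_zero[of e] by linarith
    ultimately have "g k x = 0" by (simp add: g_def supp)
    then show ?thesis using False by simp
  qed
  have gm: "g k \<in> borel_measurable lborel" for k
    unfolding g_def using borel_measurable_integrable[OF trans(1)] Fm by (intro borel_measurable_scaleR borel_measurable_diff) auto
  have wi: "integrable lborel ?w"
    by (intro integrable_scaleR_left integrable_real_indicator) (simp_all add: emeasure_bounded_finite[OF bounded_cball, simplified])
  have ae1: "AE x in lborel. (\<lambda>k. g k x) \<longlonglongrightarrow> D x"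
    using glim by (intro AE_I2)
  have ae2: "AE x in lborel. norm (g k x) \<le> ?w x" for k
    using dom by (intro AE_I2)
  have Dm: "D \<in> borel_measurable lborel" using Fm by simp
  show "integrable lborel D"
    by (rule integrable_dominated_convergence[OF Dm gm wi ae1 ae2])
  have "(\<lambda>k. \<integral>x. g k x \<partial>lborel) \<longlonglongrightarrow> (\<integral>x. D x \<partial>lborel)"
    by (rule integral_dominated_convergence[OF Dm gm wi ae1 ae2])
  then have "(\<lambda>k::nat. 0) \<longlonglongrightarrow> (\<integral>x. D x \<partial>lborel)" unfolding g0 .
  then show "(\<integral>x. D x \<partial>lborel) = 0" by (metis LIMSEQ_unique tendsto_const)
qed

section \<open>Weak derivatives\<close>

lemma integrable_lebesgue_of_lborel:
  "integrable lborel f \<Longrightarrow> integrable lebesgue (f :: 'a::euclidean_space \<Rightarrow> 'b::{banach,second_countable_topology})"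
  using integrable_completion[of f lborel] by (simp add: borel_measurable_integrable)

lemma set_integral_zero_outside:
  assumes "\<And>x. x \<notin> U \<Longrightarrow> f x = 0"
  shows "(LINT x:U|M. f x) = (\<integral>x. f x \<partial>M)"
  unfolding set_lebesgue_integral_def
  by (rule Bochner_Integration.integral_cong) (auto simp: indicator_def assms)

lemma locally_integrable_mult:
  fixes f :: "real^'n::finite \<Rightarrow> 'b::euclidean_space" and w :: "real^'n \<Rightarrow> real"
  assumes f: "locally_integrable_on f U" and C: "compact C" "C \<subseteq> U"
    and w: "w \<in> borel_measurable borel" "\<And>x. \<bar>w x\<bar> \<le> M" "\<And>x. x \<notin> C \<Longrightarrow> w x = 0"
  shows "integrable lebesgue (\<lambda>x. w x *\<^sub>R f x)"
    and "(LINT x:U|lebesgue. w x *\<^sub>R f x) = (\<integral>x. w x *\<^sub>R f x \<partial>lebesgue)"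
proof -
  have i: "integrable lebesgue (\<lambda>x. indicator C x *\<^sub>R f x)"
    using f C by (auto simp: locally_integrable_on_def set_integrable_def)
  have eq: "(\<lambda>x. w x *\<^sub>R f x) = (\<lambda>x. w x *\<^sub>R (indicator C x *\<^sub>R f x))"
    using w(3) by (auto simp: fun_eq_iff indicator_def)
  have wm: "w \<in> borel_measurable lebesgue" using w(1) by (simp add: measurable_completion)
  show "integrable lebesgue (\<lambda>x. w x *\<^sub>R f x)"
    unfolding eq
  proof (rule Bochner_Integration.integrable_bound)
    show "integrable lebesgue (\<lambda>x. M *\<^sub>R (indicator C x *\<^sub>R f x))" using i by (rule integrable_scaleR_right)
    show "(\<lambda>x. w x *\<^sub>R (indicator C x *\<^sub>R f x)) \<in> borel_measurable lebesgue"
      by (intro borel_measurable_scaleR wm borel_measurable_integrable[OF i])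
    show "AE x in lebesgue. norm (w x *\<^sub>R (indicator C x *\<^sub>R f x)) \<le> norm (M *\<^sub>R (indicator C x *\<^sub>R f x))"
    proof (intro AE_I2)
      fix x
      have "\<bar>w x\<bar> \<le> \<bar>M\<bar>" using w(2)[of x] by linarith
      then show "norm (w x *\<^sub>R (indicator C x *\<^sub>R f x)) \<le> norm (M *\<^sub>R (indicator C x *\<^sub>R f x))"
        by (simp add: mult_right_mono del: scaleR_scaleR)
    qed
  qed
  show "(LINT x:U|lebesgue. w x *\<^sub>R f x) = (\<integral>x. w x *\<^sub>R f x \<partial>lebesgue)"
    by (rule set_integral_zero_outside) (use w C in auto)
qed

lemma continuous_compact_support_bounded:
  fixes \<psi> :: "'a::euclidean_space \<Rightarrow> 'b::real_normed_vector"
  assumes "continuous_on UNIV \<psi>" "compact C" "\<And>x. x \<notin> C \<Longrightarrow> \<psi> x = 0"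
  obtains M where "M > 0" "\<And>x. norm (\<psi> x) \<le> M"
proof -
  have "bounded (\<psi> ` C)"
    by (intro compact_imp_bounded compact_continuous_image continuous_on_subset[OF assms(1)]) (use assms in auto)
  then obtain M where M: "M > 0" "\<And>x. x \<in> C \<Longrightarrow> norm (\<psi> x) \<le> M" unfolding bounded_pos by auto
  then have "norm (\<psi> x) \<le> M" for x using assms(3)[of x] by (cases "x \<in> C") auto
  with M(1) that show thesis by blast
qed

lemma test_function_support:
  assumes "test_function U \<phi>"
  obtains C where "compact C" "C \<subseteq> U" "\<And>x. x \<notin> C \<Longrightarrow> \<phi> x = 0" "\<And>x i. x \<notin> C \<Longrightarrow> pd i \<phi> x = 0"
proof (rule that)
  show "compact (closure {x. \<phi> x \<noteq> 0})" "closure {x. \<phi> x \<noteq> 0} \<subseteq> U"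
    using assms by (auto simp: test_function_def)
  show "\<phi> x = 0" if "x \<notin> closure {x. \<phi> x \<noteq> 0}" for x
    using that closure_subset[of "{x. \<phi> x \<noteq> 0}"] by blast
  show "pd i \<phi> x = 0" if "x \<notin> closure {x. \<phi> x \<noteq> 0}" for x i
    using that by (rule pd_zero_outside)
qed

lemma test_function_integral:
  fixes f :: "real^'n::finite \<Rightarrow> 'b::euclidean_space" and \<phi> :: "real^'n \<Rightarrow> real"
  assumes f: "locally_integrable_on f U" and \<phi>: "test_function U \<phi>"
  shows "integrable lebesgue (\<lambda>x. \<phi> x *\<^sub>R f x)"
    and "(LINT x:U|lebesgue. \<phi> x *\<^sub>R f x) = (\<integral>x. \<phi> x *\<^sub>R f x \<partial>lebesgue)"
proof -
  obtain C where C: "compact C" "C \<subseteq> U" "\<And>x. x \<notin> C \<Longrightarrow> \<phi> x = 0"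
    using test_function_support[OF \<phi>] by metis
  have c: "continuous_on UNIV \<phi>" using \<phi> by (simp add: test_function_smooth smooth_continuous)
  obtain M where M: "\<And>x. norm (\<phi> x) \<le> M" using continuous_compact_support_bounded[OF c C(1,3)] by metis
  have m: "\<phi> \<in> borel_measurable borel" using c by (rule borel_measurable_continuous_onI)
  have M': "\<bar>\<phi> x\<bar> \<le> M" for x using M by simp
  show "integrable lebesgue (\<lambda>x. \<phi> x *\<^sub>R f x)"
    "(LINT x:U|lebesgue. \<phi> x *\<^sub>R f x) = (\<integral>x. \<phi> x *\<^sub>R f x \<partial>lebesgue)"
    by (rule locally_integrable_mult[OF f C(1,2) m M' C(3)]; assumption)+
qed

text \<open>Test functions vanish outside \<open>U\<close>, so the integrals may be taken over the
  whole space. In this form restriction to smaller sets is immediate.\<close>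

lemma weak_pd_iff:
  "weak_pd U i f g \<longleftrightarrow> locally_integrable_on f U \<and> locally_integrable_on g U \<and>
     (\<forall>\<phi> :: real^'n::finite \<Rightarrow> real. test_function U \<phi> \<longrightarrow>
        (\<integral>x. pd i \<phi> x *\<^sub>R f x \<partial>lebesgue) = - (\<integral>x. \<phi> x *\<^sub>R g x \<partial>lebesgue))"
  unfolding weak_pd_def by (auto simp: test_function_integral test_function_pd)

lemma test_function_mono: "test_function U \<phi> \<Longrightarrow> U \<subseteq> V \<Longrightarrow> test_function V \<phi>"
  unfolding test_function_def by blast

lemma locally_integrable_mono: "locally_integrable_on f V \<Longrightarrow> U \<subseteq> V \<Longrightarrow> locally_integrable_on f U"
  unfolding locally_integrable_on_def by blast

lemma weak_pd_mono: "weak_pd V i f g \<Longrightarrow> U \<subseteq> V \<Longrightarrow> weak_pd U i f g"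
  unfolding weak_pd_iff by (blast intro: test_function_mono locally_integrable_mono)

lemma weak_hessian_mono: "weak_hessian V f H \<Longrightarrow> U \<subseteq> V \<Longrightarrow> weak_hessian U f H"
  unfolding weak_hessian_def weak_gradient_def by (blast intro: weak_pd_mono)

lemma nn_set_integral_mono_set:
  "U \<subseteq> V \<Longrightarrow> (\<integral>\<^sup>+x\<in>U. f x \<partial>M) \<le> (\<integral>\<^sup>+x\<in>V. f x \<partial>M)"
  by (intro nn_integral_mono) (auto simp: indicator_def)

lemma L2_norm_mono_set:
  assumes "U \<subseteq> V" shows "L2_norm U f \<le> L2_norm V f"
proof -
  have le: "(\<integral>\<^sup>+x\<in>U. ennreal ((norm (f x))\<^sup>2) \<partial>lebesgue) \<le> (\<integral>\<^sup>+x\<in>V. ennreal ((norm (f x))\<^sup>2) \<partial>lebesgue)"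
    by (rule nn_set_integral_mono_set[OF assms])
  show ?thesis
  proof (cases "(\<integral>\<^sup>+x\<in>V. ennreal ((norm (f x))\<^sup>2) \<partial>lebesgue) = \<infinity>")
    case False
    then have "(\<integral>\<^sup>+x\<in>V. ennreal ((norm (f x))\<^sup>2) \<partial>lebesgue) < \<infinity>" by (simp add: top.not_eq_extremum)
    then show ?thesis
      using le by (auto simp: L2_norm_def Let_def intro!: ennreal_leI real_sqrt_le_mono enn2real_mono)
  qed (simp add: L2_norm_def)
qed

text \<open>A weak Hessian on the larger set restricts to one on the smaller set. This bounds the
  norm over the gap cylinder by the norm over the whole fluid.\<close>

lemma hessian_norm_mono: "U \<subseteq> V \<Longrightarrow> hessian_norm U f \<le> hessian_norm V f"
  unfolding hessian_norm_def
proof (rule INF_mono)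
  assume UV: "U \<subseteq> V"
  fix H assume "H \<in> {H. weak_hessian V f H}"
  then show "\<exists>G\<in>{H. weak_hessian U f H}. L2_norm U (\<lambda>x. sqrt (\<Sum>i\<in>UNIV. \<Sum>j\<in>UNIV. (norm (G i j x))\<^sup>2))
      \<le> L2_norm V (\<lambda>x. sqrt (\<Sum>i\<in>UNIV. \<Sum>j\<in>UNIV. (norm (H i j x))\<^sup>2))"
    using weak_hessian_mono[OF _ UV] L2_norm_mono_set[OF UV] by blast
qed

lemma locally_integrable_diff:
  "locally_integrable_on f U \<Longrightarrow> locally_integrable_on g U \<Longrightarrow> locally_integrable_on (\<lambda>x. f x - g x) U"
  unfolding locally_integrable_on_def by (simp add: set_integral_diff)

lemma set_integrable_compact_continuous:
  fixes f :: "real^'n::finite \<Rightarrow> 'b::euclidean_space"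
  assumes "continuous_on C f" "compact C"
  shows "set_integrable lebesgue C f"
  using borel_integrable_compact[OF assms(2,1)] unfolding set_integrable_def
  by (rule integrable_lebesgue_of_lborel)

lemma continuous_locally_integrable:
  fixes f :: "real^'n::finite \<Rightarrow> 'b::euclidean_space"
  shows "continuous_on U f \<Longrightarrow> locally_integrable_on f U"
  unfolding locally_integrable_on_def
  by (auto intro: set_integrable_compact_continuous continuous_on_subset)

text \<open>Lebesgue differentiation: averages over shrinking cubes converge to \<open>g\<close>
  almost everywhere, and here all averages are 0.\<close>

lemma AE_zero_of_cbox_integrals:
  fixes g :: "'a::euclidean_space \<Rightarrow> 'b::euclidean_space"
  assumes g: "integrable lebesgue g" and z: "\<And>a b. (LINT x:cbox a b|lebesgue. g x) = 0"
  shows "AE x in lebesgue. g x = 0"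
proof -
  have si: "set_integrable lebesgue (cbox a b) g" for a b
    unfolding set_integrable_def using g by (intro integrable_mult_indicator) auto
  have int: "g integrable_on cbox a b" "integral (cbox a b) g = 0" for a b
    using set_lebesgue_integral_eq_integral[OF si] z by auto
  obtain N where N: "negligible N"
    "\<And>x e. \<lbrakk>x \<notin> N; 0 < e\<rbrakk> \<Longrightarrow> \<exists>d>0. \<forall>h. 0 < h \<and> h < d \<longrightarrow>
        norm (integral (cbox x (x + h *\<^sub>R One)) g /\<^sub>R h ^ DIM('a) - g x) < e"
    using integrable_ccontinuous_explicit[of g] int(1) by blast
  have "g x = 0" if x: "x \<notin> N" for x
  proof (rule ccontr)
    assume "g x \<noteq> 0"
    \<comment> \<open>The tolerance \<open>norm (g x)\<close> is contradictory: the averages are 0,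
      and 0 has exactly this distance from \<open>g x\<close>.\<close>
    then have "\<exists>d>0. \<forall>h. 0 < h \<and> h < d \<longrightarrow> norm (integral (cbox x (x + h *\<^sub>R One)) g /\<^sub>R h ^ DIM('a) - g x) < norm (g x)"
      by (intro N(2)[OF x]) simp
    then have "\<exists>d>0. \<forall>h>0::real. \<not> h < d"
      by (simp add: int)
    then obtain d::real where "d > 0" "\<forall>h>0. \<not> h < d"
      by blast
    then show False using dense by blast
  qed
  then show ?thesis
    using N(1) by (intro AE_I'[of N]) (auto simp: negligible_iff_null_sets)
qed

text \<open>The fundamental lemma of the calculus of variations. Bumps increasing in steepness give
  zero integrals over boxes in \<open>U\<close>, and a countable cover of \<open>U\<close> by closed
  boxes makes the exceptional set null.\<close>

theorem locally_integrable_AE_zero: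
  fixes f :: "real^'n::finite \<Rightarrow> 'b::euclidean_space"
  assumes U: "open U" and f: "locally_integrable_on f U"
    and z: "\<And>\<phi> :: real^'n \<Rightarrow> real. test_function U \<phi> \<Longrightarrow> (\<integral>x. \<phi> x *\<^sub>R f x \<partial>lebesgue) = 0"
  shows "AE x in lebesgue. x \<in> U \<longrightarrow> f x = 0"
proof -
  have box0: "(\<integral>x. indicator (box a b) x *\<^sub>R f x \<partial>lebesgue) = 0" if ab: "cbox a b \<subseteq> U" for a b
  proof -
    have C: "integrable lebesgue (\<lambda>x. indicator (cbox a b) x *\<^sub>R f x)"
      using f ab by (auto simp: locally_integrable_on_def set_integrable_def compact_cbox)
    have eq: "box_bump a b (real j + 1) x *\<^sub>R f x = box_bump a b (real j + 1) x *\<^sub>R (indicator (cbox a b) x *\<^sub>R f x)" for j x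
      using box_bump_pos_iff[of "real j + 1" a b x] box_subset_cbox[of a b] by (auto simp: indicator_def)
    have eq2: "indicator (box a b) x *\<^sub>R f x = indicator (box a b) x *\<^sub>R (indicator (cbox a b) x *\<^sub>R f x)" for x
      using box_subset_cbox[of a b] by (auto simp: indicator_def)
    have "(\<lambda>j. \<integral>x. box_bump a b (real j + 1) x *\<^sub>R f x \<partial>lebesgue) \<longlonglongrightarrow> (\<integral>x. indicator (box a b) x *\<^sub>R f x \<partial>lebesgue)"
      unfolding eq eq2
    proof (rule integral_dominated_convergence)
      show "integrable lebesgue (\<lambda>x. norm (indicator (cbox a b) x *\<^sub>R f x))" using C by (rule integrable_norm)
      have "box_bump a b (real j + 1) \<in> borel_measurable lebesgue" for j
      proof (rule measurable_completion)
        show "box_bump a b (real j + 1) \<in> borel_measurable lborel"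
          using flat_algebra_smooth[OF box_bump_flat_algebra, THEN smooth_continuous, THEN borel_measurable_continuous_onI] by simp
      qed
      then show "(\<lambda>x. box_bump a b (real j + 1) x *\<^sub>R (indicator (cbox a b) x *\<^sub>R f x)) \<in> borel_measurable lebesgue" for j
        by (intro borel_measurable_scaleR borel_measurable_integrable[OF C])
      show "(\<lambda>x. indicator (box a b) x *\<^sub>R (indicator (cbox a b) x *\<^sub>R f x)) \<in> borel_measurable lebesgue"
        by (rule borel_measurable_scaleR[OF _ borel_measurable_integrable[OF C]])
           (simp add: measurable_completion)
      show "AE x in lebesgue. (\<lambda>j. box_bump a b (real j + 1) x *\<^sub>R (indicator (cbox a b) x *\<^sub>R f x))
          \<longlonglongrightarrow> indicator (box a b) x *\<^sub>R (indicator (cbox a b) x *\<^sub>R f x)"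
        by (intro AE_I2 tendsto_scaleR tendsto_const box_bump_tendsto)
      show "AE x in lebesgue. norm (box_bump a b (real j + 1) x *\<^sub>R (indicator (cbox a b) x *\<^sub>R f x))
          \<le> norm (indicator (cbox a b) x *\<^sub>R f x)" for j
      proof (intro AE_I2)
        fix x
        have "\<bar>box_bump a b (real j + 1) x\<bar> \<le> 1" using box_bump_bounds[of a b "real j + 1" x] by auto
        then show "norm (box_bump a b (real j + 1) x *\<^sub>R (indicator (cbox a b) x *\<^sub>R f x))
          \<le> norm (indicator (cbox a b) x *\<^sub>R f x)"
          unfolding norm_scaleR[of "box_bump a b (real j + 1) x"] by (intro mult_left_le_one_le) auto
      qed
    qed
    moreover have "(\<integral>x. box_bump a b (real j + 1) x *\<^sub>R f x \<partial>lebesgue) = 0" for j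
      by (intro z box_bump_test ab) auto
    ultimately show ?thesis by (simp add: LIMSEQ_const_iff)
  qed
  have local0: "AE x in lebesgue. x \<in> C \<longrightarrow> f x = 0" if CU: "C \<subseteq> U" "C = cbox c d" for C c d
  proof -
    define g where "g = (\<lambda>x. indicator C x *\<^sub>R f x)"
    have "integrable lebesgue g"
      using f CU by (auto simp: g_def locally_integrable_on_def set_integrable_def compact_cbox)
    moreover have "(LINT x:cbox a b|lebesgue. g x) = 0" for a b
    proof -
      obtain p q where pq: "cbox a b \<inter> cbox c d = cbox p q"
        using Int_interval by blast
      have "(LINT x:cbox a b|lebesgue. g x) = (\<integral>x. indicator (cbox p q) x *\<^sub>R f x \<partial>lebesgue)"
        unfolding set_lebesgue_integral_def g_def pq[symmetric] CU(2)
        by (intro Bochner_Integration.integral_cong) (auto simp: indicator_def)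
      also have "\<dots> = (\<integral>x. indicator (box p q) x *\<^sub>R f x \<partial>lebesgue)"
      proof (rule integral_cong_AE)
        have pqU: "cbox p q \<subseteq> U" using pq CU by blast
        then have m: "(\<lambda>x. indicator (cbox p q) x *\<^sub>R f x) \<in> borel_measurable lebesgue"
          using f by (intro borel_measurable_integrable) (auto simp: locally_integrable_on_def set_integrable_def compact_cbox)
        show "(\<lambda>x. indicator (cbox p q) x *\<^sub>R f x) \<in> borel_measurable lebesgue" by (rule m)
        have "(\<lambda>x. indicator (box p q) x *\<^sub>R (indicator (cbox p q) x *\<^sub>R f x)) \<in> borel_measurable lebesgue"
          by (rule borel_measurable_scaleR[OF _ m]) (simp add: measurable_completion)
        moreover have "(\<lambda>x. indicator (box p q) x *\<^sub>R (indicator (cbox p q) x *\<^sub>R f x)) = (\<lambda>x. indicator (box p q) x *\<^sub>R f x)"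
          using box_subset_cbox[of p q] by (auto simp: indicator_def fun_eq_iff)
        ultimately show "(\<lambda>x. indicator (box p q) x *\<^sub>R f x) \<in> borel_measurable lebesgue" by simp
        show "AE x in lebesgue. indicator (cbox p q) x *\<^sub>R f x = indicator (box p q) x *\<^sub>R f x"
          by (rule AE_I'[of "cbox p q - box p q"])
             (use negligible_frontier_interval[of p q] box_subset_cbox[of p q] in \<open>auto simp: negligible_iff_null_sets indicator_def split: if_splits\<close>)
      qed
      also have "\<dots> = 0" using pq CU by (intro box0) blast
      finally show ?thesis .
    qed
    ultimately have "AE x in lebesgue. g x = 0" by (rule AE_zero_of_cbox_integrals)
    then show ?thesis by eventually_elim (auto simp: g_def indicator_def)
  qed
  obtain D where D: "countable D" "D \<subseteq> Pow U" "\<And>X. X \<in> D \<Longrightarrow> \<exists>a b. X = cbox a b" "\<Union>D = U"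
    using open_countable_Union_open_cbox[OF U] by blast
  have "AE x in lebesgue. \<forall>X\<in>D. x \<in> X \<longrightarrow> f x = 0"
  proof (rule AE_ball_countable[OF D(1), THEN iffD2], rule ballI)
    fix X assume X: "X \<in> D"
    then obtain a b where "X = cbox a b" using D(3) by blast
    moreover have "X \<subseteq> U" using X D(2) by blast
    ultimately show "AE x in lebesgue. x \<in> X \<longrightarrow> f x = 0" by (intro local0)
  qed
  then show ?thesis by (rule eventually_mono) (use D(4) in blast)
qed

theorem weak_pd_unique:
  fixes f :: "real^'n::finite \<Rightarrow> 'b::euclidean_space"
  assumes U: "open U" and gh: "weak_pd U i f g" "weak_pd U i f h"
  shows "AE x in lebesgue. x \<in> U \<longrightarrow> g x = h x"
proof -
  have l: "locally_integrable_on g U" "locally_integrable_on h U" using gh by (auto simp: weak_pd_def)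
  have "AE x in lebesgue. x \<in> U \<longrightarrow> g x - h x = 0"
  proof (rule locally_integrable_AE_zero[OF U])
    show "locally_integrable_on (\<lambda>x. g x - h x) U" using l by (rule locally_integrable_diff)
    fix \<phi> :: "real^'n \<Rightarrow> real" assume \<phi>: "test_function U \<phi>"
    have "(\<integral>x. \<phi> x *\<^sub>R (g x - h x) \<partial>lebesgue) = (\<integral>x. \<phi> x *\<^sub>R g x \<partial>lebesgue) - (\<integral>x. \<phi> x *\<^sub>R h x \<partial>lebesgue)"
      using test_function_integral(1)[OF l(1) \<phi>] test_function_integral(1)[OF l(2) \<phi>]
      by (simp add: scaleR_diff_right)
    also have "\<dots> = 0" using gh \<phi> unfolding weak_pd_iff by (metis add.inverse_inverse diff_self)
    finally show "(\<integral>x. \<phi> x *\<^sub>R (g x - h x) \<partial>lebesgue) = 0" .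
  qed
  then show ?thesis by simp
qed

lemma weak_pd_diff:
  fixes f :: "real^'n::finite \<Rightarrow> 'b::euclidean_space"
  assumes "weak_pd U i f g" "weak_pd U i f' g'"
  shows "weak_pd U i (\<lambda>x. f x - f' x) (\<lambda>x. g x - g' x)"
proof -
  have l: "locally_integrable_on f U" "locally_integrable_on g U" "locally_integrable_on f' U" "locally_integrable_on g' U"
    using assms by (auto simp: weak_pd_def)
  show ?thesis
    unfolding weak_pd_iff
  proof (intro conjI allI impI locally_integrable_diff l)
    fix \<phi> :: "real^'n \<Rightarrow> real" assume \<phi>: "test_function U \<phi>"
    note i = test_function_integral(1)[OF _ \<phi>] test_function_integral(1)[OF _ test_function_pd[OF \<phi>]]
    show "(\<integral>x. pd i \<phi> x *\<^sub>R (f x - f' x) \<partial>lebesgue) = - (\<integral>x. \<phi> x *\<^sub>R (g x - g' x) \<partial>lebesgue)"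
      using assms \<phi> l by (simp add: weak_pd_iff scaleR_diff_right i)
  qed
qed

lemma integral_directional_derivative_lebesgue:
  fixes F D :: "'a::euclidean_space \<Rightarrow> 'b::euclidean_space"
  assumes "continuous_on UNIV F" "continuous_on UNIV D" "\<And>x. norm x > R \<Longrightarrow> F x = 0"
    "\<And>x. ((\<lambda>s. F (x + s *\<^sub>R e)) has_vector_derivative D x) (at 0)"
  shows "integrable lebesgue D" "(\<integral>x. D x \<partial>lebesgue) = 0"
  using integral_directional_derivative[OF assms] integral_completion[of D lborel] assms(2)
  by (auto simp: integrable_lebesgue_of_lborel borel_measurable_continuous_onI)

text \<open>The product with a test function has compact support, so the integral of its derivative
  vanishes; the product rule turns this into the weak identity.\<close>

lemma classical_weak_pd:
  fixes f :: "real^'n::finite \<Rightarrow> 'b::euclidean_space"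
  assumes f: "\<And>x. f differentiable at x" "continuous_on UNIV (pd i f)"
  shows "weak_pd U i f (pd i f)"
proof -
  have fc: "continuous_on UNIV f"
    by (meson f(1) differentiable_imp_continuous_within continuous_at_imp_continuous_on)
  have l: "locally_integrable_on f U" "locally_integrable_on (pd i f) U"
    using fc f(2) by (auto intro: continuous_locally_integrable continuous_on_subset)
  show ?thesis
    unfolding weak_pd_iff
  proof (intro conjI allI impI l)
    fix \<phi> :: "real^'n \<Rightarrow> real" assume \<phi>: "test_function U \<phi>"
    obtain C where C: "compact C" "\<And>x. x \<notin> C \<Longrightarrow> \<phi> x = 0" using test_function_support[OF \<phi>] by metis
    obtain R where R: "\<And>x. x \<in> C \<Longrightarrow> norm x \<le> R"
      using compact_imp_bounded[OF C(1)] unfolding bounded_iff by blast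
    have s: "smooth \<phi>" using \<phi> by (rule test_function_smooth)
    have "(\<integral>x. pd i \<phi> x *\<^sub>R f x + \<phi> x *\<^sub>R pd i f x \<partial>lebesgue) = 0"
    proof (rule integral_directional_derivative_lebesgue(2)[where F="\<lambda>x. \<phi> x *\<^sub>R f x" and R=R and e="axis i 1"])
      show "continuous_on UNIV (\<lambda>x. \<phi> x *\<^sub>R f x)"
        "continuous_on UNIV (\<lambda>x. pd i \<phi> x *\<^sub>R f x + \<phi> x *\<^sub>R pd i f x)"
        by (intro continuous_intros fc f(2) smooth_continuous s smooth_pd)+
      show "\<phi> x *\<^sub>R f x = 0" if "norm x > R" for x using R[of x] C(2)[of x] that by auto
      fix x
      have 1: "((\<lambda>s. \<phi> (x + s *\<^sub>R axis i 1)) has_real_derivative pd i \<phi> x) (at 0)"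
        using dir_deriv_line[OF smooth_differentiable[OF s], of x "axis i 1"]
        by (simp add: dir_deriv_axis has_real_derivative_iff_has_vector_derivative)
      have 2: "((\<lambda>s. f (x + s *\<^sub>R axis i 1)) has_vector_derivative pd i f x) (at 0)"
        using dir_deriv_line[OF f(1), of x "axis i 1"] by (simp add: dir_deriv_axis)
      show "((\<lambda>s. \<phi> (x + s *\<^sub>R axis i 1) *\<^sub>R f (x + s *\<^sub>R axis i 1)) has_vector_derivative pd i \<phi> x *\<^sub>R f x + \<phi> x *\<^sub>R pd i f x) (at 0)"
        using has_vector_derivative_scaleR[OF 1 2] by (simp add: add.commute)
    qed
    then show "(\<integral>x. pd i \<phi> x *\<^sub>R f x \<partial>lebesgue) = - (\<integral>x. \<phi> x *\<^sub>R pd i f x \<partial>lebesgue)"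
      using test_function_integral(1)[OF l(1) test_function_pd[OF \<phi>], of i] test_function_integral(1)[OF l(2) \<phi>]
      by (simp add: eq_neg_iff_add_eq_0)
  qed
qed

section \<open>Smooth approximation\<close>

lemma lborel_distr_reflect:
  "distr lborel borel (\<lambda>y. x - y) = (lborel :: 'a::euclidean_space measure)"
proof -
  have "(\<lambda>y. x + (-1) *\<^sub>R y) = (\<lambda>y. x - y)" by simp
  then show ?thesis using lborel_affine[of "-1" x] by (simp add: density_1)
qed

lemma integral_cbox_eq_lborel:
  fixes f :: "'a::euclidean_space \<Rightarrow> 'b::euclidean_space"
  assumes "continuous_on UNIV f" "\<And>x. x \<notin> cbox a b \<Longrightarrow> f x = 0"
  shows "integral (cbox a b) f = (\<integral>x. f x \<partial>lborel)" "integrable lborel f"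
proof -
  have "integrable lborel (\<lambda>x. indicator (cbox a b) x *\<^sub>R f x)"
    using assms(1) by (intro borel_integrable_compact compact_cbox) (rule continuous_on_subset, auto)
  moreover have "(\<lambda>x. indicator (cbox a b) x *\<^sub>R f x) = f"
    using assms(2) by (auto simp: indicator_def fun_eq_iff)
  ultimately show i: "integrable lborel f" by simp
  have "integral (cbox a b) f = integral UNIV (\<lambda>x. if x \<in> cbox a b then f x else 0)"
    by (simp add: integral_restrict_UNIV)
  also have "(\<lambda>x. if x \<in> cbox a b then f x else 0) = f"
    using assms(2) by (auto simp: fun_eq_iff)
  finally show "integral (cbox a b) f = (\<integral>x. f x \<partial>lborel)"
    using integral_lborel[OF i] by simp
qed

text \<open>The left form is smooth because the kernel is; the right form lets a directional
  derivative fall on \<open>\<psi>\<close>. The mollification needs both.\<close>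

lemma integral_cbox_convolution_commute:
  fixes \<psi> \<rho> :: "'a::euclidean_space \<Rightarrow> real"
  assumes "continuous_on UNIV \<psi>" "\<And>x. x \<notin> cbox a b \<Longrightarrow> \<psi> x = 0"
    and "continuous_on UNIV \<rho>" "\<And>x. x \<notin> cbox c d \<Longrightarrow> \<rho> x = 0"
  shows "integral (cbox a b) (\<lambda>y. \<psi> y * \<rho> (x - y)) = integral (cbox c d) (\<lambda>y. \<psi> (x - y) * \<rho> y)"
proof -
  have c: "continuous_on UNIV (\<lambda>y. \<psi> (x - y))" "continuous_on UNIV (\<lambda>y. \<rho> (x - y))"
    by (intro continuous_on_compose2[OF assms(1)] continuous_on_compose2[OF assms(3)] continuous_intros; simp)+
  have c1: "continuous_on UNIV (\<lambda>y. \<psi> y * \<rho> (x - y))" and c2: "continuous_on UNIV (\<lambda>y. \<psi> (x - y) * \<rho> y)"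
    by (intro continuous_intros c assms)+
  have "integral (cbox a b) (\<lambda>y. \<psi> y * \<rho> (x - y)) = (\<integral>y. \<psi> y * \<rho> (x - y) \<partial>lborel)"
    by (rule integral_cbox_eq_lborel) (use c1 assms in auto)
  also have "\<dots> = (\<integral>y. \<psi> y * \<rho> (x - y) \<partial>(distr lborel borel (\<lambda>y. x - y)))"
    by (simp add: lborel_distr_reflect)
  also have "\<dots> = (\<integral>y. \<psi> (x - y) * \<rho> (x - (x - y)) \<partial>lborel)"
    by (rule integral_distr) (use borel_measurable_continuous_onI[OF c1] in auto)
  also have "\<dots> = integral (cbox c d) (\<lambda>y. \<psi> (x - y) * \<rho> y)"
    by (subst integral_cbox_eq_lborel) (use c2 assms in auto)
  finally show ?thesis .
qed

text \<open>The integration box carries \<open>\<psi>\<close>, so only the smooth kernel depends on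
  \<open>x\<close>, and differentiation under the integral is possible although
  \<open>\<psi>\<close> is merely continuous.\<close>

lemma convolution_pd:
  fixes \<psi> \<rho> :: "real^'n::finite \<Rightarrow> real" and a b :: "real^'n"
  assumes \<psi>: "continuous_on UNIV \<psi>" and \<rho>: "smooth \<rho>"
  defines "F \<equiv> \<lambda>\<rho> x. integral (cbox a b) (\<lambda>y. \<psi> y * \<rho> (x - y))"
  shows "F \<rho> differentiable at x" "pd i (F \<rho>) x = F (pd i \<rho>) x"
proof -
  define fx :: "real^'n \<Rightarrow> real^'n \<Rightarrow> ((real^'n) \<Rightarrow>\<^sub>L real)" where
    "fx = (\<lambda>x y. \<Sum>i\<in>UNIV. (\<psi> y * pd i \<rho> (x - y)) *\<^sub>R Blinfun (\<lambda>h. h $ i))"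
  have fx_apply: "blinfun_apply (fx x y) h = (\<Sum>i\<in>UNIV. \<psi> y * pd i \<rho> (x - y) * h $ i)" for x y h
    by (simp add: fx_def blinfun.sum_left blinfun.scaleR_left bounded_linear_Blinfun_apply bounded_linear_vec_nth)
  have \<rho>c: "continuous_on A (pd i \<rho>)" "continuous_on A \<rho>" for A i
    by (intro smooth_continuous smooth_pd \<rho>)+
  have d: "((\<lambda>x. \<psi> y * \<rho> (x - y)) has_derivative blinfun_apply (fx x y)) (at x within UNIV)" for x y
  proof -
    have "((\<lambda>x. x - y) has_derivative (\<lambda>h. h)) (at x)" by (auto intro!: derivative_eq_intros)
    from has_derivative_compose[OF this has_derivative_pd[OF smooth_differentiable[OF \<rho>]]]
    have "((\<lambda>x. \<rho> (x - y)) has_derivative (\<lambda>h. \<Sum>i\<in>UNIV. h $ i *\<^sub>R pd i \<rho> (x - y))) (at x)" .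
    from has_derivative_mult_right[OF this, of "\<psi> y"]
    show ?thesis
      by (rule has_derivative_eq_rhs) (simp add: fx_apply fun_eq_iff sum_distrib_left mult_ac)
  qed
  have cf: "continuous_on (UNIV \<times> cbox a b) (\<lambda>(x, y). fx x y)"
    unfolding fx_def split_beta
    by (intro continuous_intros continuous_on_compose2[OF \<psi>] continuous_on_compose2[OF \<rho>c(1)]) auto
  have ci: "(\<lambda>y. \<psi> y * \<rho> (x - y)) integrable_on cbox a b" for x
    by (intro integrable_continuous continuous_intros continuous_on_compose2[OF \<psi>] continuous_on_compose2[OF \<rho>c(2)]) auto
  have D: "(F \<rho> has_derivative blinfun_apply (integral (cbox a b) (fx x))) (at x)"
    unfolding F_def using leibniz_rule[OF d ci cf, of x] by simp
  then show "F \<rho> differentiable at x" by (rule differentiableI)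
  have "fx x integrable_on cbox a b"
    unfolding fx_def
    by (intro integrable_continuous continuous_intros continuous_on_compose2[OF \<psi>] continuous_on_compose2[OF \<rho>c(1)]) auto
  then have "blinfun_apply (integral (cbox a b) (fx x)) (axis i 1) = F (pd i \<rho>) x"
    by (simp add: blinfun_apply_integral fx_apply F_def axis_def if_distrib cong: if_cong)
  with pd_eqI[OF D] show "pd i (F \<rho>) x = F (pd i \<rho>) x" by simp
qed

lemma convolution_smooth:
  fixes \<psi> \<rho> :: "real^'n::finite \<Rightarrow> real"
  assumes \<psi>: "continuous_on UNIV \<psi>" and \<rho>: "smooth \<rho>"
  shows "smooth (\<lambda>x. integral (cbox a b) (\<lambda>y. \<psi> y * \<rho> (x - y)))"
proof -
  have s: "smooth (iter_pd js \<rho>)" for js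
    using \<rho> by (induction js) (auto simp: iter_pd_Nil iter_pd_Cons smooth_pd)
  have "iter_pd js (\<lambda>x. integral (cbox a b) (\<lambda>y. \<psi> y * \<rho> (x - y)))
      = (\<lambda>x. integral (cbox a b) (\<lambda>y. \<psi> y * iter_pd js \<rho> (x - y)))" for js
  proof (induction js)
    case (Cons j js)
    show ?case
      unfolding iter_pd_Cons Cons using convolution_pd(2)[OF \<psi> s, of j a b] by (simp add: fun_eq_iff)
  qed (simp add: iter_pd_Nil)
  then show ?thesis
    unfolding smooth_def using convolution_pd(1)[OF \<psi> s] by simp
qed

lemma smoothing_kernel:
  fixes \<epsilon> :: real
  assumes "\<epsilon> > 0"
  obtains \<rho> :: "real^'n::finite \<Rightarrow> real" and d where
    "smooth \<rho>" "\<And>x. \<rho> x \<ge> 0" "\<And>x. x \<notin> cbox (- d) d \<Longrightarrow> \<rho> x = 0"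
    "(\<rho> has_integral 1) (cbox (- d) d)" "\<And>x. x \<in> cbox (- d) d \<Longrightarrow> norm x \<le> \<epsilon>"
proof -
  define n where "n = real CARD('n)"
  have n: "n > 0" by (simp add: n_def)
  \<comment> \<open>Half side \<epsilon> over the dimension, so that the sum of the absolute
    coordinates, and with it the norm, is at most \<epsilon>.\<close>
  define d :: "real^'n" where "d = (\<chi> i. \<epsilon> / n)"
  have d0: "\<epsilon> / n > 0" using assms n by simp
  define \<beta> where "\<beta> = box_bump (- d) d 1"
  have s: "smooth \<beta>" unfolding \<beta>_def by (intro flat_algebra_smooth box_bump_flat_algebra)
  define c where "c = integral (cbox (- d) d) \<beta>"
  have ci: "continuous_on A \<beta>" for A by (rule smooth_continuous[OF s])
  have b0: "0 \<in> box (- d) d" using d0 by (simp add: mem_box_cart d_def)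
  have "c \<ge> 0" unfolding c_def
    by (intro integral_nonneg integrable_continuous ci) (simp add: \<beta>_def box_bump_bounds)
  moreover have "c \<noteq> 0"
  proof
    assume "c = 0"
    then have "\<forall>x\<in>cbox (- d) d. \<beta> x = 0"
      unfolding c_def using b0
      by (subst (asm) integral_cbox_eq_0_iff) (use ci in \<open>auto simp: \<beta>_def box_bump_bounds\<close>)
    then show False
      using b0 box_subset_cbox[of "- d" d] box_bump_pos_iff[of 1 "- d" d 0] by (auto simp: \<beta>_def)
  qed
  ultimately have c: "c > 0" by simp
  show thesis
  proof (rule that)
    have "(\<lambda>x. (1 / c) * \<beta> x) \<in> flat_algebra"
      unfolding \<beta>_def by (intro flat_algebra.intros box_bump_flat_algebra)
    then show "smooth (\<lambda>x. (1 / c) * \<beta> x)" by (rule flat_algebra_smooth)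
    show "(1 / c) * \<beta> x \<ge> 0" for x using c by (simp add: \<beta>_def box_bump_bounds)
    show "(1 / c) * \<beta> x = 0" if "x \<notin> cbox (- d) d" for x
      using that box_subset_cbox[of "- d" d] box_bump_pos_iff[of 1 "- d" d x] by (auto simp: \<beta>_def)
    have "(\<beta> has_integral c) (cbox (- d) d)"
      unfolding c_def by (intro integrable_integral integrable_continuous ci)
    from has_integral_mult_right[OF this, of "1 / c"] c
    show "((\<lambda>x. (1 / c) * \<beta> x) has_integral 1) (cbox (- d) d)" by simp
    show "norm x \<le> \<epsilon>" if "x \<in> cbox (- d) d" for x
    proof -
      have "norm x \<le> (\<Sum>i\<in>UNIV. \<bar>x $ i\<bar>)" by (rule norm_le_l1_cart)
      also have "\<dots> \<le> (\<Sum>i\<in>(UNIV::'n set). \<epsilon> / n)"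
        using that by (intro sum_mono) (auto simp: mem_box_cart d_def abs_le_iff minus_le_iff)
      also have "\<dots> = \<epsilon>" using n by (simp add: n_def)
      finally show ?thesis .
    qed
  qed
qed

lemma kernel_average_close:
  fixes g \<rho> :: "'a::euclidean_space \<Rightarrow> real"
  assumes g: "continuous_on UNIV g" and \<rho>: "continuous_on UNIV \<rho>" "\<And>x. \<rho> x \<ge> 0" "(\<rho> has_integral 1) (cbox c d)"
    and close: "\<And>y. y \<in> cbox c d \<Longrightarrow> \<bar>g (x - y) - g x\<bar> \<le> \<delta>"
  shows "\<bar>integral (cbox c d) (\<lambda>y. g (x - y) * \<rho> y) - g x\<bar> \<le> \<delta>"
proof -
  have c: "continuous_on UNIV (\<lambda>y. g (x - y))"
    by (intro continuous_on_compose2[OF g] continuous_intros) simp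
  have i1: "(\<lambda>y. g (x - y) * \<rho> y) integrable_on cbox c d"
    by (intro integrable_continuous continuous_on_mult continuous_on_subset[OF c] continuous_on_subset[OF \<rho>(1)]) auto
  have i2: "((\<lambda>y. g x * \<rho> y) has_integral g x) (cbox c d)"
    using has_integral_mult_right[OF \<rho>(3), of "g x"] by simp
  have i3: "((\<lambda>y. \<delta> * \<rho> y) has_integral \<delta>) (cbox c d)"
    using has_integral_mult_right[OF \<rho>(3), of \<delta>] by simp
  have d: "((\<lambda>y. g (x - y) * \<rho> y - g x * \<rho> y) has_integral integral (cbox c d) (\<lambda>y. g (x - y) * \<rho> y) - g x) (cbox c d)"
    by (intro has_integral_diff integrable_integral i1 i2)
  have "norm (integral (cbox c d) (\<lambda>y. g (x - y) * \<rho> y - g x * \<rho> y)) \<le> integral (cbox c d) (\<lambda>y. \<delta> * \<rho> y)"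
  proof (rule integral_norm_bound_integral)
    fix y assume y: "y \<in> cbox c d"
    have "\<bar>g (x - y) - g x\<bar> * \<rho> y \<le> \<delta> * \<rho> y" by (intro mult_right_mono close y \<rho>)
    then show "norm (g (x - y) * \<rho> y - g x * \<rho> y) \<le> \<delta> * \<rho> y"
      using \<rho>(2)[of y] by (simp add: left_diff_distrib[symmetric] abs_mult)
  qed (use d i3 in \<open>auto intro: has_integral_integrable\<close>)
  then show ?thesis by (simp only: integral_unique[OF d] integral_unique[OF i3] real_norm_def)
qed

lemma uniformly_continuous_compact_support:
  fixes g :: "'a::euclidean_space \<Rightarrow> real"
  assumes g: "continuous_on UNIV g" and C: "compact C" "\<And>x. x \<notin> C \<Longrightarrow> g x = 0" and "\<delta> > 0"
  obtains d where "d > 0" "\<And>x y. norm y \<le> d \<Longrightarrow> \<bar>g (x - y) - g x\<bar> \<le> \<delta>"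
proof -
  obtain R where R: "\<And>x. x \<in> C \<Longrightarrow> norm x \<le> R"
    using compact_imp_bounded[OF C(1)] unfolding bounded_iff by blast
  \<comment> \<open>The margin 2 covers a shift of norm at most 1: either both points lie in this
    ball, or both lie outside the support.\<close>
  let ?K = "cball (0::'a) (\<bar>R\<bar> + 2)"
  have "uniformly_continuous_on ?K g"
    by (intro compact_uniformly_continuous continuous_on_subset[OF g]) auto
  then obtain d where d: "d > 0" "\<And>x x'. x \<in> ?K \<Longrightarrow> x' \<in> ?K \<Longrightarrow> dist x' x < d \<Longrightarrow> dist (g x') (g x) < \<delta>"
    using \<open>\<delta> > 0\<close> unfolding uniformly_continuous_on_def by metis
  show thesis
  proof (rule that[of "min (d / 2) 1"])
    show "min (d / 2) 1 > 0" using d by simp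
    fix x y :: 'a assume y: "norm y \<le> min (d / 2) 1"
    show "\<bar>g (x - y) - g x\<bar> \<le> \<delta>"
    proof (cases "norm x \<le> \<bar>R\<bar> + 1")
      case True
      have "norm (x - y) \<le> \<bar>R\<bar> + 2" using True y norm_triangle_ineq4[of x y] by simp
      then have "dist (g (x - y)) (g x) < \<delta>"
        using True y d(1) by (intro d(2)) (auto simp: dist_norm norm_minus_commute)
      then show ?thesis by (simp add: dist_real_def)
    next
      case False
      have "norm x \<le> norm (x - y) + norm y" by (metis diff_add_cancel norm_triangle_ineq)
      then have "norm (x - y) > R" "norm x > R" using False y by auto
      then have "g (x - y) = 0" "g x = 0" using R C(2) by (meson not_le)+
      then show ?thesis using \<open>\<delta> > 0\<close> by simp
    qed
  qed
qed

lemma directional_derivative_zero_outside: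
  fixes F :: "'a::real_normed_vector \<Rightarrow> 'b::real_normed_vector"
  assumes "closed C" "\<And>x. x \<notin> C \<Longrightarrow> F x = 0" "x \<notin> C"
    and "((\<lambda>s. F (x + s *\<^sub>R e)) has_vector_derivative D) (at 0)"
  shows "D = 0"
proof -
  have "((\<lambda>s. F (x + s *\<^sub>R e)) has_vector_derivative 0) (at 0)"
  proof (rule has_vector_derivative_transform_within_open[of "\<lambda>s. 0" _ _ "(\<lambda>s. x + s *\<^sub>R e) -` (- C)"])
    show "open ((\<lambda>s. x + s *\<^sub>R e) -` (- C))"
      using assms(1) by (intro open_vimage) (auto intro!: continuous_intros)
  qed (use assms in auto)
  with assms(4) show ?thesis by (rule vector_derivative_unique_at)
qed

lemma directional_derivative_along:
  fixes F D :: "'a::real_normed_vector \<Rightarrow> 'b::real_normed_vector"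
  assumes "\<And>x. ((\<lambda>s. F (x + s *\<^sub>R e)) has_vector_derivative D x) (at 0)"
  shows "((\<lambda>s. F (x + s *\<^sub>R e)) has_vector_derivative D (x + t *\<^sub>R e)) (at t)"
proof -
  have "((\<lambda>s. F ((x + t *\<^sub>R e) + s *\<^sub>R e)) has_vector_derivative D (x + t *\<^sub>R e)) (at (t - t))"
    using assms[of "x + t *\<^sub>R e"] by simp
  moreover have "((\<lambda>s. s - t) has_vector_derivative 1) (at t)"
    by (auto intro!: derivative_eq_intros)
  ultimately have "((\<lambda>s. F ((x + t *\<^sub>R e) + s *\<^sub>R e)) \<circ> (\<lambda>s. s - t) has_vector_derivative (1 *\<^sub>R D (x + t *\<^sub>R e))) (at t)"
    by (intro vector_diff_chain_at) auto
  then show ?thesis by (simp add: o_def algebra_simps)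
qed

text \<open>Mollification. The supporting compact set \<open>C'\<close> is the same for all
  \<delta>: a locally integrable function then has one fixed mass on it, and uniform closeness
  suffices for passing to the limit under the integral. Only one directional derivative is
  approximated, since \<open>\<psi>\<close> need not have others.\<close>

theorem smooth_approximation:
  fixes \<psi> \<psi>' :: "real^'n::finite \<Rightarrow> real"
  assumes U: "open U" and C: "compact C" "C \<subseteq> U" "\<And>x. x \<notin> C \<Longrightarrow> \<psi> x = 0"
    and c: "continuous_on UNIV \<psi>" "continuous_on UNIV \<psi>'"
    and der: "\<And>x. ((\<lambda>s. \<psi> (x + s *\<^sub>R e)) has_vector_derivative \<psi>' x) (at 0)"
  obtains C' where "compact C'" "C' \<subseteq> U"
    "\<And>\<delta>. \<delta> > 0 \<Longrightarrow> \<exists>\<phi>. test_function U \<phi> \<and> (\<forall>x. x \<notin> C' \<longrightarrow> \<phi> x = 0) \<and>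
      (\<forall>x. \<bar>\<phi> x - \<psi> x\<bar> \<le> \<delta>) \<and> (\<forall>x. \<bar>dir_deriv e \<phi> x - \<psi>' x\<bar> \<le> \<delta>)"
proof -
  obtain r where r: "r > 0" "(\<Union>x\<in>C. cball x r) \<subseteq> U"
    using compact_subset_open_imp_cball_epsilon_subset[OF C(1) U C(2)] by blast
  define C' where "C' = (\<lambda>(x, y). x + y) ` (C \<times> cball 0 r)"
  have C': "compact C'" "C' \<subseteq> U"
  proof -
    show "compact C'" unfolding C'_def split_beta
      by (intro compact_continuous_image continuous_intros compact_Times C) simp
    show "C' \<subseteq> U"
    proof
      fix z assume "z \<in> C'"
      then obtain x y where "x \<in> C" "norm y \<le> r" "z = x + y" by (auto simp: C'_def)
      then have "z \<in> (\<Union>x\<in>C. cball x r)" by (force simp: dist_norm)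
      with r show "z \<in> U" by blast
    qed
  qed
  obtain a0 where a0: "C \<subseteq> cbox (- a0) a0"
    using bounded_subset_cbox_symmetric[OF compact_imp_bounded[OF C(1)]] by blast
  have p0: "\<psi>' x = 0" if "x \<notin> C" for x
    by (rule directional_derivative_zero_outside[OF compact_imp_closed[OF C(1)] C(3) that der])
  show thesis
  proof (rule that[OF C'])
    fix \<delta> :: real assume \<delta>: "\<delta> > 0"
    obtain d1 where d1: "d1 > 0" "\<And>x y. norm y \<le> d1 \<Longrightarrow> \<bar>\<psi> (x - y) - \<psi> x\<bar> \<le> \<delta>"
      using uniformly_continuous_compact_support[OF c(1) C(1,3) \<delta>] by blast
    obtain d2 where d2: "d2 > 0" "\<And>x y. norm y \<le> d2 \<Longrightarrow> \<bar>\<psi>' (x - y) - \<psi>' x\<bar> \<le> \<delta>"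
      using uniformly_continuous_compact_support[OF c(2) C(1) p0 \<delta>] by blast
    have "min r (min d1 d2) > 0" using r d1 d2 by simp
    then obtain \<rho> :: "real^'n \<Rightarrow> real" and d where \<rho>: "smooth \<rho>" "\<And>x. \<rho> x \<ge> 0"
      "\<And>x. x \<notin> cbox (- d) d \<Longrightarrow> \<rho> x = 0" "(\<rho> has_integral 1) (cbox (- d) d)"
      "\<And>x. x \<in> cbox (- d) d \<Longrightarrow> norm x \<le> min r (min d1 d2)"
      by (rule smoothing_kernel) (rule that)
    have \<rho>c: "continuous_on A \<rho>" for A by (rule smooth_continuous[OF \<rho>(1)])
    define \<phi> where "\<phi> = (\<lambda>x. integral (cbox (- a0) a0) (\<lambda>y. \<psi> y * \<rho> (x - y)))"
    have s: "smooth \<phi>" unfolding \<phi>_def by (rule convolution_smooth[OF c(1) \<rho>(1)])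
    have \<psi>0: "\<psi> x = 0" if "x \<notin> cbox (- a0) a0" for x
      using that a0 C(3)[of x] by blast
    have \<rho>1: "norm y \<le> d1" and \<rho>2: "norm y \<le> d2" if "y \<in> cbox (- d) d" for y
      using \<rho>(5)[OF that] by simp_all
    have \<phi>2: "\<phi> x = integral (cbox (- d) d) (\<lambda>y. \<psi> (x - y) * \<rho> y)" for x
      unfolding \<phi>_def
      by (rule integral_cbox_convolution_commute[OF c(1) \<psi>0 \<rho>c \<rho>(3)])
    have z: "\<phi> x = 0" if x: "x \<notin> C'" for x
    proof -
      have "\<psi> (x - y) * \<rho> y = 0" if "y \<in> cbox (- d) d" for y
      proof -
        have "norm y \<le> r" using \<rho>(5)[OF that] by simp
        then have "x - y \<notin> C" using x by (force simp: C'_def)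
        then show ?thesis using C by simp
      qed
      then have "integral (cbox (- d) d) (\<lambda>y. \<psi> (x - y) * \<rho> y) = integral (cbox (- d) d) (\<lambda>y. 0)"
        by (intro Henstock_Kurzweil_Integration.integral_cong)
      then show ?thesis unfolding \<phi>2 by simp
    qed
    have "closure {x. \<phi> x \<noteq> 0} \<subseteq> C'"
      by (rule closure_minimal) (use z compact_imp_closed[OF C'(1)] in auto)
    then have t: "test_function U \<phi>"
      unfolding test_function_def smooth_iff_C_k[symmetric]
      using s C' compact_Int_closed[OF C'(1) closed_closure[of "{x. \<phi> x \<noteq> 0}"]]
      by (simp add: Int_absorb1 subset_trans[of _ C' U])
    have n1: "\<bar>\<phi> x - \<psi> x\<bar> \<le> \<delta>" for x
      unfolding \<phi>2
      by (rule kernel_average_close[OF c(1) \<rho>c \<rho>(2,4)]) (rule d1(2)[OF \<rho>1])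
    \<comment> \<open>With the roles in the convolution exchanged, the derivative along
      \<open>e\<close> passes to \<open>\<psi>\<close>; uniqueness of derivatives identifies the
      result with \<open>dir_deriv e \<phi>\<close>.\<close>
    have dd: "dir_deriv e \<phi> x = integral (cbox (- d) d) (\<lambda>y. \<psi>' (x - y) * \<rho> y)" for x
    proof -
      have "((\<lambda>s. integral (cbox (- d) d) (\<lambda>y. \<psi> (x + s *\<^sub>R e - y) * \<rho> y)) has_vector_derivative
          integral (cbox (- d) d) (\<lambda>y. \<psi>' (x + 0 *\<^sub>R e - y) * \<rho> y)) (at 0 within UNIV)"
      proof (rule leibniz_rule_vector_derivative)
        fix s y
        have "((\<lambda>s. \<psi> ((x - y) + s *\<^sub>R e)) has_vector_derivative \<psi>' ((x - y) + s *\<^sub>R e)) (at s)"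
          by (rule directional_derivative_along[OF der])
        then have "((\<lambda>s. \<psi> (x + s *\<^sub>R e - y)) has_vector_derivative \<psi>' (x + s *\<^sub>R e - y)) (at s)"
          by (simp add: algebra_simps)
        then show "((\<lambda>s. \<psi> (x + s *\<^sub>R e - y) * \<rho> y) has_vector_derivative \<psi>' (x + s *\<^sub>R e - y) * \<rho> y) (at s within UNIV)"
          by (auto intro!: derivative_eq_intros)
      next
        fix s
        show "(\<lambda>y. \<psi> (x + s *\<^sub>R e - y) * \<rho> y) integrable_on cbox (- d) d"
          by (intro integrable_continuous continuous_on_mult \<rho>c continuous_on_compose2[OF c(1)] continuous_intros) auto
      next
        show "continuous_on (UNIV \<times> cbox (- d) d) (\<lambda>(s, y). \<psi>' (x + s *\<^sub>R e - y) * \<rho> y)"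
          unfolding split_beta
          by (intro continuous_on_mult continuous_on_compose2[OF \<rho>c[of UNIV]] continuous_on_compose2[OF c(2)] continuous_intros) auto
      qed auto
      then have "((\<lambda>s. \<phi> (x + s *\<^sub>R e)) has_vector_derivative integral (cbox (- d) d) (\<lambda>y. \<psi>' (x - y) * \<rho> y)) (at 0)"
        by (simp add: \<phi>2)
      with dir_deriv_line[OF smooth_differentiable[OF s]] show ?thesis
        by (rule vector_derivative_unique_at)
    qed
    have n2: "\<bar>dir_deriv e \<phi> x - \<psi>' x\<bar> \<le> \<delta>" for x
      unfolding dd
      by (rule kernel_average_close[OF c(2) \<rho>c \<rho>(2,4)]) (rule d2(2)[OF \<rho>2])
    show "\<exists>\<phi>. test_function U \<phi> \<and> (\<forall>x. x \<notin> C' \<longrightarrow> \<phi> x = 0) \<and>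
      (\<forall>x. \<bar>\<phi> x - \<psi> x\<bar> \<le> \<delta>) \<and> (\<forall>x. \<bar>dir_deriv e \<phi> x - \<psi>' x\<bar> \<le> \<delta>)"
      using t z n1 n2 by blast
  qed
qed

lemma norm_integral_mult_le:
  fixes f :: "real^'n::finite \<Rightarrow> 'b::euclidean_space" and w :: "real^'n \<Rightarrow> real"
  assumes f: "locally_integrable_on f U" and C: "compact C" "C \<subseteq> U"
    and w: "w \<in> borel_measurable borel" "\<And>x. \<bar>w x\<bar> \<le> \<delta>" "\<And>x. x \<notin> C \<Longrightarrow> w x = 0"
  shows "norm (\<integral>x. w x *\<^sub>R f x \<partial>lebesgue) \<le> \<delta> * (\<integral>x. indicator C x * norm (f x) \<partial>lebesgue)"
proof -
  have i: "integrable lebesgue (\<lambda>x. indicator C x *\<^sub>R f x)"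
    using f C by (auto simp: locally_integrable_on_def set_integrable_def)
  have i': "integrable lebesgue (\<lambda>x. \<delta> * (indicator C x * norm (f x)))"
    using integrable_norm[OF i] by (intro integrable_mult_right) (simp add: abs_mult)
  have "norm (\<integral>x. w x *\<^sub>R f x \<partial>lebesgue) \<le> (\<integral>x. \<delta> * (indicator C x * norm (f x)) \<partial>lebesgue)"
  proof (rule Bochner_Integration.integral_norm_bound_integral[OF locally_integrable_mult(1)[OF f C w] i'])
    fix x show "norm (w x *\<^sub>R f x) \<le> \<delta> * (indicator C x * norm (f x))"
      using w(2)[of x] w(3)[of x] by (cases "x \<in> C") (auto intro: mult_right_mono)
  qed
  then show ?thesis by simp
qed

text \<open>The test function only needs to be differentiable along one direction.\<close>

theorem weak_gradient_directional:
  fixes f :: "real^'n::finite \<Rightarrow> 'b::euclidean_space" and \<psi> \<psi>' :: "real^'n \<Rightarrow> real"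
  assumes U: "open U" and w: "weak_gradient U f g"
    and C: "compact C" "C \<subseteq> U" "\<And>x. x \<notin> C \<Longrightarrow> \<psi> x = 0"
    and c: "continuous_on UNIV \<psi>" "continuous_on UNIV \<psi>'"
    and der: "\<And>x. ((\<lambda>s. \<psi> (x + s *\<^sub>R e)) has_vector_derivative \<psi>' x) (at 0)"
  shows "(\<integral>x. \<psi>' x *\<^sub>R f x \<partial>lebesgue) = - (\<integral>x. \<psi> x *\<^sub>R (\<Sum>j\<in>UNIV. e $ j *\<^sub>R g j x) \<partial>lebesgue)"
proof -
  define G where "G = (\<lambda>x. \<Sum>j\<in>UNIV. e $ j *\<^sub>R g j x)"
  have lf: "locally_integrable_on f U" and lg: "locally_integrable_on (g j) U" for j
    using w by (auto simp: weak_gradient_def weak_pd_def)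
  have lG: "locally_integrable_on G U"
    unfolding locally_integrable_on_def G_def set_integrable_def scaleR_sum_right
  proof (intro allI impI Bochner_Integration.integrable_sum)
    fix D :: "(real^'n) set" and j assume "compact D \<and> D \<subseteq> U"
    then have "integrable lebesgue (\<lambda>x. e $ j *\<^sub>R (indicator D x *\<^sub>R g j x))"
      using lg[of j] by (intro integrable_scaleR_right) (auto simp: locally_integrable_on_def set_integrable_def)
    then show "integrable lebesgue (\<lambda>x. indicator D x *\<^sub>R (e $ j *\<^sub>R g j x))"
      by (simp add: mult.commute)
  qed
  have smooth_case: "(\<integral>x. dir_deriv e \<phi> x *\<^sub>R f x \<partial>lebesgue) = - (\<integral>x. \<phi> x *\<^sub>R G x \<partial>lebesgue)"
    if \<phi>: "test_function U \<phi>" for \<phi>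
  proof -
    have pi: "integrable lebesgue (\<lambda>x. pd j \<phi> x *\<^sub>R f x)" for j
      by (rule test_function_integral(1)[OF lf test_function_pd[OF \<phi>]])
    have "(\<integral>x. dir_deriv e \<phi> x *\<^sub>R f x \<partial>lebesgue) = (\<integral>x. (\<Sum>j\<in>UNIV. e $ j *\<^sub>R (pd j \<phi> x *\<^sub>R f x)) \<partial>lebesgue)"
      by (simp add: dir_deriv_def scaleR_sum_left)
    also have "\<dots> = (\<Sum>j\<in>UNIV. \<integral>x. e $ j *\<^sub>R (pd j \<phi> x *\<^sub>R f x) \<partial>lebesgue)"
      by (intro Bochner_Integration.integral_sum integrable_scaleR_right pi)
    also have "\<dots> = (\<Sum>j\<in>UNIV. e $ j *\<^sub>R (\<integral>x. pd j \<phi> x *\<^sub>R f x \<partial>lebesgue))"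
      by (simp only: integral_scaleR_right)
    also have "\<dots> = (\<Sum>j\<in>UNIV. e $ j *\<^sub>R (- (\<integral>x. \<phi> x *\<^sub>R g j x \<partial>lebesgue)))"
      using w \<phi> by (simp add: weak_gradient_def weak_pd_iff)
    also have "\<dots> = - (\<Sum>j\<in>UNIV. (\<integral>x. e $ j *\<^sub>R (\<phi> x *\<^sub>R g j x) \<partial>lebesgue))"
      by (simp only: integral_scaleR_right scaleR_minus_right sum_negf)
    also have "(\<Sum>j\<in>UNIV. (\<integral>x. e $ j *\<^sub>R (\<phi> x *\<^sub>R g j x) \<partial>lebesgue)) = (\<integral>x. (\<Sum>j\<in>UNIV. e $ j *\<^sub>R (\<phi> x *\<^sub>R g j x)) \<partial>lebesgue)"
      by (intro Bochner_Integration.integral_sum[symmetric] integrable_scaleR_right test_function_integral(1)[OF lg \<phi>])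
    also have "\<dots> = (\<integral>x. \<phi> x *\<^sub>R G x \<partial>lebesgue)"
      by (simp add: G_def scaleR_sum_right mult.commute)
    finally show ?thesis .
  qed
  obtain C' where C': "compact C'" "C' \<subseteq> U"
    and approx: "\<And>\<delta>. \<delta> > 0 \<Longrightarrow> \<exists>\<phi>. test_function U \<phi> \<and> (\<forall>x. x \<notin> C' \<longrightarrow> \<phi> x = 0) \<and>
      (\<forall>x. \<bar>\<phi> x - \<psi> x\<bar> \<le> \<delta>) \<and> (\<forall>x. \<bar>dir_deriv e \<phi> x - \<psi>' x\<bar> \<le> \<delta>)"
    using smooth_approximation[OF U C c der] by blast
  define D where "D = C \<union> C'"
  have D: "compact D" "D \<subseteq> U" using C C' by (auto simp: D_def)
  have p0: "\<psi>' x = 0" if "x \<notin> D" for x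
    using that by (intro directional_derivative_zero_outside[OF compact_imp_closed[OF C(1)] C(3) _ der]) (auto simp: D_def)
  \<comment> \<open>The masses of \<open>f\<close> and \<open>G\<close> on a compact set that
    carries \<open>\<psi>\<close> and all its approximants; the error of an approximant is at most
    \<open>\<delta> * (A + B)\<close>.\<close>
  define A B where "A = (\<integral>x. indicator D x * norm (f x) \<partial>lebesgue)" and "B = (\<integral>x. indicator D x * norm (G x) \<partial>lebesgue)"
  have AB: "A \<ge> 0" "B \<ge> 0" unfolding A_def B_def by (auto intro!: Bochner_Integration.integral_nonneg)
  have m: "\<psi> \<in> borel_measurable borel" "\<psi>' \<in> borel_measurable borel"
    using c by (auto intro: borel_measurable_continuous_onI)
  obtain M1 where M1: "\<And>x. norm (\<psi> x) \<le> M1" using continuous_compact_support_bounded[OF c(1) C(1,3)] by metis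
  obtain M2 where M2: "\<And>x. norm (\<psi>' x) \<le> M2" using continuous_compact_support_bounded[OF c(2) D(1) p0] by metis
  have ip: "integrable lebesgue (\<lambda>x. \<psi> x *\<^sub>R G x)" "integrable lebesgue (\<lambda>x. \<psi>' x *\<^sub>R f x)"
    using M1 M2 C(3) p0
    by (auto intro!: locally_integrable_mult(1)[OF lG D m(1), of M1] locally_integrable_mult(1)[OF lf D m(2), of M2] simp: D_def)
  have "norm ((\<integral>x. \<psi>' x *\<^sub>R f x \<partial>lebesgue) + (\<integral>x. \<psi> x *\<^sub>R G x \<partial>lebesgue)) \<le> \<delta> * (A + B)" if \<delta>: "\<delta> > 0" for \<delta>
  proof -
    obtain \<phi> where \<phi>: "test_function U \<phi>" "\<And>x. x \<notin> C' \<Longrightarrow> \<phi> x = 0"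
      "\<And>x. \<bar>\<phi> x - \<psi> x\<bar> \<le> \<delta>" "\<And>x. \<bar>dir_deriv e \<phi> x - \<psi>' x\<bar> \<le> \<delta>"
      using approx[OF \<delta>] by blast
    have s: "smooth \<phi>" by (rule test_function_smooth[OF \<phi>(1)])
    have cc: "continuous_on UNIV \<phi>" "continuous_on UNIV (dir_deriv e \<phi>)"
      by (intro smooth_continuous smooth_dir_deriv_continuous s)+
    have z: "dir_deriv e \<phi> x = 0" if "x \<notin> D" for x
      using that by (intro directional_derivative_zero_outside[OF compact_imp_closed[OF C'(1)] \<phi>(2) _ dir_deriv_line[OF smooth_differentiable[OF s]]]) (auto simp: D_def)
    have \<phi>i: "integrable lebesgue (\<lambda>x. \<phi> x *\<^sub>R G x)" "integrable lebesgue (\<lambda>x. dir_deriv e \<phi> x *\<^sub>R f x)"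
    proof -
      show "integrable lebesgue (\<lambda>x. \<phi> x *\<^sub>R G x)" by (rule test_function_integral(1)[OF lG \<phi>(1)])
      obtain M3 where "\<And>x. norm (dir_deriv e \<phi> x) \<le> M3" using continuous_compact_support_bounded[OF cc(2) D(1) z] by metis
      then show "integrable lebesgue (\<lambda>x. dir_deriv e \<phi> x *\<^sub>R f x)"
        by (intro locally_integrable_mult(1)[OF lf D borel_measurable_continuous_onI[OF cc(2)], of M3] z) auto
    qed
    have "(\<integral>x. (dir_deriv e \<phi> x - \<psi>' x) *\<^sub>R f x \<partial>lebesgue) = (\<integral>x. dir_deriv e \<phi> x *\<^sub>R f x \<partial>lebesgue) - (\<integral>x. \<psi>' x *\<^sub>R f x \<partial>lebesgue)"
      using \<phi>i ip by (simp add: scaleR_diff_left)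
    moreover have "(\<integral>x. (\<phi> x - \<psi> x) *\<^sub>R G x \<partial>lebesgue) = (\<integral>x. \<phi> x *\<^sub>R G x \<partial>lebesgue) - (\<integral>x. \<psi> x *\<^sub>R G x \<partial>lebesgue)"
      using \<phi>i ip by (simp add: scaleR_diff_left)
    ultimately have eq: "(\<integral>x. \<psi>' x *\<^sub>R f x \<partial>lebesgue) + (\<integral>x. \<psi> x *\<^sub>R G x \<partial>lebesgue)
        = - (\<integral>x. (dir_deriv e \<phi> x - \<psi>' x) *\<^sub>R f x \<partial>lebesgue) - (\<integral>x. (\<phi> x - \<psi> x) *\<^sub>R G x \<partial>lebesgue)"
      using smooth_case[OF \<phi>(1)] by simp
    have "norm (\<integral>x. (dir_deriv e \<phi> x - \<psi>' x) *\<^sub>R f x \<partial>lebesgue) \<le> \<delta> * A"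
      unfolding A_def by (rule norm_integral_mult_le[OF lf D]) (use \<phi> z p0 borel_measurable_continuous_onI[OF cc(2)] m in auto)
    moreover have "norm (\<integral>x. (\<phi> x - \<psi> x) *\<^sub>R G x \<partial>lebesgue) \<le> \<delta> * B"
      unfolding B_def by (rule norm_integral_mult_le[OF lG D]) (use \<phi> C borel_measurable_continuous_onI[OF cc(1)] m in \<open>auto simp: D_def\<close>)
    ultimately show ?thesis
      unfolding eq distrib_left
      using norm_triangle_ineq4[of "- (\<integral>x. (dir_deriv e \<phi> x - \<psi>' x) *\<^sub>R f x \<partial>lebesgue)" "\<integral>x. (\<phi> x - \<psi> x) *\<^sub>R G x \<partial>lebesgue"]
      unfolding norm_minus_cancel by linarith
  qed
  then have le: "X \<le> \<delta> * (A + B)" if "\<delta> > 0" "X = norm ((\<integral>x. \<psi>' x *\<^sub>R f x \<partial>lebesgue) + (\<integral>x. \<psi> x *\<^sub>R G x \<partial>lebesgue))" for \<delta> X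
    using that by blast
  have "norm ((\<integral>x. \<psi>' x *\<^sub>R f x \<partial>lebesgue) + (\<integral>x. \<psi> x *\<^sub>R G x \<partial>lebesgue)) \<le> 0 + \<epsilon>" if "\<epsilon> > 0" for \<epsilon> :: real
  proof -
    have "\<epsilon> / (A + B + 1) > 0" using AB that by simp
    from le[OF this refl] have "norm ((\<integral>x. \<psi>' x *\<^sub>R f x \<partial>lebesgue) + (\<integral>x. \<psi> x *\<^sub>R G x \<partial>lebesgue)) \<le> \<epsilon> / (A + B + 1) * (A + B)" .
    also have "\<dots> \<le> \<epsilon>" using AB that by (simp add: field_simps)
    finally show ?thesis by simp
  qed
  then have "norm ((\<integral>x. \<psi>' x *\<^sub>R f x \<partial>lebesgue) + (\<integral>x. \<psi> x *\<^sub>R G x \<partial>lebesgue)) \<le> 0"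
    by (rule field_le_epsilon)
  then show ?thesis unfolding G_def by (simp add: eq_neg_iff_add_eq_0)
qed

section \<open>Fields vanishing on the boundary\<close>

lemma L2_norm_le_imp:
  assumes "L2_norm U f \<le> ennreal \<epsilon>" "\<epsilon> \<ge> 0"
  shows "(\<integral>\<^sup>+x\<in>U. ennreal ((norm (f x))\<^sup>2) \<partial>lebesgue) \<le> ennreal (\<epsilon>\<^sup>2)"
proof -
  let ?I = "\<integral>\<^sup>+x\<in>U. ennreal ((norm (f x))\<^sup>2) \<partial>lebesgue"
  have fin: "?I \<noteq> \<infinity>" using assms by (auto simp: L2_norm_def Let_def top_unique split: if_splits)
  then have "ennreal (sqrt (enn2real ?I)) \<le> ennreal \<epsilon>" using assms by (simp add: L2_norm_def Let_def)
  then have "sqrt (enn2real ?I) \<le> \<epsilon>" using assms by (simp add: ennreal_le_iff)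
  then have "enn2real ?I \<le> \<epsilon>\<^sup>2" using assms by (metis real_sqrt_le_iff real_sqrt_unique)
  then have "ennreal (enn2real ?I) \<le> ennreal (\<epsilon>\<^sup>2)" by (rule ennreal_leI)
  moreover have "ennreal (enn2real ?I) = ?I" using fin by (intro ennreal_enn2real) (simp add: top.not_eq_extremum)
  ultimately show ?thesis by simp
qed

text \<open>Closeness in \<open>W12_norm\<close> only provides some weak gradient of the difference.
  By uniqueness it agrees almost everywhere with \<open>G i\<close> minus the classical derivative,
  so the convergence holds for the prescribed \<open>G\<close>.\<close>

theorem W12_0_approximation:
  fixes u :: "real^'n::finite \<Rightarrow> 'b::euclidean_space"
  assumes U: "open U" and u: "u \<in> W12_0_space U" and G: "weak_gradient U u G"
  obtains \<phi> where "\<And>n::nat. test_function U (\<phi> n)"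
    "(\<lambda>n. \<integral>\<^sup>+x\<in>U. ennreal ((norm (u x - \<phi> n x))\<^sup>2) \<partial>lebesgue) \<longlonglongrightarrow> 0"
    "\<And>i. (\<lambda>n. \<integral>\<^sup>+x\<in>U. ennreal ((norm (G i x - pd i (\<phi> n) x))\<^sup>2) \<partial>lebesgue) \<longlonglongrightarrow> 0"
proof -
  obtain \<phi> where \<phi>: "\<And>n. test_function U (\<phi> n)" "(\<lambda>n. W12_norm U (\<lambda>x. u x - \<phi> n x)) \<longlonglongrightarrow> 0"
    using u unfolding W12_0_space_def by blast
  have ev: "\<forall>\<^sub>F n in sequentially.
      (\<integral>\<^sup>+x\<in>U. ennreal ((norm (u x - \<phi> n x))\<^sup>2) \<partial>lebesgue) < ennreal r \<and>
      (\<forall>i. (\<integral>\<^sup>+x\<in>U. ennreal ((norm (G i x - pd i (\<phi> n) x))\<^sup>2) \<partial>lebesgue) < ennreal r)" if r: "r > 0" for r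
  proof -
    define \<epsilon> where "\<epsilon> = sqrt (r / 2)"
    have \<epsilon>: "\<epsilon> > 0" "\<epsilon>\<^sup>2 < r" using r by (auto simp: \<epsilon>_def)
    have "\<forall>\<^sub>F n in sequentially. W12_norm U (\<lambda>x. u x - \<phi> n x) < ennreal \<epsilon>"
      by (rule order_tendstoD(2)[OF \<phi>(2)]) (use \<epsilon> in simp)
    then show ?thesis
    proof eventually_elim
      case (elim n)
      then obtain G' where G': "weak_gradient U (\<lambda>x. u x - \<phi> n x) G'"
        and L: "L2_norm U (\<lambda>x. sqrt ((norm (u x - \<phi> n x))\<^sup>2 + (\<Sum>i\<in>UNIV. (norm (G' i x))\<^sup>2))) < ennreal \<epsilon>"
        unfolding W12_norm_def INF_less_iff by blast
      have I: "(\<integral>\<^sup>+x\<in>U. ennreal ((norm (sqrt ((norm (u x - \<phi> n x))\<^sup>2 + (\<Sum>i\<in>UNIV. (norm (G' i x))\<^sup>2))))\<^sup>2) \<partial>lebesgue) \<le> ennreal (\<epsilon>\<^sup>2)"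
        by (rule L2_norm_le_imp) (use L \<epsilon> in auto)
      have n2: "(norm (sqrt ((norm (u x - \<phi> n x))\<^sup>2 + (\<Sum>i\<in>UNIV. (norm (G' i x))\<^sup>2))))\<^sup>2
          = (norm (u x - \<phi> n x))\<^sup>2 + (\<Sum>i\<in>UNIV. (norm (G' i x))\<^sup>2)" for x
        by (simp add: sum_nonneg)
      have lt: "ennreal (\<epsilon>\<^sup>2) < ennreal r" using \<epsilon> by (simp add: ennreal_less_iff)
      have "(\<integral>\<^sup>+x\<in>U. ennreal ((norm (u x - \<phi> n x))\<^sup>2) \<partial>lebesgue) \<le> ennreal (\<epsilon>\<^sup>2)"
      proof (rule order_trans[OF nn_integral_mono I])
        fix x
        show "ennreal ((norm (u x - \<phi> n x))\<^sup>2) * indicator U x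
          \<le> ennreal ((norm (sqrt ((norm (u x - \<phi> n x))\<^sup>2 + (\<Sum>i\<in>UNIV. (norm (G' i x))\<^sup>2))))\<^sup>2) * indicator U x"
          unfolding n2 by (intro mult_right_mono ennreal_leI) (auto simp: sum_nonneg)
      qed
      moreover have "(\<integral>\<^sup>+x\<in>U. ennreal ((norm (G i x - pd i (\<phi> n) x))\<^sup>2) \<partial>lebesgue) \<le> ennreal (\<epsilon>\<^sup>2)" for i
      proof -
        have s: "smooth (\<phi> n)" by (rule test_function_smooth[OF \<phi>(1)])
        have "weak_pd U i (\<phi> n) (pd i (\<phi> n))"
          by (rule classical_weak_pd[OF smooth_differentiable[OF s] smooth_continuous[OF smooth_pd[OF s]]])
        then have "weak_pd U i (\<lambda>x. u x - \<phi> n x) (\<lambda>x. G i x - pd i (\<phi> n) x)"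
          using G by (intro weak_pd_diff) (auto simp: weak_gradient_def)
        moreover have "weak_pd U i (\<lambda>x. u x - \<phi> n x) (G' i)" using G' by (auto simp: weak_gradient_def)
        ultimately have ae: "AE x in lebesgue. x \<in> U \<longrightarrow> G i x - pd i (\<phi> n) x = G' i x"
          by (rule weak_pd_unique[OF U])
        have "(\<integral>\<^sup>+x\<in>U. ennreal ((norm (G i x - pd i (\<phi> n) x))\<^sup>2) \<partial>lebesgue)
          \<le> (\<integral>\<^sup>+x\<in>U. ennreal ((norm (sqrt ((norm (u x - \<phi> n x))\<^sup>2 + (\<Sum>i\<in>UNIV. (norm (G' i x))\<^sup>2))))\<^sup>2) \<partial>lebesgue)"
        proof (rule nn_integral_mono_AE, use ae in eventually_elim)
          fix x assume x: "x \<in> U \<longrightarrow> G i x - pd i (\<phi> n) x = G' i x"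
          have "(norm (G' i x))\<^sup>2 \<le> (\<Sum>i\<in>UNIV. (norm (G' i x))\<^sup>2)" by (intro member_le_sum) auto
          also have "\<dots> \<le> (norm (u x - \<phi> n x))\<^sup>2 + (\<Sum>i\<in>UNIV. (norm (G' i x))\<^sup>2)" by simp
          finally show "ennreal ((norm (G i x - pd i (\<phi> n) x))\<^sup>2) * indicator U x
            \<le> ennreal ((norm (sqrt ((norm (u x - \<phi> n x))\<^sup>2 + (\<Sum>i\<in>UNIV. (norm (G' i x))\<^sup>2))))\<^sup>2) * indicator U x"
            unfolding n2 using x by (cases "x \<in> U") (auto intro: ennreal_leI)
        qed
        then show ?thesis using I by (rule order_trans)
      qed
      ultimately show ?case using lt by (blast intro: le_less_trans)
    qed
  qed
  show thesis
  proof (rule that[OF \<phi>(1)])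
    show "(\<lambda>n. \<integral>\<^sup>+x\<in>U. ennreal ((norm (u x - \<phi> n x))\<^sup>2) \<partial>lebesgue) \<longlonglongrightarrow> 0"
      by (rule tendsto_zero_ennreal) (rule eventually_mono[OF ev], auto)
    show "(\<lambda>n. \<integral>\<^sup>+x\<in>U. ennreal ((norm (G i x - pd i (\<phi> n) x))\<^sup>2) \<partial>lebesgue) \<longlonglongrightarrow> 0" for i
      by (rule tendsto_zero_ennreal) (rule eventually_mono[OF ev], auto)
  qed
qed

text \<open>The weight is bounded with bounded support, hence square integrable; Cauchy-Schwarz
  turns convergence in the mean square into convergence of the weighted integrals.\<close>

lemma weighted_integral_tendsto:
  fixes f :: "'a::euclidean_space \<Rightarrow> 'b::euclidean_space" and w :: "'a \<Rightarrow> real"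
  assumes U: "U \<in> sets lebesgue" and f: "f \<in> borel_measurable (lebesgue_on U)"
    and fn: "\<And>n. continuous_on UNIV (fn n)"
    and lim: "(\<lambda>n. \<integral>\<^sup>+x\<in>U. ennreal ((norm (f x - fn n x))\<^sup>2) \<partial>lebesgue) \<longlonglongrightarrow> 0"
    and w: "w \<in> borel_measurable borel" "\<And>x. \<bar>w x\<bar> \<le> M" "\<And>x. norm x > R \<Longrightarrow> w x = 0" "\<And>x. x \<notin> U \<Longrightarrow> w x = 0"
  shows "integrable lebesgue (\<lambda>x. w x *\<^sub>R f x)"
    and "(\<lambda>n. \<integral>x. w x *\<^sub>R fn n x \<partial>lebesgue) \<longlonglongrightarrow> (\<integral>x. w x *\<^sub>R f x \<partial>lebesgue)"
    and "\<And>n. integrable lebesgue (\<lambda>x. w x *\<^sub>R fn n x)"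
proof -
  have wm: "w \<in> borel_measurable lebesgue" using w(1) by (simp add: measurable_completion)
  have fnm: "fn n \<in> borel_measurable lebesgue" for n
    using borel_measurable_continuous_onI[OF fn] by (simp add: measurable_completion)
  have fm: "(\<lambda>x. indicator U x *\<^sub>R f x) \<in> borel_measurable lebesgue"
    using f U by (simp add: borel_measurable_restrict_space_iff)
  have wU: "w x *\<^sub>R f x = w x *\<^sub>R (indicator U x *\<^sub>R f x)" for x
    using w(4)[of x] by (auto simp: indicator_def)
  have wfm: "(\<lambda>x. w x *\<^sub>R f x) \<in> borel_measurable lebesgue"
    unfolding wU by (rule borel_measurable_scaleR[OF wm fm])
  have wfnm: "(\<lambda>x. w x *\<^sub>R fn n x) \<in> borel_measurable lebesgue" for n
    by (rule borel_measurable_scaleR[OF wm fnm])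
  have M: "M \<ge> 0" using w(2)[of 0] by linarith
  define W where "W = (\<integral>\<^sup>+x. (ennreal \<bar>w x\<bar>)\<^sup>2 \<partial>lebesgue)"
  have "W \<le> (\<integral>\<^sup>+x. ennreal (M\<^sup>2) * indicator (cball (0::'a) R) x \<partial>lebesgue)"
    unfolding W_def
  proof (rule nn_integral_mono)
    fix x
    have "\<bar>w x\<bar>\<^sup>2 \<le> M\<^sup>2" using w(2)[of x] by (intro power_mono) auto
    then show "(ennreal \<bar>w x\<bar>)\<^sup>2 \<le> ennreal (M\<^sup>2) * indicator (cball 0 R) x"
      using w(3)[of x] by (cases "norm x \<le> R") (auto simp: ennreal_power intro: ennreal_leI)
  qed
  also have "\<dots> < \<infinity>"
    using emeasure_bounded_finite[of "cball (0::'a) R"]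
    by (simp add: nn_integral_cmult_indicator ennreal_mult_less_top)
  finally have W: "W < \<infinity>" .
  have fn_int: "integrable lebesgue (\<lambda>x. w x *\<^sub>R fn n x)" for n
  proof -
    have i: "integrable lebesgue (\<lambda>x. indicator (cball 0 R) x *\<^sub>R fn n x)"
      by (intro integrable_lebesgue_of_lborel borel_integrable_compact) (auto intro: continuous_on_subset[OF fn])
    show ?thesis
    proof (rule Bochner_Integration.integrable_bound[OF integrable_scaleR_right[OF i, of M] wfnm], intro AE_I2)
      fix x
      show "norm (w x *\<^sub>R fn n x) \<le> norm (M *\<^sub>R indicator (cball 0 R) x *\<^sub>R fn n x)"
        using w(2)[of x] w(3)[of x] M by (cases "norm x \<le> R") (auto intro: mult_right_mono)
    qed
  qed
  define J where "J n = (\<integral>\<^sup>+x. ennreal (norm (w x *\<^sub>R (f x - fn n x))) \<partial>lebesgue)" for n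
  have dm: "(\<lambda>x. w x *\<^sub>R (f x - fn n x)) \<in> borel_measurable lebesgue" for n
    using borel_measurable_diff[OF wfm wfnm, of n] by (simp add: scaleR_diff_right)
  have J2: "(J n)\<^sup>2 \<le> W * (\<integral>\<^sup>+x\<in>U. ennreal ((norm (f x - fn n x))\<^sup>2) \<partial>lebesgue)" for n
  proof -
    have gm: "(\<lambda>x. indicator U x *\<^sub>R (f x - fn n x)) \<in> borel_measurable lebesgue"
    proof -
      have "(\<lambda>x. indicator U x *\<^sub>R fn n x) \<in> borel_measurable lebesgue"
        using U by (intro borel_measurable_scaleR fnm borel_measurable_indicator)
      from borel_measurable_diff[OF fm this] show ?thesis by (simp add: scaleR_diff_right)
    qed
    have "J n = (\<integral>\<^sup>+x. ennreal \<bar>w x\<bar> * ennreal (norm (indicator U x *\<^sub>R (f x - fn n x))) \<partial>lebesgue)"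
      unfolding J_def using w(4) by (intro nn_integral_cong) (auto simp: ennreal_mult' indicator_def)
    also have "(\<dots>)\<^sup>2 \<le> W * (\<integral>\<^sup>+x. (ennreal (norm (indicator U x *\<^sub>R (f x - fn n x))))\<^sup>2 \<partial>lebesgue)"
      unfolding W_def
      by (intro Cauchy_Schwarz_nn_integral measurable_compose[OF measurable_compose[OF gm borel_measurable_norm] measurable_ennreal]
          measurable_compose[OF measurable_compose[OF wm borel_measurable_norm, unfolded real_norm_def] measurable_ennreal])
    also have "(\<integral>\<^sup>+x. (ennreal (norm (indicator U x *\<^sub>R (f x - fn n x))))\<^sup>2 \<partial>lebesgue)
        = (\<integral>\<^sup>+x\<in>U. ennreal ((norm (f x - fn n x))\<^sup>2) \<partial>lebesgue)"
      by (intro nn_integral_cong) (auto simp: ennreal_power indicator_def)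
    finally show ?thesis .
  qed
  have J_lim: "J \<longlonglongrightarrow> 0"
  proof (rule tendsto_zero_ennreal)
    fix r :: real assume r: "r > 0"
    have "(\<lambda>n. W * (\<integral>\<^sup>+x\<in>U. ennreal ((norm (f x - fn n x))\<^sup>2) \<partial>lebesgue)) \<longlonglongrightarrow> W * 0"
      using W lim by (intro ennreal_tendsto_cmult) auto
    then have "\<forall>\<^sub>F n in sequentially. W * (\<integral>\<^sup>+x\<in>U. ennreal ((norm (f x - fn n x))\<^sup>2) \<partial>lebesgue) < ennreal (r\<^sup>2)"
      using r by (intro order_tendstoD(2)[where y="W * 0"]) auto
    then show "\<forall>\<^sub>F n in sequentially. J n < ennreal r"
    proof eventually_elim
      case (elim n)
      then have "(J n)\<^sup>2 < (ennreal r)\<^sup>2" using J2[of n] r by (simp add: ennreal_power le_less_trans)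
      then show ?case by (metis not_le power_mono zero_le)
    qed
  qed
  have "\<forall>\<^sub>F n in sequentially. J n < 1" by (rule order_tendstoD(2)[OF J_lim]) simp
  \<comment> \<open>One approximant at finite weighted distance is enough: \<open>w\<close> times
    \<open>f\<close> is the sum of an integrable difference and the integrable product with
    \<open>fn n0\<close>.\<close>
  then obtain n0 where n0: "J n0 < 1" by (meson eventually_happens' sequentially_bot)
  have d_int0: "integrable lebesgue (\<lambda>x. w x *\<^sub>R (f x - fn n0 x))"
    unfolding integrable_iff_bounded using dm n0 by (auto simp: J_def intro: less_trans)
  show f_int: "integrable lebesgue (\<lambda>x. w x *\<^sub>R f x)"
    using Bochner_Integration.integrable_add[OF d_int0 fn_int[of n0]] by (simp add: scaleR_diff_right)
  show "\<And>n. integrable lebesgue (\<lambda>x. w x *\<^sub>R fn n x)" by (rule fn_int)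
  have bound: "ennreal (norm ((\<integral>x. w x *\<^sub>R fn n x \<partial>lebesgue) - (\<integral>x. w x *\<^sub>R f x \<partial>lebesgue))) \<le> J n" for n
  proof -
    have i: "integrable lebesgue (\<lambda>x. w x *\<^sub>R (f x - fn n x))"
      using Bochner_Integration.integrable_diff[OF f_int fn_int[of n]] by (simp add: scaleR_diff_right)
    have "(\<integral>x. w x *\<^sub>R (f x - fn n x) \<partial>lebesgue) = (\<integral>x. w x *\<^sub>R f x \<partial>lebesgue) - (\<integral>x. w x *\<^sub>R fn n x \<partial>lebesgue)"
      using Bochner_Integration.integral_diff[OF f_int fn_int[of n]] by (simp add: scaleR_diff_right)
    then show ?thesis
      using integral_norm_bound_ennreal[OF i] unfolding J_def by (simp add: norm_minus_commute)
  qed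
  show "(\<lambda>n. \<integral>x. w x *\<^sub>R fn n x \<partial>lebesgue) \<longlonglongrightarrow> (\<integral>x. w x *\<^sub>R f x \<partial>lebesgue)"
  proof (rule LIMSEQ_I)
    fix r :: real assume "r > 0"
    then have "\<forall>\<^sub>F n in sequentially. J n < ennreal r" by (intro order_tendstoD(2)[OF J_lim]) simp
    then obtain N where "\<And>n. n \<ge> N \<Longrightarrow> J n < ennreal r" by (auto simp: eventually_sequentially)
    then have "ennreal (norm ((\<integral>x. w x *\<^sub>R fn n x \<partial>lebesgue) - (\<integral>x. w x *\<^sub>R f x \<partial>lebesgue))) < ennreal r" if "n \<ge> N" for n
      using bound[of n] that le_less_trans by blast
    then show "\<exists>N. \<forall>n\<ge>N. norm ((\<integral>x. w x *\<^sub>R fn n x \<partial>lebesgue) - (\<integral>x. w x *\<^sub>R f x \<partial>lebesgue)) < r"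
      using \<open>r > 0\<close> by (auto simp: ennreal_less_iff)
  qed
qed

text \<open>Meant for functions cut off by an indicator: they are globally regular as soon as each
  point has a neighbourhood on which they agree with regular functions.\<close>

lemma directional_derivative_glue:
  fixes F D :: "'a::real_normed_vector \<Rightarrow> 'b::real_normed_vector"
  assumes loc: "\<And>x. \<exists>N F0 D0. open N \<and> x \<in> N \<and> continuous_on UNIV F0 \<and> continuous_on UNIV D0 \<and>
     ((\<lambda>s. F0 (x + s *\<^sub>R e)) has_vector_derivative D0 x) (at 0) \<and> (\<forall>y\<in>N. F y = F0 y \<and> D y = D0 y)"
  shows "continuous_on UNIV F" "continuous_on UNIV D"
    "((\<lambda>s. F (x + s *\<^sub>R e)) has_vector_derivative D x) (at 0)"
proof -
  have "isCont F x \<and> isCont D x \<and> ((\<lambda>s. F (x + s *\<^sub>R e)) has_vector_derivative D x) (at 0)" for x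
  proof -
    obtain N F0 D0 where N: "open N" "x \<in> N" "continuous_on UNIV F0" "continuous_on UNIV D0"
      "((\<lambda>s. F0 (x + s *\<^sub>R e)) has_vector_derivative D0 x) (at 0)" "\<And>y. y \<in> N \<Longrightarrow> F y = F0 y" "\<And>y. y \<in> N \<Longrightarrow> D y = D0 y"
      using loc[of x] by blast
    have c: "isCont F0 x" "isCont D0 x" using N(3,4) by (auto simp: continuous_on_eq_continuous_at)
    have "isCont F x"
      by (rule isCont_cong[THEN iffD2, OF eventually_nhds_in_open[OF N(1,2), THEN eventually_mono] c(1)]) (rule N(6))
    moreover have "isCont D x"
      by (rule isCont_cong[THEN iffD2, OF eventually_nhds_in_open[OF N(1,2), THEN eventually_mono] c(2)]) (rule N(7))
    moreover have "((\<lambda>s. F (x + s *\<^sub>R e)) has_vector_derivative D0 x) (at 0)"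
    proof (rule has_vector_derivative_transform_within_open[OF N(5)])
      show "open ((\<lambda>s. x + s *\<^sub>R e) -` N)"
        using N(1) by (intro open_vimage) (auto intro!: continuous_intros)
    qed (use N in auto)
    ultimately show ?thesis using N(2,7) by simp
  qed
  then show "continuous_on UNIV F" "continuous_on UNIV D"
    "((\<lambda>s. F (x + s *\<^sub>R e)) has_vector_derivative D x) (at 0)"
    by (auto simp: continuous_on_eq_continuous_at)
qed

text \<open>Integration by parts over a region \<open>A\<close> whose boundary lies in the complement of \<open>\<Omega>\<close>
  wherever the weight \<open>\<theta>\<close> does not vanish: there the approximating test functions vanish.\<close>

theorem W12_0_integration_by_parts:
  fixes u :: "real^'n::finite \<Rightarrow> 'b::euclidean_space" and \<theta> \<theta>' :: "real^'n \<Rightarrow> real"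
  assumes \<Omega>: "open \<Omega>" and u: "u \<in> W12_0_space \<Omega>" and G: "weak_gradient \<Omega> u G" "\<And>i. G i \<in> L2_space \<Omega>"
    and A: "open A"
    and c: "continuous_on UNIV \<theta>" "continuous_on UNIV \<theta>'"
    and der: "\<And>x. ((\<lambda>s. \<theta> (x + s *\<^sub>R e)) has_vector_derivative \<theta>' x) (at 0)"
    and bdd: "\<And>x. x \<in> A \<Longrightarrow> norm x > R \<Longrightarrow> \<theta> x = 0 \<and> \<theta>' x = 0"
    and sub: "\<And>x. x \<in> A \<Longrightarrow> \<theta> x \<noteq> 0 \<or> \<theta>' x \<noteq> 0 \<Longrightarrow> x \<in> \<Omega>"
    and bd: "\<And>x. x \<in> frontier A \<Longrightarrow> x \<in> \<Omega> \<Longrightarrow> \<exists>N. open N \<and> x \<in> N \<and> (\<forall>y\<in>N. \<theta> y = 0 \<and> \<theta>' y = 0)"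
  shows "integrable lebesgue (\<lambda>x. (indicator A x * \<theta>' x) *\<^sub>R u x)"
    and "integrable lebesgue (\<lambda>x. (indicator A x * \<theta> x) *\<^sub>R G i x)"
    and "(\<integral>x. (indicator A x * \<theta>' x) *\<^sub>R u x \<partial>lebesgue) +
      (\<Sum>i\<in>UNIV. e $ i *\<^sub>R (\<integral>x. (indicator A x * \<theta> x) *\<^sub>R G i x \<partial>lebesgue)) = 0"
proof -
  obtain \<phi> where \<phi>: "\<And>n::nat. test_function \<Omega> (\<phi> n)"
    "(\<lambda>n. \<integral>\<^sup>+x\<in>\<Omega>. ennreal ((norm (u x - \<phi> n x))\<^sup>2) \<partial>lebesgue) \<longlonglongrightarrow> 0"
    "\<And>i. (\<lambda>n. \<integral>\<^sup>+x\<in>\<Omega>. ennreal ((norm (G i x - pd i (\<phi> n) x))\<^sup>2) \<partial>lebesgue) \<longlonglongrightarrow> 0"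
    by (rule W12_0_approximation[OF \<Omega> u G(1)]) (rule that)
  have s: "smooth (\<phi> n)" for n by (rule test_function_smooth[OF \<phi>(1)])
  have \<Omega>m: "\<Omega> \<in> sets lebesgue" using \<Omega> by (simp add: borel_open)
  have um: "u \<in> borel_measurable (lebesgue_on \<Omega>)" and Gm: "G i \<in> borel_measurable (lebesgue_on \<Omega>)" for i
    using u G(2)[of i] by (auto simp: W12_0_space_def W12_space_def L2_space_def)
  have cb: "\<exists>M. \<forall>x. \<bar>indicator A x * \<theta> x\<bar> \<le> M" if "continuous_on UNIV \<theta>" "\<And>x. x \<in> A \<Longrightarrow> norm x > R \<Longrightarrow> \<theta> x = 0" for \<theta> :: "real^'n \<Rightarrow> real"
  proof -
    have "bounded (\<theta> ` cball 0 R)"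
      by (intro compact_imp_bounded compact_continuous_image continuous_on_subset[OF that(1)]) auto
    then obtain M where M: "M > 0" "\<And>x. norm x \<le> R \<Longrightarrow> \<bar>\<theta> x\<bar> \<le> M" unfolding bounded_pos by auto
    have "\<bar>indicator A x * \<theta> x\<bar> \<le> M" for x
      using M that(2)[of x] by (cases "x \<in> A"; cases "norm x \<le> R") auto
    then show ?thesis by blast
  qed
  obtain M1 where M1: "\<And>x. \<bar>indicator A x * \<theta> x\<bar> \<le> M1" using cb[OF c(1)] bdd by blast
  obtain M2 where M2: "\<And>x. \<bar>indicator A x * \<theta>' x\<bar> \<le> M2" using cb[OF c(2)] bdd by blast
  have m: "(\<lambda>x. indicator A x * \<theta> x) \<in> borel_measurable borel" "(\<lambda>x. indicator A x * \<theta>' x) \<in> borel_measurable borel"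
    using A by (auto intro!: borel_measurable_times[OF borel_measurable_indicator borel_measurable_continuous_onI] c)
  have z: "indicator A x * \<theta> x = 0" "indicator A x * \<theta>' x = 0" if "norm x > R" for x :: "real^'n"
    using bdd[of x] that by (cases "x \<in> A"; simp)+
  have z\<Omega>: "indicator A x * \<theta> x = 0" "indicator A x * \<theta>' x = 0" if "x \<notin> \<Omega>" for x :: "real^'n"
    using sub[of x] that by (cases "x \<in> A"; auto)+
  have pc: "continuous_on UNIV (pd i (\<phi> n))" "continuous_on UNIV (\<phi> n)" for i n
    by (intro smooth_continuous smooth_pd s)+
  note W1 = weighted_integral_tendsto[OF \<Omega>m um pc(2) \<phi>(2) m(2) M2 z(2) z\<Omega>(2)]
  note W2 = weighted_integral_tendsto[OF \<Omega>m Gm pc(1) \<phi>(3) m(1) M1 z(1) z\<Omega>(1)]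
  show "integrable lebesgue (\<lambda>x. (indicator A x * \<theta>' x) *\<^sub>R u x)" by (rule W1(1))
  show "integrable lebesgue (\<lambda>x. (indicator A x * \<theta> x) *\<^sub>R G i x)" by (rule W2(1))
  have zero: "(\<integral>x. (indicator A x * \<theta>' x) *\<^sub>R \<phi> n x \<partial>lebesgue) +
      (\<Sum>i\<in>UNIV. e $ i *\<^sub>R (\<integral>x. (indicator A x * \<theta> x) *\<^sub>R pd i (\<phi> n) x \<partial>lebesgue)) = 0" for n
  proof -
    define F where "F = (\<lambda>x. (indicator A x * \<theta> x) *\<^sub>R \<phi> n x)"
    define D where "D = (\<lambda>x. (indicator A x * \<theta>' x) *\<^sub>R \<phi> n x + (indicator A x * \<theta> x) *\<^sub>R dir_deriv e (\<phi> n) x)"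
    obtain C where C: "compact C" "C \<subseteq> \<Omega>" "\<And>x. x \<notin> C \<Longrightarrow> \<phi> n x = 0" "\<And>x i. x \<notin> C \<Longrightarrow> pd i (\<phi> n) x = 0"
      by (rule test_function_support[OF \<phi>(1)[of n]]) (rule that)
    have "\<exists>N F0 D0. open N \<and> x \<in> N \<and> continuous_on UNIV F0 \<and> continuous_on UNIV D0 \<and>
     ((\<lambda>s. F0 (x + s *\<^sub>R e)) has_vector_derivative D0 x) (at 0) \<and> (\<forall>y\<in>N. F y = F0 y \<and> D y = D0 y)" for x
    proof -
      have zero_case: ?thesis if "open N" "x \<in> N" "\<And>y. y \<in> N \<Longrightarrow> F y = 0 \<and> D y = 0" for N
        using that by (intro exI[of _ N] exI[of _ "\<lambda>x. 0"]) auto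
      \<comment> \<open>A frontier point of \<open>A\<close> inside \<open>\<Omega>\<close> has a
        neighbourhood where the weights vanish; at a point outside \<open>\<Omega>\<close> the test
        function vanishes nearby. Thus the jump of the indicator is never seen.\<close>
      consider "x \<in> A" | "x \<in> - closure A" | "x \<in> frontier A" "x \<in> \<Omega>" | "x \<notin> \<Omega>"
        using A by (auto simp: frontier_def interior_open)
      then show ?thesis
      proof cases
        case 1
        have "continuous_on UNIV (\<lambda>x. \<theta> x *\<^sub>R \<phi> n x)" "continuous_on UNIV (\<lambda>x. \<theta>' x *\<^sub>R \<phi> n x + \<theta> x *\<^sub>R dir_deriv e (\<phi> n) x)"
          by (intro continuous_intros c pc smooth_dir_deriv_continuous s)+
        moreover have d\<theta>: "((\<lambda>s. \<theta> (x + s *\<^sub>R e)) has_real_derivative \<theta>' x) (at 0)"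
          using der[of x] by (simp add: has_real_derivative_iff_has_vector_derivative)
        have "((\<lambda>s. \<theta> (x + s *\<^sub>R e) *\<^sub>R \<phi> n (x + s *\<^sub>R e)) has_vector_derivative \<theta>' x *\<^sub>R \<phi> n x + \<theta> x *\<^sub>R dir_deriv e (\<phi> n) x) (at 0)"
          using has_vector_derivative_scaleR[OF d\<theta> dir_deriv_line[OF smooth_differentiable[OF s[of n]], of x e]]
          by (simp add: add.commute)
        ultimately show ?thesis using 1 A
          by (intro exI[of _ A] exI[of _ "\<lambda>x. \<theta> x *\<^sub>R \<phi> n x"] exI[of _ "\<lambda>x. \<theta>' x *\<^sub>R \<phi> n x + \<theta> x *\<^sub>R dir_deriv e (\<phi> n) x"])
             (simp add: F_def D_def)
      next
        case 2
        show ?thesis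
          by (rule zero_case[OF _ 2]) (use closure_subset[of A] in \<open>auto simp: F_def D_def indicator_def\<close>)
      next
        case 3
        then obtain N where "open N" "x \<in> N" "\<forall>y\<in>N. \<theta> y = 0 \<and> \<theta>' y = 0" using bd by blast
        then show ?thesis by (intro zero_case) (auto simp: F_def D_def)
      next
        case 4
        then have "x \<in> - C" using C by blast
        then show ?thesis
          by (intro zero_case[of "- C"]) (use C compact_imp_closed[OF C(1)] in \<open>auto simp: F_def D_def dir_deriv_def\<close>)
      qed
    qed
    note g = directional_derivative_glue[where F=F and D=D and e=e, OF this]
    have "(\<integral>x. D x \<partial>lebesgue) = 0"
      by (rule integral_directional_derivative_lebesgue(2)[where R=R, OF g(1,2) _ g(3)]) (use z in \<open>simp add: F_def\<close>)
    moreover have "(\<integral>x. D x \<partial>lebesgue) = (\<integral>x. (indicator A x * \<theta>' x) *\<^sub>R \<phi> n x \<partial>lebesgue) +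
      (\<Sum>i\<in>UNIV. e $ i *\<^sub>R (\<integral>x. (indicator A x * \<theta> x) *\<^sub>R pd i (\<phi> n) x \<partial>lebesgue))"
    proof -
      have "D = (\<lambda>x. (indicator A x * \<theta>' x) *\<^sub>R \<phi> n x + (\<Sum>i\<in>UNIV. e $ i *\<^sub>R ((indicator A x * \<theta> x) *\<^sub>R pd i (\<phi> n) x)))"
        by (simp add: D_def fun_eq_iff dir_deriv_def scaleR_sum_right mult.commute)
      then have "(\<integral>x. D x \<partial>lebesgue) = (\<integral>x. (indicator A x * \<theta>' x) *\<^sub>R \<phi> n x + (\<Sum>i\<in>UNIV. e $ i *\<^sub>R ((indicator A x * \<theta> x) *\<^sub>R pd i (\<phi> n) x)) \<partial>lebesgue)"
        by simp
      also have "\<dots> = (\<integral>x. (indicator A x * \<theta>' x) *\<^sub>R \<phi> n x \<partial>lebesgue) + (\<integral>x. (\<Sum>i\<in>UNIV. e $ i *\<^sub>R ((indicator A x * \<theta> x) *\<^sub>R pd i (\<phi> n) x)) \<partial>lebesgue)"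
        by (intro Bochner_Integration.integral_add Bochner_Integration.integrable_sum integrable_scaleR_right W1(3) W2(3))
      also have "(\<integral>x. (\<Sum>i\<in>UNIV. e $ i *\<^sub>R ((indicator A x * \<theta> x) *\<^sub>R pd i (\<phi> n) x)) \<partial>lebesgue)
          = (\<Sum>i\<in>UNIV. \<integral>x. e $ i *\<^sub>R ((indicator A x * \<theta> x) *\<^sub>R pd i (\<phi> n) x) \<partial>lebesgue)"
        by (intro Bochner_Integration.integral_sum integrable_scaleR_right W2(3))
      finally show ?thesis by (simp only: integral_scaleR_right)
    qed
    ultimately show ?thesis by simp
  qed
  have lim: "(\<lambda>n. (\<integral>x. (indicator A x * \<theta>' x) *\<^sub>R \<phi> n x \<partial>lebesgue) +
      (\<Sum>i\<in>UNIV. e $ i *\<^sub>R (\<integral>x. (indicator A x * \<theta> x) *\<^sub>R pd i (\<phi> n) x \<partial>lebesgue)))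
    \<longlonglongrightarrow> (\<integral>x. (indicator A x * \<theta>' x) *\<^sub>R u x \<partial>lebesgue) +
      (\<Sum>i\<in>UNIV. e $ i *\<^sub>R (\<integral>x. (indicator A x * \<theta> x) *\<^sub>R G i x \<partial>lebesgue))"
    by (intro tendsto_add tendsto_sum tendsto_scaleR tendsto_const W1(2) W2(2))
  show "(\<integral>x. (indicator A x * \<theta>' x) *\<^sub>R u x \<partial>lebesgue) +
      (\<Sum>i\<in>UNIV. e $ i *\<^sub>R (\<integral>x. (indicator A x * \<theta> x) *\<^sub>R G i x \<partial>lebesgue)) = 0"
    by (rule LIMSEQ_unique[OF lim[unfolded zero] tendsto_const])
qed

section \<open>Graph representation of uniformly smooth boundaries\<close>

lemma abs_iter_pd_le_grad_norm:
  fixes f :: "real^'n::finite \<Rightarrow> real"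
  assumes "length js = k" shows "\<bar>iter_pd js f x\<bar> \<le> grad_norm k f x"
proof -
  have "(norm (iter_pd js f x))\<^sup>2 \<le> (\<Sum>js | length js = k. (norm (iter_pd js f x))\<^sup>2)"
    using assms finite_lists_length_eq[of "UNIV :: 'n set" k] by (intro member_le_sum) auto
  then show ?thesis unfolding grad_norm_def by (simp add: real_le_rsqrt)
qed

lemma has_real_derivative_along_ray:
  fixes f :: "real^'n::finite \<Rightarrow> real"
  assumes "f differentiable at (t *\<^sub>R y)"
  shows "((\<lambda>t. f (t *\<^sub>R y)) has_real_derivative (\<Sum>i\<in>UNIV. y $ i * pd i f (t *\<^sub>R y))) (at t)"
proof -
  have "((\<lambda>t. t *\<^sub>R y) has_derivative (\<lambda>s. s *\<^sub>R y)) (at t)"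
    by (auto intro!: derivative_eq_intros)
  from has_derivative_compose[OF this has_derivative_pd[OF assms]]
  show ?thesis
    unfolding has_field_derivative_def
    by (rule has_derivative_eq_rhs) (simp add: fun_eq_iff sum_distrib_right sum_distrib_left mult_ac)
qed

text \<open>Each of the three sums over two coordinates costs a factor 2, whence 8.\<close>

lemma norm_cube_sum_bound:
  fixes y :: "real^2"
  assumes "\<And>i j k. \<bar>T i j k\<bar> \<le> K"
  shows "\<bar>\<Sum>i\<in>UNIV. y $ i * (\<Sum>j\<in>UNIV. y $ j * (\<Sum>k\<in>(UNIV::2 set). y $ k * T i j k))\<bar> \<le> 8 * K * norm y ^ 3"
proof -
  have le: "\<bar>\<Sum>i\<in>(UNIV::2 set). y $ i * g i\<bar> \<le> 2 * norm y * L" if "\<And>i. \<bar>g i\<bar> \<le> L" for g :: "2 \<Rightarrow> real" and L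
  proof -
    have "\<bar>\<Sum>i\<in>(UNIV::2 set). y $ i * g i\<bar> \<le> (\<Sum>i\<in>(UNIV::2 set). \<bar>y $ i * g i\<bar>)" by (rule sum_abs)
    also have "\<dots> \<le> (\<Sum>i\<in>(UNIV::2 set). norm y * L)"
      unfolding abs_mult by (intro sum_mono mult_mono that component_le_norm_cart) auto
    finally show ?thesis by simp
  qed
  have "\<bar>\<Sum>i\<in>UNIV. y $ i * (\<Sum>j\<in>UNIV. y $ j * (\<Sum>k\<in>(UNIV::2 set). y $ k * T i j k))\<bar> \<le> 2 * norm y * (2 * norm y * (2 * norm y * K))"
    by (intro le assms)
  then show ?thesis by (simp add: power3_eq_cube mult_ac)
qed

text \<open>Taylor's formula for \<open>t \<mapsto> g (t *\<^sub>R y)\<close>; the bounds of orders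
  0 and 1 at the origin remove the value and the gradient. What matters later is that the subtracted
  quadratic form is even in \<open>y\<close>.\<close>

lemma third_order_expansion:
  fixes g :: "real^2 \<Rightarrow> real"
  assumes g: "C_k_on 3 (ball 0 \<sigma>) g" and K: "K \<ge> 0"
    and b: "\<And>y. y \<in> ball 0 \<sigma> \<Longrightarrow> (\<forall>i\<le>2. grad_norm i g y \<le> K * norm y ^ (2 - i)) \<and> grad_norm 3 g y \<le> K"
    and y: "y \<in> ball 0 \<sigma>"
  shows "\<bar>g y - (\<Sum>i\<in>UNIV. y $ i * (\<Sum>j\<in>UNIV. y $ j * iter_pd [j, i] g 0)) / 2\<bar> \<le> 2 * K * norm y ^ 3"
proof -
  have \<sigma>: "\<sigma> > 0" using y norm_ge_zero[of y] by (simp del: norm_ge_zero)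
  have ty: "t *\<^sub>R y \<in> ball 0 \<sigma>" if "0 \<le> t" "t \<le> 1" for t :: real
    using y that mult_left_le_one_le[of "norm y" t] by (simp add: abs_of_nonneg)
  have dd: "iter_pd js g differentiable at x" if "length js < 3" "x \<in> ball 0 \<sigma>" for js x
  proof -
    have "iter_pd js g differentiable_on ball 0 \<sigma>" using g that by (simp add: C_k_on_def)
    then show ?thesis using that by (simp add: differentiable_on_def at_within_open[OF _ open_ball])
  qed
  define diff where "diff = (\<lambda>(m::nat) t. if m = 0 then g (t *\<^sub>R y)
     else if m = 1 then (\<Sum>i\<in>UNIV. y $ i * iter_pd [i] g (t *\<^sub>R y))
     else if m = 2 then (\<Sum>i\<in>UNIV. y $ i * (\<Sum>j\<in>UNIV. y $ j * iter_pd [j, i] g (t *\<^sub>R y)))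
     else (\<Sum>i\<in>UNIV. y $ i * (\<Sum>j\<in>UNIV. y $ j * (\<Sum>k\<in>(UNIV::2 set). y $ k * iter_pd [k, j, i] g (t *\<^sub>R y)))) :: real)"
  have D: "((\<lambda>t. iter_pd js g (t *\<^sub>R y)) has_real_derivative (\<Sum>i\<in>UNIV. y $ i * iter_pd (i # js) g (t *\<^sub>R y))) (at t)"
    if "length js < 3" "0 \<le> t" "t \<le> 1" for js t
    using has_real_derivative_along_ray[OF dd[OF that(1) ty[OF that(2,3)]]] by (simp add: iter_pd_Cons)
  have "\<forall>m t. m < 3 \<and> 0 \<le> t \<and> t \<le> 1 \<longrightarrow> DERIV (diff m) t :> diff (Suc m) t"
  proof (intro allI impI)
    fix m :: nat and t :: real assume m: "m < 3 \<and> 0 \<le> t \<and> t \<le> 1"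
    then consider "m = 0" | "m = 1" | "m = 2" by linarith
    then show "DERIV (diff m) t :> diff (Suc m) t"
    proof cases
      case 1 then show ?thesis using m D[of "[]" t] by (simp add: diff_def iter_pd_Nil)
    next
      case 2
      have "((\<lambda>t. \<Sum>i\<in>UNIV. y $ i * iter_pd [i] g (t *\<^sub>R y)) has_real_derivative
          (\<Sum>i\<in>UNIV. y $ i * (\<Sum>j\<in>UNIV. y $ j * iter_pd [j, i] g (t *\<^sub>R y)))) (at t)"
        by (intro DERIV_sum DERIV_cmult D) (use m in auto)
      then show ?thesis using 2 by (simp add: diff_def)
    next
      case 3
      have "((\<lambda>t. \<Sum>i\<in>UNIV. y $ i * (\<Sum>j\<in>UNIV. y $ j * iter_pd [j, i] g (t *\<^sub>R y))) has_real_derivative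
          (\<Sum>i\<in>UNIV. y $ i * (\<Sum>j\<in>UNIV. y $ j * (\<Sum>k\<in>UNIV. y $ k * iter_pd [k, j, i] g (t *\<^sub>R y))))) (at t)"
        by (intro DERIV_sum DERIV_cmult D) (use m in auto)
      then show ?thesis using 3 by (simp add: diff_def)
    qed
  qed
  from Maclaurin[of 1 3 diff "diff 0", OF _ _ _ this]
  obtain t where t: "0 < t" "t < 1" "diff 0 1 = (\<Sum>m<3. (diff m 0 / fact m) * 1 ^ m) + (diff 3 t / fact 3) * 1 ^ 3"
    by auto
  have z: "0 \<in> ball 0 \<sigma>" using \<sigma> by simp
  have "\<bar>iter_pd [] g 0\<bar> \<le> K * norm (0::real^2) ^ (2 - 0)"
    using abs_iter_pd_le_grad_norm[of "[]" 0 g 0] b[OF z] by (auto intro: order_trans)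
  then have g0: "g 0 = 0" by (simp add: iter_pd_Nil)
  have g1: "iter_pd [i] g 0 = 0" for i
  proof -
    have "grad_norm 1 g 0 \<le> K * norm (0::real^2) ^ (2 - 1)" using b[OF z, THEN conjunct1, rule_format, of 1] by simp
    then show ?thesis using abs_iter_pd_le_grad_norm[of "[i]" 1 g 0] by simp
  qed
  have "\<bar>iter_pd [k, j, i] g (t *\<^sub>R y)\<bar> \<le> K" for i j k
    using abs_iter_pd_le_grad_norm[of "[k, j, i]" 3 g "t *\<^sub>R y"] b[OF ty, of t] t by force
  then have "\<bar>diff 3 t\<bar> \<le> 8 * K * norm y ^ 3"
    unfolding diff_def using norm_cube_sum_bound[of "\<lambda>i j k. iter_pd [k, j, i] g (t *\<^sub>R y)" K y] by simp
  moreover have "diff 0 1 = diff 2 0 / 2 + diff 3 t / 6"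
    using t(3) g0 by (simp add: eval_nat_numeral lessThan_Suc diff_def g1[simplified])
  moreover have "0 \<le> K * norm y ^ 3" using K by simp
  \<comment> \<open>The remainder is at most \<open>8 * K / 6\<close> times the cube of the norm,
    rounded up to \<open>2 * K\<close>.\<close>
  ultimately have "\<bar>diff 0 1 - diff 2 0 / 2\<bar> \<le> 2 * K * norm y ^ 3" by (simp add: abs_if split: if_splits)
  then show ?thesis by (simp add: diff_def)
qed

section \<open>Splitting along a unit vector, and boundary graphs over the tangent plane\<close>

definition perp :: "real^3 \<Rightarrow> real^3 \<Rightarrow> real^3" where
  "perp n w = w - (w \<bullet> n) *\<^sub>R n"

lemma perp_simps:
  assumes "norm n = 1"
  shows "perp n w \<bullet> n = 0" "perp n (w + t *\<^sub>R n) = perp n w" "perp n (perp n w) = perp n w"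
    "(norm w)\<^sup>2 = (norm (perp n w))\<^sup>2 + (w \<bullet> n)\<^sup>2"
proof -
  have nn: "n \<bullet> n = 1" using assms by (simp add: norm_eq_1)
  then show "perp n w \<bullet> n = 0" "perp n (w + t *\<^sub>R n) = perp n w"
    by (auto simp: perp_def inner_diff_left inner_add_left algebra_simps)
  show "perp n (perp n w) = perp n w" using nn by (auto simp: perp_def inner_diff_left algebra_simps)
  have "w \<bullet> n * (w \<bullet> n) = (w \<bullet> n) * (n \<bullet> w)" by (simp add: inner_commute)
  then show "(norm w)\<^sup>2 = (norm (perp n w))\<^sup>2 + (w \<bullet> n)\<^sup>2"
    unfolding power2_norm_eq_inner
    using nn by (simp add: perp_def inner_diff_left inner_diff_right inner_commute power2_eq_square)
qed

lemma continuous_on_perp [continuous_intros]: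
  "continuous_on A f \<Longrightarrow> continuous_on A (\<lambda>x. perp n (f x))"
  unfolding perp_def by (intro continuous_intros)

text \<open>\<open>F\<close> is, near \<open>x0\<close>, the graph of \<open>f\<close> over the plane normal to \<open>n\<close>; the fourth condition bounds the
  odd part of \<open>f\<close>, and is where the third derivatives of the boundary enter.\<close>

definition graph_over :: "(real^3) set \<Rightarrow> real^3 \<Rightarrow> real^3 \<Rightarrow> real \<Rightarrow> real \<Rightarrow> (real^3 \<Rightarrow> real) \<Rightarrow> bool" where
  "graph_over F x0 n s C f \<longleftrightarrow>
     continuous_on UNIV f \<and> (\<forall>w t. f (w + t *\<^sub>R n) = f w) \<and>
     (\<forall>w. \<bar>f w\<bar> \<le> C * (norm (perp n w))\<^sup>2) \<and>
     (\<forall>w. \<bar>f w - f (- w)\<bar> \<le> C * norm (perp n w) ^ 3) \<and>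
     (\<forall>w. norm (perp n w) < s \<and> \<bar>w \<bullet> n\<bar> < s \<longrightarrow> (x0 + w \<in> F \<longleftrightarrow> w \<bullet> n = f w))"

text \<open>The radial retraction onto a ball. It extends a function given on a disc to a continuous
  function on the plane; being odd and not increasing norms, it preserves both the quadratic bound
  and the cubic bound on the odd part.\<close>

definition clamp :: "real \<Rightarrow> 'a::real_normed_vector \<Rightarrow> 'a" where
  "clamp s y = (s / max s (norm y)) *\<^sub>R y"

lemma clamp_props:
  assumes "s > 0"
  shows "norm (clamp s y) \<le> s" "norm (clamp s y) \<le> norm y" "norm y \<le> s \<Longrightarrow> clamp s y = y"
    "clamp s (- y) = - clamp s y" "continuous_on UNIV (clamp s)"
proof -
  show "norm (clamp s y) \<le> s" "norm (clamp s y) \<le> norm y"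
    using assms by (auto simp: clamp_def max_def abs_of_nonneg field_simps mult_left_mono)
  show "norm y \<le> s \<Longrightarrow> clamp s y = y" "clamp s (- y) = - clamp s y" using assms by (auto simp: clamp_def max_def)
  show "continuous_on UNIV (clamp s)" unfolding clamp_def[abs_def]
    using assms by (intro continuous_intros) auto
qed

lemma horiz_simps:
  "horiz (x + y) = horiz x + horiz y" "horiz (c *\<^sub>R x) = c *\<^sub>R horiz x" "horiz (- x) = - horiz x"
  "(norm (horiz x))\<^sup>2 = (norm x)\<^sup>2 - (x $ 3)\<^sup>2"
  unfolding horiz_def power2_norm_eq_inner inner_vec_def
  by (auto simp: vec_eq_iff forall_2 sum_2 sum_3 power2_eq_square)

lemma linear_horiz: "linear horiz"
  by (intro linearI horiz_simps)

definition chart :: "(real^3) set \<Rightarrow> real \<Rightarrow> real \<Rightarrow> real^3 \<Rightarrow> (real^3 \<Rightarrow> real^3) \<Rightarrow> (real^2 \<Rightarrow> real) \<Rightarrow> bool" where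
  "chart F \<sigma>0 K x0 A g \<longleftrightarrow>
          orthogonal_transformation A \<and>
          (\<forall>y. norm (horiz y) < \<sigma>0 \<and> \<bar>y $ 3\<bar> < \<sigma>0 \<longrightarrow>
             (x0 + A y \<in> F \<longleftrightarrow> y $ 3 = g (horiz y))) \<and>
          C_k_on 3 (ball 0 \<sigma>0) g \<and>
          (\<forall>y'\<in>ball 0 \<sigma>0.
             (\<forall>i\<le>2. grad_norm i g y' \<le> K * norm y' ^ (2 - i)) \<and>
             grad_norm 3 g y' \<le> K)"

lemma uniformly_C3_chart:
  "uniformly_C3 D \<longleftrightarrow> (\<exists>\<sigma>0>0. \<exists>K>0. \<forall>x0\<in>frontier D. \<exists>A g. chart (frontier D) \<sigma>0 K x0 A g)"
  unfolding uniformly_C3_def chart_def by blast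

text \<open>The third axis of the chart is the line through the nearest point: moving along the boundary
  in a horizontal direction decreases the distance to the centre of an exterior ball at most to second order.\<close>

lemma chart_axis_normal:
  assumes ch: "chart F \<sigma> K x0 A g" and \<sigma>: "\<sigma> > 0" "K > 0"
    and n: "norm n = 1" and h: "h > 0" and far: "\<And>x. x \<in> F \<Longrightarrow> h \<le> dist x (x0 + h *\<^sub>R n)"
  shows "A (axis 3 1) = n \<or> A (axis 3 1) = - n"
proof -
  have A: "orthogonal_transformation A" and gr: "\<And>y. norm (horiz y) < \<sigma> \<Longrightarrow> \<bar>y $ 3\<bar> < \<sigma> \<Longrightarrow> x0 + A y \<in> F \<longleftrightarrow> y $ 3 = g (horiz y)"
    and b: "\<And>y. y \<in> ball 0 \<sigma> \<Longrightarrow> (\<forall>i\<le>2. grad_norm i g y \<le> K * norm y ^ (2 - i))"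
    using ch by (auto simp: chart_def)
  have lin: "linear A" using A by (rule orthogonal_transformation_linear)
  have iA: "A x \<bullet> A y = x \<bullet> y" for x y using A by (simp add: orthogonal_transformation_def)
  have gb: "\<bar>g y\<bar> \<le> K * (norm y)\<^sup>2" if "norm y < \<sigma>" for y
    using abs_iter_pd_le_grad_norm[of "[]" 0 g y] b[of y] that by (force simp: iter_pd_Nil)
  have le0: "n \<bullet> A v \<le> 0" if v: "norm v = 1" "v $ 3 = 0" for v
  proof (rule ccontr)
    assume "\<not> n \<bullet> A v \<le> 0"
    then have c: "n \<bullet> A v > 0" by simp
    \<comment> \<open>\<open>B\<close> collects the coefficients of \<open>s\<^sup>2\<close>: 1 from
      the horizontal part, \<open>K\<^sup>2\<close> from the squared height and
      \<open>2 * h * K\<close> from the height in the linear term. The choice of \<open>s\<close>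
      makes the linear term \<open>2 * h * s * (n \<bullet> A v)\<close> exceed their sum.\<close>
    define B where "B = 1 + K\<^sup>2 + 2 * h * K"
    have B: "B > 1" using \<sigma> h by (simp add: B_def add_pos_pos)
    define s where "s = min (1/2) (min (\<sigma> / 2) (min (\<sigma> / (2 * K)) (h * (n \<bullet> A v) / B)))"
    have s: "0 < s" "s < 1" "s < \<sigma>" "K * s < \<sigma>" "s * B \<le> h * (n \<bullet> A v)"
    proof -
      show "0 < s" using \<sigma> h c B by (simp add: s_def)
      show "s < 1" by (simp add: s_def min_def)
      show "s < \<sigma>" using \<sigma> by (simp add: s_def min_def)
      have "s \<le> \<sigma> / (2 * K)" by (simp add: s_def)
      then have "K * s \<le> \<sigma> / 2" using \<sigma> by (simp add: field_simps)
      then show "K * s < \<sigma>" using \<sigma> by simp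
      have "s \<le> h * (n \<bullet> A v) / B" by (simp add: s_def)
      then show "s * B \<le> h * (n \<bullet> A v)" using B by (simp add: field_simps)
    qed
    define \<gamma> where "\<gamma> = g (horiz (s *\<^sub>R v))"
    have nh: "norm (horiz (s *\<^sub>R v)) = s"
    proof -
      have "(norm (horiz (s *\<^sub>R v)))\<^sup>2 = s\<^sup>2"
        unfolding horiz_simps(4) using v s by (simp add: power_mult_distrib)
      then show ?thesis using s by (simp add: power2_eq_iff_nonneg)
    qed
    have g1: "\<bar>\<gamma>\<bar> \<le> K * s\<^sup>2" unfolding \<gamma>_def using gb[of "horiz (s *\<^sub>R v)"] nh s by simp
    also have "\<dots> \<le> K * s" using s \<sigma> by (simp add: power2_eq_square)
    finally have g2: "\<bar>\<gamma>\<bar> \<le> K * s" .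
    define y where "y = s *\<^sub>R v + \<gamma> *\<^sub>R axis 3 1"
    have hy: "horiz y = horiz (s *\<^sub>R v)" "y $ 3 = \<gamma>"
      using v by (auto simp: y_def horiz_def axis_def vec_eq_iff forall_2)
    have "x0 + A y \<in> F"
      using gr[of y] nh s g2 hy by (simp add: \<gamma>_def)
    then have "h \<le> norm (A y - h *\<^sub>R n)" using far[of "x0 + A y"] by (simp add: dist_norm)
    then have "h\<^sup>2 \<le> (norm (A y - h *\<^sub>R n))\<^sup>2" using h by (simp add: power_mono)
    also have "\<dots> = (norm y)\<^sup>2 - 2 * h * (n \<bullet> A y) + h\<^sup>2"
      unfolding power2_norm_eq_inner
      using n iA[of y y] by (simp add: inner_diff_left inner_diff_right inner_commute norm_eq_1 power2_eq_square)
    finally have "2 * h * (n \<bullet> A y) \<le> (norm y)\<^sup>2" by simp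
    moreover have "(norm y)\<^sup>2 = s\<^sup>2 + \<gamma>\<^sup>2"
      using nh hy horiz_simps(4)[of y] by simp
    moreover have "n \<bullet> A y = s * (n \<bullet> A v) + \<gamma> * (n \<bullet> A (axis 3 1))"
      unfolding y_def by (simp add: linear_add[OF lin] linear_cmul[OF lin] inner_add_right)
    moreover have "\<bar>n \<bullet> A (axis 3 1)\<bar> \<le> 1"
      using Cauchy_Schwarz_ineq2[of n "A (axis 3 1)"] n A by (simp add: orthogonal_transformation_norm norm_axis_1)
    then have "\<bar>\<gamma> * (n \<bullet> A (axis 3 1))\<bar> \<le> K * s\<^sup>2 * 1"
      unfolding abs_mult using g1 \<sigma> by (intro mult_mono) auto
    then have "- (K * s\<^sup>2) \<le> \<gamma> * (n \<bullet> A (axis 3 1))" by (simp add: abs_le_iff)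
    then have "2 * h * (- (K * s\<^sup>2)) \<le> 2 * h * (\<gamma> * (n \<bullet> A (axis 3 1)))"
      using h by (intro mult_left_mono) auto
    moreover have "\<gamma>\<^sup>2 \<le> K\<^sup>2 * s\<^sup>2"
      using power_mono[OF g2, of 2] by (simp add: power_mult_distrib)
    ultimately have "2 * h * (s * (n \<bullet> A v)) \<le> s\<^sup>2 + K\<^sup>2 * s\<^sup>2 + 2 * h * (K * s\<^sup>2)"
      by (simp only: distrib_left mult_minus_right)
    also have "\<dots> = s * (s * B)" by (simp add: B_def power2_eq_square algebra_simps)
    also have "\<dots> \<le> s * (h * (n \<bullet> A v))" using s by (intro mult_left_mono) auto
    finally have "2 * (s * (h * (n \<bullet> A v))) \<le> s * (h * (n \<bullet> A v))" by (simp only: mult_ac)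
    moreover have "s * (h * (n \<bullet> A v)) > 0" using s(1) h c by simp
    ultimately show False by linarith
  qed
  have z: "n \<bullet> A (axis i 1) = 0" if "i \<noteq> 3" for i :: 3
  proof -
    have "n \<bullet> A (axis i 1) \<le> 0" using that by (intro le0) (simp_all add: norm_axis_1, simp add: axis_def)
    moreover have "n \<bullet> A (- axis i 1) \<le> 0" using that by (intro le0) (simp_all add: norm_axis_1, simp add: axis_def)
    ultimately show ?thesis by (simp add: linear_neg[OF lin])
  qed
  obtain m where m: "n = A m" using orthogonal_transformation_surj[OF A] by (metis surjD)
  have mi: "m $ i = n \<bullet> A (axis i 1)" for i using iA[of m "axis i 1"] m by (simp add: inner_axis)
  have m0: "m $ 1 = 0" "m $ 2 = 0" using mi z by auto
  have "norm m = 1" using n m A by (simp add: orthogonal_transformation_norm)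
  then have "(m $ 3)\<^sup>2 = 1"
    using m0 power2_norm_eq_inner[of m] by (simp add: inner_vec_def sum_3 power2_eq_square)
  then have "m $ 3 = 1 \<or> m $ 3 = - 1" by (simp add: power2_eq_1_iff)
  then have "m = axis 3 1 \<or> m = - axis 3 1"
    using m0 by (auto simp: vec_eq_iff forall_3 axis_def)
  then show ?thesis using m by (auto simp: linear_neg[OF lin])
qed

text \<open>The third chart axis is \<open>n\<close> up to a sign \<epsilon>, which is absorbed into
  the graph function. The quadratic Taylor part is even and drops out of the difference at
  \<open>w\<close> and \<open>- w\<close>, so two remainders \<open>2 * K\<close> remain; this is
  the origin of \<open>4 * K\<close>. Clamping at half the chart radius keeps all arguments in the
  open disc.\<close>

lemma chart_graph_over:
  assumes ch: "chart F \<sigma> K x0 A g" and \<sigma>: "\<sigma> > 0" "K > 0"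
    and n: "norm n = 1" and h: "h > 0" and far: "\<And>x. x \<in> F \<Longrightarrow> h \<le> dist x (x0 + h *\<^sub>R n)"
  shows "\<exists>f. graph_over F x0 n (\<sigma> / 2) (4 * K) f"
proof -
  have A: "orthogonal_transformation A" and gr: "\<And>y. norm (horiz y) < \<sigma> \<Longrightarrow> \<bar>y $ 3\<bar> < \<sigma> \<Longrightarrow> x0 + A y \<in> F \<longleftrightarrow> y $ 3 = g (horiz y)"
    and Ck: "C_k_on 3 (ball 0 \<sigma>) g"
    and b: "\<And>y. y \<in> ball 0 \<sigma> \<Longrightarrow> (\<forall>i\<le>2. grad_norm i g y \<le> K * norm y ^ (2 - i)) \<and> grad_norm 3 g y \<le> K"
    using ch by (auto simp: chart_def)
  obtain \<epsilon> :: real where \<epsilon>: "A (axis 3 1) = \<epsilon> *\<^sub>R n" "\<epsilon> = 1 \<or> \<epsilon> = - 1"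
    using chart_axis_normal[OF ch \<sigma> n h far] by force
  have \<epsilon>2: "\<epsilon> * \<epsilon> = 1" "\<bar>\<epsilon>\<bar> = 1" using \<epsilon> by auto
  define B where "B = inv A"
  have B: "orthogonal_transformation B" unfolding B_def by (rule orthogonal_transformation_inv[OF A])
  have AB: "A (B w) = w" for w unfolding B_def by (meson A orthogonal_transformation_surj surj_f_inv_f)
  have linB: "linear B" using B by (rule orthogonal_transformation_linear)
  have Bn: "B n = \<epsilon> *\<^sub>R axis 3 1"
  proof -
    have "B (A (axis 3 1)) = axis 3 1" unfolding B_def by (meson A orthogonal_transformation_inj inv_f_f)
    then have "\<epsilon> *\<^sub>R B n = axis 3 1" using \<epsilon> by (simp add: linear_cmul[OF linB])
    then have "\<epsilon> *\<^sub>R (\<epsilon> *\<^sub>R B n) = \<epsilon> *\<^sub>R axis 3 1" by simp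
    then show ?thesis using \<epsilon>2 by simp
  qed
  have B3: "B w $ 3 = \<epsilon> * (w \<bullet> n)" for w
  proof -
    have "w \<bullet> n = B w \<bullet> B n" using B by (simp add: orthogonal_transformation_def)
    also have "\<dots> = \<epsilon> * B w $ 3" by (simp add: Bn inner_axis)
    finally show ?thesis using \<epsilon>2 by (simp add: mult.assoc[symmetric])
  qed
  have nB: "norm (horiz (B w)) = norm (perp n w)" for w
  proof -
    have "(norm (horiz (B w)))\<^sup>2 = (norm (perp n w))\<^sup>2"
      unfolding horiz_simps(4) B3 using perp_simps(4)[OF n, of w] B \<epsilon>(2)
      by (auto simp: orthogonal_transformation_norm power_mult_distrib)
    then show ?thesis by (simp add: power2_eq_iff_nonneg)
  qed
  define s where "s = \<sigma> / 2"
  have s: "s > 0" "s < \<sigma>" using \<sigma> by (auto simp: s_def)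
  define f where "f w = \<epsilon> * g (clamp s (horiz (B w)))" for w
  have cb: "clamp s y \<in> ball 0 \<sigma>" for y :: "real^2" using clamp_props(1)[OF s(1), of y] s by simp
  have abf: "\<bar>f w\<bar> = \<bar>g (clamp s (horiz (B w)))\<bar>" for w using \<epsilon>2 by (simp add: f_def abs_mult)
  have cl_le: "norm (clamp s (horiz (B w))) \<le> norm (perp n w)" for w
    using clamp_props(2)[OF s(1), of "horiz (B w)"] nB by simp
  have "graph_over F x0 n s (4 * K) f"
    unfolding graph_over_def
  proof (intro conjI allI impI)
    have "continuous_on (ball 0 \<sigma>) (iter_pd [] g)" using Ck by (simp add: C_k_on_def)
    then have gc: "continuous_on (ball 0 \<sigma>) g" by (simp add: iter_pd_Nil)
    have lc: "continuous_on UNIV (\<lambda>w. horiz (B w))"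
      by (intro linear_continuous_on_compose[OF linear_continuous_on linear_horiz] linear_conv_bounded_linear[THEN iffD1] linB)
    have "continuous_on UNIV (\<lambda>w. clamp s (horiz (B w)))"
      by (rule continuous_on_compose2[OF clamp_props(5)[OF s(1)] lc]) simp
    then have "continuous_on UNIV (\<lambda>w. g (clamp s (horiz (B w))))"
      by (rule continuous_on_compose2[OF gc]) (use cb in auto)
    then show "continuous_on UNIV f" unfolding f_def[abs_def] by (intro continuous_intros)
  next
    fix w t
    have "horiz (B (w + t *\<^sub>R n)) = horiz (B w)"
    proof -
      have "horiz (axis 3 1) = 0" by (simp add: horiz_def axis_def vec_eq_iff forall_2)
      then show ?thesis by (simp add: linear_add[OF linB] linear_cmul[OF linB] Bn horiz_simps)
    qed
    then show "f (w + t *\<^sub>R n) = f w" by (simp add: f_def)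
  next
    fix w
    have "\<bar>g (clamp s (horiz (B w)))\<bar> \<le> K * (norm (clamp s (horiz (B w))))\<^sup>2"
      using abs_iter_pd_le_grad_norm[of "[]" 0 g "clamp s (horiz (B w))"] b[OF cb, of "horiz (B w)"] by (force simp: iter_pd_Nil)
    also have "\<dots> \<le> (4 * K) * (norm (perp n w))\<^sup>2"
      using \<sigma> cl_le by (intro mult_mono power_mono) auto
    finally show "\<bar>f w\<bar> \<le> 4 * K * (norm (perp n w))\<^sup>2" unfolding abf .
  next
    fix w
    let ?y = "clamp s (horiz (B w))"
    let ?q = "\<lambda>y::real^2. (\<Sum>i\<in>UNIV. y $ i * (\<Sum>j\<in>UNIV. y $ j * iter_pd [j, i] g 0)) / 2"
    have eq: "clamp s (horiz (B (- w))) = - ?y"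
      by (simp add: linear_neg[OF linB] horiz_simps clamp_props(4)[OF s(1)])
    have q: "?q (- ?y) = ?q ?y" by (simp add: sum_negf)
    have mem: "- ?y \<in> ball 0 \<sigma>" using cb[of "horiz (B w)"] by simp
    have K0: "K \<ge> 0" using \<sigma> by simp
    have 1: "\<bar>g ?y - ?q ?y\<bar> \<le> 2 * K * norm ?y ^ 3" by (rule third_order_expansion[OF Ck K0 b cb])
    have 2: "\<bar>g (- ?y) - ?q (- ?y)\<bar> \<le> 2 * K * norm (- ?y) ^ 3" by (rule third_order_expansion[OF Ck K0 b mem])
    have "\<bar>g ?y - g (- ?y)\<bar> \<le> 4 * K * norm ?y ^ 3" using 1 2 unfolding q norm_minus_cancel by linarith
    also have "\<dots> \<le> 4 * K * norm (perp n w) ^ 3" using \<sigma> cl_le by (intro mult_mono power_mono) auto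
    finally show "\<bar>f w - f (- w)\<bar> \<le> 4 * K * norm (perp n w) ^ 3"
      unfolding f_def eq right_diff_distrib[symmetric] abs_mult using \<epsilon>2 by simp
  next
    fix w assume w: "norm (perp n w) < s \<and> \<bar>w \<bullet> n\<bar> < s"
    have "x0 + w \<in> F \<longleftrightarrow> B w $ 3 = g (horiz (B w))"
      using gr[of "B w"] w s by (simp add: nB AB B3 abs_mult \<epsilon>2)
    also have "\<dots> \<longleftrightarrow> w \<bullet> n = f w"
      using w nB[of w] \<epsilon>(2) by (auto simp: f_def clamp_props(3)[OF s(1)] B3)
    finally show "x0 + w \<in> F \<longleftrightarrow> w \<bullet> n = f w" .
  qed
  then show ?thesis unfolding s_def by blast
qed

text \<open>A boundary with uniform charts is a graph over the plane normal to any exterior ball, with constants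
  that are uniform and, unlike those of the charts, manifestly invariant under rigid motions.\<close>

definition graph_regular :: "(real^3) set \<Rightarrow> real \<Rightarrow> real \<Rightarrow> bool" where
  "graph_regular F s C \<longleftrightarrow>
     (\<forall>x0\<in>F. \<forall>n h. norm n = 1 \<and> h > 0 \<and> (\<forall>x\<in>F. h \<le> dist x (x0 + h *\<^sub>R n)) \<longrightarrow> (\<exists>f. graph_over F x0 n s C f))"

lemma uniformly_C3_graph_regular:
  assumes "uniformly_C3 D"
  obtains s C where "s > 0" "C > 0" "graph_regular (frontier D) s C"
proof -
  obtain \<sigma> K where *: "\<sigma> > 0" "K > 0" "\<forall>x0\<in>frontier D. \<exists>A g. chart (frontier D) \<sigma> K x0 A g"
    using assms unfolding uniformly_C3_chart by blast
  have "graph_regular (frontier D) (\<sigma> / 2) (4 * K)"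
    unfolding graph_regular_def
  proof (intro ballI allI impI)
    fix x0 n h assume x0: "x0 \<in> frontier D" and a: "norm n = 1 \<and> h > 0 \<and> (\<forall>x\<in>frontier D. h \<le> dist x (x0 + h *\<^sub>R n))"
    obtain A g where "chart (frontier D) \<sigma> K x0 A g" using * x0 by blast
    then show "\<exists>f. graph_over (frontier D) x0 n (\<sigma> / 2) (4 * K) f"
      by (rule chart_graph_over[OF _ *(1,2)]) (use a in auto)
  qed
  then show thesis using that[of "\<sigma> / 2" "4 * K"] * by simp
qed

lemma graph_over_mono:
  assumes "graph_over F x0 n s C f" "s' \<le> s" "C \<le> C'"
  shows "graph_over F x0 n s' C' f"
proof -
  have "C * X \<le> C' * X" if "X \<ge> 0" for X using that assms by (simp add: mult_right_mono)
  then show ?thesis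
    using assms unfolding graph_over_def by (auto intro: order_trans)
qed

text \<open>The graph is pulled back by the inverse rotation, which preserves both components of a
  splitting along a unit vector. Hence all positions of the body share the constants of its
  shape.\<close>

lemma graph_regular_isometry:
  assumes R: "orthogonal_transformation R" and F: "graph_regular F s C"
  shows "graph_regular ((\<lambda>x. c + R x) ` F) s C"
  unfolding graph_regular_def
proof (intro ballI allI impI)
  fix x' n' h
  assume "x' \<in> (\<lambda>x. c + R x) ` F" and a: "norm n' = 1 \<and> h > 0 \<and> (\<forall>x\<in>(\<lambda>x. c + R x) ` F. h \<le> dist x (x' + h *\<^sub>R n'))"
  then obtain x0 where x0: "x0 \<in> F" "x' = c + R x0" by blast
  define B where "B = inv R"
  have B: "orthogonal_transformation B" unfolding B_def by (rule orthogonal_transformation_inv[OF R])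
  have RB: "R (B w) = w" for w unfolding B_def by (meson R orthogonal_transformation_surj surj_f_inv_f)
  have BR: "B (R w) = w" for w unfolding B_def by (meson R orthogonal_transformation_inj inv_f_f)
  have lin: "linear R" "linear B" using R B by (auto intro: orthogonal_transformation_linear)
  have n: "norm (B n') = 1" using a B by (simp add: orthogonal_transformation_norm)
  have "\<forall>x\<in>F. h \<le> dist x (x0 + h *\<^sub>R B n')"
  proof
    fix x assume "x \<in> F"
    then have "h \<le> norm ((c + R x) - (x' + h *\<^sub>R n'))" using a by (auto simp: dist_norm)
    also have "(c + R x) - (x' + h *\<^sub>R n') = R (x - (x0 + h *\<^sub>R B n'))"
      by (simp add: x0 linear_diff[OF lin(1)] linear_add[OF lin(1)] linear_cmul[OF lin(1)] RB)
    finally show "h \<le> dist x (x0 + h *\<^sub>R B n')" using R by (simp add: dist_norm orthogonal_transformation_norm)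
  qed
  then obtain f where f: "graph_over F x0 (B n') s C f"
    using F x0(1) n a unfolding graph_regular_def by blast
  have pB: "norm (perp (B n') (B w)) = norm (perp n' w)" and iB: "B w \<bullet> B n' = w \<bullet> n'" for w
  proof -
    show i: "B w \<bullet> B n' = w \<bullet> n'" using B by (simp add: orthogonal_transformation_def)
    have "perp (B n') (B w) = B (perp n' w)"
      by (simp add: perp_def i linear_diff[OF lin(2)] linear_cmul[OF lin(2)])
    then show "norm (perp (B n') (B w)) = norm (perp n' w)" using B by (simp add: orthogonal_transformation_norm)
  qed
  have "graph_over ((\<lambda>x. c + R x) ` F) x' n' s C (\<lambda>w. f (B w))"
    unfolding graph_over_def
  proof (intro conjI allI impI)
    have "continuous_on UNIV f" using f by (simp add: graph_over_def)
    then show "continuous_on UNIV (\<lambda>w. f (B w))"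
      by (rule continuous_on_compose2[OF _ linear_continuous_on[OF linear_conv_bounded_linear[THEN iffD1, OF lin(2)]]]) simp
  next
    show "f (B (w + t *\<^sub>R n')) = f (B w)" for w t
      using f by (simp add: graph_over_def linear_add[OF lin(2)] linear_cmul[OF lin(2)])
  next
    show "\<bar>f (B w)\<bar> \<le> C * (norm (perp n' w))\<^sup>2" for w
      using f pB[of w] unfolding graph_over_def by metis
  next
    show "\<bar>f (B w) - f (B (- w))\<bar> \<le> C * norm (perp n' w) ^ 3" for w
      using f pB[of w] unfolding graph_over_def linear_neg[OF lin(2)] by metis
  next
    fix w assume w: "norm (perp n' w) < s \<and> \<bar>w \<bullet> n'\<bar> < s"
    have "x' + w \<in> (\<lambda>x. c + R x) ` F \<longleftrightarrow> x0 + B w \<in> F"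
    proof
      assume "x' + w \<in> (\<lambda>x. c + R x) ` F"
      then obtain x where "x \<in> F" "x' + w = c + R x" by blast
      then have "R (x0 + B w) = R x" by (simp add: x0 linear_add[OF lin(1)] RB)
      then have "x0 + B w = x" by (metis BR)
      with \<open>x \<in> F\<close> show "x0 + B w \<in> F" by simp
    next
      assume "x0 + B w \<in> F"
      moreover have "x' + w = c + R (x0 + B w)" by (simp add: x0 linear_add[OF lin(1)] RB)
      ultimately show "x' + w \<in> (\<lambda>x. c + R x) ` F" by blast
    qed
    also have "\<dots> \<longleftrightarrow> w \<bullet> n' = f (B w)"
      using f w pB[of w] iB[of w] unfolding graph_over_def by (metis (no_types))
    finally show "x' + w \<in> (\<lambda>x. c + R x) ` F \<longleftrightarrow> w \<bullet> n' = f (B w)" .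
  qed
  then show "\<exists>f. graph_over ((\<lambda>x. c + R x) ` F) x' n' s C f" by blast
qed

lemma frontier_isometry:
  fixes R :: "real^3 \<Rightarrow> real^3"
  assumes R: "orthogonal_transformation R"
  shows "frontier ((\<lambda>x. c + R x) ` S) = (\<lambda>x. c + R x) ` frontier S"
    and "closure ((\<lambda>x. c + R x) ` S) = (\<lambda>x. c + R x) ` closure S"
proof -
  have lin: "linear R" and inj: "inj R" using R by (auto intro: orthogonal_transformation_linear orthogonal_transformation_inj)
  show cl: "closure ((\<lambda>x. c + R x) ` S) = (\<lambda>x. c + R x) ` closure S" for S
  proof -
    have "closure ((+) c ` (R ` S)) = (+) c ` (R ` closure S)"
      by (simp add: closure_translation closure_injective_linear_image[OF lin inj])
    then show ?thesis by (simp add: image_image)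
  qed
  have bij: "bij (\<lambda>x. c + R x)"
    using bij_comp[OF orthogonal_transformation_bij[OF R] bij_plus_right[of c]] by (simp add: o_def add.commute)
  have "frontier ((\<lambda>x. c + R x) ` S) = closure ((\<lambda>x. c + R x) ` S) \<inter> closure ((\<lambda>x. c + R x) ` (- S))"
    by (simp add: frontier_closures bij_image_Compl_eq[OF bij])
  also have "\<dots> = (\<lambda>x. c + R x) ` (closure S \<inter> closure (- S))"
    unfolding cl by (rule image_Int[OF bij_is_inj[OF bij], symmetric])
  finally show "frontier ((\<lambda>x. c + R x) ` S) = (\<lambda>x. c + R x) ` frontier S" by (simp add: frontier_closures)
qed

section \<open>The gap between the body and the wall\<close>

lemma lborel_distr_orthogonal:
  fixes R :: "real^'n::{finite,wellorder} \<Rightarrow> real^'n::_"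
  assumes R: "orthogonal_transformation R"
  shows "distr lborel borel R = lborel"
proof -
  have lin: "linear R" and bij: "bij R" using R by (auto intro: orthogonal_transformation_linear orthogonal_transformation_bij)
  have Rm: "R \<in> borel_measurable borel"
    by (intro borel_measurable_continuous_onI linear_continuous_on linear_conv_bounded_linear[THEN iffD1] lin)
  have "lborel = distr lborel borel R"
  proof (rule lborel_eqI)
    fix l u :: "real^'n::_" assume lu: "\<And>b. b \<in> Basis \<Longrightarrow> l \<bullet> b \<le> u \<bullet> b"
    have R': "orthogonal_transformation (inv R)" by (rule orthogonal_transformation_inv[OF R])
    have m: "box l u \<in> lmeasurable" by simp
    have im: "R -` box l u = inv R ` box l u" by (rule bij_vimage_eq_inv_image[OF bij])
    have "emeasure (distr lborel borel R) (box l u) = emeasure lborel (R -` box l u)"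
      using Rm by (subst emeasure_distr) auto
    also have "\<dots> = emeasure lebesgue (R -` box l u)"
      using measurable_sets[OF Rm, of "box l u"] by simp
    also have "\<dots> = ennreal (measure lebesgue (inv R ` box l u))"
      unfolding im using measurable_orthogonal_image[OF R' m] by (simp add: emeasure_eq_measure2 fmeasurableD2)
    also have "\<dots> = ennreal (measure lebesgue (box l u))" by (simp add: measure_orthogonal_image[OF R' m])
    also have "\<dots> = emeasure lborel (box l u)" using m by (simp add: emeasure_eq_measure2 fmeasurableD2)
    also have "\<dots> = ennreal (\<Prod>b\<in>Basis. (u - l) \<bullet> b)" using lu by simp
    finally show "emeasure (distr lborel borel R) (box l u) = ennreal (\<Prod>b\<in>Basis. (u - l) \<bullet> b)" .
  qed simp
  then show ?thesis by simp
qed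

lemma lborel_distr_rigid:
  fixes R :: "real^'n::{finite,wellorder} \<Rightarrow> real^'n::_"
  assumes R: "orthogonal_transformation R"
  shows "distr lborel borel (\<lambda>x. c + R x) = lborel"
proof -
  have Rm: "R \<in> borel_measurable lborel"
    using orthogonal_transformation_linear[OF R]
    by (simp add: borel_measurable_continuous_onI linear_continuous_on linear_conv_bounded_linear)
  have "distr lborel borel (\<lambda>x. c + R x) = distr (distr lborel borel R) borel ((+) c)"
    by (subst distr_distr) (use Rm in \<open>auto simp: o_def\<close>)
  then show ?thesis by (simp add: lborel_distr_orthogonal[OF R] lborel_distr_plus)
qed

lemma integral_rigid:
  fixes f :: "real^3 \<Rightarrow> real" and R :: "real^3 \<Rightarrow> real^3"
  assumes R: "orthogonal_transformation R" and f: "continuous_on UNIV f"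
  shows "(\<integral>x. f (c + R x) \<partial>lebesgue) = (\<integral>x. f x \<partial>lebesgue)"
proof -
  have fm: "f \<in> borel_measurable borel" using f by (rule borel_measurable_continuous_onI)
  have Tm: "(\<lambda>x. c + R x) \<in> borel_measurable borel"
    using orthogonal_transformation_linear[OF R]
    by (intro borel_measurable_add borel_measurable_const borel_measurable_continuous_onI)
       (simp add: linear_continuous_on linear_conv_bounded_linear)
  have "(\<integral>x. f x \<partial>lborel) = (\<integral>x. f x \<partial>distr lborel borel (\<lambda>x. c + R x))"
    by (simp add: lborel_distr_rigid[OF R])
  also have "\<dots> = (\<integral>x. f (c + R x) \<partial>lborel)"
    using Tm fm by (subst integral_distr) auto
  finally have "(\<integral>x. f x \<partial>lborel) = (\<integral>x. f (c + R x) \<partial>lborel)" .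
  then show ?thesis
    using fm measurable_compose[OF Tm fm] by (simp add: integral_completion)
qed

text \<open>Squares of positive parts have a continuous derivative, which is all the regularity that
  the weights below require. All cutoffs are built from them.\<close>

lemma has_real_derivative_max_square:
  "((\<lambda>t. (max 0 t)\<^sup>2) has_real_derivative 2 * max 0 t) (at (t::real))"
proof -
  consider "t > 0" | "t < 0" | "t = 0" by linarith
  then show ?thesis
  proof cases
    case 1
    have "((\<lambda>t. t\<^sup>2) has_real_derivative 2 * max 0 t) (at t)" using 1 by (auto intro!: derivative_eq_intros)
    then show ?thesis
      by (rule has_field_derivative_transform_within_open[where S="{0<..}"]) (use 1 in auto)
  next
    case 2
    have "((\<lambda>t. 0) has_real_derivative 2 * max 0 t) (at t)" using 2 by simp
    then show ?thesis
      by (rule has_field_derivative_transform_within_open[where S="{..<0}"]) (use 2 in auto)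
  next
    case 3
    have "((\<lambda>h. (max 0 (0 + h))\<^sup>2 / h) \<longlongrightarrow> 0) (at (0::real))"
    proof (rule Lim_null_comparison)
      show "\<forall>\<^sub>F h in at 0. norm ((max 0 (0 + h))\<^sup>2 / h) \<le> \<bar>h::real\<bar>"
        by (intro always_eventually allI) (auto simp: max_def power2_eq_square abs_mult divide_simps)
      show "((\<lambda>h. \<bar>h\<bar>) \<longlongrightarrow> 0) (at (0::real))" by (auto intro!: tendsto_eq_intros)
    qed
    then show ?thesis using 3 unfolding DERIV_def by simp
  qed
qed

text \<open>A quadratic spline falling from 1 at \<open>t = 0\<close> to 0 at \<open>t = 1\<close>;
  its derivative is the negative tent with minimum \<open>- 2\<close> at
  \<open>t = 1 / 2\<close>.\<close>

definition cutoff :: "real \<Rightarrow> real" where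
  "cutoff t = 1 - 2 * (max 0 t)\<^sup>2 + 4 * (max 0 (t - 1 / 2))\<^sup>2 - 2 * (max 0 (t - 1))\<^sup>2"

definition cutoff' :: "real \<Rightarrow> real" where
  "cutoff' t = - 4 * max 0 t + 8 * max 0 (t - 1 / 2) - 4 * max 0 (t - 1)"

lemma has_real_derivative_cutoff: "(cutoff has_real_derivative cutoff' t) (at t)"
proof -
  have *: "((\<lambda>t. (max 0 (t - c))\<^sup>2) has_real_derivative 2 * max 0 (t - c)) (at t)" for c t :: real
  proof -
    have "((\<lambda>t. t - c) has_real_derivative 1) (at t)" by (auto intro!: derivative_eq_intros)
    from DERIV_chain2[where f="\<lambda>t. (max 0 t)\<^sup>2" and g="\<lambda>t. t - c" and x=t and s=UNIV, OF has_real_derivative_max_square this]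
    show ?thesis by simp
  qed
  have "((\<lambda>t. 1 - 2 * (max 0 t)\<^sup>2 + 4 * (max 0 (t - 1 / 2))\<^sup>2 - 2 * (max 0 (t - 1))\<^sup>2) has_real_derivative
      (0 - 2 * (2 * max 0 t) + 4 * (2 * max 0 (t - 1 / 2)) - 2 * (2 * max 0 (t - 1)))) (at t)"
    by (intro DERIV_diff DERIV_add DERIV_cmult DERIV_const * has_real_derivative_max_square)
  then show ?thesis
    unfolding cutoff_def[abs_def] cutoff'_def by (simp add: algebra_simps)
qed

lemma cutoff_props:
  "t \<le> 0 \<Longrightarrow> cutoff t = 1" "t \<ge> 1 \<Longrightarrow> cutoff t = 0" "0 \<le> cutoff t" "cutoff t \<le> 1"
  "t \<le> 0 \<Longrightarrow> cutoff' t = 0" "t \<ge> 1 \<Longrightarrow> cutoff' t = 0" "cutoff' t \<le> 0" "- 2 \<le> cutoff' t"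
  "1 / 4 \<le> t \<Longrightarrow> t \<le> 3 / 4 \<Longrightarrow> cutoff' t \<le> - 1"
proof -
  show "t \<le> 0 \<Longrightarrow> cutoff t = 1" by (simp add: cutoff_def)
  show "t \<ge> 1 \<Longrightarrow> cutoff t = 0" by (simp add: cutoff_def power2_eq_square algebra_simps)
  show "t \<le> 0 \<Longrightarrow> cutoff' t = 0" by (simp add: cutoff'_def)
  show "t \<ge> 1 \<Longrightarrow> cutoff' t = 0" by (simp add: cutoff'_def)
  show "cutoff' t \<le> 0" "- 2 \<le> cutoff' t" "1 / 4 \<le> t \<Longrightarrow> t \<le> 3 / 4 \<Longrightarrow> cutoff' t \<le> - 1"
    by (auto simp: cutoff'_def max_def)
  consider "t \<le> 0" | "0 \<le> t" "t \<le> 1/2" | "1/2 \<le> t" "t \<le> 1" | "1 \<le> t" by linarith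
  then have "0 \<le> cutoff t \<and> cutoff t \<le> 1"
  proof cases
    case 2
    have "t\<^sup>2 \<le> (1/2)\<^sup>2" using 2 by (intro power_mono) auto
    then show ?thesis using 2 by (simp add: cutoff_def power2_eq_square)
  next
    case 3
    have "cutoff t = 2 * (1 - t)\<^sup>2" using 3 by (simp add: cutoff_def power2_eq_square algebra_simps)
    moreover have "(1 - t)\<^sup>2 \<le> (1/2)\<^sup>2" using 3 by (intro power_mono) auto
    ultimately show ?thesis by (simp add: power2_eq_square)
  qed (simp_all add: cutoff_def power2_eq_square algebra_simps)
  then show "0 \<le> cutoff t" "cutoff t \<le> 1" by auto
qed

lemma continuous_on_cutoff: "continuous_on A cutoff" "continuous_on A cutoff'"
  unfolding cutoff_def[abs_def] cutoff'_def[abs_def] by (intro continuous_intros)+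

text \<open>One instant: \<open>V\<close> is the body, \<open>q\<close> the nearest wall point,
  \<open>q + h *\<^sub>R n\<close> the nearest body point. The condition
  \<open>C * \<sigma>\<^sup>2 \<le> h / 8\<close> keeps both graphs within \<open>h / 8\<close> of
  their tangent planes over the disc of radius \<sigma>. The conditions \<open>\<sigma> < s\<close>
  and \<open>8 * h < s\<close> put the cylinder between the heights \<open>- h\<close> and
  \<open>7 * h\<close> inside the region where both boundaries are known to be graphs; this explains
  the height \<open>7 * h\<close> below.\<close>

locale gap =
  fixes \<Omega> V :: "(real^3) set" and q n :: "real^3" and h s C \<sigma> :: real and fa fb :: "real^3 \<Rightarrow> real"
  assumes open_\<Omega>: "open \<Omega>" and open_V: "open V" and V_\<Omega>: "V \<subseteq> \<Omega>"
    and q: "q \<in> frontier \<Omega>" and p: "q + h *\<^sub>R n \<in> frontier V"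
    and n: "norm n = 1" and h: "h > 0"
    and far: "\<And>x y. x \<in> closure V \<Longrightarrow> y \<in> frontier \<Omega> \<Longrightarrow> h \<le> dist x y"
    and ga: "graph_over (frontier \<Omega>) q n s C fa"
    and gb: "graph_over (frontier V) (q + h *\<^sub>R n) n s C fb"
    and C: "C > 0" and \<sigma>: "\<sigma> > 0" "C * \<sigma>\<^sup>2 \<le> h / 8" "\<sigma> < s" and hs: "8 * h < s"
begin

definition pr :: "real^3 \<Rightarrow> real^3" where "pr x = perp n (x - q)"
definition z :: "real^3 \<Rightarrow> real" where "z x = (x - q) \<bullet> n"
definition a :: "real^3 \<Rightarrow> real" where "a x = fa (x - q)"
definition b :: "real^3 \<Rightarrow> real" where "b x = h + fb (x - (q + h *\<^sub>R n))"
definition W :: "(real^3 \<Rightarrow> real) \<Rightarrow> (real^3 \<Rightarrow> real) \<Rightarrow> (real^3) set" where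
  "W lo hi = {x. norm (pr x) < \<sigma> \<and> lo x < z x \<and> z x < hi x}"

lemma nn: "n \<bullet> n = 1" using n by (simp add: norm_eq_1)

lemma decomp: "x = q + pr x + z x *\<^sub>R n" by (simp add: pr_def z_def perp_def)

lemma pr_n: "pr x \<bullet> n = 0" using perp_simps(1)[OF n] by (simp add: pr_def)

lemma pr_add: "pr (x + t *\<^sub>R n) = pr x"
  using perp_simps(2)[OF n, of "x - q" t] by (simp add: pr_def algebra_simps)

lemma z_add: "z (x + t *\<^sub>R n) = z x + t" using nn by (simp add: z_def inner_diff_left inner_add_left)

lemma a_add: "a (x + t *\<^sub>R n) = a x"
proof -
  have "fa ((x - q) + t *\<^sub>R n) = fa (x - q)" using ga by (simp add: graph_over_def)
  then show ?thesis by (simp add: a_def algebra_simps)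
qed

lemma fb_add: "fb (w + t *\<^sub>R n) = fb w" using gb by (simp add: graph_over_def)

lemma b_add: "b (x + t *\<^sub>R n) = b x"
  using fb_add[of "x - (q + h *\<^sub>R n)" t] by (simp add: b_def algebra_simps)

lemma perp_p: "perp n (x - (q + h *\<^sub>R n)) = pr x"
proof -
  have "x - (q + h *\<^sub>R n) = (x - q) + (- h) *\<^sub>R n" by simp
  then show ?thesis unfolding pr_def by (simp only: perp_simps(2)[OF n])
qed

lemma z_p: "(x - (q + h *\<^sub>R n)) \<bullet> n = z x - h"
  using nn by (simp add: z_def inner_diff_left inner_add_left)

lemma continuous_pr [continuous_intros]: "continuous_on A pr"
  unfolding pr_def[abs_def] by (intro continuous_intros)
lemma continuous_z [continuous_intros]: "continuous_on A z"
  unfolding z_def[abs_def] by (intro continuous_intros)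
lemma continuous_a [continuous_intros]: "continuous_on A a"
proof -
  have "continuous_on UNIV fa" using ga by (simp add: graph_over_def)
  then show ?thesis unfolding a_def[abs_def] by (rule continuous_on_compose2) (auto intro!: continuous_intros)
qed
lemma continuous_b [continuous_intros]: "continuous_on A b"
proof -
  have "continuous_on UNIV fb" using gb by (simp add: graph_over_def)
  then have "continuous_on A (\<lambda>x. fb (x - (q + h *\<^sub>R n)))" by (rule continuous_on_compose2) (auto intro!: continuous_intros)
  then show ?thesis unfolding b_def[abs_def] by (intro continuous_intros)
qed

lemma ab_bounds:
  assumes "norm (pr x) \<le> \<sigma>" shows "\<bar>a x\<bar> \<le> h / 8" "\<bar>b x - h\<bar> \<le> h / 8"
proof -
  have "C * (norm (pr x))\<^sup>2 \<le> C * \<sigma>\<^sup>2" using assms C by (intro mult_left_mono power_mono) auto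
  then have le: "C * (norm (pr x))\<^sup>2 \<le> h / 8" using \<sigma> by simp
  have "\<bar>fa (x - q)\<bar> \<le> C * (norm (perp n (x - q)))\<^sup>2" using ga by (simp add: graph_over_def)
  then show "\<bar>a x\<bar> \<le> h / 8" using le by (simp add: a_def pr_def)
  have "\<bar>fb (x - (q + h *\<^sub>R n))\<bar> \<le> C * (norm (perp n (x - (q + h *\<^sub>R n))))\<^sup>2" using gb by (simp add: graph_over_def)
  then show "\<bar>b x - h\<bar> \<le> h / 8" using le by (simp add: b_def perp_p)
qed

lemma wall_iff: "norm (pr x) < s \<Longrightarrow> \<bar>z x\<bar> < s \<Longrightarrow> x \<in> frontier \<Omega> \<longleftrightarrow> z x = a x"
proof -
  assume "norm (pr x) < s" "\<bar>z x\<bar> < s"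
  then have "q + (x - q) \<in> frontier \<Omega> \<longleftrightarrow> (x - q) \<bullet> n = fa (x - q)"
    using ga unfolding graph_over_def pr_def z_def by blast
  then show ?thesis by (simp add: z_def a_def)
qed

lemma body_iff: "norm (pr x) < s \<Longrightarrow> \<bar>z x - h\<bar> < s \<Longrightarrow> x \<in> frontier V \<longleftrightarrow> z x = b x"
proof -
  let ?w = "x - (q + h *\<^sub>R n)"
  assume "norm (pr x) < s" "\<bar>z x - h\<bar> < s"
  then have "norm (perp n ?w) < s \<and> \<bar>?w \<bullet> n\<bar> < s" unfolding perp_p z_p by simp
  then have "(q + h *\<^sub>R n) + ?w \<in> frontier V \<longleftrightarrow> ?w \<bullet> n = fb ?w"
    using gb unfolding graph_over_def by blast
  then show ?thesis unfolding z_p by (auto simp: b_def)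
qed

text \<open>The half turn about the axis: symmetrizing with it leaves only the odd parts of the boundary graphs.\<close>

definition rho :: "real^3 \<Rightarrow> real^3" where "rho x = q + (2 *\<^sub>R (z x *\<^sub>R n) - (x - q))"

lemma rho_props: "pr (rho x) = - pr x" "z (rho x) = z x"
  "\<bar>a x - a (rho x)\<bar> \<le> C * norm (pr x) ^ 3" "\<bar>b x - b (rho x)\<bar> \<le> C * norm (pr x) ^ 3"
proof -
  show zr: "z (rho x) = z x" using nn by (simp add: rho_def z_def inner_diff_left inner_add_left)
  have "pr (rho x) = rho x - q - z (rho x) *\<^sub>R n" by (simp add: pr_def perp_def z_def)
  moreover have "rho x - q = (z x *\<^sub>R n + z x *\<^sub>R n) - (x - q)" by (simp only: rho_def scaleR_2 add_diff_cancel_left')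
  moreover have "pr x = x - q - z x *\<^sub>R n" by (simp add: pr_def perp_def z_def)
  ultimately show "pr (rho x) = - pr x" unfolding zr by simp
  have "rho x - q = - (x - q) + (2 * z x) *\<^sub>R n" by (simp add: rho_def)
  then have "a (rho x) = fa (- (x - q))" using ga unfolding a_def graph_over_def by metis
  moreover have "\<bar>fa (x - q) - fa (- (x - q))\<bar> \<le> C * norm (perp n (x - q)) ^ 3" using ga unfolding graph_over_def by blast
  ultimately show "\<bar>a x - a (rho x)\<bar> \<le> C * norm (pr x) ^ 3" by (simp add: a_def pr_def)
  have "rho x - (q + h *\<^sub>R n) = - (x - (q + h *\<^sub>R n)) + (2 * z x - 2 * h) *\<^sub>R n"
    by (simp add: vec_eq_iff rho_def algebra_simps)
  then have "b (rho x) = h + fb (- (x - (q + h *\<^sub>R n)))" unfolding b_def by (simp only: fb_add)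
  moreover have "\<bar>fb (x - (q + h *\<^sub>R n)) - fb (- (x - (q + h *\<^sub>R n)))\<bar> \<le> C * norm (perp n (x - (q + h *\<^sub>R n))) ^ 3"
    using gb unfolding graph_over_def by blast
  ultimately show "\<bar>b x - b (rho x)\<bar> \<le> C * norm (pr x) ^ 3" by (simp add: b_def perp_p)
qed

lemma integral_rho:
  assumes "continuous_on UNIV f" shows "(\<integral>x. f (rho x) \<partial>lebesgue) = (\<integral>x. (f x :: real) \<partial>lebesgue)"
proof -
  define R where "R w = 2 *\<^sub>R ((w \<bullet> n) *\<^sub>R n) - w" for w :: "real^3"
  have lin: "linear R" unfolding R_def by (intro linearI) (auto simp: inner_add_left algebra_simps)
  have "R v \<bullet> R w = v \<bullet> w" for v w
    using nn by (simp add: R_def inner_diff_left inner_diff_right inner_commute)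
  then have R: "orthogonal_transformation R" using lin by (simp add: orthogonal_transformation_def)
  have "rho = (\<lambda>x. (q - R q) + R x)"
    by (rule ext) (simp add: rho_def R_def z_def inner_diff_left algebra_simps scaleR_2)
  then show ?thesis using integral_rigid[OF R assms, of "q - R q"] by simp
qed

lemma pr_z_combine:
  assumes "w \<bullet> n = 0" shows "pr (q + w + t *\<^sub>R n) = w" "z (q + w + t *\<^sub>R n) = t"
proof -
  show z: "z (q + w + t *\<^sub>R n) = t" using assms nn by (simp add: z_def inner_add_left)
  show "pr (q + w + t *\<^sub>R n) = w" using decomp[of "q + w + t *\<^sub>R n"] unfolding z by simp
qed

text \<open>Every point moves parallel to the axis to the level \<open>c\<close>, which always lies
  between \<open>lo\<close> and \<open>hi\<close>, and then at that level straight to the axis. The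
  first move stays inside because \<open>lo\<close> and \<open>hi\<close> do not change along
  \<open>n\<close>.\<close>

lemma connected_W:
  assumes lo: "\<And>x t. lo (x + t *\<^sub>R n) = lo x" and hi: "\<And>x t. hi (x + t *\<^sub>R n) = hi x"
    and c: "\<And>x. norm (pr x) < \<sigma> \<Longrightarrow> lo x < c \<and> c < hi x"
  shows "connected (W lo hi)"
proof -
  define m where "m = q + c *\<^sub>R n"
  have prm: "pr m = 0" "z m = c" using pr_z_combine[of 0 c] by (auto simp: m_def)
  have path: "\<exists>T. connected T \<and> x \<in> T \<and> m \<in> T \<and> T \<subseteq> W lo hi" if x: "x \<in> W lo hi" for x
  proof -
    define x1 where "x1 = x + (c - z x) *\<^sub>R n"
    have x1: "x1 = q + pr x + c *\<^sub>R n" using decomp[of x] by (simp add: x1_def algebra_simps)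
    have "closed_segment x x1 \<subseteq> W lo hi"
    proof
      fix y assume "y \<in> closed_segment x x1"
      then obtain t where t: "0 \<le> t" "t \<le> 1" "y = (1 - t) *\<^sub>R x + t *\<^sub>R x1" by (auto simp: in_segment)
      then have y: "y = x + (t * (c - z x)) *\<^sub>R n" by (simp add: x1_def algebra_simps)
      have zy: "z y = (1 - t) * z x + t * c" unfolding y z_add by (simp add: algebra_simps)
      have l: "lo x < z x" "z x < hi x" "lo x < c" "c < hi x" "norm (pr x) < \<sigma>" using x c by (auto simp: W_def)
      have "lo x < (1 - t) * z x + t * c" "(1 - t) * z x + t * c < hi x"
        using convex_bound_lt[of "z x" "hi x" c "1 - t" t] convex_bound_lt[of "- z x" "- lo x" "- c" "1 - t" t] l t by auto
      then show "y \<in> W lo hi" unfolding W_def mem_Collect_eq zy using l by (simp add: y lo hi pr_add)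
    qed
    moreover have "closed_segment x1 m \<subseteq> W lo hi"
    proof
      fix y assume "y \<in> closed_segment x1 m"
      then obtain t where t: "0 \<le> t" "t \<le> 1" "y = (1 - t) *\<^sub>R x1 + t *\<^sub>R m" by (auto simp: in_segment)
      then have y: "y = q + (1 - t) *\<^sub>R pr x + c *\<^sub>R n" by (simp add: x1 m_def algebra_simps)
      have pz: "pr y = (1 - t) *\<^sub>R pr x" "z y = c"
        unfolding y by (rule pr_z_combine; simp add: pr_n)+
      have "norm (pr y) \<le> norm (pr x)" using t(1,2) unfolding pz by (simp add: mult_left_le_one_le)
      then have "norm (pr y) < \<sigma>" using x by (simp add: W_def)
      then show "y \<in> W lo hi" using c pz by (simp add: W_def)
    qed
    ultimately show ?thesis
      by (intro exI[of _ "closed_segment x x1 \<union> closed_segment x1 m"] conjI connected_Un) auto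
  qed
  show ?thesis
  proof (cases "W lo hi = {}")
    case False
    obtain T where T: "\<And>x. x \<in> W lo hi \<Longrightarrow> connected (T x) \<and> x \<in> T x \<and> m \<in> T x \<and> T x \<subseteq> W lo hi"
      using path by metis
    have "connected (\<Union>x\<in>W lo hi. T x)"
      by (rule connected_Union) (use T False in blast)+
    moreover have "(\<Union>x\<in>W lo hi. T x) = W lo hi" using T by blast
    ultimately show ?thesis by simp
  qed simp
qed

lemma p_in_\<Omega>: "q + h *\<^sub>R n \<in> \<Omega>"
proof -
  have "q + h *\<^sub>R n \<in> closure V" using p by (simp add: frontier_def)
  then have c: "q + h *\<^sub>R n \<in> closure \<Omega>" using closure_mono[OF V_\<Omega>] by blast
  have "q + h *\<^sub>R n \<notin> frontier \<Omega>"
    using far[OF \<open>q + h *\<^sub>R n \<in> closure V\<close>, of "q + h *\<^sub>R n"] h by auto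
  then show ?thesis using c open_\<Omega> by (simp add: frontier_def interior_open)
qed

lemma connected_subset_or_disjoint:
  assumes "connected T" "T \<inter> frontier S = {}" shows "T \<subseteq> S \<or> T \<inter> S = {}"
  using connected_Int_frontier[OF assms(1), of S] assms(2) by blast

text \<open>The graphs describe only the boundaries; on which side the sets lie follows from
  connectedness. This region misses the wall and contains the nearest body point, which lies in
  \<open>\<Omega>\<close>. The next lemmas argue alike.\<close>

lemma above_wall: "W a (\<lambda>x. 7 * h) \<subseteq> \<Omega>"
proof -
  have con: "connected (W a (\<lambda>x. 7 * h))"
  proof (rule connected_W)
    show "a x < h / 2 \<and> h / 2 < 7 * h" if "norm (pr x) < \<sigma>" for x
      using ab_bounds(1)[of x] that h by auto
  qed (auto simp: a_add)
  have disj: "W a (\<lambda>x. 7 * h) \<inter> frontier \<Omega> = {}"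
  proof -
    have "z x \<noteq> a x \<and> norm (pr x) < s \<and> \<bar>z x\<bar> < s" if "x \<in> W a (\<lambda>x. 7 * h)" for x
      using ab_bounds(1)[of x] that h hs \<sigma> by (auto simp: W_def)
    then show ?thesis using wall_iff by blast
  qed
  have "q + h *\<^sub>R n \<in> W a (\<lambda>x. 7 * h)"
    using pr_z_combine[of 0 h] ab_bounds(1)[of "q + h *\<^sub>R n"] h \<sigma> by (simp add: W_def)
  then show ?thesis
    using connected_subset_or_disjoint[OF con disj] p_in_\<Omega> by blast
qed

lemma below_body: "W (\<lambda>x. - h) b \<inter> closure V = {}"
proof -
  have con: "connected (W (\<lambda>x. - h) b)"
  proof (rule connected_W)
    show "- h < h / 2 \<and> h / 2 < b x" if "norm (pr x) < \<sigma>" for x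
      using ab_bounds(2)[OF less_imp_le[OF that]] h by linarith
  qed (auto simp: b_add)
  have disj: "W (\<lambda>x. - h) b \<inter> frontier V = {}"
  proof -
    have "z x \<noteq> b x \<and> norm (pr x) < s \<and> \<bar>z x - h\<bar> < s" if "x \<in> W (\<lambda>x. - h) b" for x
    proof -
      have l: "norm (pr x) < \<sigma>" "- h < z x" "z x < b x" using that by (simp_all add: W_def)
      show ?thesis using ab_bounds(2)[OF less_imp_le[OF l(1)]] l h hs \<sigma> by (intro conjI) linarith+
    qed
    then show ?thesis using body_iff by blast
  qed
  \<comment> \<open>The midpoint of the gap is closer than \<open>h\<close> to \<open>q\<close>,
    hence not in the body.\<close>
  let ?m = "q + (h / 2) *\<^sub>R n"
  have mW: "?m \<in> W (\<lambda>x. - h) b"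
  proof -
    have l: "pr ?m = 0" "z ?m = h / 2" using pr_z_combine[of 0 "h / 2"] by simp_all
    have "\<bar>b ?m - h\<bar> \<le> h / 8" using ab_bounds(2)[of ?m] l \<sigma> by simp
    then have "- h < z ?m \<and> z ?m < b ?m" using h unfolding l by linarith
    then show ?thesis using l \<sigma> by (simp add: W_def)
  qed
  have "dist ?m q < h" using n h by (simp add: dist_norm)
  then have "?m \<notin> V" using far[of ?m q] q closure_subset by fastforce
  then have "W (\<lambda>x. - h) b \<inter> V = {}" using connected_subset_or_disjoint[OF con disj] mW by blast
  then show ?thesis using disj open_V by (auto simp: frontier_def interior_open)
qed

lemma gap_subset: "W a b \<subseteq> \<Omega> - closure V"
proof -
  have "W a b \<subseteq> W a (\<lambda>x. 7 * h)" "W a b \<subseteq> W (\<lambda>x. - h) b"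
  proof -
    have "- h < a x \<and> b x < 7 * h" if "norm (pr x) < \<sigma>" for x
      using ab_bounds[OF less_imp_le[OF that]] h by linarith
    then show "W a b \<subseteq> W a (\<lambda>x. 7 * h)" "W a b \<subseteq> W (\<lambda>x. - h) b" by (fastforce simp: W_def)+
  qed
  then show ?thesis using above_wall below_body by blast
qed

text \<open>Here a point of \<open>V\<close> in the region has to be found first. Points of
  \<open>V\<close> accumulate at the nearest body point; they do not lie on the graph, since
  \<open>V\<close> is open, nor below it, so one of them lies above.\<close>

lemma body_subset: "W b (\<lambda>x. 7 * h) \<subseteq> V"
proof -
  have con: "connected (W b (\<lambda>x. 7 * h))"
  proof (rule connected_W)
    show "b x < 2 * h \<and> 2 * h < 7 * h" if "norm (pr x) < \<sigma>" for x
      using ab_bounds(2)[OF less_imp_le[OF that]] h by linarith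
  qed (auto simp: b_add)
  have disj: "W b (\<lambda>x. 7 * h) \<inter> frontier V = {}"
  proof -
    have "z x \<noteq> b x \<and> norm (pr x) < s \<and> \<bar>z x - h\<bar> < s" if "x \<in> W b (\<lambda>x. 7 * h)" for x
    proof -
      have l: "norm (pr x) < \<sigma>" "b x < z x" "z x < 7 * h" using that by (simp_all add: W_def)
      show ?thesis using ab_bounds(2)[OF less_imp_le[OF l(1)]] l h hs \<sigma> by (intro conjI) linarith+
    qed
    then show ?thesis using body_iff by blast
  qed
  define N where "N = {x. norm (pr x) < \<sigma> \<and> 0 < z x \<and> z x < 2 * h}"
  have "open N" unfolding N_def by (intro open_Collect_conj open_Collect_less continuous_intros)
  moreover have "q + h *\<^sub>R n \<in> N" using pr_z_combine[of 0 h] h \<sigma> by (simp add: N_def)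
  moreover have "q + h *\<^sub>R n \<in> closure V" using p by (simp add: frontier_def)
  ultimately have "V \<inter> N \<noteq> {}" using open_Int_closure_eq_empty by blast
  then obtain y where y: "y \<in> V" "y \<in> N" by blast
  have "y \<notin> frontier V" using y open_V by (simp add: frontier_def interior_open)
  moreover have "norm (pr y) < s" "0 < z y" "z y < 2 * h" using y \<sigma> by (auto simp: N_def)
  then have "norm (pr y) < s \<and> \<bar>z y - h\<bar> < s" using h hs by linarith
  ultimately have "z y \<noteq> b y" using body_iff[of y] by blast
  moreover have "\<not> z y < b y"
  proof
    assume "z y < b y"
    then have "y \<in> W (\<lambda>x. - h) b" using y h by (auto simp: N_def W_def)
    then show False using below_body y closure_subset by blast
  qed
  ultimately have "y \<in> W b (\<lambda>x. 7 * h)" using y h by (auto simp: N_def W_def)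
  then show ?thesis using connected_subset_or_disjoint[OF con disj] y by blast
qed

definition slab :: "real \<Rightarrow> real \<Rightarrow> real \<Rightarrow> (real^3) set" where
  "slab \<rho> \<alpha> \<beta> = {x. norm (pr x) \<le> \<rho> \<and> \<alpha> \<le> z x \<and> z x \<le> \<beta>}"

lemma slab_compact: "compact (slab \<rho> \<alpha> \<beta>)"
proof -
  have "closed (slab \<rho> \<alpha> \<beta>)" unfolding slab_def
    by (intro closed_Collect_conj closed_Collect_le continuous_intros)
  moreover have "bounded (slab \<rho> \<alpha> \<beta>)"
  proof (rule boundedI)
    fix x assume x: "x \<in> slab \<rho> \<alpha> \<beta>"
    have "norm x = norm (q + pr x + z x *\<^sub>R n)" using decomp[of x] by (rule arg_cong)
    then have "norm x \<le> norm q + norm (pr x) + norm (z x *\<^sub>R n)"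
      using norm_triangle_ineq[of "q + pr x" "z x *\<^sub>R n"] norm_triangle_ineq[of q "pr x"] by linarith
    then show "norm x \<le> norm q + \<rho> + (\<bar>\<alpha>\<bar> + \<bar>\<beta>\<bar>)" using x n by (auto simp: slab_def)
  qed
  ultimately show ?thesis by (simp add: compact_eq_bounded_closed)
qed

text \<open>The disc of radius \<rho> is compared with the squares of side \<open>2 * \<rho>\<close>
  around it and of side \<rho> inside it; the exact area of the disc is irrelevant.\<close>

lemma slab_measure:
  assumes "\<rho> \<ge> 0" "\<alpha> \<le> \<beta>"
  shows "slab \<rho> \<alpha> \<beta> \<in> lmeasurable" "measure lebesgue (slab \<rho> \<alpha> \<beta>) \<le> 4 * \<rho>\<^sup>2 * (\<beta> - \<alpha>)"
    "\<rho>\<^sup>2 * (\<beta> - \<alpha>) \<le> measure lebesgue (slab \<rho> \<alpha> \<beta>)"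
proof -
  show lm: "slab \<rho> \<alpha> \<beta> \<in> lmeasurable" by (rule lmeasurable_compact[OF slab_compact])
  obtain A :: "real^3 \<Rightarrow> real^3" where A: "orthogonal_transformation A" "A (axis 3 1) = n"
    using orthogonal_transformation_exists_1[of "axis 3 1 :: real^3" n] n by (metis norm_axis_1)
  define T where "T y = q + A y" for y
  have Ty: "z (T y) = y $ 3" "(norm (pr (T y)))\<^sup>2 = (y $ 1)\<^sup>2 + (y $ 2)\<^sup>2" for y
  proof -
    have "A y \<bullet> A (axis 3 1) = y \<bullet> axis 3 1" using A(1) by (simp add: orthogonal_transformation_def)
    then show zz: "z (T y) = y $ 3" by (simp add: z_def T_def A inner_axis)
    have "(norm (A y))\<^sup>2 = (norm (pr (T y)))\<^sup>2 + (z (T y))\<^sup>2"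
      using perp_simps(4)[OF n, of "A y"] by (simp add: pr_def z_def T_def)
    moreover have "(norm (A y))\<^sup>2 = (y $ 1)\<^sup>2 + (y $ 2)\<^sup>2 + (y $ 3)\<^sup>2"
      using A(1) unfolding orthogonal_transformation_norm[OF A(1)] power2_norm_eq_inner by (simp add: inner_vec_def sum_3 power2_eq_square)
    ultimately show "(norm (pr (T y)))\<^sup>2 = (y $ 1)\<^sup>2 + (y $ 2)\<^sup>2" by (simp add: zz)
  qed
  define S' where "S' = T -` slab \<rho> \<alpha> \<beta>"
  have Tm: "T \<in> borel_measurable borel"
    unfolding T_def[abs_def] using orthogonal_transformation_linear[OF A(1)]
    by (intro borel_measurable_add borel_measurable_const borel_measurable_continuous_onI)
       (simp add: linear_continuous_on linear_conv_bounded_linear)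
  have sb: "slab \<rho> \<alpha> \<beta> \<in> sets borel" using slab_compact by (simp add: borel_compact)
  have em: "emeasure lborel (slab \<rho> \<alpha> \<beta>) = emeasure lborel S'"
  proof -
    have "emeasure lborel (slab \<rho> \<alpha> \<beta>) = emeasure (distr lborel borel T) (slab \<rho> \<alpha> \<beta>)"
      unfolding T_def[abs_def] by (simp add: lborel_distr_rigid[OF A(1)])
    also have "\<dots> = emeasure lborel S'"
      unfolding S'_def using Tm sb by (subst emeasure_distr) auto
    finally show ?thesis .
  qed
  have S'b: "S' \<in> sets borel" unfolding S'_def using measurable_sets[OF Tm sb] by simp
  have me: "ennreal (measure lebesgue (slab \<rho> \<alpha> \<beta>)) = emeasure lborel S'"
  proof -
    have "emeasure lborel (slab \<rho> \<alpha> \<beta>) = emeasure lebesgue (slab \<rho> \<alpha> \<beta>)" using sb by simp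
    also have "\<dots> = ennreal (measure lebesgue (slab \<rho> \<alpha> \<beta>))"
      using lm by (simp add: emeasure_eq_measure2 fmeasurableD2)
    finally show ?thesis using em by simp
  qed
  define B where "B \<rho> = cbox (vector [- \<rho>, - \<rho>, \<alpha>]) (vector [\<rho>, \<rho>, \<beta>] :: real^3)" for \<rho> :: real
  have Bc: "emeasure lborel (B \<rho>) = ennreal (4 * \<rho>\<^sup>2 * (\<beta> - \<alpha>))" if "\<rho> \<ge> 0" for \<rho>
  proof -
    have ne: "B \<rho> \<noteq> {}" using that assms by (simp add: B_def interval_ne_empty_cart forall_3 vector_3)
    have "emeasure lborel (B \<rho>) = ennreal (measure lborel (B \<rho>))"
      unfolding B_def by (intro emeasure_eq_ennreal_measure) (metis emeasure_lborel_cbox_finite infinity_ennreal_def less_irrefl)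
    also have "measure lborel (B \<rho>) = 4 * \<rho>\<^sup>2 * (\<beta> - \<alpha>)"
    proof -
      have p3: "prod f (UNIV::3 set) = f 1 * f 2 * f 3" for f :: "3 \<Rightarrow> real"
        unfolding UNIV_3 by (simp add: mult.assoc)
      have "measure lborel (B \<rho>) = (\<Prod>i\<in>UNIV. (vector [\<rho>, \<rho>, \<beta>] :: real^3) $ i - (vector [- \<rho>, - \<rho>, \<alpha>] :: real^3) $ i)"
        using ne unfolding B_def by (rule content_cbox_cart)
      also have "\<dots> = (2 * \<rho>) * (2 * \<rho>) * (\<beta> - \<alpha>)" unfolding p3 vector_3 by simp
      finally show ?thesis by (simp add: power2_eq_square)
    qed
    finally show ?thesis .
  qed
  have "S' \<subseteq> B \<rho>"
  proof
    fix y assume "y \<in> S'"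
    then have y: "norm (pr (T y)) \<le> \<rho>" "\<alpha> \<le> y $ 3" "y $ 3 \<le> \<beta>" by (auto simp: S'_def slab_def Ty)
    have "(norm (pr (T y)))\<^sup>2 \<le> \<rho>\<^sup>2" using y assms by (intro power_mono) auto
    then have "(y $ 1)\<^sup>2 \<le> \<rho>\<^sup>2" "(y $ 2)\<^sup>2 \<le> \<rho>\<^sup>2" unfolding Ty by (auto intro: order_trans[rotated])
    then have "\<bar>y $ 1\<bar> \<le> \<rho>" "\<bar>y $ 2\<bar> \<le> \<rho>" using assms by (auto simp: abs_le_square_iff[symmetric])
    then show "y \<in> B \<rho>" using y by (auto simp: B_def mem_box_cart forall_3 vector_3)
  qed
  then have "emeasure lborel S' \<le> ennreal (4 * \<rho>\<^sup>2 * (\<beta> - \<alpha>))"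
    using emeasure_mono[of S' "B \<rho>" lborel] Bc assms by (simp add: B_def)
  then show "measure lebesgue (slab \<rho> \<alpha> \<beta>) \<le> 4 * \<rho>\<^sup>2 * (\<beta> - \<alpha>)"
    unfolding me[symmetric] using assms by (simp add: ennreal_le_iff)
  have "B (\<rho> / 2) \<subseteq> S'"
  proof
    fix y assume "y \<in> B (\<rho> / 2)"
    then have y: "\<bar>y $ 1\<bar> \<le> \<rho> / 2" "\<bar>y $ 2\<bar> \<le> \<rho> / 2" "\<alpha> \<le> y $ 3" "y $ 3 \<le> \<beta>"
      by (auto simp: B_def mem_box_cart forall_3 vector_3)
    then have "(y $ 1)\<^sup>2 \<le> (\<rho> / 2)\<^sup>2" "(y $ 2)\<^sup>2 \<le> (\<rho> / 2)\<^sup>2" using assms by (auto simp: abs_le_square_iff[symmetric])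
    moreover have "(\<rho> / 2)\<^sup>2 = \<rho>\<^sup>2 / 4" by (simp add: power_divide)
    ultimately have "(norm (pr (T y)))\<^sup>2 \<le> \<rho>\<^sup>2" unfolding Ty using zero_le_power2[of \<rho>] by linarith
    then have "norm (pr (T y)) \<le> \<rho>" using assms(1) by (rule power2_le_imp_le)
    then show "y \<in> S'" using y by (simp add: S'_def slab_def Ty)
  qed
  then have "ennreal (4 * (\<rho> / 2)\<^sup>2 * (\<beta> - \<alpha>)) \<le> emeasure lborel S'"
    using emeasure_mono[of "B (\<rho> / 2)" S' lborel] Bc[of "\<rho> / 2"] assms S'b by simp
  then show "\<rho>\<^sup>2 * (\<beta> - \<alpha>) \<le> measure lebesgue (slab \<rho> \<alpha> \<beta>)"
    unfolding me[symmetric] using assms by (simp add: ennreal_le_iff power2_eq_square)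
qed

text \<open>The graph is null: it has arbitrarily many disjoint translates inside a bounded set.\<close>

lemma graph_negligible: "negligible {x. norm (pr x) \<le> \<sigma> \<and> z x = b x}"
proof -
  define Z where "Z = {x. norm (pr x) \<le> \<sigma> \<and> z x = b x}"
  have Zsub: "Z \<subseteq> slab \<sigma> 0 (2 * h)"
  proof
    fix x assume "x \<in> Z"
    then have x: "norm (pr x) \<le> \<sigma>" "z x = b x" by (auto simp: Z_def)
    have "0 \<le> b x \<and> b x \<le> 2 * h" using ab_bounds(2)[OF x(1)] h by linarith
    then show "x \<in> slab \<sigma> 0 (2 * h)" using x by (simp add: slab_def)
  qed
  have "closed Z" unfolding Z_def by (intro closed_Collect_conj closed_Collect_le closed_Collect_eq continuous_intros)
  then have "compact Z" using Zsub slab_compact by (metis compact_Int_closed inf.absorb2)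
  then have Zm: "Z \<in> lmeasurable" by (rule lmeasurable_compact)
  define D where "D = measure lebesgue (slab \<sigma> 0 (3 * h))"
  have le: "real N * measure lebesgue Z \<le> D" for N :: nat
  proof (cases "N = 0")
    case True then show ?thesis by (simp add: D_def)
  next
    case False
    \<comment> \<open>Shifts by multiples of \<open>h / N\<close> along \<open>n\<close> are
      disjoint, since the height on the graph is constant along \<open>n\<close> and so determines
      the shift; all of them fit below height \<open>3 * h\<close>.\<close>
    define f where "f i = (\<lambda>x. (real i * h / real N) *\<^sub>R n + x) ` Z" for i :: nat
    have disj: "f i \<inter> f j = {}" if "i \<noteq> j" for i j
    proof (rule ccontr)
      assume "f i \<inter> f j \<noteq> {}"
      then obtain x y where xy: "x \<in> Z" "y \<in> Z" "(real i * h / real N) *\<^sub>R n + x = (real j * h / real N) *\<^sub>R n + y"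
        by (auto simp: f_def)
      then have "y = x + (real i * h / real N - real j * h / real N) *\<^sub>R n" by (simp add: algebra_simps)
      then have "z y = z x + (real i * h / real N - real j * h / real N)" "b y = b x" by (simp_all only: z_add b_add)
      then have "real i * h / real N = real j * h / real N" using xy by (simp add: Z_def)
      then show False using h False that by simp
    qed
    have fm: "f i \<in> lmeasurable" "measure lebesgue (f i) = measure lebesgue Z" for i
      unfolding f_def using Zm by (auto simp: measurable_translation measure_translation)
    have "real N * measure lebesgue Z = (\<Sum>i<N. measure lebesgue (f i))" by (simp add: fm)
    also have "\<dots> = measure lebesgue (\<Union>i<N. f i)"
      by (rule measure_UNION'[symmetric]) (use fm disj in \<open>auto simp: pairwise_def disjnt_def\<close>)
    also have "\<dots> \<le> D"
      unfolding D_def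
    proof (rule measure_mono_fmeasurable)
      show "(\<Union>i<N. f i) \<subseteq> slab \<sigma> 0 (3 * h)"
      proof clarify
        fix i x assume i: "i < N" and "x \<in> f i"
        then obtain y where y: "y \<in> Z" "x = y + (real i * h / real N) *\<^sub>R n" by (auto simp: f_def add.commute)
        have "0 \<le> real i * h / real N" "real i * h / real N \<le> h" using i h by (auto simp: field_simps)
        moreover have "y \<in> slab \<sigma> 0 (2 * h)" using y Zsub by blast
        ultimately show "x \<in> slab \<sigma> 0 (3 * h)" unfolding y(2) slab_def mem_Collect_eq pr_add z_add by simp
      qed
      show "slab \<sigma> 0 (3 * h) \<in> lmeasurable" by (rule lmeasurable_compact[OF slab_compact])
      show "(\<Union>i<N. f i) \<in> sets lebesgue" using fm by (auto intro!: sets.finite_UN)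
    qed
    finally show ?thesis .
  qed
  have "measure lebesgue Z = 0"
  proof (rule ccontr)
    assume "measure lebesgue Z \<noteq> 0"
    then have pos: "measure lebesgue Z > 0" by (simp add: zero_less_measure_iff)
    obtain N :: nat where "D / measure lebesgue Z < real N" using reals_Archimedean2 by blast
    then have "D < real N * measure lebesgue Z" using pos by (simp add: field_simps)
    then show False using le[of N] by simp
  qed
  then show ?thesis using Zm unfolding Z_def[symmetric] by (simp add: negligible_iff_measure)
qed

end

section \<open>Test functions in the gap\<close>

lemma norm_cross3_le: "norm (cross3 x y) \<le> norm x * norm y"
proof -
  have "(norm (cross3 x y))\<^sup>2 \<le> (norm x * norm y)\<^sup>2"
    using norm_cross_dot[of x y] zero_le_power2[of "x \<bullet> y"] by linarith
  then show ?thesis by (rule power2_le_imp_le) simp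
qed

lemma cross3_bounded_linear: "bounded_linear (cross3 \<omega>)"
  by (rule linear_conv_bounded_linear[THEN iffD1]) (auto intro!: linearI simp: cross_add_right cross_mult_right)

lemma abs_inner_le:
  assumes "norm x \<le> A" "norm y \<le> B" shows "\<bar>x \<bullet> y\<bar> \<le> A * B"
proof -
  have "\<bar>x \<bullet> y\<bar> \<le> norm x * norm y" by (rule Cauchy_Schwarz_ineq2)
  also have "\<dots> \<le> A * B" using assms order_trans[OF norm_ge_zero assms(1)] by (intro mult_mono) simp_all
  finally show ?thesis .
qed

text \<open>Serves to replace \<open>u\<close> by the rigid field on the body, so that uniqueness of
  weak derivatives yields the gradient of \<open>u\<close> there.\<close>

lemma weak_pd_cong_AE:
  fixes f :: "real^'n::finite \<Rightarrow> 'b::euclidean_space"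
  assumes f: "weak_pd U i f g" and f': "locally_integrable_on f' U" and eq: "AE x in lebesgue. x \<in> U \<longrightarrow> f x = f' x"
  shows "weak_pd U i f' g"
  unfolding weak_pd_iff
proof (intro conjI allI impI)
  show "locally_integrable_on f' U" by fact
  show "locally_integrable_on g U" using f by (simp add: weak_pd_def)
  fix \<phi> :: "real^'n \<Rightarrow> real" assume \<phi>: "test_function U \<phi>"
  have lf: "locally_integrable_on f U" using f by (simp add: weak_pd_def)
  obtain C where C: "C \<subseteq> U" "\<And>x. x \<notin> C \<Longrightarrow> pd i \<phi> x = 0"
    using test_function_support[OF \<phi>] by metis
  have "(\<integral>x. pd i \<phi> x *\<^sub>R f' x \<partial>lebesgue) = (\<integral>x. pd i \<phi> x *\<^sub>R f x \<partial>lebesgue)"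
  proof (rule integral_cong_AE)
    show "(\<lambda>x. pd i \<phi> x *\<^sub>R f' x) \<in> borel_measurable lebesgue" "(\<lambda>x. pd i \<phi> x *\<^sub>R f x) \<in> borel_measurable lebesgue"
      using test_function_integral(1)[OF f' test_function_pd[OF \<phi>]] test_function_integral(1)[OF lf test_function_pd[OF \<phi>]]
      by (auto dest: borel_measurable_integrable)
    show "AE x in lebesgue. pd i \<phi> x *\<^sub>R f' x = pd i \<phi> x *\<^sub>R f x"
      using eq by eventually_elim (use C in force)
  qed
  then show "(\<integral>x. pd i \<phi> x *\<^sub>R f' x \<partial>lebesgue) = - (\<integral>x. \<phi> x *\<^sub>R g x \<partial>lebesgue)"
    using f \<phi> by (simp add: weak_pd_iff)
qed

text \<open>A regularized positive part: 0 up to \<epsilon> and of slope 1 beyond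
  \<open>2 * \<epsilon>\<close>. Composed with a weight that is positive exactly in the gap, it
  keeps a distance from the boundary.\<close>

definition ramp :: "real \<Rightarrow> real \<Rightarrow> real" where
  "ramp \<epsilon> t = ((max 0 (t - \<epsilon>))\<^sup>2 - (max 0 (t - 2 * \<epsilon>))\<^sup>2) / (2 * \<epsilon>)"

definition ramp' :: "real \<Rightarrow> real \<Rightarrow> real" where
  "ramp' \<epsilon> t = (max 0 (t - \<epsilon>) - max 0 (t - 2 * \<epsilon>)) / \<epsilon>"

lemma ramp_props:
  assumes e: "\<epsilon> > 0"
  shows "(ramp \<epsilon> has_real_derivative ramp' \<epsilon> t) (at t)" "0 \<le> ramp \<epsilon> t" "ramp \<epsilon> t \<le> max 0 t" "t \<le> \<epsilon> \<Longrightarrow> ramp \<epsilon> t = 0"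
    "0 \<le> ramp' \<epsilon> t" "ramp' \<epsilon> t \<le> 1" "t \<le> \<epsilon> \<Longrightarrow> ramp' \<epsilon> t = 0" "2 * \<epsilon> \<le> t \<Longrightarrow> ramp' \<epsilon> t = 1"
    "continuous_on A (ramp \<epsilon>)" "continuous_on A (ramp' \<epsilon>)"
proof -
  have *: "((\<lambda>t. (max 0 (t - c))\<^sup>2) has_real_derivative 2 * max 0 (t - c)) (at t)" for c t :: real
  proof -
    have "((\<lambda>t. t - c) has_real_derivative 1) (at t)" by (auto intro!: derivative_eq_intros)
    from DERIV_chain2[where f="\<lambda>t. (max 0 t)\<^sup>2" and g="\<lambda>t. t - c" and x=t and s=UNIV, OF has_real_derivative_max_square this]
    show ?thesis by simp
  qed
  have "((\<lambda>t. ((max 0 (t - \<epsilon>))\<^sup>2 - (max 0 (t - 2 * \<epsilon>))\<^sup>2) / (2 * \<epsilon>)) has_real_derivative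
      (2 * max 0 (t - \<epsilon>) - 2 * max 0 (t - 2 * \<epsilon>)) / (2 * \<epsilon>)) (at t)"
    by (intro DERIV_cdivide DERIV_diff *)
  moreover have "(2 * max 0 (t - \<epsilon>) - 2 * max 0 (t - 2 * \<epsilon>)) / (2 * \<epsilon>) = ramp' \<epsilon> t"
    using e by (simp add: ramp'_def field_simps)
  ultimately show "(ramp \<epsilon> has_real_derivative ramp' \<epsilon> t) (at t)" unfolding ramp_def[abs_def] by simp
  have sq: "(t - 2 * \<epsilon>)\<^sup>2 \<le> (t - \<epsilon>)\<^sup>2" if "t \<ge> 2 * \<epsilon>" using that e by (intro power_mono) auto
  show "0 \<le> ramp \<epsilon> t" unfolding ramp_def using e by (intro divide_nonneg_pos) (auto intro!: power_mono)
  show "ramp \<epsilon> t \<le> max 0 t"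
  proof -
    consider "t \<le> \<epsilon>" | "\<epsilon> \<le> t" "t \<le> 2 * \<epsilon>" | "2 * \<epsilon> \<le> t" by linarith
    then show ?thesis
    proof cases
      case 2
      have "(t - \<epsilon>) * (t - \<epsilon>) \<le> (t - \<epsilon>) * \<epsilon>" using 2 by (intro mult_left_mono) auto
      also have "\<dots> \<le> t * \<epsilon>" using e by (intro mult_right_mono) auto
      also have "\<dots> \<le> t * (2 * \<epsilon>)" using 2 e by simp
      finally show ?thesis using 2 e by (simp add: ramp_def power2_eq_square divide_le_eq)
    next
      case 3
      have "(t - \<epsilon>)\<^sup>2 - (t - 2 * \<epsilon>)\<^sup>2 = (2 * t - 3 * \<epsilon>) * \<epsilon>" by (simp add: power2_eq_square algebra_simps)
      also have "\<dots> \<le> t * (2 * \<epsilon>)" using e by (simp add: algebra_simps)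
      finally show ?thesis using 3 e by (simp add: ramp_def divide_le_eq)
    qed (use e in \<open>simp add: ramp_def\<close>)
  qed
  show "t \<le> \<epsilon> \<Longrightarrow> ramp \<epsilon> t = 0" using e by (simp add: ramp_def)
  show "t \<le> \<epsilon> \<Longrightarrow> ramp' \<epsilon> t = 0" using e by (simp add: ramp'_def)
  show "2 * \<epsilon> \<le> t \<Longrightarrow> ramp' \<epsilon> t = 1" using e by (simp add: ramp'_def)
  show "0 \<le> ramp' \<epsilon> t" "ramp' \<epsilon> t \<le> 1" using e by (auto simp: ramp'_def divide_le_eq max_def)
  show "continuous_on A (ramp \<epsilon>)" "continuous_on A (ramp' \<epsilon>)"
    unfolding ramp_def[abs_def] ramp'_def[abs_def] by (intro continuous_intros; use e in simp)+
qed

text \<open>Cauchy-Schwarz in each index: a second derivative along a unit vector is at most the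
  Euclidean norm of the Hessian.\<close>

lemma norm_weighted_double_sum_le:
  fixes H :: "'n::finite \<Rightarrow> 'n \<Rightarrow> 'b::real_inner" and n :: "real^'n"
  assumes "norm n = 1"
  shows "norm (\<Sum>i\<in>UNIV. n $ i *\<^sub>R (\<Sum>j\<in>UNIV. n $ j *\<^sub>R H i j)) \<le> sqrt (\<Sum>i\<in>UNIV. \<Sum>j\<in>UNIV. (norm (H i j))\<^sup>2)"
proof -
  have n1: "(\<Sum>i\<in>UNIV. (n $ i)\<^sup>2) = 1"
    using assms by (simp add: norm_vec_def L2_set_def)
  have "norm (\<Sum>i\<in>UNIV. n $ i *\<^sub>R (\<Sum>j\<in>UNIV. n $ j *\<^sub>R H i j)) \<le> (\<Sum>i\<in>UNIV. \<bar>n $ i\<bar> * (\<Sum>j\<in>UNIV. \<bar>n $ j\<bar> * norm (H i j)))"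
    by (rule order_trans[OF norm_sum], rule sum_mono)
       (auto intro!: mult_left_mono order_trans[OF norm_sum])
  also have "\<dots> \<le> (\<Sum>i\<in>UNIV. \<bar>n $ i\<bar> * \<bar>sqrt (\<Sum>j\<in>UNIV. (norm (H i j))\<^sup>2)\<bar>)"
  proof (intro sum_mono mult_left_mono)
    fix i
    have "(\<Sum>j\<in>UNIV. \<bar>n $ j\<bar> * \<bar>norm (H i j)\<bar>) \<le> L2_set (\<lambda>j. n $ j) UNIV * L2_set (\<lambda>j. norm (H i j)) UNIV"
      by (rule L2_set_mult_ineq)
    then show "(\<Sum>j\<in>UNIV. \<bar>n $ j\<bar> * norm (H i j)) \<le> \<bar>sqrt (\<Sum>j\<in>UNIV. (norm (H i j))\<^sup>2)\<bar>"
      by (simp add: L2_set_def n1 sum_nonneg)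
  qed auto
  also have "\<dots> \<le> L2_set (\<lambda>i. n $ i) UNIV * L2_set (\<lambda>i. sqrt (\<Sum>j\<in>UNIV. (norm (H i j))\<^sup>2)) UNIV"
    by (rule L2_set_mult_ineq)
  also have "\<dots> = sqrt (\<Sum>i\<in>UNIV. \<Sum>j\<in>UNIV. (norm (H i j))\<^sup>2)"
    by (simp add: L2_set_def n1 sum_nonneg)
  finally show ?thesis .
qed

lemma weak_pd_euclidean_unique:
  assumes "open U" "weak_gradient U f G" "weak_gradient U f G'"
  shows "AE x in lebesgue. \<forall>i. x \<in> U \<longrightarrow> G i x = G' i x"
  using assms by (intro eventually_all_finite weak_pd_unique[of U]) (auto simp: weak_gradient_def)

context gap
begin

text \<open>Half of \<sigma>, so that the weights vanish near the lateral surface of the cylinder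
  and no boundary terms arise there.\<close>

definition r :: real where "r = \<sigma> / 2"
definition E :: "real^3 \<Rightarrow> real" where "E x = max 0 (r\<^sup>2 - (norm (pr x))\<^sup>2)"
text \<open>The square makes the gradient \<open>d\<eta>\<close> continuous across the edge of the
  support; it is a multiple of \<open>pr x\<close>, hence odd under the half turn.\<close>

definition \<eta> :: "real^3 \<Rightarrow> real" where "\<eta> x = (E x)\<^sup>2"
definition d\<eta> :: "real^3 \<Rightarrow> real^3" where "d\<eta> x = (- 4 * E x) *\<^sub>R pr x"
text \<open>The transition takes place between the heights \<open>2 * h\<close> and
  \<open>3 * h\<close>, above the body surface and below \<open>7 * h\<close>. Thus
  \<open>cut\<close> is 1 throughout the gap and its derivative lives where \<open>u\<close> is
  rigid.\<close>

definition cut :: "real^3 \<Rightarrow> real" where "cut x = cutoff ((z x - 2 * h) / h)"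
definition dcut :: "real^3 \<Rightarrow> real" where "dcut x = cutoff' ((z x - 2 * h) / h) / h"
definition m :: "real^3 \<Rightarrow> real" where "m x = (a x + b x) / 2"
text \<open>No upper face: the set continues into the body, so that no boundary values on the body
  surface are needed, and \<open>cut\<close> ends the integrations.\<close>

definition A :: "(real^3) set" where "A = {x. norm (pr x) < \<sigma> \<and> a x < z x}"

lemma r: "r > 0" "r < \<sigma>" using \<sigma> by (auto simp: r_def)

lemma E_bounds: "0 \<le> E x" "E x \<le> r\<^sup>2" "r \<le> norm (pr x) \<Longrightarrow> E x = 0" "norm (pr x) \<le> r / 2 \<Longrightarrow> r\<^sup>2 * (3 / 4) \<le> E x"
proof -
  show "0 \<le> E x" "E x \<le> r\<^sup>2" by (auto simp: E_def)
  show "E x = 0" if "r \<le> norm (pr x)" using power_mono[OF that, of 2] r by (simp add: E_def)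
  show "r\<^sup>2 * (3 / 4) \<le> E x" if "norm (pr x) \<le> r / 2"
  proof -
    have "(norm (pr x))\<^sup>2 \<le> r\<^sup>2 / 4" using power_mono[OF that, of 2] by (simp add: power_divide)
    moreover have "r\<^sup>2 - (norm (pr x))\<^sup>2 \<le> E x" by (simp add: E_def)
    ultimately show ?thesis by linarith
  qed
qed

lemma continuous_bumps [continuous_intros]:
  "continuous_on S E" "continuous_on S \<eta>" "continuous_on S d\<eta>" "continuous_on S cut" "continuous_on S dcut" "continuous_on S m"
proof -
  show E: "continuous_on S E" unfolding E_def[abs_def] by (intro continuous_intros)
  then show "continuous_on S \<eta>" "continuous_on S d\<eta>"
    unfolding \<eta>_def[abs_def] d\<eta>_def[abs_def] by (intro continuous_intros; assumption)+
  have l: "continuous_on S (\<lambda>x. (z x - 2 * h) / h)" using h by (intro continuous_intros) auto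
  show "continuous_on S cut" unfolding cut_def[abs_def]
    by (rule continuous_on_compose2[OF continuous_on_cutoff(1)[of UNIV] l]) simp
  have "continuous_on S (\<lambda>x. cutoff' ((z x - 2 * h) / h))"
    by (rule continuous_on_compose2[OF continuous_on_cutoff(2)[of UNIV] l]) simp
  then show "continuous_on S dcut" unfolding dcut_def[abs_def] using h by (intro continuous_intros) auto
  show "continuous_on S m" unfolding m_def[abs_def] by (intro continuous_intros) auto
qed

lemma d\<eta>_bound: "norm (d\<eta> x) \<le> 4 * r ^ 3"
proof (cases "norm (pr x) \<le> r")
  case True
  have "norm (d\<eta> x) = 4 * E x * norm (pr x)" using E_bounds(1)[of x] by (simp add: d\<eta>_def)
  also have "\<dots> \<le> 4 * r\<^sup>2 * r" using True E_bounds[of x] by (intro mult_mono) auto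
  finally show ?thesis by (simp add: power2_eq_square power3_eq_cube)
qed (use E_bounds(3)[of x] r in \<open>simp add: d\<eta>_def\<close>)

lemma \<eta>_bound: "0 \<le> \<eta> x" "\<eta> x \<le> r ^ 4"
proof -
  show "0 \<le> \<eta> x" by (simp add: \<eta>_def)
  have "(E x)\<^sup>2 \<le> (r\<^sup>2)\<^sup>2" using E_bounds[of x] by (intro power_mono) auto
  then show "\<eta> x \<le> r ^ 4" by (simp add: \<eta>_def power_mult[symmetric])
qed

lemma outside_cylinder: "r \<le> norm (pr x) \<Longrightarrow> \<eta> x = 0" "r \<le> norm (pr x) \<Longrightarrow> d\<eta> x = 0"
  using E_bounds(3) by (auto simp: \<eta>_def d\<eta>_def)

lemma cut_props: "z x \<le> 2 * h \<Longrightarrow> cut x = 1" "3 * h \<le> z x \<Longrightarrow> cut x = 0" "0 \<le> cut x" "cut x \<le> 1"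
  "z x \<le> 2 * h \<Longrightarrow> dcut x = 0" "3 * h \<le> z x \<Longrightarrow> dcut x = 0" "\<bar>dcut x\<bar> \<le> 2 / h" "dcut x \<le> 0"
  "9 / 4 * h \<le> z x \<Longrightarrow> z x \<le> 11 / 4 * h \<Longrightarrow> dcut x \<le> - 1 / h"
proof -
  let ?t = "(z x - 2 * h) / h"
  show "z x \<le> 2 * h \<Longrightarrow> cut x = 1" "z x \<le> 2 * h \<Longrightarrow> dcut x = 0"
    using h cutoff_props(1,5)[of ?t] by (simp_all add: cut_def dcut_def divide_le_eq)
  show "3 * h \<le> z x \<Longrightarrow> cut x = 0" "3 * h \<le> z x \<Longrightarrow> dcut x = 0"
    using h cutoff_props(2,6)[of ?t] by (simp_all add: cut_def dcut_def le_divide_eq)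
  show "0 \<le> cut x" "cut x \<le> 1" by (simp_all add: cut_def cutoff_props)
  have "\<bar>cutoff' ?t\<bar> \<le> 2" using cutoff_props(7,8)[of ?t] by simp
  then show "\<bar>dcut x\<bar> \<le> 2 / h" using h by (simp add: dcut_def divide_right_mono)
  show "dcut x \<le> 0" using h cutoff_props(7)[of ?t] by (simp add: dcut_def divide_nonpos_pos)
  show "dcut x \<le> - 1 / h" if "9 / 4 * h \<le> z x" "z x \<le> 11 / 4 * h"
  proof -
    have "cutoff' ?t \<le> - 1" using that h by (intro cutoff_props(9)) (simp_all add: le_divide_eq divide_le_eq)
    then show ?thesis unfolding dcut_def using h by (intro divide_right_mono) auto
  qed
qed

lemma \<eta>_line: "((\<lambda>s. \<eta> (x + s *\<^sub>R e)) has_real_derivative d\<eta> x \<bullet> e) (at 0)"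
proof -
  \<comment> \<open>By Pythagoras \<open>(norm (pr y))\<^sup>2\<close> is the full squared distance
    minus the squared height, hence a quadratic polynomial along any line.\<close>
  define P where "P s = r\<^sup>2 - ((x - q) \<bullet> (x - q) + 2 * s * ((x - q) \<bullet> e) + s\<^sup>2 * (e \<bullet> e) - (z x + s * (e \<bullet> n))\<^sup>2)" for s
  have np: "(norm (pr y))\<^sup>2 = (y - q) \<bullet> (y - q) - (z y)\<^sup>2" for y
    using perp_simps(4)[OF n, of "y - q"] by (simp add: pr_def z_def power2_norm_eq_inner)
  have zl: "z (x + s *\<^sub>R e) = z x + s * (e \<bullet> n)" for s
    by (simp add: z_def inner_diff_left inner_add_left)
  have P: "\<eta> (x + s *\<^sub>R e) = (max 0 (P s))\<^sup>2" for s
    unfolding \<eta>_def E_def np zl P_def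
    by (simp add: inner_add_left inner_add_right inner_diff_left inner_diff_right inner_commute power2_eq_square algebra_simps)
  have "(P has_real_derivative - (2 * ((x - q) \<bullet> e) - 2 * z x * (e \<bullet> n))) (at 0)"
    unfolding P_def[abs_def] by (auto intro!: derivative_eq_intros simp: algebra_simps)
  from DERIV_chain2[where f="\<lambda>t. (max 0 t)\<^sup>2" and g=P and x=0 and s=UNIV, OF has_real_derivative_max_square this]
  have d: "((\<lambda>s. (max 0 (P s))\<^sup>2) has_real_derivative 2 * max 0 (P 0) * (- (2 * ((x - q) \<bullet> e) - 2 * z x * (e \<bullet> n)))) (at 0)" .
  have P0: "max 0 (P 0) = E x" unfolding P_def E_def np by simp
  have pe: "(x - q) \<bullet> e - z x * (e \<bullet> n) = pr x \<bullet> e"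
    by (simp add: pr_def perp_def z_def inner_diff_left inner_diff_right inner_commute)
  have "2 * max 0 (P 0) * (- (2 * ((x - q) \<bullet> e) - 2 * z x * (e \<bullet> n))) = - 4 * E x * ((x - q) \<bullet> e - z x * (e \<bullet> n))"
    unfolding P0 by (simp add: algebra_simps)
  also have "\<dots> = d\<eta> x \<bullet> e" unfolding pe by (simp add: d\<eta>_def)
  finally show ?thesis using d unfolding P by simp
qed

lemma cut_line: "((\<lambda>s. cut (x + s *\<^sub>R e)) has_real_derivative dcut x * (e \<bullet> n)) (at 0)"
proof -
  have l: "((\<lambda>s. (z x + s * (e \<bullet> n) - 2 * h) / h) has_real_derivative (e \<bullet> n) / h) (at 0)"
    using h by (auto intro!: derivative_eq_intros)
  have "((\<lambda>s. cutoff ((z x + s * (e \<bullet> n) - 2 * h) / h)) has_real_derivative cutoff' ((z x - 2 * h) / h) * ((e \<bullet> n) / h)) (at 0)"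
    using DERIV_chain2[where f=cutoff and g="\<lambda>s. (z x + s * (e \<bullet> n) - 2 * h) / h" and x=0 and s=UNIV, OF has_real_derivative_cutoff l] by simp
  moreover have "z (x + s *\<^sub>R e) = z x + s * (e \<bullet> n)" for s by (simp add: z_def inner_diff_left inner_add_left)
  ultimately show ?thesis by (simp add: cut_def dcut_def)
qed

lemma axial_invariance: "\<eta> (x + t *\<^sub>R n) = \<eta> x" "d\<eta> (x + t *\<^sub>R n) = d\<eta> x" "m (x + t *\<^sub>R n) = m x"
  by (simp_all add: \<eta>_def d\<eta>_def E_def pr_add m_def a_add b_add)

lemma open_A: "open A"
  unfolding A_def by (intro open_Collect_conj open_Collect_less continuous_intros)

lemma m_bound:
  assumes "norm (pr x) \<le> \<sigma>" shows "\<bar>m x\<bar> \<le> h"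
proof -
  have "- (h / 8) \<le> a x" "a x \<le> h / 8" "- (h / 8) \<le> b x - h" "b x - h \<le> h / 8"
    using ab_bounds[OF assms] by linarith+
  moreover have "2 * m x = a x + b x" by (simp add: m_def)
  ultimately have "m x \<le> h" "- m x \<le> h" using h by linarith+
  then show ?thesis by (rule abs_leI)
qed

text \<open>Where the weights can be nonzero, the frontier of \<open>A\<close> is the graph of the
  wall, which misses the open set \<open>\<Omega>\<close>; on the lateral surface
  \<open>norm (pr x) = \<sigma>\<close> the weights vanish because
  \<open>r < \<sigma>\<close>.\<close>

lemma wall_integration_by_parts:
  fixes u :: "real^3 \<Rightarrow> real^3" and \<theta> \<theta>' :: "real^3 \<Rightarrow> real"
  assumes u: "u \<in> W12_0_space \<Omega>" and G: "weak_gradient \<Omega> u G" "\<And>i. G i \<in> L2_space \<Omega>"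
    and c: "continuous_on UNIV \<theta>" "continuous_on UNIV \<theta>'"
    and der: "\<And>x. ((\<lambda>s. \<theta> (x + s *\<^sub>R e)) has_real_derivative \<theta>' x) (at 0)"
    and cyl: "\<And>x. r \<le> norm (pr x) \<Longrightarrow> \<theta> x = 0 \<and> \<theta>' x = 0"
    and top: "\<And>x. 3 * h \<le> z x \<Longrightarrow> \<theta> x = 0 \<and> \<theta>' x = 0"
  shows "integrable lebesgue (\<lambda>x. (indicator A x * \<theta>' x) *\<^sub>R u x)"
    and "integrable lebesgue (\<lambda>x. (indicator A x * \<theta> x) *\<^sub>R G i x)"
    and "(\<integral>x. (indicator A x * \<theta>' x) *\<^sub>R u x \<partial>lebesgue) +
      (\<Sum>i\<in>UNIV. e $ i *\<^sub>R (\<integral>x. (indicator A x * \<theta> x) *\<^sub>R G i x \<partial>lebesgue)) = 0"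
proof -
  have der': "((\<lambda>s. \<theta> (x + s *\<^sub>R e)) has_vector_derivative \<theta>' x) (at 0)" for x
    using der[of x] by (simp add: has_real_derivative_iff_has_vector_derivative)
  have Az: "- h \<le> z x" if "x \<in> A" for x
    using that ab_bounds(1)[of x] h by (auto simp: A_def)
  have bdd: "\<theta> x = 0 \<and> \<theta>' x = 0" if x: "x \<in> A" "norm x > norm q + r + 4 * h" for x
  proof (rule ccontr)
    assume c: "\<not> (\<theta> x = 0 \<and> \<theta>' x = 0)"
    then have "norm (pr x) < r" "z x < 3 * h" using cyl[of x] top[of x] by (auto simp: not_le[symmetric])
    moreover have "norm x \<le> norm q + norm (pr x) + \<bar>z x\<bar>"
      using arg_cong[OF decomp[of x], of norm] norm_triangle_ineq[of "q + pr x" "z x *\<^sub>R n"] norm_triangle_ineq[of q "pr x"] n by simp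
    ultimately show False using Az[OF x(1)] x(2) h by linarith
  qed
  have sub: "x \<in> \<Omega>" if x: "x \<in> A" "\<theta> x \<noteq> 0 \<or> \<theta>' x \<noteq> 0" for x
  proof -
    have "z x < 3 * h" using x top[of x] by (auto simp: not_le[symmetric])
    then have "x \<in> W a (\<lambda>x. 7 * h)" using x h by (simp add: W_def A_def)
    then show ?thesis using above_wall by blast
  qed
  have bd: "\<exists>N. open N \<and> x \<in> N \<and> (\<forall>y\<in>N. \<theta> y = 0 \<and> \<theta>' y = 0)" if x: "x \<in> frontier A" "x \<in> \<Omega>" for x
  proof -
    have clA: "closure A \<subseteq> {x. norm (pr x) \<le> \<sigma> \<and> a x \<le> z x}"
      by (rule closure_minimal) (auto simp: A_def intro!: closed_Collect_conj closed_Collect_le continuous_intros)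
    have xc: "norm (pr x) \<le> \<sigma>" "a x \<le> z x" "x \<notin> A"
      using x(1) clA open_A by (auto simp: frontier_def interior_open)
    have "norm (pr x) = \<sigma>"
    proof (rule ccontr)
      assume "norm (pr x) \<noteq> \<sigma>"
      then have "z x = a x" using xc by (auto simp: A_def)
      moreover have "\<bar>a x\<bar> < s" using ab_bounds(1)[OF xc(1)] h hs by linarith
      ultimately have "x \<in> frontier \<Omega>" using wall_iff[of x] xc \<sigma> by simp
      then show False using x(2) open_\<Omega> by (simp add: frontier_def interior_open)
    qed
    moreover have "open {y. r < norm (pr y)}" by (intro open_Collect_less continuous_intros)
    ultimately show ?thesis using cyl r by (intro exI[of _ "{y. r < norm (pr y)}"]) auto
  qed
  note I = W12_0_integration_by_parts[OF open_\<Omega> u G open_A c der' bdd sub bd]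
  show "integrable lebesgue (\<lambda>x. (indicator A x * \<theta>' x) *\<^sub>R u x)" by (rule I(1))
  show "integrable lebesgue (\<lambda>x. (indicator A x * \<theta> x) *\<^sub>R G i x)" by (rule I(2))
  show "(\<integral>x. (indicator A x * \<theta>' x) *\<^sub>R u x \<partial>lebesgue) +
      (\<Sum>i\<in>UNIV. e $ i *\<^sub>R (\<integral>x. (indicator A x * \<theta> x) *\<^sub>R G i x \<partial>lebesgue)) = 0" by (rule I(3))
qed

lemma slab_integral_bound:
  fixes f :: "real^3 \<Rightarrow> real"
  assumes f: "integrable lebesgue f" and B: "\<And>x. \<bar>f x\<bar> \<le> B" and supp: "\<And>x. x \<notin> slab r (- h) (3 * h) \<Longrightarrow> f x = 0"
  shows "\<bar>\<integral>x. f x \<partial>lebesgue\<bar> \<le> B * (16 * r\<^sup>2 * h)"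
proof -
  let ?D = "slab r (- h) (3 * h)"
  have D: "?D \<in> lmeasurable" "measure lebesgue ?D \<le> 16 * r\<^sup>2 * h"
    using slab_measure[of r "- h" "3 * h"] r h by (auto simp: algebra_simps)
  have B0: "B \<ge> 0" using B[of 0] by linarith
  have "\<bar>\<integral>x. f x \<partial>lebesgue\<bar> \<le> (\<integral>x. B * indicator ?D x \<partial>lebesgue)"
    unfolding real_norm_def[symmetric]
  proof (rule Bochner_Integration.integral_norm_bound_integral[OF f])
    show "integrable lebesgue (\<lambda>x. B * indicator ?D x)"
      using D(1) by (intro integrable_mult_right integrable_real_indicator) (auto simp: fmeasurable_def)
    show "norm (f x) \<le> B * indicator ?D x" for x
      using B[of x] supp[of x] by (cases "x \<in> ?D") auto
  qed
  also have "\<dots> = B * measure lebesgue ?D" using D(1) by simp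
  also have "\<dots> \<le> B * (16 * r\<^sup>2 * h)" using D(2) B0 by (intro mult_left_mono)
  finally show ?thesis .
qed

lemma integrable_slab_continuous:
  fixes f :: "real^3 \<Rightarrow> real"
  assumes "continuous_on UNIV f" "\<And>x. x \<notin> slab r (- h) (3 * h) \<Longrightarrow> f x = 0"
  shows "integrable lebesgue f"
proof -
  have "integrable lebesgue (\<lambda>x. indicator (slab r (- h) (3 * h)) x *\<^sub>R f x)"
    using assms(1) by (intro integrable_lebesgue_of_lborel borel_integrable_compact slab_compact) (rule continuous_on_subset, auto)
  moreover have "(\<lambda>x. indicator (slab r (- h) (3 * h)) x *\<^sub>R f x) = f"
    using assms(2) by (auto simp: fun_eq_iff indicator_def)
  ultimately show ?thesis by simp
qed

end

lemma ennreal_le_of_square_le: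
  assumes "J\<^sup>2 \<le> (ennreal c)\<^sup>2" "0 \<le> c" shows "J \<le> ennreal c"
proof (cases J)
  case (real j)
  have "ennreal (j\<^sup>2) \<le> ennreal (c\<^sup>2)" using assms real by (simp add: ennreal_power)
  then have "j\<^sup>2 \<le> c\<^sup>2" by (subst (asm) ennreal_le_iff) auto
  then have "j \<le> c" using assms(2) by (rule power2_le_imp_le)
  then show ?thesis using real by (simp add: ennreal_leI)
next
  case top
  then show ?thesis using assms by (simp add: ennreal_power top_unique power2_eq_square ennreal_mult_eq_top_iff)
qed

context gap
begin

text \<open>The second integration by parts. The parabola
  \<open>(z x - a x) * (b x - z x) / 2\<close> vanishes on both graphs and has derivative
  \<open>m x - z x\<close> along \<open>n\<close>. The Hessian is known only inside the fluid, so
  the parabola is first composed with \<open>ramp \<epsilon>\<close>, and \<epsilon> tends to 0 at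
  the end. Cauchy-Schwarz combines the bounds \<open>h\<^sup>2 / 4\<close> for the parabola,
  \<open>4 * r ^ 3\<close> for \<open>d\<eta>\<close> and the root of the gap volume.\<close>

lemma hessian_term_bound:
  fixes u :: "real^3 \<Rightarrow> real^3"
  defines "U \<equiv> {x. norm (pr x) < \<sigma>} \<inter> (\<Omega> - closure V)"
  assumes G: "weak_gradient \<Omega> u G"
    and H: "weak_hessian U u H"
    and N: "L2_norm U (\<lambda>x. sqrt (\<Sum>i\<in>UNIV. \<Sum>j\<in>UNIV. (norm (H i j x))\<^sup>2)) \<le> ennreal N" "N \<ge> 0"
    and int: "\<And>l i. integrable lebesgue (\<lambda>x. (indicator (W a b) x * ((m x - z x) * d\<eta> x $ l)) *\<^sub>R G i x)"
  shows "\<bar>\<Sum>l\<in>UNIV. \<Sum>i\<in>UNIV. n $ i * (\<integral>x. (indicator (W a b) x * ((m x - z x) * d\<eta> x $ l)) *\<^sub>R G i x \<partial>lebesgue) $ l\<bar>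
    \<le> 4 * r ^ 4 * h\<^sup>2 * sqrt h * N"
proof -
  have openU: "open U"
    unfolding U_def using open_\<Omega> by (intro open_Int open_Diff open_Collect_less continuous_intros) auto
  have U\<Omega>: "U \<subseteq> \<Omega>" by (auto simp: U_def)
  obtain GU where GU: "weak_gradient U u GU" "\<And>i j. weak_pd U j (GU i) (H i j)"
    using H unfolding weak_hessian_def by blast
  have GU_H: "weak_gradient U (GU i) (H i)" for i using GU(2) by (simp add: weak_gradient_def)
  have lGU: "locally_integrable_on (GU i) U" for i using GU(1) by (simp add: weak_gradient_def weak_pd_def)
  have lH: "locally_integrable_on (H i j) U" for i j using GU(2)[of j i] by (simp add: weak_pd_def)
  \<comment> \<open>The Hessian comes with its own gradient \<open>GU\<close> on \<open>U\<close>;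
    uniqueness allows the exchange with the gradient \<open>G\<close> on
    \<open>\<Omega>\<close>.\<close>
  have aeG: "AE x in lebesgue. \<forall>i. x \<in> U \<longrightarrow> GU i x = G i x"
    by (rule weak_pd_euclidean_unique[OF openU GU(1)])
       (use G U\<Omega> in \<open>auto simp: weak_gradient_def intro: weak_pd_mono\<close>)
  define kk where "kk x = (z x - a x) * (b x - z x) / 2" for x
  have kk_cont: "continuous_on S kk" for S unfolding kk_def[abs_def] by (intro continuous_intros) auto
  have ab: "a x < b x" "- h \<le> a x" "b x \<le> 2 * h" if "norm (pr x) \<le> \<sigma>" for x
    using ab_bounds[OF that] h by linarith+
  have kk_pos: "a x < z x \<and> z x < b x" if "norm (pr x) \<le> \<sigma>" "kk x > 0" for x
    using that ab(1)[OF that(1)] by (auto simp: kk_def zero_less_mult_iff)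
  have kk_le: "kk x \<le> h\<^sup>2 / 4" if "norm (pr x) \<le> \<sigma>" for x
  proof -
    have "0 \<le> (z x - a x - (b x - z x))\<^sup>2" by simp
    moreover have "(b x - a x)\<^sup>2 = (z x - a x - (b x - z x))\<^sup>2 + 8 * kk x"
      by (simp add: kk_def power2_eq_square field_simps)
    ultimately have "8 * kk x \<le> (b x - a x)\<^sup>2" by linarith
    also have "\<dots> \<le> (5 / 4 * h)\<^sup>2" using ab_bounds[OF that] h by (intro power_mono) linarith+
    also have "\<dots> \<le> 2 * h\<^sup>2" by (simp add: power2_eq_square)
    finally show ?thesis by simp
  qed
  \<comment> \<open>\<open>H\<close> is only locally integrable on \<open>U\<close>, so the weight
    must have compact support there. Within the cylinder \<open>kk\<close> is positive only between
    the graphs, hence this compact set lies in the gap.\<close>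
  define C where "C \<epsilon> = slab r (- h) (2 * h) \<inter> {x. \<epsilon> \<le> kk x}" for \<epsilon>
  have C: "compact (C \<epsilon>)" "\<epsilon> > 0 \<Longrightarrow> C \<epsilon> \<subseteq> W a b" for \<epsilon>
  proof -
    show "compact (C \<epsilon>)" unfolding C_def
      by (intro compact_Int_closed slab_compact closed_Collect_le continuous_intros kk_cont)
    assume "\<epsilon> > 0"
    then show "C \<epsilon> \<subseteq> W a b" using kk_pos r by (force simp: C_def slab_def W_def)
  qed
  have gapU: "W a b \<subseteq> U" using gap_subset by (auto simp: U_def W_def)
  define \<psi> where "\<psi> \<epsilon> l x = ramp \<epsilon> (kk x) * d\<eta> x $ l" for \<epsilon> l x
  define \<psi>' where "\<psi>' \<epsilon> l x = ramp' \<epsilon> (kk x) * (m x - z x) * d\<eta> x $ l" for \<epsilon> l x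
  have outC: "ramp \<epsilon> (kk x) * d\<eta> x $ l = 0" "ramp' \<epsilon> (kk x) * (m x - z x) * d\<eta> x $ l = 0"
    if "\<epsilon> > 0" "x \<notin> C \<epsilon>" for \<epsilon> l x
  proof -
    have "kk x \<le> \<epsilon> \<or> r \<le> norm (pr x)"
    proof (rule ccontr)
      assume "\<not> (kk x \<le> \<epsilon> \<or> r \<le> norm (pr x))"
      then have k: "\<epsilon> < kk x" "norm (pr x) < r" by auto
      then have "a x < z x \<and> z x < b x" using kk_pos[of x] r that(1) by simp
      then have "- h \<le> z x \<and> z x \<le> 2 * h" using ab[of x] k r by simp
      then show False using that k by (auto simp: C_def slab_def)
    qed
    then show "ramp \<epsilon> (kk x) * d\<eta> x $ l = 0" "ramp' \<epsilon> (kk x) * (m x - z x) * d\<eta> x $ l = 0"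
      using ramp_props(4,7)[OF that(1)] outside_cylinder(2) by auto
  qed
  have \<psi>_cont: "continuous_on UNIV (\<psi> \<epsilon> l)" "continuous_on UNIV (\<psi>' \<epsilon> l)" if "\<epsilon> > 0" for \<epsilon> l
  proof -
    have c: "continuous_on UNIV (\<lambda>x. ramp \<epsilon> (kk x))" "continuous_on UNIV (\<lambda>x. ramp' \<epsilon> (kk x))"
      using continuous_on_compose2[OF ramp_props(9)[OF that, of UNIV] kk_cont] continuous_on_compose2[OF ramp_props(10)[OF that, of UNIV] kk_cont] by auto
    show "continuous_on UNIV (\<psi> \<epsilon> l)" "continuous_on UNIV (\<psi>' \<epsilon> l)"
      unfolding \<psi>_def[abs_def] \<psi>'_def[abs_def]
      by (intro continuous_on_mult continuous_on_diff c continuous_on_component continuous_bumps continuous_z)+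
  qed
  have \<psi>_der: "((\<lambda>s. \<psi> \<epsilon> l (x + s *\<^sub>R n)) has_vector_derivative \<psi>' \<epsilon> l x) (at 0)" if "\<epsilon> > 0" for \<epsilon> l x
  proof -
    have "((\<lambda>s. (z x + s - a x) * (b x - (z x + s)) / 2) has_real_derivative m x - z x) (at 0)"
      by (auto intro!: derivative_eq_intros simp: m_def field_simps)
    then have k: "((\<lambda>s. kk (x + s *\<^sub>R n)) has_real_derivative m x - z x) (at 0)"
      by (simp add: kk_def z_add a_add b_add)
    have "((\<lambda>s. ramp \<epsilon> (kk (x + s *\<^sub>R n))) has_real_derivative ramp' \<epsilon> (kk x) * (m x - z x)) (at 0)"
      using DERIV_chain2[where f="ramp \<epsilon>" and g="\<lambda>s. kk (x + s *\<^sub>R n)" and x=0 and s=UNIV, OF ramp_props(1)[OF that] k] by simp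
    from DERIV_cmult_right[OF this, of "d\<eta> x $ l"]
    show ?thesis by (simp add: \<psi>_def \<psi>'_def axial_invariance has_real_derivative_iff_has_vector_derivative)
  qed
  define Hn where "Hn i x = (\<Sum>j\<in>UNIV. n $ j *\<^sub>R H i j x)" for i x
  define Y where "Y l i = (\<integral>x. (indicator (W a b) x * ((m x - z x) * d\<eta> x $ l)) *\<^sub>R G i x \<partial>lebesgue)" for l i
  define X where "X \<epsilon> l i = (\<integral>x. \<psi>' \<epsilon> l x *\<^sub>R G i x \<partial>lebesgue)" for \<epsilon> l i
  \<comment> \<open>The approximating integrand is the limiting one times a factor
    \<open>ramp'\<close> between 0 and 1; this gives both the domination and the pointwise
    limit.\<close>
  have \<psi>'_eq: "\<psi>' \<epsilon> l x *\<^sub>R G i x = ramp' \<epsilon> (kk x) *\<^sub>R ((indicator (W a b) x * ((m x - z x) * d\<eta> x $ l)) *\<^sub>R G i x)" if "\<epsilon> > 0" for \<epsilon> l i x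
    using outC(2)[OF that, of x l] C(2)[OF that] by (cases "x \<in> W a b") (auto simp: \<psi>'_def mult.assoc)
  have ramp'_m: "(\<lambda>x. ramp' \<epsilon> (kk x)) \<in> borel_measurable lebesgue" if "\<epsilon> > 0" for \<epsilon>
    using borel_measurable_continuous_onI[OF continuous_on_compose2[OF ramp_props(10)[OF that, of UNIV] kk_cont[of UNIV]]]
    by (simp add: measurable_completion)
  have Xm: "(\<lambda>x. \<psi>' \<epsilon> l x *\<^sub>R G i x) \<in> borel_measurable lebesgue" if "\<epsilon> > 0" for \<epsilon> l i
    unfolding \<psi>'_eq[OF that] by (rule borel_measurable_scaleR[OF ramp'_m[OF that] borel_measurable_integrable[OF int]])
  have bound_ex: "\<exists>M. \<forall>x. \<bar>\<psi> \<epsilon> l x\<bar> \<le> M" "\<exists>M. \<forall>x. \<bar>\<psi>' \<epsilon> l x\<bar> \<le> M" if "\<epsilon> > 0" for \<epsilon> l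
    using continuous_compact_support_bounded[OF \<psi>_cont(1)[OF that, of l] C(1)[of \<epsilon>]] outC(1)[OF that]
      continuous_compact_support_bounded[OF \<psi>_cont(2)[OF that, of l] C(1)[of \<epsilon>]] outC(2)[OF that]
    unfolding \<psi>_def \<psi>'_def by (metis real_norm_def)+
  have CU: "C \<epsilon> \<subseteq> U" if "\<epsilon> > 0" for \<epsilon> using C(2)[OF that] gapU by blast
  have z0: "\<psi> \<epsilon> l x = 0" "\<psi>' \<epsilon> l x = 0" if "\<epsilon> > 0" "x \<notin> C \<epsilon>" for \<epsilon> l x
    using outC[OF that] by (simp_all add: \<psi>_def \<psi>'_def)
  have X_eq: "X \<epsilon> l i = - (\<integral>x. \<psi> \<epsilon> l x *\<^sub>R Hn i x \<partial>lebesgue)" if e: "\<epsilon> > 0" for \<epsilon> l i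
  proof -
    obtain M where M: "\<And>x. \<bar>\<psi>' \<epsilon> l x\<bar> \<le> M" using bound_ex(2)[OF e] by blast
    have "X \<epsilon> l i = (\<integral>x. \<psi>' \<epsilon> l x *\<^sub>R GU i x \<partial>lebesgue)"
      unfolding X_def
    proof (rule integral_cong_AE[OF Xm[OF e]])
      show "(\<lambda>x. \<psi>' \<epsilon> l x *\<^sub>R GU i x) \<in> borel_measurable lebesgue"
        by (rule borel_measurable_integrable, rule locally_integrable_mult(1)[OF lGU C(1) CU[OF e] borel_measurable_continuous_onI[OF \<psi>_cont(2)[OF e]] M z0(2)[OF e]])
      show "AE x in lebesgue. \<psi>' \<epsilon> l x *\<^sub>R G i x = \<psi>' \<epsilon> l x *\<^sub>R GU i x"
        using aeG
      proof eventually_elim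
        case (elim x)
        show ?case
        proof (cases "x \<in> C \<epsilon>")
          case True
          then have "x \<in> U" using CU[OF e] by blast
          then show ?thesis using elim by simp
        qed (simp add: z0(2)[OF e])
      qed
    qed
    also have "\<dots> = - (\<integral>x. \<psi> \<epsilon> l x *\<^sub>R Hn i x \<partial>lebesgue)"
      unfolding Hn_def
      by (rule weak_gradient_directional[OF openU GU_H C(1) CU[OF e] z0(1)[OF e] \<psi>_cont[OF e] \<psi>_der[OF e]])
    finally show ?thesis .
  qed
  have bound: "\<bar>\<Sum>l\<in>UNIV. \<Sum>i\<in>UNIV. n $ i * X \<epsilon> l i $ l\<bar> \<le> 4 * r ^ 4 * h\<^sup>2 * sqrt h * N" if e: "\<epsilon> > 0" for \<epsilon>
  proof -
    let ?C = "C \<epsilon>"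
    have iH: "integrable lebesgue (\<lambda>x. indicator ?C x *\<^sub>R H i j x)" for i j
      using lH[of i j] C(1)[of \<epsilon>] CU[OF e] by (auto simp: locally_integrable_on_def set_integrable_def)
    have iHn: "integrable lebesgue (\<lambda>x. \<psi> \<epsilon> l x *\<^sub>R Hn i x)" for l i
    proof -
      obtain M where M: "\<And>x. \<bar>\<psi> \<epsilon> l x\<bar> \<le> M" using bound_ex(1)[OF e] by blast
      have "integrable lebesgue (\<lambda>x. \<Sum>j\<in>UNIV. n $ j *\<^sub>R (\<psi> \<epsilon> l x *\<^sub>R H i j x))"
        by (intro Bochner_Integration.integrable_sum integrable_scaleR_right
            locally_integrable_mult(1)[OF lH C(1) CU[OF e] borel_measurable_continuous_onI[OF \<psi>_cont(1)[OF e]] M z0(1)[OF e]])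
      then show ?thesis by (simp add: Hn_def scaleR_sum_right mult.commute)
    qed
    define g where "g x = (\<Sum>l\<in>UNIV. \<Sum>i\<in>UNIV. n $ i * (\<psi> \<epsilon> l x *\<^sub>R Hn i x) $ l)" for x
    have ic: "integrable lebesgue (\<lambda>x. (\<psi> \<epsilon> l x *\<^sub>R Hn i x) $ l)" for l i
      by (rule integrable_bounded_linear[OF bounded_linear_vec_nth iHn])
    have g_int: "integrable lebesgue g"
      unfolding g_def[abs_def] by (intro Bochner_Integration.integrable_sum integrable_mult_right ic)
    have "(\<integral>x. g x \<partial>lebesgue) = (\<Sum>l\<in>UNIV. \<Sum>i\<in>UNIV. n $ i * (\<integral>x. (\<psi> \<epsilon> l x *\<^sub>R Hn i x) $ l \<partial>lebesgue))"
      unfolding g_def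
      by (simp only: Bochner_Integration.integral_sum Bochner_Integration.integrable_sum integrable_mult_right ic integral_mult_right_zero)
    also have "\<dots> = (\<Sum>l\<in>UNIV. \<Sum>i\<in>UNIV. n $ i * (\<integral>x. \<psi> \<epsilon> l x *\<^sub>R Hn i x \<partial>lebesgue) $ l)"
      by (intro sum.cong refl arg_cong[where f="\<lambda>y. _ * y"] integral_bounded_linear[OF bounded_linear_vec_nth iHn])
    also have "\<dots> = - (\<Sum>l\<in>UNIV. \<Sum>i\<in>UNIV. n $ i * X \<epsilon> l i $ l)"
      unfolding X_eq[OF e] by (simp add: sum_negf)
    finally have gX: "\<bar>\<Sum>l\<in>UNIV. \<Sum>i\<in>UNIV. n $ i * X \<epsilon> l i $ l\<bar> = norm (\<integral>x. g x \<partial>lebesgue)" by simp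
    define Hq where "Hq x = sqrt (\<Sum>i\<in>UNIV. \<Sum>j\<in>UNIV. (norm (H i j x))\<^sup>2)" for x
    have Hq0: "Hq x \<ge> 0" for x by (simp add: Hq_def sum_nonneg)
    have g_le: "\<bar>g x\<bar> \<le> h\<^sup>2 * r ^ 3 * (indicator ?C x * Hq x)" for x
    proof (cases "x \<in> ?C")
      case False
      then show ?thesis by (simp add: g_def z0(1)[OF e])
    next
      case True
      have g: "g x = ramp \<epsilon> (kk x) * (d\<eta> x \<bullet> (\<Sum>i\<in>UNIV. n $ i *\<^sub>R Hn i x))"
        unfolding g_def \<psi>_def inner_vec_def
        by (simp add: sum_distrib_left mult_ac)
      have g1: "\<bar>d\<eta> x \<bullet> (\<Sum>i\<in>UNIV. n $ i *\<^sub>R Hn i x)\<bar> \<le> (4 * r ^ 3) * Hq x"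
        unfolding Hn_def Hq_def by (rule abs_inner_le[OF d\<eta>_bound norm_weighted_double_sum_le[OF n]])
      have g2: "\<bar>ramp \<epsilon> (kk x)\<bar> \<le> h\<^sup>2 / 4"
      proof -
        have "norm (pr x) \<le> \<sigma>" using True r by (simp add: C_def slab_def)
        then have "max 0 (kk x) \<le> h\<^sup>2 / 4" using kk_le[of x] by (intro max.boundedI) simp_all
        then show ?thesis using ramp_props(2,3)[OF e, of "kk x"] by linarith
      qed
      have "\<bar>g x\<bar> \<le> h\<^sup>2 / 4 * ((4 * r ^ 3) * Hq x)"
        unfolding g abs_mult by (rule mult_mono[OF g2 g1]) simp_all
      then show ?thesis using True by simp
    qed
    define J where "J = (\<integral>\<^sup>+x. indicator ?C x * ennreal (indicator ?C x * Hq x) \<partial>lebesgue)"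
    have Hqm: "(\<lambda>x. indicator ?C x * Hq x) \<in> borel_measurable lebesgue"
    proof -
      have nm: "(\<lambda>x. norm (indicator ?C x *\<^sub>R H i j x)) \<in> borel_measurable lebesgue" for i j
        by (rule measurable_compose[OF borel_measurable_integrable[OF iH] borel_measurable_norm])
      have "(\<lambda>x. sqrt (\<Sum>i\<in>UNIV. \<Sum>j\<in>UNIV. (norm (indicator ?C x *\<^sub>R H i j x))\<^sup>2)) \<in> borel_measurable lebesgue"
        by (intro measurable_compose[OF _ borel_measurable_sqrt] borel_measurable_sum borel_measurable_power nm)
      moreover have "sqrt (\<Sum>i\<in>UNIV. \<Sum>j\<in>UNIV. (norm (indicator ?C x *\<^sub>R H i j x))\<^sup>2) = indicator ?C x * Hq x" for x
        by (cases "x \<in> ?C") (auto simp: Hq_def)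
      ultimately show ?thesis by simp
    qed
    have Cm: "?C \<in> lmeasurable" by (rule lmeasurable_compact[OF C(1)])
    have "J\<^sup>2 \<le> (\<integral>\<^sup>+x. (indicator ?C x)\<^sup>2 \<partial>lebesgue) * (\<integral>\<^sup>+x. (ennreal (indicator ?C x * Hq x))\<^sup>2 \<partial>lebesgue)"
      unfolding J_def
      by (intro Cauchy_Schwarz_nn_integral measurable_compose[OF Hqm measurable_ennreal] borel_measurable_indicator fmeasurableD[OF Cm])
    also have "(\<integral>\<^sup>+x. (indicator ?C x)\<^sup>2 \<partial>lebesgue) = emeasure lebesgue ?C"
    proof -
      have "(indicator ?C x :: ennreal)\<^sup>2 = indicator ?C x" for x by (simp add: indicator_def)
      then show ?thesis using nn_integral_indicator[OF fmeasurableD[OF Cm]] by simp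
    qed
    also have "\<dots> \<le> ennreal (12 * r\<^sup>2 * h)"
    proof -
      have "measure lebesgue ?C \<le> measure lebesgue (slab r (- h) (2 * h))"
        by (rule measure_mono_fmeasurable[OF _ fmeasurableD[OF Cm] lmeasurable_compact[OF slab_compact]]) (simp add: C_def)
      also have "\<dots> \<le> 12 * r\<^sup>2 * h" using slab_measure(2)[of r "- h" "2 * h"] r h by simp
      finally show ?thesis using Cm by (simp add: emeasure_eq_measure2 fmeasurableD2 ennreal_leI)
    qed
    also have "(\<integral>\<^sup>+x. (ennreal (indicator ?C x * Hq x))\<^sup>2 \<partial>lebesgue) \<le> (\<integral>\<^sup>+x\<in>U. ennreal ((norm (Hq x))\<^sup>2) \<partial>lebesgue)"
    proof (rule nn_integral_mono)
      fix x
      show "(ennreal (indicator ?C x * Hq x))\<^sup>2 \<le> ennreal ((norm (Hq x))\<^sup>2) * indicator U x"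
        using CU[OF e] Hq0[of x] by (cases "x \<in> ?C") (auto simp: ennreal_power)
    qed
    also have "\<dots> \<le> ennreal (N\<^sup>2)"
      using N unfolding Hq_def[symmetric] by (rule L2_norm_le_imp)
    finally have "J\<^sup>2 \<le> ennreal (12 * r\<^sup>2 * h) * ennreal (N\<^sup>2)" by (simp add: mult_mono)
    also have "\<dots> \<le> (ennreal (4 * r * sqrt h * N))\<^sup>2"
    proof -
      \<comment> \<open>The volume constant 12 is rounded up to 16 to obtain a perfect
        square.\<close>
      have "12 * r\<^sup>2 * h * N\<^sup>2 \<le> (4 * r * sqrt h * N)\<^sup>2" using h by (simp add: power_mult_distrib)
      then have "ennreal (12 * r\<^sup>2 * h * N\<^sup>2) \<le> ennreal ((4 * r * sqrt h * N)\<^sup>2)" by (rule ennreal_leI)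
      moreover have "ennreal (12 * r\<^sup>2 * h * N\<^sup>2) = ennreal (12 * r\<^sup>2 * h) * ennreal (N\<^sup>2)"
        using h by (intro ennreal_mult) auto
      moreover have "(ennreal (4 * r * sqrt h * N))\<^sup>2 = ennreal ((4 * r * sqrt h * N)\<^sup>2)"
        using r h N by (intro ennreal_power) auto
      ultimately show ?thesis by simp
    qed
    finally have J2: "J\<^sup>2 \<le> (ennreal (4 * r * sqrt h * N))\<^sup>2" .
    have J: "J \<le> ennreal (4 * r * sqrt h * N)"
    proof (rule ennreal_le_of_square_le)
      show "J\<^sup>2 \<le> (ennreal (4 * r * sqrt h * N))\<^sup>2" by (rule J2)
      show "0 \<le> 4 * r * sqrt h * N" using r h N by simp
    qed
    have "ennreal (norm (\<integral>x. g x \<partial>lebesgue)) \<le> (\<integral>\<^sup>+x. ennreal (norm (g x)) \<partial>lebesgue)"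
      by (rule integral_norm_bound_ennreal[OF g_int])
    also have "\<dots> \<le> (\<integral>\<^sup>+x. ennreal (h\<^sup>2 * r ^ 3) * (indicator ?C x * ennreal (indicator ?C x * Hq x)) \<partial>lebesgue)"
    proof (rule nn_integral_mono)
      fix x
      have "ennreal (norm (g x)) \<le> ennreal (h\<^sup>2 * r ^ 3 * (indicator ?C x * Hq x))"
        using g_le[of x] by (intro ennreal_leI) simp
      also have "\<dots> = ennreal (h\<^sup>2 * r ^ 3) * (indicator ?C x * ennreal (indicator ?C x * Hq x))"
        using h r Hq0[of x] by (cases "x \<in> ?C") (auto simp: ennreal_mult)
      finally show "ennreal (norm (g x)) \<le> ennreal (h\<^sup>2 * r ^ 3) * (indicator ?C x * ennreal (indicator ?C x * Hq x))" .
    qed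
    also have "\<dots> = ennreal (h\<^sup>2 * r ^ 3) * J"
      unfolding J_def
      by (intro nn_integral_cmult borel_measurable_times_ennreal measurable_compose[OF Hqm measurable_ennreal] borel_measurable_indicator fmeasurableD[OF Cm])
    also have "\<dots> \<le> ennreal (h\<^sup>2 * r ^ 3) * ennreal (4 * r * sqrt h * N)" by (intro mult_left_mono J) simp
    also have "\<dots> = ennreal (h\<^sup>2 * r ^ 3 * (4 * r * sqrt h * N))" using r h N by (simp add: ennreal_mult)
    finally have "norm (\<integral>x. g x \<partial>lebesgue) \<le> h\<^sup>2 * r ^ 3 * (4 * r * sqrt h * N)"
      using r h N by (subst (asm) ennreal_le_iff) auto
    also have "\<dots> = 4 * r ^ 4 * h\<^sup>2 * sqrt h * N" by (simp add: eval_nat_numeral)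
    finally show ?thesis unfolding gX .
  qed
  define \<epsilon> where "\<epsilon> k = 1 / real (Suc k)" for k
  have e: "\<epsilon> k > 0" for k by (simp add: \<epsilon>_def)
  have e0: "\<epsilon> \<longlonglongrightarrow> 0" using LIMSEQ_inverse_real_of_nat by (simp add: \<epsilon>_def[abs_def] inverse_eq_divide)
  \<comment> \<open>At each point of the gap \<open>kk\<close> exceeds
    \<open>2 * \<epsilon> k\<close> for large \<open>k\<close>, so the factor \<open>ramp'\<close>
    is eventually 1.\<close>
  have "(\<lambda>k. X (\<epsilon> k) l i) \<longlonglongrightarrow> Y l i" for l i
    unfolding X_def Y_def
  proof (rule integral_dominated_convergence[where w="\<lambda>x. norm ((indicator (W a b) x * ((m x - z x) * d\<eta> x $ l)) *\<^sub>R G i x)"])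
    show "integrable lebesgue (\<lambda>x. norm ((indicator (W a b) x * ((m x - z x) * d\<eta> x $ l)) *\<^sub>R G i x))"
      by (rule integrable_norm[OF int])
    show "(\<lambda>x. (indicator (W a b) x * ((m x - z x) * d\<eta> x $ l)) *\<^sub>R G i x) \<in> borel_measurable lebesgue"
      by (rule borel_measurable_integrable[OF int])
    show "(\<lambda>x. \<psi>' (\<epsilon> k) l x *\<^sub>R G i x) \<in> borel_measurable lebesgue" for k by (rule Xm[OF e])
    show "AE x in lebesgue. norm (\<psi>' (\<epsilon> k) l x *\<^sub>R G i x) \<le> norm ((indicator (W a b) x * ((m x - z x) * d\<eta> x $ l)) *\<^sub>R G i x)" for k
    proof (intro AE_I2)
      fix x
      have "\<bar>ramp' (\<epsilon> k) (kk x)\<bar> \<le> 1" using ramp_props(5,6)[OF e[of k], of "kk x"] by simp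
      then show "norm (\<psi>' (\<epsilon> k) l x *\<^sub>R G i x) \<le> norm ((indicator (W a b) x * ((m x - z x) * d\<eta> x $ l)) *\<^sub>R G i x)"
        unfolding \<psi>'_eq[OF e] norm_scaleR[of "ramp' (\<epsilon> k) (kk x)"] by (intro mult_left_le_one_le) auto
    qed
    show "AE x in lebesgue. (\<lambda>k. \<psi>' (\<epsilon> k) l x *\<^sub>R G i x) \<longlonglongrightarrow> (indicator (W a b) x * ((m x - z x) * d\<eta> x $ l)) *\<^sub>R G i x"
    proof (intro AE_I2)
      fix x
      show "(\<lambda>k. \<psi>' (\<epsilon> k) l x *\<^sub>R G i x) \<longlonglongrightarrow> (indicator (W a b) x * ((m x - z x) * d\<eta> x $ l)) *\<^sub>R G i x"
      proof (cases "x \<in> W a b")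
        case True
        then have "kk x / 2 > 0" by (simp add: kk_def W_def)
        then have "\<forall>\<^sub>F k in sequentially. \<epsilon> k < kk x / 2" by (rule order_tendstoD(2)[OF e0])
        then have "\<forall>\<^sub>F k in sequentially. (indicator (W a b) x * ((m x - z x) * d\<eta> x $ l)) *\<^sub>R G i x = \<psi>' (\<epsilon> k) l x *\<^sub>R G i x"
        proof eventually_elim
          case (elim k)
          then have "ramp' (\<epsilon> k) (kk x) = 1" by (intro ramp_props(8)[OF e]) simp
          then show ?case unfolding \<psi>'_eq[OF e] by simp
        qed
        then show ?thesis by (rule Lim_transform_eventually[OF tendsto_const])
      qed (simp add: \<psi>'_eq[OF e])
    qed
  qed
  then have "(\<lambda>k. \<bar>\<Sum>l\<in>UNIV. \<Sum>i\<in>UNIV. n $ i * X (\<epsilon> k) l i $ l\<bar>) \<longlonglongrightarrow> \<bar>\<Sum>l\<in>UNIV. \<Sum>i\<in>UNIV. n $ i * Y l i $ l\<bar>"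
    by (intro tendsto_rabs tendsto_sum tendsto_mult tendsto_const tendsto_vec_nth)
  then show ?thesis
    unfolding Y_def[symmetric] by (rule LIMSEQ_le_const2) (use bound[OF e] in blast)
qed

end

section \<open>The rigid velocity field and the squeezing estimate at one instant\<close>

lemma weak_gradient_rigid_field:
  fixes v0 \<omega> p :: "real^3"
  shows "weak_gradient V (\<lambda>x. v0 + cross3 \<omega> (x - p)) (\<lambda>i x. cross3 \<omega> (axis i 1))"
proof -
  have d: "((\<lambda>x. v0 + cross3 \<omega> (x - p)) has_derivative cross3 \<omega>) (at x)" for x
  proof -
    have "((\<lambda>x. cross3 \<omega> (x - p)) has_derivative (\<lambda>h. cross3 \<omega> h)) (at x)"
      by (rule bounded_linear.has_derivative[OF cross3_bounded_linear]) (auto intro!: derivative_eq_intros)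
    then show ?thesis by (auto intro!: derivative_eq_intros)
  qed
  have p: "pd i (\<lambda>x. v0 + cross3 \<omega> (x - p)) = (\<lambda>x. cross3 \<omega> (axis i 1))" for i
    by (rule ext) (rule pd_eqI[OF d])
  have "weak_pd V i (\<lambda>x. v0 + cross3 \<omega> (x - p)) (pd i (\<lambda>x. v0 + cross3 \<omega> (x - p)))" for i
    by (rule classical_weak_pd) (use d in \<open>auto simp: p intro: differentiableI\<close>)
  then show ?thesis unfolding weak_gradient_def p by blast
qed

lemma cross3_axis_expansion: "(\<Sum>i\<in>UNIV. n $ i *\<^sub>R cross3 \<omega> (axis i 1)) = cross3 \<omega> n"
proof -
  have "cross3 \<omega> n = cross3 \<omega> (\<Sum>i\<in>UNIV. n $ i *\<^sub>R axis i 1)"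
    using basis_expansion[of n] by (simp add: scalar_mult_eq_scaleR)
  also have "\<dots> = (\<Sum>i\<in>UNIV. n $ i *\<^sub>R cross3 \<omega> (axis i 1))"
    by (simp only: linear_sum[OF bounded_linear.linear[OF cross3_bounded_linear]] cross_mult_right)
  finally show ?thesis by simp
qed

context gap
begin

text \<open>The integrand has one sign, so half the radius and the middle half of the transition
  layer suffice: there \<open>\<eta>\<close> is at least \<open>r ^ 4 / 2\<close>,
  \<open>- dcut\<close> at least \<open>1 / h\<close>, and the volume at least
  \<open>(r / 2)\<^sup>2 * (h / 2)\<close>.\<close>

lemma flux_weight_bound: "r ^ 6 / 16 \<le> - (\<integral>x. \<eta> x * dcut x \<partial>lebesgue)"
proof -
  let ?S = "slab (r / 2) (9 / 4 * h) (11 / 4 * h)"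
  have S: "?S \<in> lmeasurable" "(r / 2)\<^sup>2 * (h / 2) \<le> measure lebesgue ?S"
    using slab_measure[of "r / 2" "9 / 4 * h" "11 / 4 * h"] r h by (auto simp: algebra_simps)
  have supp: "\<eta> x * dcut x = 0" if "x \<notin> slab r (- h) (3 * h)" for x
  proof -
    have "r \<le> norm (pr x) \<or> z x \<le> 2 * h \<or> 3 * h \<le> z x" using that h by (auto simp: slab_def)
    then show ?thesis using outside_cylinder(1) cut_props(5,6) by auto
  qed
  have i: "integrable lebesgue (\<lambda>x. - (\<eta> x * dcut x))"
    by (intro integrable_slab_continuous) (auto intro!: continuous_intros simp: supp)
  have "r ^ 6 / 16 \<le> (r ^ 4 / 2 * (1 / h)) * ((r / 2)\<^sup>2 * (h / 2))"
    using h by (simp add: power2_eq_square eval_nat_numeral)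
  also have "\<dots> \<le> (r ^ 4 / 2 * (1 / h)) * measure lebesgue ?S"
    using S r h by (intro mult_left_mono) auto
  also have "\<dots> = (\<integral>x. (r ^ 4 / 2 * (1 / h)) * indicator ?S x \<partial>lebesgue)"
    using S(1) by simp
  also have "\<dots> \<le> (\<integral>x. - (\<eta> x * dcut x) \<partial>lebesgue)"
  proof (rule integral_mono[OF _ i])
    show "integrable lebesgue (\<lambda>x. (r ^ 4 / 2 * (1 / h)) * indicator ?S x)"
      using S(1) by (intro integrable_mult_right integrable_real_indicator) (auto simp: fmeasurable_def)
    fix x
    show "(r ^ 4 / 2 * (1 / h)) * indicator ?S x \<le> - (\<eta> x * dcut x)"
    proof (cases "x \<in> ?S")
      case True
      then have x: "norm (pr x) \<le> r / 2" "9 / 4 * h \<le> z x" "z x \<le> 11 / 4 * h" by (auto simp: slab_def)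
      have "(r\<^sup>2 * (3 / 4))\<^sup>2 \<le> \<eta> x" unfolding \<eta>_def using E_bounds(4)[OF x(1)] by (intro power_mono) auto
      moreover have "(r\<^sup>2 * (3 / 4))\<^sup>2 = r ^ 4 * (9 / 16)" by (simp add: power_mult_distrib power_mult[symmetric] power_divide)
      moreover have "r ^ 4 / 2 \<le> r ^ 4 * (9 / 16)" using r by simp
      ultimately have "r ^ 4 / 2 \<le> \<eta> x" by linarith
      moreover have "1 / h \<le> - dcut x" using cut_props(9)[OF x(2,3)] by simp
      ultimately have "r ^ 4 / 2 * (1 / h) \<le> \<eta> x * (- dcut x)"
        using r h \<eta>_bound(1)[of x] by (intro mult_mono) auto
      then show ?thesis using True by simp
    next
      case False
      then show ?thesis using \<eta>_bound(1)[of x] cut_props(8)[of x] by (simp add: mult_nonneg_nonpos)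
    qed
  qed
  finally show ?thesis by simp
qed

lemma E_rho: "E (rho x) = E x" "\<eta> (rho x) = \<eta> x" "d\<eta> (rho x) = - d\<eta> x" "dcut (rho x) = dcut x"
  by (simp_all add: E_def \<eta>_def d\<eta>_def dcut_def rho_props)

text \<open>Two identities over \<open>A\<close> are added: the divergence tested with
  \<open>\<eta> * cut\<close>, and the integration along \<open>n\<close> with the weight
  \<open>d\<eta> * (m - z) * cut\<close>. The terms \<open>cut * (d\<eta> \<bullet> u)\<close>
  cancel. What remains is a gap term with the first normal derivative, left to
  \<open>hessian_term_bound\<close>, and terms in the body, where \<open>u\<close> is explicit; one
  of them is the flux \<open>n \<bullet> v0\<close>.\<close>

theorem squeezing_estimate:
  fixes u :: "real^3 \<Rightarrow> real^3" and v0 \<omega> :: "real^3"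
  defines "U \<equiv> {x. norm (pr x) < \<sigma>} \<inter> (\<Omega> - closure V)"
  assumes u: "u \<in> W12_0_space \<Omega>" and div: "weakly_div_free \<Omega> u"
    and rigid: "AE x in lebesgue. x \<in> V \<longrightarrow> u x = v0 + cross3 \<omega> (x - (q + h *\<^sub>R n))"
    and H: "weak_hessian U u H"
    and N: "L2_norm U (\<lambda>x. sqrt (\<Sum>i\<in>UNIV. \<Sum>j\<in>UNIV. (norm (H i j x))\<^sup>2)) \<le> ennreal N" "N \<ge> 0"
    and M: "norm v0 \<le> M" "norm \<omega> \<le> M"
  shows "\<bar>n \<bullet> v0\<bar> * (r ^ 6 / 16) \<le> 4 * r ^ 4 * h\<^sup>2 * sqrt h * N
    + M * (256 * h\<^sup>2 * r ^ 5 + 512 * r ^ 5 * h * (r + 2 * h) + 64 * C * r ^ 8)"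
proof -
  define v where "v x = v0 + cross3 \<omega> (x - (q + h *\<^sub>R n))" for x
  have M0: "M \<ge> 0" using M norm_ge_zero order_trans by blast
  obtain G where G: "weak_gradient \<Omega> u G" "\<And>i. G i \<in> L2_space \<Omega>"
    using u by (auto simp: W12_0_space_def W12_space_def)
  have \<Omega>m: "\<Omega> \<inter> space lebesgue \<in> sets lebesgue" using open_\<Omega> by (simp add: borel_open)
  have tr: "AE x in lebesgue. x \<in> \<Omega> \<longrightarrow> (\<Sum>i\<in>UNIV. G i x $ i) = 0"
  proof -
    obtain G' where G': "weak_gradient \<Omega> u G'" "AE x in lebesgue_on \<Omega>. (\<Sum>i\<in>UNIV. G' i x $ i) = 0"
      using div by (auto simp: weakly_div_free_def)
    have "AE x in lebesgue. x \<in> \<Omega> \<longrightarrow> (\<Sum>i\<in>UNIV. G' i x $ i) = 0"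
      using G'(2) unfolding AE_restrict_space_iff[OF \<Omega>m] .
    moreover have "AE x in lebesgue. \<forall>i. x \<in> \<Omega> \<longrightarrow> G i x = G' i x"
      by (rule weak_pd_euclidean_unique[OF open_\<Omega> G(1) G'(1)])
    ultimately show ?thesis by eventually_elim simp
  qed
  have uv: "AE x in lebesgue. x \<in> V \<longrightarrow> u x = v x" using rigid by (simp add: v_def)
  have GV: "AE x in lebesgue. \<forall>i. x \<in> V \<longrightarrow> G i x = cross3 \<omega> (axis i 1)"
  proof (rule weak_pd_euclidean_unique[OF open_V])
    have lv: "locally_integrable_on v V"
      using weak_gradient_rigid_field[of V v0 \<omega> "q + h *\<^sub>R n"] by (auto simp: v_def[abs_def] weak_gradient_def weak_pd_def)
    show "weak_gradient V v G"
      unfolding weak_gradient_def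
      using G(1) V_\<Omega> by (intro allI weak_pd_cong_AE[OF _ lv uv]) (auto simp: weak_gradient_def intro: weak_pd_mono)
    show "weak_gradient V v (\<lambda>i x. cross3 \<omega> (axis i 1))"
      unfolding v_def[abs_def] by (rule weak_gradient_rigid_field)
  qed
  have nullgraph: "AE x in lebesgue. \<not> (norm (pr x) \<le> \<sigma> \<and> z x = b x)"
    using graph_negligible by (intro AE_I'[of "{x. norm (pr x) \<le> \<sigma> \<and> z x = b x}"]) (auto simp: negligible_iff_null_sets)

  define \<kappa> where "\<kappa> x = (m x - z x) * cut x" for x
  \<comment> \<open>\<open>A1\<close>, \<open>A2\<close> belong to the test with
    \<open>\<eta> * cut\<close> along the coordinate axes, \<open>B1\<close>, \<open>B2\<close> to
    the components of the integration along \<open>n\<close>. They are kept apart because each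
    identity holds componentwise.\<close>
  define A1 where "A1 i x = indicator A x * (cut x * d\<eta> x $ i + \<eta> x * dcut x * n $ i) * u x $ i" for i x
  define A2 where "A2 i x = indicator A x * (\<eta> x * cut x) * G i x $ i" for i x
  define B1 where "B1 l x = indicator A x * (d\<eta> x $ l * (- cut x + (m x - z x) * dcut x)) * u x $ l" for l x
  define B2 where "B2 l i x = indicator A x * (d\<eta> x $ l * \<kappa> x) * G i x $ l" for l i x
  note comp = integral_bounded_linear[OF bounded_linear_vec_nth] integrable_bounded_linear[OF bounded_linear_vec_nth]
  have A12: "\<exists>p. has_bochner_integral lebesgue (A1 i) p \<and> has_bochner_integral lebesgue (A2 i) (- p)" for i
  proof -
    let ?\<theta> = "\<lambda>x. \<eta> x * cut x" and ?\<theta>' = "\<lambda>x. cut x * d\<eta> x $ i + \<eta> x * dcut x * n $ i"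
    have c: "continuous_on UNIV ?\<theta>" "continuous_on UNIV ?\<theta>'" by (intro continuous_intros)+
    have der: "((\<lambda>s. ?\<theta> (x + s *\<^sub>R axis i 1)) has_real_derivative ?\<theta>' x) (at 0)" for x
      by (rule DERIV_cong[OF DERIV_mult[OF \<eta>_line cut_line]]) (simp add: inner_axis inner_axis')
    have 1: "?\<theta> x = 0 \<and> ?\<theta>' x = 0" if "r \<le> norm (pr x)" for x using outside_cylinder[OF that] by simp
    have 2: "?\<theta> x = 0 \<and> ?\<theta>' x = 0" if "3 * h \<le> z x" for x using cut_props(2,6)[OF that] by simp
    note I = wall_integration_by_parts[OF u G c der 1 2]
    have "(\<Sum>j\<in>UNIV. axis i 1 $ j *\<^sub>R (\<integral>x. (indicator A x * ?\<theta> x) *\<^sub>R G j x \<partial>lebesgue)) = (\<integral>x. (indicator A x * ?\<theta> x) *\<^sub>R G i x \<partial>lebesgue)"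
      by (simp add: axis_def if_distrib[where f="\<lambda>c. c *\<^sub>R _"] cong: if_cong)
    then have s: "(\<integral>x. (indicator A x * ?\<theta>' x) *\<^sub>R u x \<partial>lebesgue) $ i + (\<integral>x. (indicator A x * ?\<theta> x) *\<^sub>R G i x \<partial>lebesgue) $ i = 0"
      using arg_cong[OF I(3), of "\<lambda>y. y $ i"] by simp
    have s': "(\<integral>x. (indicator A x * ?\<theta> x) *\<^sub>R G i x \<partial>lebesgue) $ i = - ((\<integral>x. (indicator A x * ?\<theta>' x) *\<^sub>R u x \<partial>lebesgue) $ i)"
      using s by linarith
    have hb1: "has_bochner_integral lebesgue (A1 i) ((\<integral>x. (indicator A x * ?\<theta>' x) *\<^sub>R u x \<partial>lebesgue) $ i)"
      using comp(1)[OF I(1), of i] comp(2)[OF I(1), of i] by (simp add: has_bochner_integral_iff A1_def[abs_def])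
    have hb2: "has_bochner_integral lebesgue (A2 i) ((\<integral>x. (indicator A x * ?\<theta> x) *\<^sub>R G i x \<partial>lebesgue) $ i)"
      using comp(1)[OF I(2), of i i] comp(2)[OF I(2), of i i] by (simp add: has_bochner_integral_iff A2_def[abs_def])
    show ?thesis using hb1 hb2[unfolded s'] by blast
  qed
  define Y where "Y l i = (\<integral>x. (indicator (W a b) x * ((m x - z x) * d\<eta> x $ l)) *\<^sub>R G i x \<partial>lebesgue)" for l i
  have B: "\<exists>p. has_bochner_integral lebesgue (B1 l) p \<and> has_bochner_integral lebesgue (\<lambda>x. \<Sum>i\<in>UNIV. n $ i * B2 l i x) (- p)"
    and Yint: "\<And>i. integrable lebesgue (\<lambda>x. (indicator (W a b) x * ((m x - z x) * d\<eta> x $ l)) *\<^sub>R G i x)" for l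
  proof -
    let ?\<theta> = "\<lambda>x. d\<eta> x $ l * \<kappa> x" and ?\<theta>' = "\<lambda>x. d\<eta> x $ l * (- cut x + (m x - z x) * dcut x)"
    have c: "continuous_on UNIV ?\<theta>" "continuous_on UNIV ?\<theta>'" unfolding \<kappa>_def by (intro continuous_intros)+
    have der: "((\<lambda>s. ?\<theta> (x + s *\<^sub>R n)) has_real_derivative ?\<theta>' x) (at 0)" for x
    proof -
      have "((\<lambda>s. m x - (z x + s)) has_real_derivative - 1) (at 0)" by (auto intro!: derivative_eq_intros)
      from DERIV_cmult[OF DERIV_mult[OF this cut_line[of x n]], of "d\<eta> x $ l"]
      have "((\<lambda>s. d\<eta> x $ l * ((m x - (z x + s)) * cut (x + s *\<^sub>R n))) has_real_derivative ?\<theta>' x) (at 0)"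
        by (rule DERIV_cong) (simp add: nn algebra_simps)
      then show ?thesis by (simp add: \<kappa>_def axial_invariance z_add)
    qed
    have 1: "?\<theta> x = 0 \<and> ?\<theta>' x = 0" if "r \<le> norm (pr x)" for x using outside_cylinder[OF that] by simp
    have 2: "?\<theta> x = 0 \<and> ?\<theta>' x = 0" if "3 * h \<le> z x" for x using cut_props(2,6)[OF that] by (simp add: \<kappa>_def)
    note I = wall_integration_by_parts[OF u G c der 1 2]
    have s: "(\<integral>x. (indicator A x * ?\<theta>' x) *\<^sub>R u x \<partial>lebesgue) $ l + (\<Sum>i\<in>UNIV. n $ i * (\<integral>x. (indicator A x * ?\<theta> x) *\<^sub>R G i x \<partial>lebesgue) $ l) = 0"
      using arg_cong[OF I(3), of "\<lambda>y. y $ l"] by (simp add: sum_component)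
    have b1: "has_bochner_integral lebesgue (B1 l) ((\<integral>x. (indicator A x * ?\<theta>' x) *\<^sub>R u x \<partial>lebesgue) $ l)"
      using comp(1)[OF I(1), of l] comp(2)[OF I(1), of l] by (simp add: has_bochner_integral_iff B1_def[abs_def])
    have "has_bochner_integral lebesgue (B2 l i) ((\<integral>x. (indicator A x * ?\<theta> x) *\<^sub>R G i x \<partial>lebesgue) $ l)" for i
      using comp(1)[OF I(2), of i l] comp(2)[OF I(2), of i l] by (simp add: has_bochner_integral_iff B2_def[abs_def])
    then have "has_bochner_integral lebesgue (\<lambda>x. \<Sum>i\<in>UNIV. n $ i * B2 l i x) (\<Sum>i\<in>UNIV. n $ i * (\<integral>x. (indicator A x * ?\<theta> x) *\<^sub>R G i x \<partial>lebesgue) $ l)"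
      by (intro has_bochner_integral_sum has_bochner_integral_mult_right)
    moreover have "(\<Sum>i\<in>UNIV. n $ i * (\<integral>x. (indicator A x * ?\<theta> x) *\<^sub>R G i x \<partial>lebesgue) $ l) = - ((\<integral>x. (indicator A x * ?\<theta>' x) *\<^sub>R u x \<partial>lebesgue) $ l)"
      using s by linarith
    ultimately have "has_bochner_integral lebesgue (\<lambda>x. \<Sum>i\<in>UNIV. n $ i * B2 l i x) (- ((\<integral>x. (indicator A x * ?\<theta>' x) *\<^sub>R u x \<partial>lebesgue) $ l))"
      by (simp only:)
    with b1 show "\<exists>p. has_bochner_integral lebesgue (B1 l) p \<and> has_bochner_integral lebesgue (\<lambda>x. \<Sum>i\<in>UNIV. n $ i * B2 l i x) (- p)"
      by blast
    fix i
    have Wm: "W a b \<in> sets lebesgue"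
      unfolding W_def by (intro sets_completionI_sets) (auto intro!: borel_open open_Collect_conj open_Collect_less continuous_intros)
    have "integrable lebesgue (\<lambda>x. indicator (W a b) x *\<^sub>R ((indicator A x * ?\<theta> x) *\<^sub>R G i x))"
      by (rule integrable_mult_indicator[OF Wm I(2)])
    moreover have "indicator (W a b) x *\<^sub>R ((indicator A x * ?\<theta> x) *\<^sub>R G i x) = (indicator (W a b) x * ((m x - z x) * d\<eta> x $ l)) *\<^sub>R G i x" for x
    proof (cases "x \<in> W a b")
      case True
      then have "x \<in> A" "norm (pr x) \<le> \<sigma>" by (auto simp: W_def A_def)
      moreover have "cut x = 1"
      proof (rule cut_props(1))
        have "z x < b x" using True by (simp add: W_def)
        then show "z x \<le> 2 * h" using ab_bounds(2)[OF calculation(2)] h by linarith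
      qed
      ultimately show ?thesis by (simp add: \<kappa>_def mult_ac)
    qed simp
    ultimately show "integrable lebesgue (\<lambda>x. (indicator (W a b) x * ((m x - z x) * d\<eta> x $ l)) *\<^sub>R G i x)" by (simp only:)
  qed
  define Tot where "Tot x = (\<Sum>i\<in>UNIV. A1 i x + A2 i x) + (\<Sum>l\<in>UNIV. B1 l x + (\<Sum>i\<in>UNIV. n $ i * B2 l i x))" for x
  have Tot: "has_bochner_integral lebesgue Tot 0"
  proof -
    have "has_bochner_integral lebesgue (\<lambda>x. A1 i x + A2 i x) 0" for i
    proof -
      obtain p where "has_bochner_integral lebesgue (A1 i) p" "has_bochner_integral lebesgue (A2 i) (- p)"
        using A12[of i] by blast
      from has_bochner_integral_add[OF this] show ?thesis by simp
    qed
    moreover have "has_bochner_integral lebesgue (\<lambda>x. B1 l x + (\<Sum>i\<in>UNIV. n $ i * B2 l i x)) 0" for l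
    proof -
      obtain p where "has_bochner_integral lebesgue (B1 l) p" "has_bochner_integral lebesgue (\<lambda>x. \<Sum>i\<in>UNIV. n $ i * B2 l i x) (- p)"
        using B[of l] by blast
      from has_bochner_integral_add[OF this] show ?thesis by simp
    qed
    ultimately have "has_bochner_integral lebesgue Tot ((\<Sum>i\<in>(UNIV::3 set). 0) + (\<Sum>l\<in>(UNIV::3 set). 0))"
      unfolding Tot_def[abs_def] by (intro has_bochner_integral_add has_bochner_integral_sum)
    then show ?thesis by simp
  qed
  define Gn where "Gn x = (\<Sum>i\<in>UNIV. n $ i *\<^sub>R G i x)" for x
  \<comment> \<open>Here the terms \<open>cut * (d\<eta> \<bullet> u)\<close> of \<open>A1\<close>
    and \<open>B1\<close> cancel, and \<open>A2\<close> collects the divergence.\<close>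
  have Tot_eq: "Tot x = indicator A x * (\<eta> x * dcut x * (n \<bullet> u x) + (m x - z x) * dcut x * (d\<eta> x \<bullet> u x)
      + \<eta> x * cut x * (\<Sum>i\<in>UNIV. G i x $ i) + \<kappa> x * (d\<eta> x \<bullet> Gn x))" for x
  proof -
    have 1: "(\<Sum>i\<in>UNIV. A1 i x) = indicator A x * (cut x * (d\<eta> x \<bullet> u x) + \<eta> x * dcut x * (n \<bullet> u x))"
    proof -
      have "A1 i x = indicator A x * (cut x * (d\<eta> x $ i * u x $ i) + \<eta> x * dcut x * (n $ i * u x $ i))" for i
        by (simp add: A1_def algebra_simps)
      then show ?thesis by (simp add: inner_vec_def sum.distrib flip: sum_distrib_left)
    qed
    have 2: "(\<Sum>i\<in>UNIV. A2 i x) = indicator A x * (\<eta> x * cut x * (\<Sum>i\<in>UNIV. G i x $ i))"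
      by (simp add: A2_def mult.assoc flip: sum_distrib_left)
    have 3: "(\<Sum>l\<in>UNIV. B1 l x) = indicator A x * ((- cut x + (m x - z x) * dcut x) * (d\<eta> x \<bullet> u x))"
    proof -
      have "B1 l x = (indicator A x * (- cut x + (m x - z x) * dcut x)) * (d\<eta> x $ l * u x $ l)" for l
        by (simp add: B1_def mult_ac)
      then show ?thesis by (simp add: inner_vec_def flip: sum_distrib_left)
    qed
    have 4: "(\<Sum>l\<in>UNIV. \<Sum>i\<in>UNIV. n $ i * B2 l i x) = indicator A x * (\<kappa> x * (d\<eta> x \<bullet> Gn x))"
      by (simp add: B2_def Gn_def inner_vec_def sum_distrib_left mult_ac)
    show ?thesis unfolding Tot_def sum.distrib 1 2 3 4 by (simp add: algebra_simps)
  qed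
  define I4 where "I4 x = (\<Sum>l\<in>UNIV. \<Sum>i\<in>UNIV. n $ i * ((indicator (W a b) x * ((m x - z x) * d\<eta> x $ l)) *\<^sub>R G i x) $ l)" for x
  have I4: "has_bochner_integral lebesgue I4 (\<Sum>l\<in>UNIV. \<Sum>i\<in>UNIV. n $ i * Y l i $ l)"
    unfolding I4_def[abs_def] Y_def
    by (intro has_bochner_integral_sum has_bochner_integral_mult_right has_bochner_integral_bounded_linear[OF bounded_linear_vec_nth]
        has_bochner_integral_integrable Yint)
  have I4_eq: "I4 x = indicator (W a b) x * ((m x - z x) * (d\<eta> x \<bullet> Gn x))" for x
    unfolding I4_def Gn_def inner_vec_def by (simp add: sum_distrib_left mult_ac)
  \<comment> \<open>\<open>J\<close> is the normal derivative term inside the body, where the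
    derivative of the rigid field is constant. \<open>L1\<close> is the flux of the translation,
    \<open>L2\<close> its tangential counterpart, \<open>L3\<close> and \<open>L4\<close> come from
    the rotation; in \<open>L4\<close> the normal part of the position drops out.\<close>
  define J where "J x = indicator (W b (\<lambda>x. 7 * h)) x * (\<kappa> x * (d\<eta> x \<bullet> cross3 \<omega> n))" for x
  define L1 where "L1 x = (n \<bullet> v0) * (\<eta> x * dcut x)" for x
  define L2 where "L2 x = (m x - z x) * dcut x * (d\<eta> x \<bullet> v0)" for x
  define L3 where "L3 x = (m x - z x) * dcut x * (d\<eta> x \<bullet> cross3 \<omega> (x - (q + h *\<^sub>R n)))" for x
  define L4 where "L4 x = \<eta> x * dcut x * (n \<bullet> cross3 \<omega> (pr x))" for x
  have L_eq: "L1 x + L2 x + L3 x + L4 x = \<eta> x * dcut x * (n \<bullet> v x) + (m x - z x) * dcut x * (d\<eta> x \<bullet> v x)" for x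
  proof -
    have "x - (q + h *\<^sub>R n) = pr x + (z x - h) *\<^sub>R n" using decomp[of x] by (simp add: algebra_simps)
    then have "n \<bullet> cross3 \<omega> (x - (q + h *\<^sub>R n)) = n \<bullet> cross3 \<omega> (pr x)"
      by (simp add: cross_add_right cross_mult_right inner_add_right dot_cross_self)
    then show ?thesis by (simp add: L1_def L2_def L3_def L4_def v_def inner_add_right algebra_simps)
  qed
  have main_ae: "AE x in lebesgue. Tot x = I4 x + J x + (L1 x + L2 x + L3 x + L4 x)"
    using tr uv GV nullgraph
  proof eventually_elim
    case (elim x)
    show ?case
    proof (cases "norm (pr x) < \<sigma>")
      case False
      then have "\<eta> x = 0" "d\<eta> x = 0" using outside_cylinder[of x] r by auto
      then show ?thesis unfolding Tot_eq I4_eq J_def L_eq by simp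
    next
      case cyl: True
      then have cyl': "norm (pr x) \<le> \<sigma>" by simp
      have ab: "a x < b x" "a x \<le> 2 * h" "b x < 2 * h" using ab_bounds[OF cyl'] h by linarith+
      \<comment> \<open>Below the wall nothing is integrated; in the gap \<open>cut = 1\<close>,
        \<open>dcut = 0\<close> and the divergence vanishes; in the body everything is rigid; from
        height \<open>7 * h\<close> on the cutoffs vanish. The body surface itself is null.\<close>
      consider "z x \<le> a x" | "a x < z x" "z x < b x" | "b x < z x" "z x < 7 * h" | "b x < z x" "7 * h \<le> z x"
        using elim(4) cyl' by fastforce
      then show ?thesis
      proof cases
        case 1
        then have "x \<notin> A" "x \<notin> W a b" "x \<notin> W b (\<lambda>x. 7 * h)" using ab by (auto simp: A_def W_def)
        moreover have "dcut x = 0" using 1 ab by (intro cut_props(5)) simp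
        ultimately show ?thesis unfolding Tot_eq I4_eq J_def L_eq by simp
      next
        case 2
        then have w: "x \<in> W a b" "x \<in> A" "x \<notin> W b (\<lambda>x. 7 * h)" using cyl by (auto simp: A_def W_def)
        then have "x \<in> \<Omega>" using gap_subset by blast
        then have "(\<Sum>i\<in>UNIV. G i x $ i) = 0" using elim by blast
        moreover have "dcut x = 0" "cut x = 1" using 2 ab cut_props(1,5)[of x] by auto
        ultimately show ?thesis unfolding Tot_eq I4_eq J_def L_eq using w by (simp add: \<kappa>_def)
      next
        case 3
        then have w: "x \<in> W b (\<lambda>x. 7 * h)" "x \<in> A" "x \<notin> W a b" using cyl ab by (auto simp: A_def W_def)
        then have V: "x \<in> V" "x \<in> \<Omega>" using body_subset V_\<Omega> by auto
        then have "(\<Sum>i\<in>UNIV. G i x $ i) = 0" "u x = v x" "Gn x = cross3 \<omega> n"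
          using elim by (auto simp: Gn_def cross3_axis_expansion)
        then show ?thesis unfolding Tot_eq I4_eq J_def L_eq using w by simp
      next
        case 4
        then have "cut x = 0" "dcut x = 0" "x \<notin> W a b" using h ab cut_props(2,6)[of x] by (auto simp: W_def)
        then show ?thesis unfolding Tot_eq I4_eq J_def L_eq by (simp add: \<kappa>_def)
      qed
    qed
  qed
  have dsupp: "d\<eta> x = 0 \<and> \<eta> x = 0 \<or> dcut x = 0" if "x \<notin> slab r (- h) (3 * h)" for x
  proof -
    have "r \<le> norm (pr x) \<or> z x \<le> 2 * h \<or> 3 * h \<le> z x" using that h by (auto simp: slab_def)
    then show ?thesis using outside_cylinder cut_props(5,6) by blast
  qed
  have crossc: "continuous_on UNIV (\<lambda>x. cross3 \<omega> (g x))" if "continuous_on UNIV g" for g :: "real^3 \<Rightarrow> real^3"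
    by (rule bounded_linear.continuous_on[OF cross3_bounded_linear that])
  have Lc: "continuous_on UNIV L1" "continuous_on UNIV L2" "continuous_on UNIV L3" "continuous_on UNIV L4"
    unfolding L1_def[abs_def] L2_def[abs_def] L3_def[abs_def] L4_def[abs_def]
    by (intro continuous_intros crossc)+
  have Ls: "L1 x = 0" "L2 x = 0" "L3 x = 0" "L4 x = 0" if "x \<notin> slab r (- h) (3 * h)" for x
    using dsupp[OF that] by (auto simp: L1_def L2_def L3_def L4_def)
  note Li = integrable_slab_continuous[OF Lc(1) Ls(1)] integrable_slab_continuous[OF Lc(2) Ls(2)]
    integrable_slab_continuous[OF Lc(3) Ls(3)] integrable_slab_continuous[OF Lc(4) Ls(4)]
  have Js: "J x = 0" if "x \<notin> slab r (- h) (3 * h)" for x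
  proof (cases "x \<in> W b (\<lambda>x. 7 * h)")
    case True
    then have w: "norm (pr x) \<le> \<sigma>" "b x < z x" by (auto simp: W_def)
    have "- h \<le> z x" using ab_bounds(2)[OF w(1)] w(2) h by linarith
    then have "r \<le> norm (pr x) \<or> 3 * h \<le> z x" using that by (auto simp: slab_def)
    then show ?thesis using outside_cylinder(2) cut_props(2) by (auto simp: J_def \<kappa>_def)
  qed (simp add: J_def)
  have J_int: "integrable lebesgue J"
  proof -
    have c: "continuous_on UNIV (\<lambda>x. \<kappa> x * (d\<eta> x \<bullet> cross3 \<omega> n))" unfolding \<kappa>_def by (intro continuous_intros)
    have Wm: "W b (\<lambda>x. 7 * h) \<in> sets lebesgue"
      unfolding W_def by (intro sets_completionI_sets) (auto intro!: borel_open open_Collect_conj open_Collect_less continuous_intros)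
    have "integrable lebesgue (\<lambda>x. indicator (slab r (- h) (3 * h)) x *\<^sub>R (\<kappa> x * (d\<eta> x \<bullet> cross3 \<omega> n)))"
      by (intro integrable_lebesgue_of_lborel borel_integrable_compact slab_compact continuous_on_subset[OF c]) simp
    from integrable_mult_indicator[OF Wm this]
    show ?thesis
      by (rule Bochner_Integration.integrable_cong[THEN iffD1, rotated -1]) (use Js in \<open>auto simp: J_def indicator_def\<close>)
  qed
  have sum0: "(\<Sum>l\<in>UNIV. \<Sum>i\<in>UNIV. n $ i * Y l i $ l) + (\<integral>x. J x \<partial>lebesgue)
      + ((\<integral>x. L1 x \<partial>lebesgue) + (\<integral>x. L2 x \<partial>lebesgue) + (\<integral>x. L3 x \<partial>lebesgue) + (\<integral>x. L4 x \<partial>lebesgue)) = 0"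
  proof -
    have "has_bochner_integral lebesgue (\<lambda>x. I4 x + J x + (L1 x + L2 x + L3 x + L4 x)) ((\<Sum>l\<in>UNIV. \<Sum>i\<in>UNIV. n $ i * Y l i $ l) + (\<integral>x. J x \<partial>lebesgue)
      + ((\<integral>x. L1 x \<partial>lebesgue) + (\<integral>x. L2 x \<partial>lebesgue) + (\<integral>x. L3 x \<partial>lebesgue) + (\<integral>x. L4 x \<partial>lebesgue)))"
      by (intro has_bochner_integral_add I4 has_bochner_integral_integrable J_int Li)
    moreover from this Tot have "(\<integral>x. I4 x + J x + (L1 x + L2 x + L3 x + L4 x) \<partial>lebesgue) = (\<integral>x. Tot x \<partial>lebesgue)"
      by (intro integral_cong_AE) (use main_ae in \<open>auto simp: has_bochner_integral_iff dest: borel_measurable_integrable\<close>)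
    ultimately show ?thesis using Tot by (simp add: has_bochner_integral_iff)
  qed
  have mz: "\<bar>m x - z x\<bar> \<le> 4 * h" if "norm (pr x) \<le> r" "- h \<le> z x" "z x \<le> 3 * h" for x
  proof -
    have "\<bar>m x\<bar> \<le> h" using m_bound[of x] that r by simp
    then show ?thesis using that h by (auto simp: abs_le_iff)
  qed
  have b4: "\<bar>\<Sum>l\<in>UNIV. \<Sum>i\<in>UNIV. n $ i * Y l i $ l\<bar> \<le> 4 * r ^ 4 * h\<^sup>2 * sqrt h * N"
    unfolding Y_def using H N unfolding U_def by (intro hessian_term_bound[OF G(1) _ _ _ Yint])
  have bJ: "\<bar>\<integral>x. J x \<partial>lebesgue\<bar> \<le> 256 * M * h\<^sup>2 * r ^ 5"
  proof -
    have "\<bar>J x\<bar> \<le> (4 * h) * ((4 * r ^ 3) * (M * 1))" for x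
    proof (cases "x \<in> slab r (- h) (3 * h)")
      case True
      have "\<bar>\<kappa> x\<bar> \<le> 4 * h * 1"
        unfolding \<kappa>_def abs_mult using mz[of x] True cut_props(3,4)[of x] h by (intro mult_mono) (auto simp: slab_def)
      moreover have "norm (cross3 \<omega> n) \<le> M * 1"
        using norm_cross3_le[of \<omega> n] M n by simp
      then have "\<bar>d\<eta> x \<bullet> cross3 \<omega> n\<bar> \<le> (4 * r ^ 3) * (M * 1)" by (rule abs_inner_le[OF d\<eta>_bound])
      ultimately have "\<bar>\<kappa> x * (d\<eta> x \<bullet> cross3 \<omega> n)\<bar> \<le> (4 * h) * ((4 * r ^ 3) * (M * 1))"
        unfolding abs_mult using h by (intro mult_mono) auto
      then show ?thesis using h r M0 by (auto simp: J_def indicator_def)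
    qed (use Js h r M0 in simp)
    from slab_integral_bound[OF J_int this Js]
    show ?thesis by (simp add: eval_nat_numeral mult_ac)
  qed
  have b3: "\<bar>\<integral>x. L3 x \<partial>lebesgue\<bar> \<le> 512 * M * r ^ 5 * h * (r + 2 * h)"
  proof -
    have "\<bar>L3 x\<bar> \<le> (4 * h * (2 / h)) * ((4 * r ^ 3) * (M * (r + 2 * h)))" for x
    proof (cases "x \<in> slab r (- h) (3 * h)")
      case True
      have "\<bar>(m x - z x) * dcut x\<bar> \<le> 4 * h * (2 / h)"
        unfolding abs_mult using mz[of x] True cut_props(7)[of x] h by (intro mult_mono) (auto simp: slab_def)
      moreover have "norm (x - (q + h *\<^sub>R n)) \<le> r + 2 * h"
      proof -
        have "x - (q + h *\<^sub>R n) = pr x + (z x - h) *\<^sub>R n" using decomp[of x] by (simp add: algebra_simps)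
        then have "norm (x - (q + h *\<^sub>R n)) \<le> norm (pr x) + \<bar>z x - h\<bar>"
          using norm_triangle_ineq[of "pr x" "(z x - h) *\<^sub>R n"] n by simp
        then show ?thesis using True by (auto simp: slab_def abs_if split: if_splits)
      qed
      then have "norm (cross3 \<omega> (x - (q + h *\<^sub>R n))) \<le> M * (r + 2 * h)"
        using norm_cross3_le[of \<omega> "x - (q + h *\<^sub>R n)"] M M0 by (meson mult_mono norm_ge_zero order_trans)
      then have "\<bar>d\<eta> x \<bullet> cross3 \<omega> (x - (q + h *\<^sub>R n))\<bar> \<le> (4 * r ^ 3) * (M * (r + 2 * h))"
        by (rule abs_inner_le[OF d\<eta>_bound])
      ultimately show ?thesis unfolding L3_def abs_mult[of "(m x - z x) * dcut x"] using h by (intro mult_mono) auto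
    qed (use Ls(3) h r M0 in simp)
    from slab_integral_bound[OF Li(3) this Ls(3)]
    show ?thesis using h by (simp add: eval_nat_numeral mult_ac)
  qed
  \<comment> \<open>The direct bound is of order \<open>r ^ 5 * h\<close>, which after division by
    \<open>r ^ 6\<close> gives only \<open>sqrt h\<close>. Averaging with the half turn replaces
    \<open>m - z\<close> by half the difference of \<open>m\<close> at opposite points, of size
    \<open>C * r ^ 3\<close>, since \<open>d\<eta>\<close> is odd and \<open>z\<close>,
    \<open>dcut\<close> are invariant; this gains the missing order.\<close>
  have b2: "\<bar>\<integral>x. L2 x \<partial>lebesgue\<bar> \<le> 64 * C * M * r ^ 8"
  proof -
    have rc: "continuous_on UNIV rho" unfolding rho_def[abs_def] by (intro continuous_intros)
    have eq: "(\<integral>x. L2 x \<partial>lebesgue) = (\<integral>x. (L2 x + L2 (rho x)) / 2 \<partial>lebesgue)"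
    proof -
      have sl: "rho x \<in> slab r (- h) (3 * h) \<longleftrightarrow> x \<in> slab r (- h) (3 * h)" for x by (simp add: slab_def rho_props)
      have "integrable lebesgue (\<lambda>x. L2 (rho x))"
        by (rule integrable_slab_continuous[OF continuous_on_compose2[OF Lc(2) rc]]) (use sl Ls(2) in auto)
      then show ?thesis using integral_rho[OF Lc(2)] Li(2) by simp
    qed
    have c: "continuous_on UNIV (\<lambda>x. (L2 x + L2 (rho x)) / 2)"
      by (intro continuous_intros Lc continuous_on_compose2[OF Lc(2) rc]) auto
    have s: "(L2 x + L2 (rho x)) / 2 = 0" if "x \<notin> slab r (- h) (3 * h)" for x
      using that Ls(2)[of x] Ls(2)[of "rho x"] by (auto simp: slab_def rho_props)
    have "\<bar>(L2 x + L2 (rho x)) / 2\<bar> \<le> (C * r ^ 3 * (2 / h) * ((4 * r ^ 3) * M)) / 2" for x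
    proof (cases "norm (pr x) \<le> r")
      case True
      have "L2 x + L2 (rho x) = (m x - m (rho x)) * dcut x * (d\<eta> x \<bullet> v0)"
        by (simp add: L2_def E_rho rho_props algebra_simps)
      moreover have "\<bar>m x - m (rho x)\<bar> \<le> C * r ^ 3"
      proof -
        have "\<bar>m x - m (rho x)\<bar> \<le> C * norm (pr x) ^ 3"
        proof -
          have "2 * (m x - m (rho x)) = (a x - a (rho x)) + (b x - b (rho x))" by (simp add: m_def field_simps)
          then show ?thesis using rho_props(3,4)[of x] by (simp add: abs_le_iff)
        qed
        also have "\<dots> \<le> C * r ^ 3" using True C by (intro mult_left_mono power_mono) auto
        finally show ?thesis .
      qed
      moreover have "\<bar>d\<eta> x \<bullet> v0\<bar> \<le> (4 * r ^ 3) * M" by (rule abs_inner_le[OF d\<eta>_bound M(1)])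
      ultimately have "\<bar>L2 x + L2 (rho x)\<bar> \<le> C * r ^ 3 * (2 / h) * ((4 * r ^ 3) * M)"
        using cut_props(7)[of x] C r h unfolding abs_mult by (simp only: abs_mult) (intro mult_mono; simp)
      then have "\<bar>L2 x + L2 (rho x)\<bar> / 2 \<le> (C * r ^ 3 * (2 / h) * ((4 * r ^ 3) * M)) / 2" by (rule divide_right_mono) simp
      then show ?thesis by (simp only: abs_divide abs_numeral)
    next
      case False
      then have "x \<notin> slab r (- h) (3 * h)" by (simp add: slab_def)
      then show ?thesis unfolding s[OF \<open>x \<notin> slab r (- h) (3 * h)\<close>] using C r h M0 by simp
    qed
    from slab_integral_bound[OF integrable_slab_continuous[OF c s] this s]
    show ?thesis unfolding eq using h by (simp add: eval_nat_numeral mult_ac)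
  qed
  \<comment> \<open>\<open>L4\<close> is odd under the half turn, so its integral vanishes; a direct
    bound would again be too weak by a factor \<open>sqrt h\<close>.\<close>
  have b0: "(\<integral>x. L4 x \<partial>lebesgue) = 0"
  proof -
    have "L4 (rho x) = - L4 x" for x
      using linear_neg[OF bounded_linear.linear[OF cross3_bounded_linear[of \<omega>]]] by (simp add: L4_def E_rho rho_props)
    then show ?thesis using integral_rho[OF Lc(4)] by simp
  qed
  have "\<bar>n \<bullet> v0\<bar> * (r ^ 6 / 16) \<le> \<bar>n \<bullet> v0\<bar> * \<bar>\<integral>x. \<eta> x * dcut x \<partial>lebesgue\<bar>"
    using flux_weight_bound by (intro mult_left_mono) auto
  also have "\<dots> = \<bar>\<integral>x. L1 x \<partial>lebesgue\<bar>" by (simp add: L1_def abs_mult)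
  also have "\<dots> \<le> 4 * r ^ 4 * h\<^sup>2 * sqrt h * N + (256 * M * h\<^sup>2 * r ^ 5 + 512 * M * r ^ 5 * h * (r + 2 * h) + 64 * C * M * r ^ 8)"
    using sum0 b0 b2 b3 bJ b4 by linarith
  finally show ?thesis by (simp add: algebra_simps)
qed

end

section \<open>Differential inequality for the distance\<close>

text \<open>The ball exterior to the body lies on the side of the wall, in the direction
  \<open>- n\<close>; the graph obtained from it has to be turned over.\<close>

lemma graph_over_uminus:
  assumes "graph_over F x0 (- n) s C f" shows "graph_over F x0 n s C (\<lambda>w. - f w)"
proof -
  have p: "perp (- n) w = perp n w" for w by (simp add: perp_def)
  have "f (w + t *\<^sub>R n) = f w" for w t
  proof -
    have "f (w + (- t) *\<^sub>R (- n)) = f w" using assms unfolding graph_over_def by blast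
    then show ?thesis by simp
  qed
  then show ?thesis
    using assms unfolding graph_over_def p by (auto intro!: continuous_intros simp: abs_minus_commute)
qed

lemma setdist_le_dist_closure:
  assumes "x \<in> closure S" "y \<in> closure T" shows "setdist S T \<le> dist x y"
  using setdist_le_dist[OF assms] by (simp add: setdist_closure_1 setdist_closure_2)

text \<open>For wide gaps the estimate is trivial because the velocity is bounded, so the geometric
  argument is only needed when \<open>h\<close> is small.\<close>

lemma normal_velocity_estimate:
  fixes s C c0 M :: real
  assumes s: "s > 0" and C: "C > 0" and c0: "c0 > 0" "C * c0\<^sup>2 \<le> 1 / 8" and M: "M \<ge> 0"
  obtains C1 C2 where "C1 > 0" "C2 \<ge> 0"
    "\<And>\<Omega> V p q u v0 \<omega> H N. open \<Omega> \<Longrightarrow> open V \<Longrightarrow> V \<subseteq> \<Omega> \<Longrightarrow>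
      graph_regular (frontier \<Omega>) s C \<Longrightarrow> graph_regular (frontier V) s C \<Longrightarrow>
      p \<in> frontier V \<Longrightarrow> q \<in> frontier \<Omega> \<Longrightarrow> dist p q = setdist V (frontier \<Omega>) \<Longrightarrow> dist p q > 0 \<Longrightarrow>
      u \<in> W12_0_space \<Omega> \<Longrightarrow> weakly_div_free \<Omega> u \<Longrightarrow>
      AE x in lebesgue. x \<in> V \<longrightarrow> u x = v0 + cross3 \<omega> (x - p) \<Longrightarrow>
      weak_hessian (cylinder q p (c0 * sqrt (dist p q)) \<inter> (\<Omega> - closure V)) u H \<Longrightarrow>
      L2_norm (cylinder q p (c0 * sqrt (dist p q)) \<inter> (\<Omega> - closure V))
        (\<lambda>x. sqrt (\<Sum>i\<in>UNIV. \<Sum>j\<in>UNIV. (norm (H i j x))\<^sup>2)) \<le> ennreal N \<Longrightarrow> N \<ge> 0 \<Longrightarrow>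
      norm v0 \<le> M \<Longrightarrow> norm \<omega> \<le> M \<Longrightarrow>
      \<bar>sgn (p - q) \<bullet> v0\<bar> \<le> dist p q * (C1 * (sqrt (dist p q) * N) + C2)"
proof -
  \<comment> \<open>The first entry ensures \<open>8 * h < s\<close>, the second
    \<open>c0 * sqrt h \<le> s / 2\<close>, as the locale \<open>gap\<close> requires.\<close>
  define h0 where "h0 = min (s / 16) ((s / (2 * c0))\<^sup>2)"
  have h0: "h0 > 0" "8 * h0 < s" "c0 * sqrt h0 < s"
  proof -
    show "h0 > 0" "8 * h0 < s" using s c0 by (auto simp: h0_def min_def)
    have "h0 \<le> (s / (2 * c0))\<^sup>2" by (simp add: h0_def)
    then have "sqrt h0 \<le> sqrt ((s / (2 * c0))\<^sup>2)" by (rule real_sqrt_le_mono)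
    also have "\<dots> = s / (2 * c0)" using s c0 by simp
    finally have "c0 * sqrt h0 \<le> s / 2" using c0 by (simp add: field_simps)
    then show "c0 * sqrt h0 < s" using s by simp
  qed
  \<comment> \<open>\<open>\<kappa>\<close> bounds \<open>h / r = 2 * sqrt h / c0\<close> for
    \<open>h \<le> h0\<close>. In \<open>C2\<close> the number 1280 is \<open>256 + 1024\<close>,
    514 is \<open>512 + 2\<close>, and \<open>M / h0\<close> settles the wide gaps;
    \<open>C1\<close> arises from
    \<open>64 * (h / r)\<^sup>2 = 256 * h / c0\<^sup>2\<close>.\<close>
  define \<kappa> where "\<kappa> = 2 * sqrt h0 / c0"
  define C1 where "C1 = 256 / c0\<^sup>2"
  define C2 where "C2 = 16 * M * (1280 * \<kappa> + 514) + M / h0"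
  have \<kappa>0: "\<kappa> \<ge> 0" using c0 h0 by (simp add: \<kappa>_def)
  have C1: "C1 > 0" using c0 by (simp add: C1_def)
  have C2: "C2 \<ge> 0" using M \<kappa>0 h0 by (simp add: C2_def)
  show thesis
  proof (rule that[OF C1 C2])
    fix \<Omega> V p q u v0 \<omega> H N
    assume op: "open \<Omega>" "open V" "V \<subseteq> \<Omega>"
      and gr: "graph_regular (frontier \<Omega>) s C" "graph_regular (frontier V) s C"
      and pq: "p \<in> frontier V" "q \<in> frontier \<Omega>" "dist p q = setdist V (frontier \<Omega>)" "dist p q > 0"
      and u: "u \<in> W12_0_space \<Omega>" "weakly_div_free \<Omega> u" "AE x in lebesgue. x \<in> V \<longrightarrow> u x = v0 + cross3 \<omega> (x - p)"
      and H: "weak_hessian (cylinder q p (c0 * sqrt (dist p q)) \<inter> (\<Omega> - closure V)) u H"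
      and N: "L2_norm (cylinder q p (c0 * sqrt (dist p q)) \<inter> (\<Omega> - closure V))
        (\<lambda>x. sqrt (\<Sum>i\<in>UNIV. \<Sum>j\<in>UNIV. (norm (H i j x))\<^sup>2)) \<le> ennreal N" "N \<ge> 0"
      and Mb: "norm v0 \<le> M" "norm \<omega> \<le> M"
    define h where "h = dist p q"
    define n where "n = sgn (p - q)"
    have h: "h > 0" using pq by (simp add: h_def)
    have nb: "norm n = 1" "p = q + h *\<^sub>R n"
      using h by (auto simp: n_def h_def dist_norm norm_sgn sgn_div_norm)
    have "\<bar>n \<bullet> v0\<bar> \<le> 1 * M" by (rule abs_inner_le) (use nb Mb in auto)
    then have nv: "\<bar>n \<bullet> v0\<bar> \<le> M" by simp
    show "\<bar>sgn (p - q) \<bullet> v0\<bar> \<le> dist p q * (C1 * (sqrt (dist p q) * N) + C2)"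
      unfolding n_def[symmetric] h_def[symmetric]
    proof (cases "h \<le> h0")
      case False
      have "M \<le> h * (M / h0)" using False h0 M by (simp add: field_simps mult_left_mono)
      also have "\<dots> \<le> h * (C1 * (sqrt h * N) + C2)"
        using h C1 N(2) M \<kappa>0 by (intro mult_left_mono) (auto simp: C2_def)
      finally show "\<bar>n \<bullet> v0\<bar> \<le> h * (C1 * (sqrt h * N) + C2)" using nv by linarith
    next
      case True
      have cl: "p \<in> closure V" using pq by (simp add: frontier_def)
      have fd: "h \<le> dist x y" if "x \<in> closure V" "y \<in> frontier \<Omega>" for x y
        unfolding h_def pq(3) using that by (intro setdist_le_dist_closure) (auto simp: closure_closed frontier_closed)
      obtain fa where fa: "graph_over (frontier \<Omega>) q n s C fa"
      proof -
        have "\<forall>x\<in>frontier \<Omega>. h \<le> dist x (q + h *\<^sub>R n)"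
          using fd[OF cl] nb(2) by (metis dist_commute)
        then show thesis using gr(1) pq(2) nb(1) h that unfolding graph_regular_def by blast
      qed
      obtain fb' where fb': "graph_over (frontier V) p (- n) s C fb'"
      proof -
        have "p + h *\<^sub>R (- n) = q" using nb(2) by simp
        then have "\<forall>x\<in>frontier V. h \<le> dist x (p + h *\<^sub>R (- n))"
          using fd pq(2) by (auto simp: frontier_def)
        moreover have "norm (- n) = 1" using nb by simp
        ultimately show thesis using gr(2) pq(1) h that unfolding graph_regular_def by blast
      qed
      define \<sigma> where "\<sigma> = c0 * sqrt h"
      have sb: "\<sigma> > 0" "\<sigma>\<^sup>2 = c0\<^sup>2 * h" using c0 h by (auto simp: \<sigma>_def power_mult_distrib)
      interpret gap \<Omega> V q n h s C \<sigma> fa "\<lambda>w. - fb' w"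
      proof
        show "graph_over (frontier V) (q + h *\<^sub>R n) n s C (\<lambda>w. - fb' w)"
          using graph_over_uminus[OF fb'] nb(2) by simp
        have "C * c0\<^sup>2 * h \<le> 1 / 8 * h" using c0(2) h by (intro mult_right_mono) auto
        then show "C * \<sigma>\<^sup>2 \<le> h / 8" by (simp add: sb)
        have "\<sigma> \<le> c0 * sqrt h0" using True c0 by (simp add: \<sigma>_def)
        then show "\<sigma> < s" using h0 by simp
        show "8 * h < s" using True h0 by simp
      qed (use op pq nb h fd fa C sb in auto)
      have U: "cylinder q p (c0 * sqrt (dist p q)) \<inter> (\<Omega> - closure V) = {x. norm (pr x) < \<sigma>} \<inter> (\<Omega> - closure V)"
        by (simp add: cylinder_def pr_def perp_def n_def[symmetric] h_def[symmetric] \<sigma>_def)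
      have est: "\<bar>n \<bullet> v0\<bar> * (r ^ 6 / 16) \<le> 4 * r ^ 4 * h\<^sup>2 * sqrt h * N
          + M * (256 * h\<^sup>2 * r ^ 5 + 512 * r ^ 5 * h * (r + 2 * h) + 64 * C * r ^ 8)"
        using u H N Mb unfolding U unfolding nb(2) by (rule squeezing_estimate)
      \<comment> \<open>In terms of \<open>y\<close> every summand of the estimate contains the
        factor \<open>r ^ 6 / 16\<close>, which is then divided out.\<close>
      define y where "y = h / r"
      have r2: "r\<^sup>2 = c0\<^sup>2 * h / 4" using sb(2) by (simp add: r_def power_divide)
      have y: "y \<le> \<kappa>" "y > 0" "h = y * r"
      proof -
        show "y > 0" "h = y * r" using h r by (auto simp: y_def)
        have "y = 2 * (h / sqrt h) / c0"
          unfolding y_def r_def by (simp add: \<sigma>_def mult.commute)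
        then have "y = 2 * sqrt h / c0" using h by (simp add: real_div_sqrt)
        then show "y \<le> \<kappa>" using True c0 by (simp add: \<kappa>_def divide_right_mono)
      qed
      have yr: "y = 4 * r / c0\<^sup>2"
      proof -
        have "4 * r\<^sup>2 = c0\<^sup>2 * h" using r2 by simp
        then have "(4 * r) * r = (c0\<^sup>2 * y) * r" using y(3) by algebra
        then have "4 * r = c0\<^sup>2 * y" using r(1) by (metis less_irrefl mult_right_cancel)
        then show ?thesis using c0 by (simp add: field_simps)
      qed
      have "4 * r ^ 4 * h\<^sup>2 * sqrt h * N + M * (256 * h\<^sup>2 * r ^ 5 + 512 * r ^ 5 * h * (r + 2 * h) + 64 * C * r ^ 8)
         = (r ^ 6 / 16) * (64 * y\<^sup>2 * sqrt h * N + 16 * M * (256 * (h * y) + 512 * h * (1 + 2 * y) + 64 * (C * r\<^sup>2)))"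
        unfolding y(3) by (simp add: eval_nat_numeral algebra_simps)
      then have "\<bar>n \<bullet> v0\<bar> * (r ^ 6 / 16) \<le> (64 * y\<^sup>2 * sqrt h * N + 16 * M * (256 * (h * y) + 512 * h * (1 + 2 * y) + 64 * (C * r\<^sup>2))) * (r ^ 6 / 16)"
        using est by (simp only: mult.commute)
      then have "\<bar>n \<bullet> v0\<bar> \<le> 64 * y\<^sup>2 * sqrt h * N + 16 * M * (256 * (h * y) + 512 * h * (1 + 2 * y) + 64 * (C * r\<^sup>2))"
        by (rule mult_right_le_imp_le) (use r in simp)
      also have "64 * y\<^sup>2 * sqrt h * N = h * (C1 * (sqrt h * N))"
      proof -
        have "y\<^sup>2 = h * 4 / c0\<^sup>2" using y(3) yr by (simp add: power2_eq_square)
        then show ?thesis by (simp add: C1_def)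
      qed
      also have "16 * M * (256 * (h * y) + 512 * h * (1 + 2 * y) + 64 * (C * r\<^sup>2)) \<le> h * C2"
      proof -
        have "h * y \<le> h * \<kappa>" using y h by (intro mult_left_mono) auto
        \<comment> \<open>The smallness of \<open>C * c0\<^sup>2\<close> absorbs \<open>C\<close>,
          so that the term from the third derivatives becomes a plain multiple of
          \<open>h\<close>.\<close>
        moreover have "64 * (C * r\<^sup>2) \<le> 2 * h"
        proof -
          have "64 * (C * r\<^sup>2) = 16 * (C * c0\<^sup>2) * h" by (simp add: r2)
          also have "\<dots> \<le> 16 * (1 / 8) * h" using c0(2) h by (intro mult_right_mono mult_left_mono) auto
          finally show ?thesis by simp
        qed
        ultimately have "256 * (h * y) + 512 * h * (1 + 2 * y) + 64 * (C * r\<^sup>2) \<le> h * (1280 * \<kappa> + 514)"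
          by (simp add: algebra_simps)
        then have "16 * M * (256 * (h * y) + 512 * h * (1 + 2 * y) + 64 * (C * r\<^sup>2)) \<le> 16 * M * (h * (1280 * \<kappa> + 514))"
          using M by (intro mult_left_mono) auto
        also have "\<dots> \<le> h * C2" using M h h0 by (simp add: C2_def algebra_simps)
        finally show ?thesis .
      qed
      finally show "\<bar>n \<bullet> v0\<bar> \<le> h * (C1 * (sqrt h * N) + C2)" by (simp add: algebra_simps)
    qed
  qed
qed

text \<open>A form of the fundamental theorem of calculus that needs neither differentiability of \<open>\<psi>\<close> nor
  measurability of \<open>f\<close>: reverse Fatou applied to backward difference quotients.\<close>

lemma lipschitz_decrement_le_nn_integral:
  fixes \<psi> :: "real \<Rightarrow> real" and f :: "real \<Rightarrow> ennreal"
  assumes ab: "a \<le> b" and L: "L-lipschitz_on {a..b} \<psi>"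
    and ae: "AE t in lebesgue. t \<in> {a<..<b} \<longrightarrow> (\<forall>c. f t < ennreal c \<longrightarrow>
        (\<forall>\<^sub>F k in sequentially. real (Suc k) * (\<psi> (t - 1 / real (Suc k)) - \<psi> t) \<le> c))"
  shows "ennreal (\<psi> a - \<psi> b) \<le> (\<integral>\<^sup>+t\<in>{a<..<b}. f t \<partial>lebesgue)"
proof -
  have L0: "L \<ge> 0" using L by (rule lipschitz_on_nonneg)
  \<comment> \<open>Constant continuation beyond the interval keeps the Lipschitz constant and gives
    a meaning to backward shifts at every point.\<close>
  define cl where "cl t = max a (min b t)" for t
  have cl: "cl t \<in> {a..b}" "\<bar>cl t - cl s\<bar> \<le> \<bar>t - s\<bar>" "t \<in> {a..b} \<Longrightarrow> cl t = t" for s t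
    using ab by (auto simp: cl_def)
  define \<Psi> where "\<Psi> t = \<psi> (cl t)" for t
  have lip: "\<bar>\<Psi> t - \<Psi> s\<bar> \<le> L * \<bar>t - s\<bar>" for s t
  proof -
    have "\<bar>\<Psi> t - \<Psi> s\<bar> \<le> L * \<bar>cl t - cl s\<bar>"
      using lipschitz_onD[OF L cl(1) cl(1), of t s] by (simp add: \<Psi>_def dist_real_def)
    also have "\<dots> \<le> L * \<bar>t - s\<bar>" using cl(2) L0 by (intro mult_left_mono)
    finally show ?thesis .
  qed
  have "L-lipschitz_on UNIV \<Psi>" using lip L0 by (auto simp: lipschitz_on_def dist_real_def)
  then have cont: "continuous_on A \<Psi>" for A
    by (meson lipschitz_on_continuous_on continuous_on_subset subset_UNIV)
  define \<delta> where "\<delta> k = 1 / real (Suc k)" for k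
  have \<delta>: "\<delta> k > 0" "real (Suc k) = 1 / \<delta> k" for k by (auto simp: \<delta>_def)
  have \<delta>0: "\<delta> \<longlonglongrightarrow> 0" using LIMSEQ_inverse_real_of_nat by (simp add: \<delta>_def[abs_def] inverse_eq_divide)
  define p where "p k t = (\<Psi> (t - \<delta> k) - \<Psi> t) / \<delta> k" for k t
  have pc: "continuous_on A (p k)" for A k
    unfolding p_def using \<delta>(1)[of k] by (intro continuous_intros continuous_on_compose2[OF cont[of UNIV]]) auto
  have pL: "p k t \<le> L" for k t
    using lip[of "t - \<delta> k" t] \<delta>(1)[of k] by (simp add: p_def divide_le_eq)
  \<comment> \<open>Telescoping: the integral of a difference quotient is the mean over the layer
    before \<open>a\<close> minus the mean over the layer before \<open>b\<close>. The former is
    \<open>\<psi> a\<close> exactly, by the constant continuation, the latter exceeds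
    \<open>\<psi> b\<close> by at most \<open>L * \<delta> k\<close>.\<close>
  have ipk: "\<psi> a - \<psi> b - L * \<delta> k \<le> integral {a..b} (p k)" for k
  proof -
    have i: "\<Psi> integrable_on {c..d}" for c d by (rule integrable_continuous_interval[OF cont])
    have sh: "integral {a..b} (\<lambda>t. \<Psi> (t - \<delta> k)) = integral {a - \<delta> k..b - \<delta> k} \<Psi>"
      using integral_shift_Icc_real[of a b \<Psi> "- \<delta> k"] by (simp add: o_def)
    have "integral {a - \<delta> k..b} \<Psi> = integral {a - \<delta> k..a} \<Psi> + integral {a..b} \<Psi>"
      using \<delta>(1)[of k] ab by (intro Henstock_Kurzweil_Integration.integral_combine[symmetric] i) auto
    moreover have "integral {a - \<delta> k..b} \<Psi> = integral {a - \<delta> k..b - \<delta> k} \<Psi> + integral {b - \<delta> k..b} \<Psi>"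
      using \<delta>(1)[of k] ab by (intro Henstock_Kurzweil_Integration.integral_combine[symmetric] i) auto
    moreover have "integral {a - \<delta> k..a} \<Psi> = \<delta> k * \<psi> a"
    proof -
      have "integral {a - \<delta> k..a} \<Psi> = integral {a - \<delta> k..a} (\<lambda>t. \<psi> a)"
        using ab by (intro Henstock_Kurzweil_Integration.integral_cong) (auto simp: \<Psi>_def cl_def)
      then show ?thesis using \<delta>(1)[of k] by simp
    qed
    moreover have "integral {b - \<delta> k..b} \<Psi> \<le> \<delta> k * (\<psi> b + L * \<delta> k)"
    proof -
      have "integral {b - \<delta> k..b} \<Psi> \<le> integral {b - \<delta> k..b} (\<lambda>t. \<psi> b + L * \<delta> k)"
      proof (rule integral_le[OF i])
        fix t assume t: "t \<in> {b - \<delta> k..b}"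
        have "\<Psi> t \<le> \<Psi> b + L * \<bar>t - b\<bar>" using lip[of t b] by linarith
        also have "\<dots> \<le> \<Psi> b + L * \<delta> k" using t L0 by (intro add_left_mono mult_left_mono) auto
        finally show "\<Psi> t \<le> \<psi> b + L * \<delta> k" using ab by (simp add: \<Psi>_def cl_def)
      qed (rule integrable_const_ivl)
      then show ?thesis using \<delta>(1)[of k] by simp
    qed
    ultimately have "\<delta> k * (\<psi> a - \<psi> b - L * \<delta> k) \<le> integral {a..b} (\<lambda>t. \<Psi> (t - \<delta> k)) - integral {a..b} \<Psi>"
      unfolding sh by (simp add: algebra_simps)
    also have "\<dots> = integral {a..b} (\<lambda>t. \<Psi> (t - \<delta> k) - \<Psi> t)"
      by (intro Henstock_Kurzweil_Integration.integral_diff[symmetric] i integrable_continuous_interval continuous_on_compose2[OF cont[of UNIV]] continuous_intros) auto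
    finally show ?thesis
      using \<delta>(1)[of k] unfolding p_def by (simp add: le_divide_eq mult.commute)
  qed
  \<comment> \<open>Passing to \<open>ennreal\<close> discards negative values, which only enlarges
    the integral; the two end points are null.\<close>
  have Ipk: "ennreal (integral {a..b} (p k)) \<le> (\<integral>\<^sup>+t. ennreal (p k t) * indicator {a<..<b} t \<partial>lebesgue)" for k
  proof -
    have si: "integrable lborel (\<lambda>t. indicator {a..b} t *\<^sub>R p k t)"
      by (rule borel_integrable_compact[OF _ pc]) auto
    have "integral {a..b} (p k) = (\<integral>t. indicator {a..b} t *\<^sub>R p k t \<partial>lborel)"
      using set_borel_integral_eq_integral(2)[of "{a..b}" "p k"] si by (simp add: set_integrable_def set_lebesgue_integral_def)
    also have "\<dots> \<le> (\<integral>t. max 0 (indicator {a..b} t *\<^sub>R p k t) \<partial>lborel)"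
      by (intro integral_mono si integrable_max) auto
    finally have "ennreal (integral {a..b} (p k)) \<le> ennreal (\<integral>t. max 0 (indicator {a..b} t *\<^sub>R p k t) \<partial>lborel)" by (rule ennreal_leI)
    also have "\<dots> = (\<integral>\<^sup>+t. ennreal (max 0 (indicator {a..b} t *\<^sub>R p k t)) \<partial>lborel)"
      by (intro nn_integral_eq_integral[symmetric] integrable_max si) auto
    also have "\<dots> = (\<integral>\<^sup>+t. ennreal (max 0 (indicator {a..b} t *\<^sub>R p k t)) \<partial>lebesgue)"
      by (rule nn_integral_completion[symmetric])
    also have "\<dots> = (\<integral>\<^sup>+t. ennreal (p k t) * indicator {a<..<b} t \<partial>lebesgue)"
    proof (rule nn_integral_cong_AE)
      show "AE t in lebesgue. ennreal (max 0 (indicator {a..b} t *\<^sub>R p k t)) = ennreal (p k t) * indicator {a<..<b} t"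
        by (rule AE_I'[of "{a, b}"]) (auto simp: negligible_iff_null_sets[symmetric] indicator_def max_def ennreal_neg split: if_splits)
    qed
    finally show ?thesis .
  qed
  have lim1: "ennreal (\<psi> a - \<psi> b) \<le> limsup (\<lambda>k. \<integral>\<^sup>+t. ennreal (p k t) * indicator {a<..<b} t \<partial>lebesgue)"
  proof -
    have "(\<lambda>k. \<psi> a - \<psi> b - L * \<delta> k) \<longlonglongrightarrow> \<psi> a - \<psi> b - L * 0" by (intro tendsto_intros \<delta>0)
    then have "(\<lambda>k. ennreal (\<psi> a - \<psi> b - L * \<delta> k)) \<longlonglongrightarrow> ennreal (\<psi> a - \<psi> b)"
      by (intro tendsto_ennrealI) simp
    then have "ennreal (\<psi> a - \<psi> b) = limsup (\<lambda>k. ennreal (\<psi> a - \<psi> b - L * \<delta> k))"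
      by (simp add: lim_imp_Limsup)
    also have "\<dots> \<le> limsup (\<lambda>k. \<integral>\<^sup>+t. ennreal (p k t) * indicator {a<..<b} t \<partial>lebesgue)"
      by (intro Limsup_mono always_eventually allI order_trans[OF ennreal_leI[OF ipk] Ipk])
    finally show ?thesis .
  qed
  \<comment> \<open>Reverse Fatou, with the Lipschitz constant on the bounded interval as integrable
    majorant.\<close>
  also have "\<dots> \<le> (\<integral>\<^sup>+t. limsup (\<lambda>k. ennreal (p k t) * indicator {a<..<b} t) \<partial>lebesgue)"
  proof (rule nn_integral_limsup[where w="\<lambda>t. ennreal L * indicator {a<..<b} t"])
    show "(\<lambda>t. ennreal (p k t) * indicator {a<..<b} t) \<in> borel_measurable lebesgue" for k
      using borel_measurable_continuous_onI[OF pc[of UNIV k]]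
      by (intro borel_measurable_times_ennreal measurable_compose[OF _ measurable_ennreal] borel_measurable_indicator) (auto simp: measurable_completion)
    show "(\<lambda>t. ennreal L * indicator {a<..<b} t) \<in> borel_measurable lebesgue"
      by (intro borel_measurable_times_ennreal borel_measurable_indicator) auto
    show "AE t in lebesgue. ennreal (p k t) * indicator {a<..<b} t \<le> ennreal L * indicator {a<..<b} t" for k
      using pL by (intro AE_I2 mult_right_mono ennreal_leI) auto
    show "(\<integral>\<^sup>+t. ennreal L * indicator {a<..<b} t \<partial>lebesgue) < \<infinity>"
      using ab by (subst nn_integral_cmult_indicator) (auto simp: ennreal_mult_less_top)
  qed
  also have "\<dots> \<le> (\<integral>\<^sup>+t\<in>{a<..<b}. f t \<partial>lebesgue)"
  proof (rule nn_integral_mono_AE, use ae in eventually_elim)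
    fix t assume t: "t \<in> {a<..<b} \<longrightarrow> (\<forall>c. f t < ennreal c \<longrightarrow>
        (\<forall>\<^sub>F k in sequentially. real (Suc k) * (\<psi> (t - 1 / real (Suc k)) - \<psi> t) \<le> c))"
    show "limsup (\<lambda>k. ennreal (p k t) * indicator {a<..<b} t) \<le> f t * indicator {a<..<b} t"
    proof (cases "t \<in> {a<..<b}")
      case True
      have "limsup (\<lambda>k. ennreal (p k t)) \<le> y" if y: "f t < y" for y
      proof (cases y)
        case (real c)
        then have "\<forall>\<^sub>F k in sequentially. real (Suc k) * (\<psi> (t - 1 / real (Suc k)) - \<psi> t) \<le> c"
          using t True y by blast
        moreover have "\<forall>\<^sub>F k in sequentially. \<delta> k < t - a"
          using order_tendstoD(2)[OF \<delta>0, of "t - a"] True by simp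
        ultimately have "\<forall>\<^sub>F k in sequentially. ennreal (p k t) \<le> y"
        proof eventually_elim
          case (elim k)
          then have "cl (t - \<delta> k) = t - \<delta> k" "cl t = t" using True \<delta>(1)[of k] by (auto intro!: cl(3))
          then have "p k t \<le> c" using elim(1) by (simp add: p_def \<Psi>_def \<delta>_def mult.commute)
          then show ?case using real by (simp add: ennreal_leI)
        qed
        then show ?thesis by (rule Limsup_bounded)
      qed simp
      \<comment> \<open>The hypothesis speaks only of bounds strictly above \<open>f t\<close>, and
        the order of \<open>ennreal\<close> is dense; the case of the bound \<infinity> is
        trivial.\<close>
      then have "limsup (\<lambda>k. ennreal (p k t)) \<le> f t" by (rule dense_ge)
      then show ?thesis using True by simp
    qed (simp add: Limsup_const)
  qed
  finally show ?thesis .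
qed

lemma backward_quotient_tendsto:
  fixes \<psi> :: "real \<Rightarrow> real"
  assumes "(\<psi> has_real_derivative D) (at t)"
  shows "(\<lambda>k. real (Suc k) * (\<psi> (t - 1 / real (Suc k)) - \<psi> t)) \<longlonglongrightarrow> - D"
proof -
  have "((\<lambda>h. (\<psi> (t + h) - \<psi> t) / h) \<longlongrightarrow> D) (at 0)" using assms by (simp add: DERIV_def)
  moreover have "filterlim (\<lambda>k. - (1 / real (Suc k))) (at 0) sequentially"
    using tendsto_minus[OF LIMSEQ_inverse_real_of_nat] by (auto simp: filterlim_at inverse_eq_divide)
  ultimately have "(\<lambda>k. (\<psi> (t + - (1 / real (Suc k))) - \<psi> t) / (- (1 / real (Suc k)))) \<longlonglongrightarrow> D"
    by (rule filterlim_compose)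
  then have "(\<lambda>k. - ((\<psi> (t + - (1 / real (Suc k))) - \<psi> t) / (- (1 / real (Suc k))))) \<longlonglongrightarrow> - D"
    by (rule tendsto_minus)
  then show ?thesis by (simp add: mult.commute)
qed

text \<open>The case of a constant majorant. Applied to a function and its negative it shows that a
  Lipschitz function with derivative 0 almost everywhere is constant.\<close>

lemma lipschitz_decrement_le:
  fixes \<psi> :: "real \<Rightarrow> real"
  assumes ab: "a \<le> b" and L: "L-lipschitz_on {a..b} \<psi>" and c: "c \<ge> 0"
    and ae: "AE t in lebesgue. t \<in> {a<..<b} \<longrightarrow> (\<exists>D. (\<psi> has_real_derivative D) (at t) \<and> - D \<le> c)"
  shows "\<psi> a - \<psi> b \<le> c * (b - a)"
proof -
  have "ennreal (\<psi> a - \<psi> b) \<le> (\<integral>\<^sup>+t\<in>{a<..<b}. ennreal c \<partial>lebesgue)"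
  proof (rule lipschitz_decrement_le_nn_integral[OF ab L], use ae in eventually_elim, intro impI allI)
    fix t c' assume t: "t \<in> {a<..<b} \<longrightarrow> (\<exists>D. (\<psi> has_real_derivative D) (at t) \<and> - D \<le> c)" "t \<in> {a<..<b}"
      and c': "ennreal c < ennreal c'"
    then obtain D where D: "(\<psi> has_real_derivative D) (at t)" "- D \<le> c" by blast
    have "c < c'" using c' c by (simp add: ennreal_less_iff)
    then have "- D < c'" using D by simp
    from order_tendstoD(2)[OF backward_quotient_tendsto[OF D(1)] this]
    show "\<forall>\<^sub>F k in sequentially. real (Suc k) * (\<psi> (t - 1 / real (Suc k)) - \<psi> t) \<le> c'"
      by eventually_elim simp
  qed
  also have "\<dots> = ennreal c * ennreal (b - a)" using ab by (subst nn_integral_cmult_indicator) auto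
  also have "\<dots> = ennreal (c * (b - a))" using c by (simp add: ennreal_mult')
  finally show ?thesis using c ab by (subst (asm) ennreal_le_iff) auto
qed

section \<open>Rigid motions with bounded measurable velocity\<close>

text \<open>Lebesgue differentiation is used in a one-sided form: applied to \<open>g\<close> it
  gives the right derivative, applied to the reflection of \<open>g\<close> the left one. The
  exceptional set does not depend on the starting point \<open>c\<close>.\<close>

lemma indefinite_integral_has_vector_derivative_ae:
  fixes g :: "real \<Rightarrow> 'a::euclidean_space"
  assumes g: "\<And>a b. g integrable_on {a..b}"
  shows "AE t in lebesgue. \<forall>c<t. ((\<lambda>x. integral {c..x} g) has_vector_derivative g t) (at t)"
proof -
  obtain N1 where N1: "negligible N1" "\<And>x e. x \<notin> N1 \<Longrightarrow> 0 < e \<Longrightarrow>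
      \<exists>d>0. \<forall>h. 0 < h \<and> h < d \<longrightarrow> norm (integral {x..x + h} g /\<^sub>R h - g x) < e"
    using integrable_ccontinuous_explicit[of g] g by (auto simp: cbox_interval)
  have gm: "(\<lambda>x. g (- x)) integrable_on {a..b}" for a b
    using Henstock_Kurzweil_Integration.integrable_reflect_real[of g "- a" "- b"] g[of "- b" "- a"] by simp
  obtain N2 where N2: "negligible N2" "\<And>x e. x \<notin> N2 \<Longrightarrow> 0 < e \<Longrightarrow>
      \<exists>d>0. \<forall>h. 0 < h \<and> h < d \<longrightarrow> norm (integral {x..x + h} (\<lambda>x. g (- x)) /\<^sub>R h - g (- x)) < e"
    using integrable_ccontinuous_explicit[of "\<lambda>x. g (- x)"] gm by (auto simp: cbox_interval)
  have neg: "negligible (N1 \<union> uminus ` N2)"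
    by (intro negligible_Un N1 negligible_differentiable_image_negligible N2) (auto simp: differentiable_on_def)
  have "((\<lambda>x. integral {c..x} g) has_vector_derivative g t) (at t)"
    if t: "t \<notin> N1 \<union> uminus ` N2" and c: "c < t" for t c
    unfolding has_vector_derivative_def has_derivative_at'
  proof (intro conjI allI impI)
    show "bounded_linear (\<lambda>h. h *\<^sub>R g t)" by (rule bounded_linear_scaleR_left)
    fix e :: real assume e: "e > 0"
    have "- t \<notin> N2" using t by (metis UnI2 image_eqI minus_minus)
    then obtain d2 where d2: "d2 > 0" "\<And>h. 0 < h \<Longrightarrow> h < d2 \<Longrightarrow> norm (integral {- t..- t + h} (\<lambda>x. g (- x)) /\<^sub>R h - g t) < e"
      using N2(2)[of "- t" e] e by auto
    obtain d1 where d1: "d1 > 0" "\<And>h. 0 < h \<Longrightarrow> h < d1 \<Longrightarrow> norm (integral {t..t + h} g /\<^sub>R h - g t) < e"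
      using N1(2)[of t e] e t by auto
    define d where "d = min (min d1 d2) (t - c)"
    have "norm (integral {c..x} g - integral {c..t} g - (x - t) *\<^sub>R g t) / norm (x - t) < e"
      if x: "0 < norm (x - t)" "norm (x - t) < d" for x
    proof (cases "t < x")
      case True
      have "integral {c..x} g = integral {c..t} g + integral {t..x} g"
        using True c by (intro Henstock_Kurzweil_Integration.integral_combine[symmetric] g) auto
      then have "norm (integral {c..x} g - integral {c..t} g - (x - t) *\<^sub>R g t) / norm (x - t)
          = norm ((integral {t..t + (x - t)} g - (x - t) *\<^sub>R g t) /\<^sub>R (x - t))"
        using True by (simp add: divide_inverse mult.commute)
      also have "\<dots> = norm (integral {t..t + (x - t)} g /\<^sub>R (x - t) - g t)"
        using True by (simp add: scaleR_diff_right)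
      also have "\<dots> < e" using True x by (intro d1) (auto simp: d_def)
      finally show ?thesis .
    next
      case False
      then have xt: "x < t" "c < x" using x by (auto simp: d_def)
      have "integral {c..t} g = integral {c..x} g + integral {x..t} g"
        using xt by (intro Henstock_Kurzweil_Integration.integral_combine[symmetric] g) auto
      define J where "J = integral {- t..- t + (t - x)} (\<lambda>x. g (- x))"
      have "J = integral {x..t} g"
      proof -
        have "- t + (t - x) = - x" by simp
        then show ?thesis
          unfolding J_def by (simp only: Henstock_Kurzweil_Integration.integral_reflect_real[of t x g])
      qed
      then have "integral {c..x} g - integral {c..t} g - (x - t) *\<^sub>R g t = - (J - (t - x) *\<^sub>R g t)"
        using \<open>integral {c..t} g = _\<close> by (simp add: algebra_simps)
      then have "norm (integral {c..x} g - integral {c..t} g - (x - t) *\<^sub>R g t) / norm (x - t)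
          = norm ((J - (t - x) *\<^sub>R g t) /\<^sub>R (t - x))"
        using xt by (simp only: norm_minus_cancel) (simp add: divide_inverse mult.commute abs_minus_commute)
      also have "\<dots> = norm (J /\<^sub>R (t - x) - g t)"
        using xt by (simp add: scaleR_diff_right)
      also have "\<dots> < e" unfolding J_def using xt x by (intro d2) (auto simp: d_def)
      finally show ?thesis .
    qed
    moreover have "d > 0" using d1 d2 c by (simp add: d_def)
    ultimately show "\<exists>d>0. \<forall>x'. 0 < norm (x' - t) \<and> norm (x' - t) < d \<longrightarrow>
        norm (integral {c..x'} g - integral {c..t} g - (x' - t) *\<^sub>R g t) / norm (x' - t) < e" by blast
  qed
  then show ?thesis
    by (intro AE_I'[of "N1 \<union> uminus ` N2"]) (use neg in \<open>auto simp: negligible_iff_null_sets\<close>)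
qed

text \<open>Picard iteration; the weight \<open>exp (2 * M * t)\<close> makes it a contraction on the whole interval.\<close>

lemma rotation_integral_equation:
  fixes \<omega> :: "real \<Rightarrow> real^3"
  assumes m: "\<omega> \<in> borel_measurable lebesgue" and M: "\<And>t. norm (\<omega> t) \<le> M" and T: "T \<ge> 0"
  obtains w where "continuous_on {0..T} w" "\<And>t. t \<in> {0..T} \<Longrightarrow> (\<lambda>s. cross3 (\<omega> s) (w s)) integrable_on {0..t}"
    "\<And>t. t \<in> {0..T} \<Longrightarrow> w t = w0 + integral {0..t} (\<lambda>s. cross3 (\<omega> s) (w s))"
proof -
  have M0: "M \<ge> 0" using M[of 0] norm_ge_zero order_trans by blast
  have int: "(\<lambda>s. cross3 (\<omega> s) (v s)) integrable_on {0..t}" if v: "continuous_on {0..T} v" and t: "t \<in> {0..T}" for v t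
  proof -
    have v': "continuous_on {0..t} v" using v t continuous_on_subset by fastforce
    obtain K where K: "\<And>s. s \<in> {0..t} \<Longrightarrow> norm (v s) \<le> K"
      using compact_imp_bounded[OF compact_continuous_image[OF v' compact_Icc]] unfolding bounded_iff by blast
    have "(\<lambda>s. cross3 (\<omega> s) (v s)) \<in> borel_measurable (lebesgue_on {0..t})"
    proof (rule borel_measurable_continuous_Pair[where H=cross3])
      show "\<omega> \<in> borel_measurable (lebesgue_on {0..t})" using m by (rule measurable_restrict_space1)
      show "v \<in> borel_measurable (lebesgue_on {0..t})"
        using v' by (rule continuous_imp_measurable_on_sets_lebesgue) simp
      show "continuous_on UNIV (\<lambda>x. cross3 (fst x) (snd x))"
        by (intro continuous_on_cross continuous_intros)
    qed
    moreover have "norm (cross3 (\<omega> s) (v s)) \<le> M * K" if "s \<in> {0..t}" for s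
    proof -
      have "norm (cross3 (\<omega> s) (v s)) \<le> norm (\<omega> s) * norm (v s)" by (rule norm_cross3_le)
      also have "\<dots> \<le> M * K" using M K[OF that] M0 by (intro mult_mono) auto
      finally show ?thesis .
    qed
    ultimately show ?thesis
      by (rule measurable_bounded_by_integrable_imp_integrable[OF _ integrable_const_ivl]) simp_all
  qed
  \<comment> \<open>By linearity the difference of consecutive Picard iterates is the integral
    operator applied \<open>n\<close> times to \<open>w0\<close>; the solution is the sum of these
    differences.\<close>
  define W where "W n = ((\<lambda>v t. integral {0..t} (\<lambda>s. cross3 (\<omega> s) (v s))) ^^ n) (\<lambda>_. w0)" for n
  have W0: "W 0 = (\<lambda>_. w0)" and WS: "W (Suc n) = (\<lambda>t. integral {0..t} (\<lambda>s. cross3 (\<omega> s) (W n s)))" for n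
    by (simp_all add: W_def)
  have Wc: "continuous_on {0..T} (W n)" for n
  proof (induction n)
    case (Suc n)
    show ?case unfolding WS using T by (intro indefinite_integral_continuous_1 int Suc.IH) auto
  qed (simp add: W0)
  have Wb: "norm (W n t) \<le> norm w0 * exp (2 * M * t) / 2 ^ n" if "t \<in> {0..T}" for n t
    using that
  proof (induction n arbitrary: t)
    case 0
    have "norm w0 * 1 \<le> norm w0 * exp (2 * M * t)" using 0 M0 by (intro mult_left_mono) auto
    then show ?case by (simp add: W0)
  next
    case (Suc n)
    define F where "F s = norm w0 * exp (2 * M * s) / 2 ^ Suc n" for s
    \<comment> \<open>Integrating \<open>M * exp (2 * M * s)\<close> produces a factor 1/2, the
      contraction gained from the exponential weight.\<close>
    have "((\<lambda>s. M * (norm w0 * exp (2 * M * s) / 2 ^ n)) has_integral (F t - F 0)) {0..t}"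
      using Suc.prems unfolding F_def
      by (intro fundamental_theorem_of_calculus)
         (auto intro!: derivative_eq_intros simp: has_real_derivative_iff_has_vector_derivative[symmetric])
    moreover have "norm (cross3 (\<omega> s) (W n s)) \<le> M * (norm w0 * exp (2 * M * s) / 2 ^ n)" if "s \<in> {0..t}" for s
    proof -
      have "norm (cross3 (\<omega> s) (W n s)) \<le> norm (\<omega> s) * norm (W n s)" by (rule norm_cross3_le)
      also have "\<dots> \<le> M * (norm w0 * exp (2 * M * s) / 2 ^ n)"
        using M Suc.IH[of s] that Suc.prems M0 by (intro mult_mono) auto
      finally show ?thesis .
    qed
    ultimately have "norm (W (Suc n) t) \<le> integral {0..t} (\<lambda>s. M * (norm w0 * exp (2 * M * s) / 2 ^ n))"
      unfolding WS using Suc.prems by (intro integral_norm_bound_integral int Wc) auto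
    also have "\<dots> = F t - F 0" using \<open>(_ has_integral _) _\<close> by (rule integral_unique)
    also have "\<dots> \<le> F t" by (simp add: F_def)
    finally show ?case by (simp add: F_def)
  qed
  define K where "K = norm w0 * exp (2 * M * T)"
  have WK: "norm (W n t) \<le> K * (1 / 2) ^ n" if "t \<in> {0..T}" for n t
  proof -
    have "norm w0 * exp (2 * M * t) / 2 ^ n \<le> K / 2 ^ n"
      unfolding K_def using that M0 by (intro divide_right_mono mult_left_mono) (auto intro: mult_left_mono)
    then show ?thesis using Wb[OF that, of n] by (simp add: power_one_over)
  qed
  define w where "w t = (\<Sum>n. W n t)" for t
  have ul: "uniform_limit {0..T} (\<lambda>n t. \<Sum>i<n. W i t) w sequentially"
    unfolding w_def[abs_def] by (rule Weierstrass_m_test[OF WK]) (auto intro!: summable_mult summable_geometric)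
  show thesis
  proof
    show wc: "continuous_on {0..T} w"
      by (rule uniform_limit_theorem[OF always_eventually ul]) (auto intro!: continuous_on_sum Wc)
    show "(\<lambda>s. cross3 (\<omega> s) (w s)) integrable_on {0..t}" if "t \<in> {0..T}" for t
      using int[OF wc that] .
    fix t assume t: "t \<in> {0..T}"
    define I where "I v = integral {0..t} (\<lambda>s. cross3 (\<omega> s) (v s))" for v
    define F where "F n = (\<lambda>t. \<Sum>i<n. W i t)" for n
    have Fc: "continuous_on {0..T} (F n)" for n unfolding F_def by (intro continuous_on_sum Wc)
    have FS: "F (Suc n) t = w0 + I (F n)" for n
    proof -
      have "I (F n) = integral {0..t} (\<lambda>s. \<Sum>i<n. cross3 (\<omega> s) (W i s))"
        unfolding I_def F_def by (simp add: linear_sum[OF bounded_linear.linear[OF cross3_bounded_linear]])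
      also have "\<dots> = (\<Sum>i<n. W (Suc i) t)"
        unfolding WS using t by (intro integral_sum int Wc) auto
      finally show ?thesis unfolding F_def by (simp add: sum.lessThan_Suc_shift W0 del: sum.lessThan_Suc)
    qed
    have "(\<lambda>n. I (F n)) \<longlonglongrightarrow> I w"
      unfolding tendsto_iff
    proof (intro allI impI)
      fix e :: real assume e: "e > 0"
      define e' where "e' = e / (2 * (M * T + 1))"
      have MT: "M * T + 1 > 0" using M0 T by (simp add: add_nonneg_pos)
      have e': "e' > 0" using e MT by (simp add: e'_def)
      from uniform_limitD[OF ul e'] show "\<forall>\<^sub>F n in sequentially. dist (I (F n)) (I w) < e"
      proof eventually_elim
        case (elim n)
        have "I (F n) - I w = integral {0..t} (\<lambda>s. cross3 (\<omega> s) (F n s) - cross3 (\<omega> s) (w s))"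
          unfolding I_def by (intro Henstock_Kurzweil_Integration.integral_diff[symmetric] int wc Fc t)
        also have "norm \<dots> \<le> integral {0..t} (\<lambda>s. M * e')"
        proof (rule integral_norm_bound_integral)
          show "(\<lambda>s. cross3 (\<omega> s) (F n s) - cross3 (\<omega> s) (w s)) integrable_on {0..t}"
            by (intro integrable_diff int wc Fc t)
          fix s assume "s \<in> {0..t}"
          then have "norm (F n s - w s) \<le> e'" using elim t unfolding F_def by (force simp: dist_norm)
          then have "norm (\<omega> s) * norm (F n s - w s) \<le> M * e'" using M M0 by (intro mult_mono) auto
          then show "norm (cross3 (\<omega> s) (F n s) - cross3 (\<omega> s) (w s)) \<le> M * e'"
            using norm_cross3_le[of "\<omega> s" "F n s - w s"] by (simp add: Cross3.right_diff_distrib)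
        qed (rule integrable_const_ivl)
        also have "\<dots> = (M * t) * e'" using t by simp
        also have "\<dots> \<le> (M * T + 1) * e'" using t M0 e' by (intro mult_right_mono) (auto intro: add_increasing2 mult_left_mono)
        also have "\<dots> < e" using mult_pos_pos[OF e MT] MT by (simp add: e'_def divide_less_eq algebra_simps)
        finally show ?case by (simp add: dist_norm)
      qed
    qed
    then have "(\<lambda>n. F (Suc n) t) \<longlonglongrightarrow> w0 + I w" unfolding FS by (intro tendsto_intros)
    moreover have "(\<lambda>n. F (Suc n) t) \<longlonglongrightarrow> w t"
      using LIMSEQ_Suc[OF tendsto_uniform_limitI[OF ul t]] unfolding F_def .
    ultimately show "w t = w0 + integral {0..t} (\<lambda>s. cross3 (\<omega> s) (w s))"
      unfolding I_def using LIMSEQ_unique by blast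
  qed
qed

text \<open>The bound on \<open>\<omega>\<close> holds only almost everywhere, so the integral
  equation is solved for a version bounded everywhere. Both versions agree at almost every time of
  the interval, which is all that the differential equation asks for.\<close>

lemma rotation_ode:
  fixes \<omega> :: "real \<Rightarrow> real^3"
  assumes \<omega>: "\<omega> \<in> Linf T" and T: "T > 0"
  obtains w L where "w 0 = w0" "L-lipschitz_on {0..<T} w"
    "AE t in lebesgue_on {0<..<T}. (w has_vector_derivative cross3 (\<omega> t) (w t)) (at t)"
proof -
  obtain M where m: "\<omega> \<in> borel_measurable (lebesgue_on {0<..<T})"
    and M: "AE t in lebesgue_on {0<..<T}. norm (\<omega> t) \<le> M"
    using \<omega> by (auto simp: Linf_def)
  \<comment> \<open>First extended by 0 to all times, which keeps measurability, then set to 0 where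
    the bound fails.\<close>
  define \<omega>1 where "\<omega>1 t = (if t \<in> {0<..<T} then \<omega> t else 0)" for t
  have m1: "\<omega>1 \<in> borel_measurable lebesgue"
    unfolding \<omega>1_def[abs_def] using m by (subst borel_measurable_if) auto
  define \<omega>2 where "\<omega>2 t = (if norm (\<omega>1 t) \<le> \<bar>M\<bar> then \<omega>1 t else 0)" for t
  have m2: "\<omega>2 \<in> borel_measurable lebesgue"
    unfolding \<omega>2_def[abs_def] using measurable_compose[OF m1 borel_measurable_norm]
    by (intro measurable_If m1 borel_measurable_const borel_measurable_le) auto
  have b2: "norm (\<omega>2 t) \<le> \<bar>M\<bar>" for t by (simp add: \<omega>2_def)
  obtain w where w: "continuous_on {0..T} w" "\<And>t. t \<in> {0..T} \<Longrightarrow> (\<lambda>s. cross3 (\<omega>2 s) (w s)) integrable_on {0..t}"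
    "\<And>t. t \<in> {0..T} \<Longrightarrow> w t = w0 + integral {0..t} (\<lambda>s. cross3 (\<omega>2 s) (w s))"
    using rotation_integral_equation[OF m2 b2, of T w0] T by auto
  define G where "G s = (if s \<in> {0..T} then cross3 (\<omega>2 s) (w s) else 0)" for s
  have iU: "G integrable_on UNIV"
    unfolding G_def using w(2)[of T] T by (subst integrable_restrict_UNIV) auto
  have iG: "G integrable_on {a..b}" for a b by (rule integrable_on_subinterval[OF iU]) simp
  have wG: "w t = w0 + integral {0..t} G" if "t \<in> {0..T}" for t
    using w(3)[OF that] that by (auto simp: G_def intro!: Henstock_Kurzweil_Integration.integral_cong)
  obtain K where K: "\<And>t. t \<in> {0..T} \<Longrightarrow> norm (w t) \<le> K"
    using compact_imp_bounded[OF compact_continuous_image[OF w(1) compact_Icc]] unfolding bounded_iff by blast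
  have K0: "K \<ge> 0" using K[of 0] T order_trans[OF norm_ge_zero[of "w 0"]] by simp
  have Gb: "norm (G s) \<le> \<bar>M\<bar> * K" for s
  proof (cases "s \<in> {0..T}")
    case True
    have "norm (cross3 (\<omega>2 s) (w s)) \<le> norm (\<omega>2 s) * norm (w s)" by (rule norm_cross3_le)
    also have "\<dots> \<le> \<bar>M\<bar> * K" using b2 K[OF True] by (intro mult_mono) auto
    finally show ?thesis using True by (simp add: G_def)
  qed (use K0 in \<open>auto simp: G_def\<close>)
  show thesis
  proof
    show "w 0 = w0" using w(3)[of 0] T by simp
    have incr: "norm (w b - w a) \<le> \<bar>M\<bar> * K * (b - a)" if ab: "0 \<le> a" "a \<le> b" "b \<le> T" for a b
    proof -
      have "integral {0..b} G = integral {0..a} G + integral {a..b} G"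
        using ab by (intro Henstock_Kurzweil_Integration.integral_combine[symmetric] iG) auto
      then have "w b - w a = integral {a..b} G" using wG[of a] wG[of b] ab by simp
      also have "norm \<dots> \<le> integral {a..b} (\<lambda>_. \<bar>M\<bar> * K)"
        by (intro integral_norm_bound_integral iG integrable_const_ivl Gb)
      also have "\<dots> = \<bar>M\<bar> * K * (b - a)" using ab by simp
      finally show ?thesis .
    qed
    show "(\<bar>M\<bar> * K)-lipschitz_on {0..<T} w"
    proof (rule lipschitz_onI)
      fix s t assume "s \<in> {0..<T}" "t \<in> {0..<T}"
      then show "dist (w s) (w t) \<le> \<bar>M\<bar> * K * dist s t"
        using incr[of s t] incr[of t s] by (cases "s \<le> t") (auto simp: dist_norm norm_minus_commute)
    qed (use K0 in simp)
    have "AE t in lebesgue. t \<in> {0<..<T} \<longrightarrow> norm (\<omega> t) \<le> M"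
      using M by (simp add: AE_restrict_space_iff)
    with indefinite_integral_has_vector_derivative_ae[OF iG]
    have "AE t in lebesgue. t \<in> {0<..<T} \<longrightarrow> (w has_vector_derivative cross3 (\<omega> t) (w t)) (at t)"
    proof eventually_elim
      case (elim t)
      show ?case
      proof
        assume t: "t \<in> {0<..<T}"
        then have "((\<lambda>x. w0 + integral {0..x} G) has_vector_derivative 0 + G t) (at t)"
          using elim(1) by (intro has_vector_derivative_add has_vector_derivative_const) auto
        moreover have "G t = cross3 (\<omega> t) (w t)"
          using t elim(2) by (auto simp: G_def \<omega>2_def \<omega>1_def)
        ultimately have "((\<lambda>x. w0 + integral {0..x} G) has_vector_derivative cross3 (\<omega> t) (w t)) (at t)" by simp
        then show "(w has_vector_derivative cross3 (\<omega> t) (w t)) (at t)"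
          by (rule has_vector_derivative_transform_within_open[where S="{0<..<T}"]) (use t wG in auto)
      qed
    qed
    then show "AE t in lebesgue_on {0<..<T}. (w has_vector_derivative cross3 (\<omega> t) (w t)) (at t)"
      by (simp add: AE_restrict_space_iff)
  qed
qed

text \<open>The difference \<open>d\<close> satisfies \<open>d' = cross3 \<omega> d\<close> almost
  everywhere, which is orthogonal to \<open>d\<close>; so the squared distance is Lipschitz with
  derivative 0 almost everywhere. Equal initial points give uniqueness of trajectories.\<close>

lemma dist_trajectories:
  assumes x: "trajectory T us \<omega> xs x" and y: "trajectory T us \<omega> xs y" and t: "t \<in> {0..<T}"
  shows "dist (x t) (y t) = dist (x 0) (y 0)"
proof -
  define d where "d s = x s - y s" for s
  obtain K1 K2 where "K1-lipschitz_on {0..<T} x" "K2-lipschitz_on {0..<T} y"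
    using x y unfolding trajectory_def by blast
  then have "(K1 + K2)-lipschitz_on {0..<T} d" unfolding d_def by (rule lipschitz_on_diff)
  then have L: "(K1 + K2)-lipschitz_on {0..t} d" using t by (auto intro: lipschitz_on_subset)
  obtain B where B: "\<And>s. s \<in> {0..t} \<Longrightarrow> norm (d s) \<le> B"
    using compact_imp_bounded[OF compact_continuous_image[OF lipschitz_on_continuous_on[OF L] compact_Icc]]
    unfolding bounded_iff by blast
  have B0: "B \<ge> 0" using B[of 0] t order_trans[OF norm_ge_zero[of "d 0"]] by simp
  define \<psi> where "\<psi> s = d s \<bullet> d s" for s
  have \<psi>L: "((K1 + K2) * (2 * B))-lipschitz_on {0..t} \<psi>"
  proof (rule lipschitz_onI)
    fix a b assume ab: "a \<in> {0..t}" "b \<in> {0..t}"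
    have "\<psi> a - \<psi> b = (d a - d b) \<bullet> (d a + d b)"
      by (simp add: \<psi>_def inner_simps inner_commute)
    then have "dist (\<psi> a) (\<psi> b) \<le> norm (d a - d b) * norm (d a + d b)"
      by (simp add: dist_real_def Cauchy_Schwarz_ineq2)
    also have "\<dots> \<le> ((K1 + K2) * dist a b) * (2 * B)"
    proof (rule mult_mono)
      show "norm (d a - d b) \<le> (K1 + K2) * dist a b" using lipschitz_onD[OF L ab] by (simp add: dist_norm)
      show "norm (d a + d b) \<le> 2 * B" using norm_triangle_ineq[of "d a" "d b"] B[OF ab(1)] B[OF ab(2)] by linarith
    qed (use lipschitz_on_nonneg[OF L] in auto)
    finally show "dist (\<psi> a) (\<psi> b) \<le> (K1 + K2) * (2 * B) * dist a b" by (simp add: algebra_simps)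
  qed (use lipschitz_on_nonneg[OF L] B0 in simp)
  have "AE s in lebesgue_on {0<..<T}. (\<psi> has_real_derivative 0) (at s)"
  proof -
    have "AE s in lebesgue_on {0<..<T}. (x has_vector_derivative us s + cross3 (\<omega> s) (x s - xs s)) (at s)"
      "AE s in lebesgue_on {0<..<T}. (y has_vector_derivative us s + cross3 (\<omega> s) (y s - xs s)) (at s)"
      using x y by (auto simp: trajectory_def)
    then show ?thesis
    proof eventually_elim
      case (elim s)
      have "(d has_vector_derivative cross3 (\<omega> s) (d s)) (at s)"
        using has_vector_derivative_diff[OF elim] unfolding d_def
        by (simp add: Cross3.right_diff_distrib)
      then have "(\<psi> has_vector_derivative d s \<bullet> cross3 (\<omega> s) (d s) + cross3 (\<omega> s) (d s) \<bullet> d s) (at s)"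
        unfolding \<psi>_def using bounded_bilinear.has_vector_derivative[OF bounded_bilinear_inner] by blast
      then show ?case by (simp add: dot_cross_self has_real_derivative_iff_has_vector_derivative)
    qed
  qed
  then have ae: "AE s in lebesgue. s \<in> {0<..<T} \<longrightarrow> (\<psi> has_real_derivative 0) (at s)"
    by (simp add: AE_restrict_space_iff)
  \<comment> \<open>Neither \<open>\<psi>\<close> nor \<open>- \<psi>\<close> can decrease, hence
    \<open>\<psi>\<close> is constant.\<close>
  have "\<psi> 0 - \<psi> t \<le> 0 * (t - 0)"
    by (rule lipschitz_decrement_le[OF _ \<psi>L], use t in simp, simp, use ae in eventually_elim) (use t in force)
  moreover have "(\<lambda>s. - \<psi> s) 0 - (\<lambda>s. - \<psi> s) t \<le> 0 * (t - 0)"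
  proof (rule lipschitz_decrement_le)
    show "((K1 + K2) * (2 * B))-lipschitz_on {0..t} (\<lambda>s. - \<psi> s)" using \<psi>L by simp
    show "AE s in lebesgue. s \<in> {0<..<t} \<longrightarrow> (\<exists>D. ((\<lambda>s. - \<psi> s) has_real_derivative D) (at s) \<and> - D \<le> 0)"
      using ae
    proof eventually_elim
      case (elim s)
      then show ?case using t DERIV_minus[of \<psi> 0 s UNIV] by force
    qed
  qed (use t in auto)
  ultimately have "\<psi> 0 = \<psi> t" by simp
  then show ?thesis by (simp add: \<psi>_def d_def dist_norm norm_eq)
qed

text \<open>Relative to \<open>xs\<close> the equation is linear and homogeneous, so a solution of
  the rotation equation is added to \<open>xs\<close>.\<close>

lemma trajectory_exists:
  assumes \<omega>: "\<omega> \<in> Linf T" and T: "T > 0" and xs: "trajectory T us \<omega> xs xs"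
  shows "\<exists>x. trajectory T us \<omega> xs x \<and> x 0 = x0"
proof -
  obtain w L where w: "w 0 = x0 - xs 0" "L-lipschitz_on {0..<T} w"
    "AE t in lebesgue_on {0<..<T}. (w has_vector_derivative cross3 (\<omega> t) (w t)) (at t)"
    using rotation_ode[OF \<omega> T] .
  obtain K where K: "K-lipschitz_on {0..<T} xs" using xs by (auto simp: trajectory_def)
  have "AE t in lebesgue_on {0<..<T}. (xs has_vector_derivative us t + cross3 (\<omega> t) (xs t - xs t)) (at t)"
    using xs by (simp add: trajectory_def)
  then have "AE t in lebesgue_on {0<..<T}. ((\<lambda>s. xs s + w s) has_vector_derivative
      us t + cross3 (\<omega> t) ((xs t + w t) - xs t)) (at t)"
    using w(3) by eventually_elim (auto dest: has_vector_derivative_add)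
  moreover have "(K + L)-lipschitz_on {0..<T} (\<lambda>s. xs s + w s)" using K w(2) by (rule lipschitz_on_add)
  ultimately have "trajectory T us \<omega> xs (\<lambda>s. xs s + w s)" unfolding trajectory_def by blast
  then show ?thesis using w(1) by (intro exI[of _ "\<lambda>s. xs s + w s"]) simp
qed

text \<open>The flow maps preserve distances and are therefore affine, determined by the images of
  the origin and the three unit vectors. Four trajectories thus control all others: this gives a
  Lipschitz constant uniform over the body and a single null set of times outside of which every
  particle has its velocity.\<close>

lemma rigid_motion_flow:
  assumes rm: "rigid_motion \<Omega> B T us \<omega> xs S" and T: "T > 0" and B: "bounded B"
  obtains E :: "real \<Rightarrow> real^3 \<Rightarrow> real^3" and L where
    "\<And>t. t \<in> {0..<T} \<Longrightarrow> S t = E t ` B" "\<And>x. E 0 x = x"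
    "\<And>t. t \<in> {0..<T} \<Longrightarrow> \<exists>R :: real^3 \<Rightarrow> real^3. orthogonal_transformation R \<and> E t = (\<lambda>x. E t 0 + R x)"
    "L \<ge> 0" "\<And>x s t. x \<in> closure B \<Longrightarrow> s \<in> {0..<T} \<Longrightarrow> t \<in> {0..<T} \<Longrightarrow> dist (E s x) (E t x) \<le> L * \<bar>s - t\<bar>"
    "\<And>t. t \<in> {0..<T} \<Longrightarrow> xs t = E t (xs 0)"
    "AE t in lebesgue. t \<in> {0<..<T} \<longrightarrow>
      (\<forall>x. ((\<lambda>s. E s x) has_vector_derivative us t + cross3 (\<omega> t) (E t x - xs t)) (at t))"
proof -
  have \<omega>: "\<omega> \<in> Linf T" and xs: "trajectory T us \<omega> xs xs"
    and S: "\<And>t. t \<in> {0..<T} \<Longrightarrow> S t = {x t |x. trajectory T us \<omega> xs x \<and> x 0 \<in> B}"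
    using rm unfolding rigid_motion_def by auto
  define E where "E t x0 = (SOME x. trajectory T us \<omega> xs x \<and> x 0 = x0) t" for t x0
  have E: "trajectory T us \<omega> xs (\<lambda>t. E t x0)" "E 0 x0 = x0" for x0
    using someI_ex[OF trajectory_exists[OF \<omega> T xs, of x0]] by (auto simp: E_def)
  have uniq: "x t = E t (x 0)" if "trajectory T us \<omega> xs x" "t \<in> {0..<T}" for x t
    using dist_trajectories[OF that(1) E(1)[of "x 0"] that(2)] E(2) by simp
  have iso: "dist (E t x) (E t y) = dist x y" if "t \<in> {0..<T}" for t x y
    using dist_trajectories[OF E(1)[of x] E(1)[of y] that] E(2) by simp
  have orth: "orthogonal_transformation (\<lambda>x. E t x - E t 0)" if "t \<in> {0..<T}" for t
    unfolding orthogonal_transformation_isometry using iso[OF that] by (simp add: dist_norm)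
  have aff: "E t x = E t 0 + (\<Sum>i\<in>UNIV. x $ i *\<^sub>R (E t (axis i 1) - E t 0))" if "t \<in> {0..<T}" for t x
  proof -
    have lin: "linear (\<lambda>x. E t x - E t 0)" using orth[OF that] by (simp add: orthogonal_transformation_linear)
    have "E t x - E t 0 = E t (\<Sum>i\<in>UNIV. x $ i *\<^sub>R axis i 1) - E t 0"
      using basis_expansion[of x] by (simp add: scalar_mult_eq_scaleR)
    also have "\<dots> = (\<Sum>i\<in>UNIV. x $ i *\<^sub>R (E t (axis i 1) - E t 0))"
      using linear_sum[OF lin, of "\<lambda>i. x $ i *\<^sub>R axis i 1" UNIV] linear_scale[OF lin] by simp
    finally show ?thesis by (simp add: algebra_simps)
  qed
  \<comment> \<open>At first the Lipschitz constant depends on the particle.\<close>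
  obtain K where K: "\<And>x0. (K x0)-lipschitz_on {0..<T} (\<lambda>t. E t x0)"
    using E(1) unfolding trajectory_def by metis
  have K0: "K x \<ge> 0" for x using lipschitz_on_nonneg[OF K] .
  obtain D where D: "D > 0" "\<And>x. x \<in> closure B \<Longrightarrow> norm x \<le> D"
    using B bounded_closure bounded_pos by metis
  define L where "L = K 0 + (\<Sum>i\<in>UNIV. D * (K (axis i 1) + K 0))"
  show thesis
  proof (rule that)
    show "S t = E t ` B" if t: "t \<in> {0..<T}" for t
      unfolding S[OF t] using uniq[OF _ t] E by force
    show "E 0 x = x" for x by (rule E)
    show "\<exists>R :: real^3 \<Rightarrow> real^3. orthogonal_transformation R \<and> E t = (\<lambda>x. E t 0 + R x)" if "t \<in> {0..<T}" for t
      using orth[OF that] by (intro exI[of _ "\<lambda>x. E t x - E t 0"]) auto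
    show "L \<ge> 0" using K0 D by (auto simp: L_def intro!: add_nonneg_nonneg sum_nonneg)
    show "xs t = E t (xs 0)" if "t \<in> {0..<T}" for t using uniq[OF xs that] .
    show "dist (E s x) (E t x) \<le> L * \<bar>s - t\<bar>" if x: "x \<in> closure B" and st: "s \<in> {0..<T}" "t \<in> {0..<T}" for x s t
    proof -
      have k: "norm (E s y - E t y) \<le> K y * \<bar>s - t\<bar>" for y
        using lipschitz_onD[OF K st] by (simp add: dist_norm)
      have "E s x - E t x = (E s 0 - E t 0)
          + (\<Sum>i\<in>UNIV. x $ i *\<^sub>R ((E s (axis i 1) - E t (axis i 1)) - (E s 0 - E t 0)))"
        by (subst (1 2) aff[of _ x]) (use st in \<open>auto simp: algebra_simps sum.distrib sum_subtractf\<close>)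
      also have "norm \<dots> \<le> K 0 * \<bar>s - t\<bar> + (\<Sum>i\<in>UNIV. D * (K (axis i 1) * \<bar>s - t\<bar> + K 0 * \<bar>s - t\<bar>))"
      proof (intro norm_triangle_le add_mono k sum_norm_le)
        fix i :: 3
        have "norm ((E s (axis i 1) - E t (axis i 1)) - (E s 0 - E t 0)) \<le> K (axis i 1) * \<bar>s - t\<bar> + K 0 * \<bar>s - t\<bar>"
          using norm_triangle_ineq4 k add_mono order_trans by (metis (no_types, lifting))
        moreover have "\<bar>x $ i\<bar> \<le> D" using D(2)[OF x] component_le_norm_cart[of x i] by linarith
        ultimately show "norm (x $ i *\<^sub>R ((E s (axis i 1) - E t (axis i 1)) - (E s 0 - E t 0)))
            \<le> D * (K (axis i 1) * \<bar>s - t\<bar> + K 0 * \<bar>s - t\<bar>)"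
          using D(1) by (simp add: mult_mono)
      qed
      also have "\<dots> = L * \<bar>s - t\<bar>" by (simp add: L_def algebra_simps sum_distrib_left sum_distrib_right sum.distrib)
      finally show ?thesis by (simp add: dist_norm)
    qed
    let ?V = "\<lambda>t x. us t + cross3 (\<omega> t) (E t x - xs t)"
    have ae: "AE t in lebesgue. t \<in> {0<..<T} \<longrightarrow> ((\<lambda>s. E s x) has_vector_derivative ?V t x) (at t)" for x
      using E(1)[of x] by (simp add: trajectory_def AE_restrict_space_iff)
    \<comment> \<open>A countable union of null sets is null, and three unit vectors with the origin
      suffice for all \<open>x\<close>.\<close>
    have "AE t in lebesgue. \<forall>i::3. t \<in> {0<..<T} \<longrightarrow> ((\<lambda>s. E s (axis i 1)) has_vector_derivative ?V t (axis i 1)) (at t)"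
      using ae by (subst AE_all_countable) blast
    with ae[of 0] show "AE t in lebesgue. t \<in> {0<..<T} \<longrightarrow> (\<forall>x. ((\<lambda>s. E s x) has_vector_derivative ?V t x) (at t))"
    proof eventually_elim
      case (elim t)
      show ?case
      proof (intro impI allI)
        fix x assume t: "t \<in> {0<..<T}"
        let ?d = "?V t 0 + (\<Sum>i\<in>UNIV. x $ i *\<^sub>R (?V t (axis i 1) - ?V t 0))"
        have "((\<lambda>s. E s 0 + (\<Sum>i\<in>UNIV. x $ i *\<^sub>R (E s (axis i 1) - E s 0))) has_vector_derivative ?d) (at t)"
          using elim t
          by (intro has_vector_derivative_add has_vector_derivative_sum has_vector_derivative_diff
              bounded_linear.has_vector_derivative[OF bounded_linear_scaleR_right]) auto
        then have "((\<lambda>s. E s x) has_vector_derivative ?d) (at t)"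
          by (rule has_vector_derivative_transform_within_open[where S="{0<..<T}"]) (use t aff[of _ x] in auto)
        moreover have "?d = ?V t x"
        proof -
          have "cross3 (\<omega> t) (E t x - E t 0) = (\<Sum>i\<in>UNIV. x $ i *\<^sub>R cross3 (\<omega> t) (E t (axis i 1) - E t 0))"
            using aff[of t x] t
            by (simp add: linear_sum[OF bounded_linear.linear[OF cross3_bounded_linear]] cross_mult_right)
          then show ?thesis by (simp add: Cross3.right_diff_distrib algebra_simps)
        qed
        ultimately show "((\<lambda>s. E s x) has_vector_derivative ?V t x) (at t)" by (simp only:)
      qed
    qed
  qed
qed

section \<open>Decay of the distance\<close>

lemma graph_regular_mono: "graph_regular F s C \<Longrightarrow> s' \<le> s \<Longrightarrow> C \<le> C' \<Longrightarrow> graph_regular F s' C'"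
  unfolding graph_regular_def using graph_over_mono by meson

lemma isometric_image:
  fixes R :: "real^3 \<Rightarrow> real^3"
  assumes R: "orthogonal_transformation R"
  shows "open A \<Longrightarrow> open ((\<lambda>x. c + R x) ` A)" "bounded A \<Longrightarrow> bounded ((\<lambda>x. c + R x) ` A)"
proof -
  have e: "(\<lambda>x. c + R x) ` A = (+) c ` R ` A" by auto
  show "open A \<Longrightarrow> open ((\<lambda>x. c + R x) ` A)"
    unfolding e by (intro open_translation open_surjective_linear_image orthogonal_transformation_surj
      orthogonal_transformation_linear R)
  show "bounded A \<Longrightarrow> bounded ((\<lambda>x. c + R x) ` A)"
    unfolding e by (intro bounded_translation bounded_linear_image)
      (use R in \<open>auto simp: linear_linear orthogonal_transformation_linear\<close>)
qed

text \<open>The distance is attained on the compact closure, and the minimizer cannot be interior,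
  since a small move towards the wall would reduce the distance.\<close>

lemma distance_points_exist:
  assumes S: "open (S t)" "bounded (S t)" "S t \<noteq> {}" and h: "wall_distance \<Omega> S t > 0"
  shows "\<exists>p q. distance_points \<Omega> S t p q"
proof -
  have F: "frontier \<Omega> \<noteq> {}" using h by (auto simp: wall_distance_def)
  obtain p q where p: "p \<in> closure (S t)" and q: "q \<in> frontier \<Omega>" and d: "dist p q = wall_distance \<Omega> S t"
    using setdist_compact_closed[of "closure (S t)" "frontier \<Omega>"] S F
    by (auto simp: wall_distance_def setdist_closure_1)
  have "p \<notin> S t"
  proof
    assume "p \<in> S t"
    then obtain e where e: "e > 0" "ball p e \<subseteq> S t" using S(1) open_contains_ball by blast
    \<comment> \<open>The fraction of the way towards \<open>q\<close> is short enough to stay in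
      the ball around \<open>p\<close> and at most 1.\<close>
    define r where "r = min 1 (e / (2 * dist p q))"
    have dp: "dist p q > 0" using d h by simp
    have r: "0 < r" "r \<le> 1" "r * dist p q \<le> e / 2"
    proof -
      show "0 < r" "r \<le> 1" using e dp by (auto simp: r_def)
      have "r * dist p q \<le> e / (2 * dist p q) * dist p q" by (intro mult_right_mono) (auto simp: r_def)
      then show "r * dist p q \<le> e / 2" using dp by simp
    qed
    define p' where "p' = p + r *\<^sub>R (q - p)"
    have "dist p p' = r * dist p q" using r by (simp add: p'_def dist_norm norm_minus_commute)
    then have "p' \<in> S t" using r e by (intro subsetD[OF e(2)]) simp
    then have "wall_distance \<Omega> S t \<le> dist p' q" unfolding wall_distance_def using q by (rule setdist_le_dist)
    also have "p' - q = (1 - r) *\<^sub>R (p - q)" by (simp add: p'_def algebra_simps)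
    then have "dist p' q = (1 - r) * dist p q" using r by (simp add: dist_norm)
    also have "\<dots> < dist p q" using r dp by (simp add: algebra_simps)
    finally show False using d by simp
  qed
  then have "p \<in> frontier (S t)" using p S(1) by (simp add: frontier_def interior_open)
  then show ?thesis using q d unfolding distance_points_def by blast
qed

text \<open>The trajectory of the body point realizing the distance at time \<open>t\<close> bounds \<open>h\<close> from above
  at earlier times, which suffices for one-sided difference quotients and avoids differentiating \<open>h\<close>.\<close>

lemma wall_distance_log_decrement:
  fixes S0 B \<Omega> :: "(real^3) set" and u :: "real \<Rightarrow> real^3 \<Rightarrow> real^3"
  assumes \<Omega>: "open \<Omega>" "graph_regular (frontier \<Omega>) s C"
    and S0: "open S0" "bounded S0" "S0 \<noteq> {}" "graph_regular (frontier S0) s C"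
    and c: "s > 0" "C > 0" "c0 > 0" "C * c0\<^sup>2 \<le> 1 / 8"
    and B: "congruent_sets S0 B" and T: "T > 0" and rm: "rigid_motion \<Omega> B T us \<omega> xs S"
    and u: "u \<in> L1_W12_0_body T \<Omega> S us \<omega> xs"
    and div: "AE t in lebesgue_on {0<..<T}. weakly_div_free \<Omega> (u t)"
    and h0: "wall_distance \<Omega> S 0 > 0"
  obtains C1 C2 L where "C1 > 0" "C2 \<ge> 0" "L-lipschitz_on {0..<T} (wall_distance \<Omega> S)"
    "\<And>t. t \<in> {0..<T} \<Longrightarrow> wall_distance \<Omega> S t > 0 \<Longrightarrow> \<exists>p q. distance_points \<Omega> S t p q"
    "AE t in lebesgue. t \<in> {0<..<T} \<longrightarrow> wall_distance \<Omega> S t > 0 \<longrightarrow>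
      (\<forall>p q c. distance_points \<Omega> S t p q \<longrightarrow>
        ennreal (sqrt (wall_distance \<Omega> S t)) *
          hessian_norm (cylinder q p (c0 * sqrt (wall_distance \<Omega> S t)) \<inter> fluid \<Omega> S t) (u t) < ennreal c \<longrightarrow>
        (\<forall>\<^sub>F k in sequentially. real (Suc k) *
          ((ln (wall_distance \<Omega> S (t - 1 / real (Suc k))) + C2 * (t - 1 / real (Suc k))) / C1
            - (ln (wall_distance \<Omega> S t) + C2 * t) / C1) \<le> c))"
proof -
  define h where "h = wall_distance \<Omega> S"
  obtain a0 and R0 :: "real^3 \<Rightarrow> real^3" where R0: "orthogonal_transformation R0" and Beq: "B = (\<lambda>x. a0 + R0 x) ` S0"
    using B unfolding congruent_sets_def by blast
  have Bo: "open B" "bounded B" "B \<noteq> {}" "graph_regular (frontier B) s C"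
    unfolding Beq frontier_isometry[OF R0] using S0 isometric_image[OF R0] graph_regular_isometry[OF R0] by auto
  obtain E :: "real \<Rightarrow> real^3 \<Rightarrow> real^3" and L where
    E: "\<And>t. t \<in> {0..<T} \<Longrightarrow> S t = E t ` B" "\<And>x. E 0 x = x"
    and ER: "\<And>t. t \<in> {0..<T} \<Longrightarrow> \<exists>R :: real^3 \<Rightarrow> real^3. orthogonal_transformation R \<and> E t = (\<lambda>x. E t 0 + R x)"
    and L: "L \<ge> 0" "\<And>x s t. x \<in> closure B \<Longrightarrow> s \<in> {0..<T} \<Longrightarrow> t \<in> {0..<T} \<Longrightarrow> dist (E s x) (E t x) \<le> L * \<bar>s - t\<bar>"
    and Exs: "\<And>t. t \<in> {0..<T} \<Longrightarrow> xs t = E t (xs 0)"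
    and ED: "AE t in lebesgue. t \<in> {0<..<T} \<longrightarrow>
      (\<forall>x. ((\<lambda>s. E s x) has_vector_derivative us t + cross3 (\<omega> t) (E t x - xs t)) (at t))"
    using rigid_motion_flow[OF rm T Bo(2)] by blast
  have St: "open (S t)" "bounded (S t)" "S t \<noteq> {}" "graph_regular (frontier (S t)) s C"
    "closure (S t) = E t ` closure B" "\<And>x y. dist (E t x) (E t y) = dist x y" if t: "t \<in> {0..<T}" for t
  proof -
    obtain R :: "real^3 \<Rightarrow> real^3" where R: "orthogonal_transformation R" and Et: "E t = (\<lambda>x. E t 0 + R x)"
      using ER[OF t] by blast
    have Seq: "S t = (\<lambda>x. E t 0 + R x) ` B" using E(1)[OF t] Et by metis
    show "open (S t)" "bounded (S t)" "S t \<noteq> {}" "graph_regular (frontier (S t)) s C"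
      unfolding Seq frontier_isometry[OF R] using Bo isometric_image[OF R] graph_regular_isometry[OF R] by auto
    show "closure (S t) = E t ` closure B" unfolding Seq frontier_isometry[OF R] by (subst (2) Et) simp
    show "dist (E t x) (E t y) = dist x y" for x y
      using R by (subst (1 2) Et) (simp add: orthogonal_transformation_isometry)
  qed
  have S\<Omega>: "S t \<subseteq> \<Omega>" and xsS: "xs t \<in> closure (S t)" if "t \<in> {0..<T}" for t
    using rm that unfolding rigid_motion_def by blast+
  have "S 0 = B" using E(1)[of 0] E(2) T by auto
  then have xs0: "xs 0 \<in> closure B" using xsS[of 0] T by simp
  have F: "frontier \<Omega> \<noteq> {}" using h0 by (auto simp: wall_distance_def)
  have hle: "h t \<le> dist (E t x) q" if "t \<in> {0..<T}" "x \<in> closure B" "q \<in> frontier \<Omega>" for t x q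
    unfolding h_def wall_distance_def using that St(5)[OF that(1)]
    by (intro setdist_le_dist_closure) (auto simp: closure_closed frontier_closed)
  \<comment> \<open>Every particle moves by at most \<open>L * \<bar>s - t\<bar>\<close>, so the
    infimum of the distances changes by no more.\<close>
  have hL: "L-lipschitz_on {0..<T} h"
  proof -
    have 1: "h s - L * \<bar>s - t\<bar> \<le> h t" if st: "s \<in> {0..<T}" "t \<in> {0..<T}" for s t
    proof -
      have "h s - L * \<bar>s - t\<bar> \<le> setdist (S t) (frontier \<Omega>)"
      proof (rule le_setdistI[OF St(3)[OF st(2)] F])
        fix x' q assume x': "x' \<in> S t" and q: "q \<in> frontier \<Omega>"
        obtain x where x: "x \<in> B" "x' = E t x" using x' E(1)[OF st(2)] by blast
        have xc: "x \<in> closure B" using x closure_subset by blast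
        show "h s - L * \<bar>s - t\<bar> \<le> dist x' q"
          unfolding x(2) using hle[OF st(1) xc q] L(2)[OF xc st] dist_triangle[of "E s x" q "E t x"] by linarith
      qed
      then show ?thesis by (simp add: h_def wall_distance_def)
    qed
    show ?thesis
    proof (rule lipschitz_onI[OF _ L(1)])
      fix s t assume "s \<in> {0..<T}" "t \<in> {0..<T}"
      then show "dist (h s) (h t) \<le> L * dist s t"
        using 1[of s t] 1[of t s] unfolding dist_real_def abs_minus_commute[of t s] by linarith
    qed
  qed
  obtain M1 M2 where M12: "AE t in lebesgue_on {0<..<T}. norm (us t) \<le> M1" "AE t in lebesgue_on {0<..<T}. norm (\<omega> t) \<le> M2"
    using rm unfolding rigid_motion_def Linf_def by blast
  obtain D where D: "\<And>x. x \<in> closure B \<Longrightarrow> norm x \<le> D"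
    using bounded_closure[OF Bo(2)] unfolding bounded_iff by blast
  have D0: "D \<ge> 0" using D[OF xs0] norm_ge_zero order_trans by blast
  \<comment> \<open>Bounds the velocity of every point of the closed body, whose distance from
    \<open>xs\<close> is at most \<open>2 * D\<close>, and also the angular velocity.\<close>
  define M where "M = \<bar>M1\<bar> + \<bar>M2\<bar> * (2 * D) + \<bar>M2\<bar>"
  have M0: "M \<ge> 0" using D0 by (simp add: M_def)
  obtain C1 C2 where C12: "C1 > 0" "C2 \<ge> 0" and est:
    "\<And>\<Omega> V p q u v0 \<omega> H N. open \<Omega> \<Longrightarrow> open V \<Longrightarrow> V \<subseteq> \<Omega> \<Longrightarrow>
      graph_regular (frontier \<Omega>) s C \<Longrightarrow> graph_regular (frontier V) s C \<Longrightarrow>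
      p \<in> frontier V \<Longrightarrow> q \<in> frontier \<Omega> \<Longrightarrow> dist p q = setdist V (frontier \<Omega>) \<Longrightarrow> dist p q > 0 \<Longrightarrow>
      u \<in> W12_0_space \<Omega> \<Longrightarrow> weakly_div_free \<Omega> u \<Longrightarrow>
      AE x in lebesgue. x \<in> V \<longrightarrow> u x = v0 + cross3 \<omega> (x - p) \<Longrightarrow>
      weak_hessian (cylinder q p (c0 * sqrt (dist p q)) \<inter> (\<Omega> - closure V)) u H \<Longrightarrow>
      L2_norm (cylinder q p (c0 * sqrt (dist p q)) \<inter> (\<Omega> - closure V))
        (\<lambda>x. sqrt (\<Sum>i\<in>UNIV. \<Sum>j\<in>UNIV. (norm (H i j x))\<^sup>2)) \<le> ennreal N \<Longrightarrow> N \<ge> 0 \<Longrightarrow>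
      norm v0 \<le> M \<Longrightarrow> norm \<omega> \<le> M \<Longrightarrow>
      \<bar>sgn (p - q) \<bullet> v0\<bar> \<le> dist p q * (C1 * (sqrt (dist p q) * N) + C2)"
    using normal_velocity_estimate[OF c M0] by blast
  have uae: "AE t in lebesgue_on {0<..<T}. u t \<in> W12_0_space \<Omega>"
    and rig: "AE t in lebesgue_on {0<..<T}. AE x in lebesgue_on (S t). u t x = us t + cross3 (\<omega> t) (x - xs t)"
    using u unfolding L1_W12_0_body_def L1_time_def bochner_measurable_def by auto
  have key: "\<forall>\<^sub>F k in sequentially. real (Suc k) *
        ((ln (h (t - 1 / real (Suc k))) + C2 * (t - 1 / real (Suc k))) / C1 - (ln (h t) + C2 * t) / C1) \<le> c"
    if t: "t \<in> {0<..<T}" and ht: "h t > 0"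
      and Ed: "\<forall>x. ((\<lambda>s. E s x) has_vector_derivative us t + cross3 (\<omega> t) (E t x - xs t)) (at t)"
      and b: "norm (us t) \<le> M1" "norm (\<omega> t) \<le> M2"
      and ut: "u t \<in> W12_0_space \<Omega>" "weakly_div_free \<Omega> (u t)"
        "AE x in lebesgue_on (S t). u t x = us t + cross3 (\<omega> t) (x - xs t)"
      and dp: "distance_points \<Omega> S t p q"
      and lt: "ennreal (sqrt (h t)) * hessian_norm (cylinder q p (c0 * sqrt (h t)) \<inter> fluid \<Omega> S t) (u t) < ennreal c"
    for t p q c
  proof -
    have t': "t \<in> {0..<T}" using t by simp
    have p: "p \<in> frontier (S t)" and q: "q \<in> frontier \<Omega>" and pq: "dist p q = h t"
      using dp by (auto simp: distance_points_def h_def)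
    obtain p0 where p0: "p0 \<in> closure B" "p = E t p0"
      using p St(5)[OF t'] by (auto simp: frontier_def)
    define v where "v = us t + cross3 (\<omega> t) (p - xs t)"
    define n where "n = sgn (p - q)"
    let ?U = "cylinder q p (c0 * sqrt (h t)) \<inter> fluid \<Omega> S t"
    \<comment> \<open>For \<open>c \<le> 0\<close> the value \<open>ennreal c\<close> is 0 and
      nothing lies strictly below it.\<close>
    have c_pos: "c > 0" using lt by (cases "c > 0") (auto simp: ennreal_neg)
    have "hessian_norm ?U (u t) < ennreal (c / sqrt (h t))"
    proof (rule ccontr)
      assume "\<not> ?thesis"
      then have "ennreal (sqrt (h t)) * ennreal (c / sqrt (h t)) \<le> ennreal (sqrt (h t)) * hessian_norm ?U (u t)"
        by (intro mult_left_mono) auto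
      then have "ennreal c \<le> ennreal (sqrt (h t)) * hessian_norm ?U (u t)"
        using ht c_pos by (simp add: ennreal_mult'[symmetric])
      then show False using lt by simp
    qed
    then obtain H where H: "weak_hessian ?U (u t) H"
      "L2_norm ?U (\<lambda>x. sqrt (\<Sum>i\<in>UNIV. \<Sum>j\<in>UNIV. (norm (H i j x))\<^sup>2)) < ennreal (c / sqrt (h t))" (is "?X < _")
      unfolding hessian_norm_def INF_less_iff by blast
    define N where "N = enn2real ?X"
    have "?X \<noteq> \<infinity>" using H(2) by auto
    then have XN: "?X = ennreal N" by (simp add: N_def less_top)
    have N0: "N \<ge> 0" by (simp add: N_def)
    have "N < c / sqrt (h t)" using H(2) N0 unfolding XN by (simp add: ennreal_less_iff)
    then have Nc: "sqrt (h t) * N < c" using ht by (simp add: field_simps)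
    have pxs: "norm (p - xs t) \<le> 2 * D"
    proof -
      have "norm (p - xs t) = dist p0 (xs 0)"
        using p0 Exs[OF t'] St(6)[OF t'] by (simp add: dist_norm[symmetric])
      then show ?thesis using norm_triangle_ineq4[of p0 "xs 0"] D[OF p0(1)] D[OF xs0] by (simp add: dist_norm)
    qed
    have "norm v \<le> norm (us t) + norm (\<omega> t) * norm (p - xs t)"
      unfolding v_def using norm_triangle_ineq norm_cross3_le add_left_mono order_trans by blast
    also have "\<dots> \<le> \<bar>M1\<bar> + \<bar>M2\<bar> * (2 * D)" using b pxs by (intro add_mono mult_mono) auto
    finally have vM: "norm v \<le> M" by (simp add: M_def)
    have \<omega>M: "norm (\<omega> t) \<le> M"
    proof -
      have "0 \<le> \<bar>M2\<bar> * (2 * D)" using D0 by simp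
      then show ?thesis unfolding M_def using b(2) by linarith
    qed
    have "AE x in lebesgue. x \<in> S t \<longrightarrow> u t x = us t + cross3 (\<omega> t) (x - xs t)"
      using ut(3) St(1)[OF t'] by (subst (asm) AE_restrict_space_iff) auto
    then have rigid: "AE x in lebesgue. x \<in> S t \<longrightarrow> u t x = v + cross3 (\<omega> t) (x - p)"
      by eventually_elim (simp add: v_def Cross3.right_diff_distrib)
    have bound: "\<bar>n \<bullet> v\<bar> \<le> h t * (C1 * (sqrt (h t) * N) + C2)"
      using est[OF \<Omega>(1) St(1)[OF t'] S\<Omega>[OF t'] \<Omega>(2) St(4)[OF t'] p q _ _ ut(1,2) rigid _ _ N0 vM \<omega>M, of H]
        H(1) XN ht unfolding pq n_def fluid_def by (simp add: h_def wall_distance_def)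
    \<comment> \<open>The particle at \<open>p\<close> and the wall point \<open>q\<close> are
      frozen at time \<open>t\<close>. Then \<open>g\<close> is differentiable at \<open>t\<close>,
      touches \<open>h\<close> there and lies above it at the other times.\<close>
    define g where "g r = norm (E r p0 - q)" for r
    have gt: "g t = h t" using pq p0 by (simp add: g_def dist_norm)
    have "(g has_real_derivative n \<bullet> v) (at t)"
    proof -
      have "((\<lambda>r. E r p0 - q) has_derivative (\<lambda>r. r *\<^sub>R v)) (at t)"
        using Ed[rule_format, of p0] unfolding v_def p0(2) has_vector_derivative_def
        by (auto intro!: derivative_eq_intros)
      moreover have "E t p0 - q \<noteq> 0" using gt ht by (auto simp: g_def)
      ultimately have "(g has_derivative (\<lambda>r. (r *\<^sub>R v) \<bullet> sgn (E t p0 - q))) (at t)"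
        unfolding g_def[abs_def] by (intro has_derivative_compose[OF _ has_derivative_norm, of "\<lambda>r. E r p0 - q"])
      then show ?thesis
        by (rule has_derivative_imp_has_field_derivative) (simp add: n_def p0 inner_commute)
    qed
    \<comment> \<open>The summand \<open>C2 * r\<close> and the division by \<open>C1\<close>
      normalize the velocity estimate: the decrease rate becomes at most
      \<open>sqrt (h t) * N\<close>, hence smaller than \<open>c\<close>.\<close>
    then have "((\<lambda>r. (ln (g r) + C2 * r) / C1) has_real_derivative (n \<bullet> v / h t + C2) / C1) (at t)"
      using ht C12 gt by (auto intro!: derivative_eq_intros simp: field_simps)
    note lim = backward_quotient_tendsto[OF this]
    have "- ((n \<bullet> v / h t + C2) / C1) < c"
    proof -
      have "- (n \<bullet> v) \<le> h t * (C1 * (sqrt (h t) * N) + C2)" using bound by linarith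
      then have "- (n \<bullet> v) / h t \<le> C1 * (sqrt (h t) * N) + C2" by (simp only: pos_divide_le_eq[OF ht] mult.commute[of _ "h t"])
      moreover have "C1 * (sqrt (h t) * N) < C1 * c" using Nc C12 by simp
      ultimately have "- (n \<bullet> v / h t + C2) < c * C1" by (simp add: mult.commute)
      then have "- (n \<bullet> v / h t + C2) / C1 < c" using C12 by (simp only: divide_less_eq if_True)
      then show ?thesis by (simp only: minus_divide_left)
    qed
    from order_tendstoD(2)[OF lim this]
    have ev1: "\<forall>\<^sub>F k in sequentially. real (Suc k) *
        ((ln (g (t - 1 / real (Suc k))) + C2 * (t - 1 / real (Suc k))) / C1 - (ln (g t) + C2 * t) / C1) < c" .
    \<comment> \<open>Short steps keep the earlier time in \<open>{0..<T}\<close> and, by the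
      Lipschitz bound, the earlier distance positive, so that \<open>ln\<close> is monotone
      there.\<close>
    have ev2: "\<forall>\<^sub>F k in sequentially. 1 / real (Suc k) < min t (h t / (L + 1))"
      using order_tendstoD(2)[OF LIMSEQ_inverse_real_of_nat, of "min t (h t / (L + 1))"] t ht L
      by (simp add: inverse_eq_divide)
    show ?thesis
      using ev1 ev2
    proof eventually_elim
      case (elim k)
      define r where "r = t - 1 / real (Suc k)"
      define e where "e = 1 / real (Suc k)"
      have "e > 0" by (simp add: e_def)
      then have r: "r \<in> {0..<T}" "\<bar>r - t\<bar> < h t / (L + 1)"
        using elim(2) t unfolding r_def e_def[symmetric] by auto
      have "\<bar>r - t\<bar> * (L + 1) < h t" using r(2) L by (simp add: less_divide_eq)
      then have "L * \<bar>r - t\<bar> < h t" by (simp add: algebra_simps)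
      moreover have "\<bar>h r - h t\<bar> \<le> L * \<bar>r - t\<bar>" using lipschitz_onD[OF hL r(1) t'] by (simp add: dist_real_def)
      ultimately have hr: "h r > 0" by linarith
      have hg: "h r \<le> g r" using hle[OF r(1) p0(1) q] by (simp add: g_def dist_norm)
      then have "ln (h r) \<le> ln (g r)" using hr by simp
      then have "(ln (h r) + C2 * r) / C1 \<le> (ln (g r) + C2 * r) / C1" using C12 by (simp add: divide_right_mono)
      then have "real (Suc k) * ((ln (h r) + C2 * r) / C1 - (ln (h t) + C2 * t) / C1)
          \<le> real (Suc k) * ((ln (g r) + C2 * r) / C1 - (ln (g t) + C2 * t) / C1)"
        unfolding gt by (intro mult_left_mono) auto
      then show ?case using elim(1) unfolding r_def by linarith
    qed
  qed
  have "AE t in lebesgue. t \<in> {0<..<T} \<longrightarrow> norm (us t) \<le> M1" "AE t in lebesgue. t \<in> {0<..<T} \<longrightarrow> norm (\<omega> t) \<le> M2"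
    "AE t in lebesgue. t \<in> {0<..<T} \<longrightarrow> u t \<in> W12_0_space \<Omega>"
    "AE t in lebesgue. t \<in> {0<..<T} \<longrightarrow> weakly_div_free \<Omega> (u t)"
    "AE t in lebesgue. t \<in> {0<..<T} \<longrightarrow> (AE x in lebesgue_on (S t). u t x = us t + cross3 (\<omega> t) (x - xs t))"
    using M12 uae div rig by (simp_all add: AE_restrict_space_iff)
  with ED have "AE t in lebesgue. t \<in> {0<..<T} \<longrightarrow> h t > 0 \<longrightarrow> (\<forall>p q c. distance_points \<Omega> S t p q \<longrightarrow>
      ennreal (sqrt (h t)) * hessian_norm (cylinder q p (c0 * sqrt (h t)) \<inter> fluid \<Omega> S t) (u t) < ennreal c \<longrightarrow>
      (\<forall>\<^sub>F k in sequentially. real (Suc k) *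
        ((ln (h (t - 1 / real (Suc k))) + C2 * (t - 1 / real (Suc k))) / C1 - (ln (h t) + C2 * t) / C1) \<le> c))"
    by eventually_elim (intro impI allI key; blast)
  note ae = this
  show thesis
  proof (rule that[OF C12 hL[unfolded h_def] _ ae[unfolded h_def]])
    fix t assume t: "t \<in> {0..<T}" "wall_distance \<Omega> S t > 0"
    show "\<exists>p q. distance_points \<Omega> S t p q" by (rule distance_points_exist[OF St(1-3)[OF t(1)] t(2)])
  qed
qed

section \<open>Integration of the logarithmic inequality and the two claims\<close>

lemma lipschitz_on_log:
  fixes h :: "real \<Rightarrow> real"
  assumes L: "L-lipschitz_on A h" and m: "m > 0" "\<And>t. t \<in> A \<Longrightarrow> m \<le> h t"
  shows "(L / m)-lipschitz_on A (\<lambda>t. ln (h t))"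
proof (rule lipschitz_onI)
  show "0 \<le> L / m" using lipschitz_on_nonneg[OF L] m by simp
  have 1: "ln (h s) - ln (h t) \<le> L / m * dist s t" if "s \<in> A" "t \<in> A" for s t
  proof -
    have p: "h s > 0" "h t > 0" using m that by force+
    have "ln (h s) - ln (h t) \<le> (h s - h t) / h t" using p by (rule ln_diff_le)
    also have "\<dots> \<le> dist (h s) (h t) / h t" using p by (intro divide_right_mono) (auto simp: dist_real_def)
    also have "\<dots> \<le> L * dist s t / m"
      using lipschitz_onD[OF L that] m that lipschitz_on_nonneg[OF L] by (intro frac_le) auto
    finally show ?thesis by simp
  qed
  fix s t assume "s \<in> A" "t \<in> A"
  then show "dist (ln (h s)) (ln (h t)) \<le> L / m * dist s t"
    using 1[of s t] 1[of t s] unfolding dist_real_def abs_minus_commute[of t s] by linarith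
qed

text \<open>On a closed time interval a positive continuous distance has a positive minimum, so its
  logarithm is Lipschitz and the decrement bound applies. The factor \<open>K\<close> serves both
  claims: it bounds the weight \<open>sqrt h\<close> for the first and equals 1 for the
  second.\<close>

lemma log_decrement_le_nn_integral:
  fixes h :: "real \<Rightarrow> real" and f :: "real \<Rightarrow> ennreal"
  assumes L: "L-lipschitz_on {0..<T} h" and b: "0 \<le> b" "b < T" and pos: "\<And>t. t \<in> {0..b} \<Longrightarrow> h t > 0"
    and C: "C1 > 0" and K: "K > 0"
    and ae: "AE t in lebesgue. t \<in> {0<..<b} \<longrightarrow> (\<forall>c. f t < ennreal c \<longrightarrow> (\<forall>\<^sub>F k in sequentially. real (Suc k) *
          ((ln (h (t - 1 / real (Suc k))) + C2 * (t - 1 / real (Suc k))) / C1 - (ln (h t) + C2 * t) / C1) \<le> K * c))"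
  shows "ennreal ((ln (h 0) - ln (h b) - C2 * b) / C1 / K) \<le> (\<integral>\<^sup>+t\<in>{0<..<b}. f t \<partial>lebesgue)"
proof -
  have Lb: "L-lipschitz_on {0..b} h" using L b by (auto intro: lipschitz_on_subset)
  obtain t0 where "t0 \<in> {0..b}" "\<And>t. t \<in> {0..b} \<Longrightarrow> h t0 \<le> h t"
    using continuous_attains_inf[OF compact_Icc _ lipschitz_on_continuous_on[OF Lb]] b by auto
  then have "(L / h t0)-lipschitz_on {0..b} (\<lambda>t. ln (h t))" using pos Lb by (intro lipschitz_on_log)
  moreover have "\<bar>C2\<bar>-lipschitz_on {0..b} (\<lambda>t. C2 * t)"
    by (rule lipschitz_onI) (auto simp: dist_real_def abs_mult right_diff_distrib[symmetric])
  ultimately have "(L / h t0 + \<bar>C2\<bar>)-lipschitz_on {0..b} (\<lambda>t. ln (h t) + C2 * t)" by (rule lipschitz_on_add)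
  then have "(\<bar>1 / (C1 * K)\<bar> * (L / h t0 + \<bar>C2\<bar>))-lipschitz_on {0..b} (\<lambda>t. 1 / (C1 * K) * (ln (h t) + C2 * t))"
    by (rule lipschitz_on_cmult_real)
  note lip = this
  have "ennreal (1 / (C1 * K) * (ln (h 0) + C2 * 0) - 1 / (C1 * K) * (ln (h b) + C2 * b)) \<le> (\<integral>\<^sup>+t\<in>{0<..<b}. f t \<partial>lebesgue)"
  proof (rule lipschitz_decrement_le_nn_integral[OF b(1) lip])
    show "AE t in lebesgue. t \<in> {0<..<b} \<longrightarrow> (\<forall>c. f t < ennreal c \<longrightarrow> (\<forall>\<^sub>F k in sequentially. real (Suc k) *
      (1 / (C1 * K) * (ln (h (t - 1 / real (Suc k))) + C2 * (t - 1 / real (Suc k)))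
        - 1 / (C1 * K) * (ln (h t) + C2 * t)) \<le> c))"
      using ae
    proof eventually_elim
      case (elim t)
      have *: "x * (1 / (C1 * K) * y - 1 / (C1 * K) * z) \<le> c" if "x * (y / C1 - z / C1) \<le> K * c" for x y z c
      proof -
        have "x * (1 / (C1 * K) * y - 1 / (C1 * K) * z) = x * (y / C1 - z / C1) / K"
          by (simp add: diff_divide_distrib right_diff_distrib)
        then show ?thesis using that K by (simp add: pos_divide_le_eq mult.commute)
      qed
      show ?case
      proof (intro impI allI)
        fix c assume "t \<in> {0<..<b}" "f t < ennreal c"
        then have "\<forall>\<^sub>F k in sequentially. real (Suc k) *
          ((ln (h (t - 1 / real (Suc k))) + C2 * (t - 1 / real (Suc k))) / C1 - (ln (h t) + C2 * t) / C1) \<le> K * c"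
          using elim by blast
        then show "\<forall>\<^sub>F k in sequentially. real (Suc k) *
          (1 / (C1 * K) * (ln (h (t - 1 / real (Suc k))) + C2 * (t - 1 / real (Suc k)))
            - 1 / (C1 * K) * (ln (h t) + C2 * t)) \<le> c"
          by eventually_elim (rule *)
      qed
    qed
  qed
  moreover have "1 / (C1 * K) * (ln (h 0) + C2 * 0) - 1 / (C1 * K) * (ln (h b) + C2 * b)
      = (ln (h 0) - ln (h b) - C2 * b) / C1 / K"
    by (simp add: diff_divide_distrib add_divide_distrib)
  ultimately show ?thesis by simp
qed

text \<open>\<open>c0\<close> is fixed before the motion is given, from a graph constant
  \<open>C\<close> valid for the wall and for every congruent copy of the body. The constants
  obtained afterwards may depend on the motion, since both claims only separate finite from infinite
  values.\<close>

theorem corollary3p2: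
  fixes \<Omega> S0 :: "(real^3) set"
  assumes "open \<Omega>" "connected \<Omega>" "uniformly_C3 \<Omega>"
    and "open S0" "connected S0" "bounded S0" "S0 \<noteq> {}" "uniformly_C3 S0"
    and "S0 \<subseteq> \<Omega>"
  shows "\<exists>c0>0. \<forall>(B :: (real^3) set) (T :: real) us \<omega> xs S (u :: real \<Rightarrow> real^3 \<Rightarrow> real^3).
    congruent_sets S0 B \<and> 0 < T \<and>
    rigid_motion \<Omega> B T us \<omega> xs S \<and>
    (\<forall>t\<in>{0..<T}. wall_distance \<Omega> S t < diameter B) \<and>
    u \<in> Linf_time T (L2_space \<Omega>) (L2_norm \<Omega>) \<and>
    u \<in> L1_W12_0_body T \<Omega> S us \<omega> xs \<and>
    (AE t in lebesgue_on {0<..<T}. weakly_div_free \<Omega> (u t)) \<and>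
    (\<forall>t\<in>{0..<T}. (\<integral>\<^sup>+s\<in>{0<..<t}. hessian_norm (fluid \<Omega> S s) (u s) \<partial>lebesgue) < \<infinity>) \<and>
    wall_distance \<Omega> S 0 > 0
    \<longrightarrow>
    (\<forall>t\<in>{0..<T}. wall_distance \<Omega> S t > 0) \<and>
    (Liminf (at_left T) (\<lambda>t. ereal (wall_distance \<Omega> S t)) = 0 \<longrightarrow>
      (\<forall>P Q. (\<forall>t\<in>{0..<T}. distance_points \<Omega> S t (P t) (Q t)) \<longrightarrow>
        ((\<lambda>t. \<integral>\<^sup>+\<tau>\<in>{0<..<t}.
              ennreal (wall_distance \<Omega> S \<tau> powr (1/2)) *
              hessian_norm
                (cylinder (Q \<tau>) (P \<tau>) (c0 * wall_distance \<Omega> S \<tau> powr (1/2)) \<inter> fluid \<Omega> S \<tau>)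
                (u \<tau>)
            \<partial>lebesgue)
          \<longlongrightarrow> \<infinity>) (at_left T)))"
proof -
  obtain s1 D1 where 1: "s1 > 0" "D1 > 0" "graph_regular (frontier \<Omega>) s1 D1"
    using uniformly_C3_graph_regular[OF assms(3)] .
  obtain s2 D2 where 2: "s2 > 0" "D2 > 0" "graph_regular (frontier S0) s2 D2"
    using uniformly_C3_graph_regular[OF assms(8)] .
  define s where "s = min s1 s2"
  define C where "C = max D1 D2"
  have sC: "s > 0" "C > 0" using 1 2 by (auto simp: s_def C_def)
  have gr: "graph_regular (frontier \<Omega>) s C" "graph_regular (frontier S0) s C"
    using 1(3) 2(3) by (auto intro: graph_regular_mono simp: s_def C_def)
  \<comment> \<open>Chosen to give \<open>C * c0\<^sup>2 = 1 / 8\<close>.\<close>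
  define c0 where "c0 = 1 / sqrt (8 * C)"
  have c0: "c0 > 0" "C * c0\<^sup>2 \<le> 1 / 8" using sC by (auto simp: c0_def power_divide)
  show ?thesis
  proof (intro exI[of _ c0] conjI c0(1) allI impI; elim conjE)
    fix B :: "(real^3) set" and T :: real and us \<omega> xs S and u :: "real \<Rightarrow> real^3 \<Rightarrow> real^3"
    assume B: "congruent_sets S0 B" and T: "0 < T" and rm: "rigid_motion \<Omega> B T us \<omega> xs S"
      and u: "u \<in> L1_W12_0_body T \<Omega> S us \<omega> xs"
      and div: "AE t in lebesgue_on {0<..<T}. weakly_div_free \<Omega> (u t)"
      and fin: "\<forall>t\<in>{0..<T}. (\<integral>\<^sup>+s\<in>{0<..<t}. hessian_norm (fluid \<Omega> S s) (u s) \<partial>lebesgue) < \<infinity>"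
      and h0: "wall_distance \<Omega> S 0 > 0"
    define h where "h = wall_distance \<Omega> S"
    define \<Psi> where "\<Psi> C1 C2 t k = real (Suc k) * ((ln (h (t - 1 / real (Suc k))) + C2 * (t - 1 / real (Suc k))) / C1
        - (ln (h t) + C2 * t) / C1)" for C1 C2 t k
    define f where "f p q t = ennreal (sqrt (h t)) * hessian_norm (cylinder q p (c0 * sqrt (h t)) \<inter> fluid \<Omega> S t) (u t)" for p q t
    obtain C1 C2 L where C12: "C1 > 0" "C2 \<ge> 0" and L: "L-lipschitz_on {0..<T} h"
      and dp: "\<And>t. t \<in> {0..<T} \<Longrightarrow> h t > 0 \<Longrightarrow> \<exists>p q. distance_points \<Omega> S t p q"
      and ae: "AE t in lebesgue. t \<in> {0<..<T} \<longrightarrow> h t > 0 \<longrightarrow> (\<forall>p q c. distance_points \<Omega> S t p q \<longrightarrow>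
        f p q t < ennreal c \<longrightarrow> (\<forall>\<^sub>F k in sequentially. \<Psi> C1 C2 t k \<le> c))"
      by (rule wall_distance_log_decrement[OF assms(1) gr(1) assms(4,6,7) gr(2) sC c0 B T rm u div h0])
        (rule that[unfolded h_def \<Psi>_def f_def])
    have L0: "L \<ge> 0" using L by (rule lipschitz_on_nonneg)
    have h_nonneg: "h t \<ge> 0" for t by (simp add: h_def wall_distance_def)
    have h_pos: "h t > 0" if t: "t \<in> {0..<T}" for t
    proof (rule ccontr)
      assume "\<not> h t > 0"
      then have ht: "h t = 0" using h_nonneg[of t] by simp
      have cont: "continuous_on {0..t} h"
        using t by (intro continuous_on_subset[OF lipschitz_on_continuous_on[OF L]]) auto
      \<comment> \<open>The first zero \<open>b0\<close> of the distance exists by compactness;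
        before it the logarithm is available.\<close>
      define Z where "Z = {0..t} \<inter> h -` {0}"
      have "closed Z" unfolding Z_def by (rule continuous_closed_preimage[OF cont]) auto
      then have "compact ({0..t} \<inter> Z)" by (rule compact_Int_closed[OF compact_Icc])
      moreover have "{0..t} \<inter> Z = Z" "t \<in> Z" using t ht by (auto simp: Z_def)
      ultimately obtain b0 where "b0 \<in> Z" "\<forall>r\<in>Z. b0 \<le> r"
        using compact_attains_inf[of Z] by auto
      then have b0: "b0 \<in> {0..t}" "h b0 = 0" "\<And>r. r \<in> {0..t} \<Longrightarrow> h r = 0 \<Longrightarrow> b0 \<le> r"
        by (auto simp: Z_def)
      have b0T: "b0 \<in> {0..<T}" using b0 t by auto
      have pos: "h r > 0" if "r \<in> {0..<b0}" for r
        using b0(3)[of r] that b0(1) h_nonneg[of r] by (cases "h r = 0") auto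
      \<comment> \<open>A bound for \<open>sqrt h\<close> up to time \<open>T\<close>, from the
        Lipschitz property; it removes the weight, so that the finite integral over the whole fluid
        can be used.\<close>
      define K where "K = sqrt (h 0 + L * T)"
      have K: "K > 0" using h0 L0 T unfolding K_def h_def by (simp add: add_pos_nonneg)
      have hK: "sqrt (h r) \<le> K" if "r \<in> {0..<T}" for r
      proof -
        have "dist (h r) (h 0) \<le> L * dist r 0" using T that by (intro lipschitz_onD[OF L]) auto
        also have "\<dots> \<le> L * T" using that L0 by (intro mult_left_mono) auto
        finally show ?thesis unfolding K_def dist_real_def by (intro real_sqrt_le_mono) linarith
      qed
      define I where "I = enn2real (\<integral>\<^sup>+s\<in>{0<..<b0}. hessian_norm (fluid \<Omega> S s) (u s) \<partial>lebesgue)"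
      have I: "(\<integral>\<^sup>+s\<in>{0<..<b0}. hessian_norm (fluid \<Omega> S s) (u s) \<partial>lebesgue) = ennreal I"
        using fin b0T by (simp add: I_def)
      have I0: "I \<ge> 0" by (simp add: I_def)
      define m where "m = ln (h 0) - C2 * T - I * K * C1"
      \<comment> \<open>A lower bound for \<open>h\<close> independent of \<open>b < b0\<close>;
        continuity carries it to \<open>b0\<close>, where it contradicts
        \<open>h b0 = 0\<close>.\<close>
      have low: "exp m \<le> h b" if b: "b \<in> {0..<b0}" for b
      proof -
        have "ennreal ((ln (h 0) - ln (h b) - C2 * b) / C1 / K)
            \<le> (\<integral>\<^sup>+s\<in>{0<..<b}. hessian_norm (fluid \<Omega> S s) (u s) \<partial>lebesgue)"
        proof (rule log_decrement_le_nn_integral[OF L _ _ _ C12(1) K])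
          show "AE r in lebesgue. r \<in> {0<..<b} \<longrightarrow> (\<forall>c. hessian_norm (fluid \<Omega> S r) (u r) < ennreal c \<longrightarrow>
            (\<forall>\<^sub>F k in sequentially. real (Suc k) * ((ln (h (r - 1 / real (Suc k))) + C2 * (r - 1 / real (Suc k))) / C1
              - (ln (h r) + C2 * r) / C1) \<le> K * c))"
            unfolding \<Psi>_def[symmetric] using ae
          proof eventually_elim
            case (elim r)
            show ?case
            proof (intro impI allI)
              fix c assume r: "r \<in> {0<..<b}" and lt: "hessian_norm (fluid \<Omega> S r) (u r) < ennreal c"
              have r': "r \<in> {0<..<T}" "r \<in> {0..<T}" "h r > 0" using r b b0T pos[of r] by auto
              obtain p q where pq: "distance_points \<Omega> S r p q" using dp[OF r'(2,3)] by blast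
              have "f p q r \<le> ennreal K * hessian_norm (fluid \<Omega> S r) (u r)"
                unfolding f_def by (intro mult_mono ennreal_leI hK r' hessian_norm_mono) auto
              also have "\<dots> < ennreal K * ennreal c" using lt K by (intro ennreal_mult_strict_left_mono) auto
              also have "\<dots> = ennreal (K * c)" using K by (simp add: ennreal_mult')
              finally show "\<forall>\<^sub>F k in sequentially. \<Psi> C1 C2 r k \<le> K * c" using elim r' pq by blast
            qed
          qed
        qed (use b b0T pos in auto)
        also have "\<dots> \<le> (\<integral>\<^sup>+s\<in>{0<..<b0}. hessian_norm (fluid \<Omega> S s) (u s) \<partial>lebesgue)"
          using b by (intro nn_integral_mono mult_left_mono) (auto split: split_indicator)
        finally have "(ln (h 0) - ln (h b) - C2 * b) / C1 / K \<le> I"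
          unfolding I using I0 by (simp add: ennreal_le_iff)
        then have "ln (h 0) - ln (h b) - C2 * b \<le> I * K * C1"
          using K C12 by (simp only: pos_divide_le_eq)
        moreover have "C2 * b \<le> C2 * T" using b b0T C12 by (intro mult_left_mono) auto
        ultimately have "m \<le> ln (h b)" unfolding m_def by linarith
        then show ?thesis using pos[OF b] by (simp add: ln_ge_iff)
      qed
      have "b0 \<noteq> 0" using b0(2) h0 unfolding h_def by auto
      then have cl: "closure {0..<b0} = {0..b0}" using b0(1) by simp
      have "exp m \<le> h b0"
      proof (rule continuous_ge_on_closure[of "{0..<b0}" h])
        show "continuous_on (closure {0..<b0}) h" unfolding cl using b0(1) by (intro continuous_on_subset[OF cont]) auto
        show "b0 \<in> closure {0..<b0}" unfolding cl using b0(1) by simp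
      qed (rule low)
      then show False using b0(2) exp_gt_zero[of m] by linarith
    qed
    then show "\<forall>t\<in>{0..<T}. wall_distance \<Omega> S t > 0" by (simp add: h_def)
    fix P Q assume lim: "Liminf (at_left T) (\<lambda>t. ereal (wall_distance \<Omega> S t)) = 0"
      and PQ: "\<forall>t\<in>{0..<T}. distance_points \<Omega> S t (P t) (Q t)"
    have dec: "ennreal ((ln (h 0) - ln (h b) - C2 * b) / C1) \<le> (\<integral>\<^sup>+\<tau>\<in>{0<..<b}. f (P \<tau>) (Q \<tau>) \<tau> \<partial>lebesgue)"
      if b: "b \<in> {0..<T}" for b
    proof -
      have "ennreal ((ln (h 0) - ln (h b) - C2 * b) / C1 / 1) \<le> (\<integral>\<^sup>+\<tau>\<in>{0<..<b}. f (P \<tau>) (Q \<tau>) \<tau> \<partial>lebesgue)"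
      proof (rule log_decrement_le_nn_integral[OF L _ _ _ C12(1)])
        show "AE r in lebesgue. r \<in> {0<..<b} \<longrightarrow> (\<forall>c. f (P r) (Q r) r < ennreal c \<longrightarrow>
            (\<forall>\<^sub>F k in sequentially. real (Suc k) * ((ln (h (r - 1 / real (Suc k))) + C2 * (r - 1 / real (Suc k))) / C1
              - (ln (h r) + C2 * r) / C1) \<le> 1 * c))"
          unfolding \<Psi>_def[symmetric] using ae
        proof eventually_elim
          case (elim r)
          show ?case
          proof (intro impI allI)
            fix c assume r: "r \<in> {0<..<b}" and lt: "f (P r) (Q r) r < ennreal c"
            have r': "r \<in> {0<..<T}" "r \<in> {0..<T}" using r b by auto
            show "\<forall>\<^sub>F k in sequentially. \<Psi> C1 C2 r k \<le> 1 * c"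
              unfolding mult_1 by (rule elim[rule_format, OF r'(1) h_pos[OF r'(2)] PQ[rule_format, OF r'(2)] lt])
          qed
        qed
      qed (use b h_pos in auto)
      then show ?thesis by simp
    qed
    have "((\<lambda>t. \<integral>\<^sup>+\<tau>\<in>{0<..<t}. f (P \<tau>) (Q \<tau>) \<tau> \<partial>lebesgue) \<longlongrightarrow> top) (at_left T)"
      unfolding tendsto_top_iff_ennreal
    proof (intro allI impI)
      fix l :: real assume l: "l \<ge> 0"
      \<comment> \<open>The threshold below which the logarithmic decrement forces the integral
        above \<open>l\<close>.\<close>
      define e where "e = exp (ln (h 0) - C2 * T - l * C1)"
      have "\<exists>b\<in>{0<..<T}. h b < e"
      proof (rule ccontr)
        assume "\<not> ?thesis"
        then have "eventually (\<lambda>t. ereal e \<le> ereal (h t)) (at_left T)"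
          using eventually_at_left_real[OF T] by (auto elim!: eventually_mono simp: not_less)
        then have "ereal e \<le> Liminf (at_left T) (\<lambda>t. ereal (h t))" by (rule Liminf_bounded)
        then show False using lim by (simp add: h_def e_def not_le)
      qed
      \<comment> \<open>A single such time is enough: the integral does not decrease with its upper
        limit, so the bound persists up to \<open>T\<close>.\<close>
      then obtain b where b: "b \<in> {0<..<T}" "h b < e" by blast
      then have hb: "ln (h b) < ln (h 0) - C2 * T - l * C1"
        using h_pos[of b] ln_less_cancel_iff[of "h b" e] by (simp add: e_def)
      moreover have "C2 * b \<le> C2 * T" using b C12 by (intro mult_left_mono) auto
      ultimately have "l * C1 < ln (h 0) - ln (h b) - C2 * b" by linarith
      then have lb: "ennreal l < ennreal ((ln (h 0) - ln (h b) - C2 * b) / C1)"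
        using l C12 by (simp add: ennreal_less_iff pos_less_divide_eq)
      show "\<forall>\<^sub>F t in at_left T. ennreal l < (\<integral>\<^sup>+\<tau>\<in>{0<..<t}. f (P \<tau>) (Q \<tau>) \<tau> \<partial>lebesgue)"
      proof (rule eventually_mono)
        show "\<forall>\<^sub>F t in at_left T. t \<in> {b<..<T}" using eventually_at_left_real[of b T] b(1) by simp
        fix t assume t: "t \<in> {b<..<T}"
        note lb
        also have "ennreal ((ln (h 0) - ln (h b) - C2 * b) / C1) \<le> (\<integral>\<^sup>+\<tau>\<in>{0<..<b}. f (P \<tau>) (Q \<tau>) \<tau> \<partial>lebesgue)"
          using b by (intro dec) auto
        also have "\<dots> \<le> (\<integral>\<^sup>+\<tau>\<in>{0<..<t}. f (P \<tau>) (Q \<tau>) \<tau> \<partial>lebesgue)"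
          using t by (intro nn_integral_mono mult_left_mono) (auto split: split_indicator)
        finally show "ennreal l < (\<integral>\<^sup>+\<tau>\<in>{0<..<t}. f (P \<tau>) (Q \<tau>) \<tau> \<partial>lebesgue)" .
      qed
    qed
    then show "((\<lambda>t. \<integral>\<^sup>+\<tau>\<in>{0<..<t}.
              ennreal (wall_distance \<Omega> S \<tau> powr (1/2)) *
              hessian_norm
                (cylinder (Q \<tau>) (P \<tau>) (c0 * wall_distance \<Omega> S \<tau> powr (1/2)) \<inter> fluid \<Omega> S \<tau>)
                (u \<tau>)
            \<partial>lebesgue)
          \<longlongrightarrow> \<infinity>) (at_left T)"
      using h_nonneg by (simp add: f_def h_def powr_half_sqrt)
  qed
qed

end
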